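(* Let $k$ be a field and $A$ a graded, square-free Hodge algebra over $k$ generated by a finite poset $H$ and governed by $\Sigma$. Suppose that $A$ is Cohen–Macaulay and that $\operatorname{core}A_{\rm dis}$ is Buchsbaum. Then $A_{\rm dis}$ is Cohen–Macaulay.
   Context: Let $H$ be a finite poset and $\Sigma$ an ideal of monomials on $H$ (set of monomials in elements of $H$ closed under multiplication by monomials); monomials not in $\Sigma$ are standard. A commutative $k$-algebra $A\supseteq H$ is a Hodge algebra generated by $H$ governed by $\Sigma$ if (i) the standard monomials form a $k$-basis of $A$, and (ii) for every minimal generator $\mu$ of $\Sigma$ with expansion $\mu=\sum_i r_i\mu_i$ ($0\ne r_i\in k$, $\mu_i$ standard), for every $i$ and every $x\in H$ dividing $\mu$, $\mu_i$ has a factor $y<x$. It is square-free if $\Sigma$ is generated by square-free monomials, and graded if $A=\bigoplus_{n\ge0}A_n$, $A_0=k$, with elements of $H$ homogeneous of positive degree. The discrete counterpart is $A_{\rm dis}=k[X_h:h\in H]/(\Sigma)$. Let $\operatorname{core}H$ be the union of the supports of the minimal generators of $\Sigma$, and $\operatorname{core}A_{\rm dis}=A_{\rm dis}/(X_h: h\in H\setminus\operatorname{core}H)$, i.e. $k[X_h:h\in\operatorname{core}H]$ modulo the monomials of $\Sigma$ supported in $\operatorname{core}H$. *)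

theory Defs
  imports "HOL-Algebra.Algebra" "HOL-Library.Multiset" "HOL-Library.Extended_Nat"
begin

definition type_ring :: "('k::comm_ring_1) ring" where
  "type_ring = \<lparr>carrier = UNIV, monoid.mult = (*), monoid.one = 1, ring.zero = 0, ring.add = (+)\<rparr>"

definition loc_rel :: "('a, 'b) ring_scheme \<Rightarrow> 'a set \<Rightarrow> (('a \<times> 'a) \<times> ('a \<times> 'a)) set" where
  "loc_rel R S = {((a, s), (b, t)). a \<in> carrier R \<and> b \<in> carrier R \<and> s \<in> S \<and> t \<in> S \<and>
      (\<exists>u\<in>S. u \<otimes>\<^bsub>R\<^esub> ((a \<otimes>\<^bsub>R\<^esub> t) \<ominus>\<^bsub>R\<^esub> (b \<otimes>\<^bsub>R\<^esub> s)) = \<zero>\<^bsub>R\<^esub>)}"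

definition loc_rep :: "('a \<times> 'a) set \<Rightarrow> 'a \<times> 'a" where
  "loc_rep C = (SOME p. p \<in> C)"

definition loc_mult :: "('a, 'b) ring_scheme \<Rightarrow> 'a set \<Rightarrow> ('a \<times> 'a) set \<Rightarrow> ('a \<times> 'a) set \<Rightarrow> ('a \<times> 'a) set" where
  "loc_mult R S C D = loc_rel R S `` {(fst (loc_rep C) \<otimes>\<^bsub>R\<^esub> fst (loc_rep D),
                                       snd (loc_rep C) \<otimes>\<^bsub>R\<^esub> snd (loc_rep D))}"

definition loc_add :: "('a, 'b) ring_scheme \<Rightarrow> 'a set \<Rightarrow> ('a \<times> 'a) set \<Rightarrow> ('a \<times> 'a) set \<Rightarrow> ('a \<times> 'a) set" where
  "loc_add R S C D = loc_rel R S `` {((fst (loc_rep C) \<otimes>\<^bsub>R\<^esub> snd (loc_rep D))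
                                        \<oplus>\<^bsub>R\<^esub> (fst (loc_rep D) \<otimes>\<^bsub>R\<^esub> snd (loc_rep C)),
                                      snd (loc_rep C) \<otimes>\<^bsub>R\<^esub> snd (loc_rep D))}"

definition localization :: "('a, 'b) ring_scheme \<Rightarrow> 'a set \<Rightarrow> ('a \<times> 'a) set ring" where
  "localization R S =
    \<lparr>carrier = (carrier R \<times> S) // loc_rel R S,
     monoid.mult = loc_mult R S,
     monoid.one = loc_rel R S `` {(\<one>\<^bsub>R\<^esub>, \<one>\<^bsub>R\<^esub>)},
     ring.zero = loc_rel R S `` {(\<zero>\<^bsub>R\<^esub>, \<one>\<^bsub>R\<^esub>)},
     ring.add = loc_add R S\<rparr>"

definition localize_at :: "('a, 'b) ring_scheme \<Rightarrow> 'a set \<Rightarrow> ('a \<times> 'a) set ring" where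
  "localize_at R P = localization R (carrier R - P)"

definition krull_dim :: "('a, 'b) ring_scheme \<Rightarrow> enat" where
  "krull_dim R = Sup {enat n | n. \<exists>P. (\<forall>i\<le>n. primeideal (P i) R) \<and> (\<forall>i<n. P i \<subset> P (Suc i))}"

definition local_ring :: "('a, 'b) ring_scheme \<Rightarrow> bool" where
  "local_ring R \<longleftrightarrow> cring R \<and> noetherian_ring R \<and> (\<exists>!M. maximalideal M R)"

definition max_ideal :: "('a, 'b) ring_scheme \<Rightarrow> 'a set" where
  "max_ideal R = (THE M. maximalideal M R)"

definition colon_ideal :: "('a, 'b) ring_scheme \<Rightarrow> 'a set \<Rightarrow> 'a set \<Rightarrow> 'a set" where
  "colon_ideal R I J = {a \<in> carrier R. \<forall>b\<in>J. a \<otimes>\<^bsub>R\<^esub> b \<in> I}"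

definition radical_ideal :: "('a, 'b) ring_scheme \<Rightarrow> 'a set \<Rightarrow> 'a set" where
  "radical_ideal R I = {a \<in> carrier R. \<exists>n::nat. a [^]\<^bsub>R\<^esub> n \<in> I}"

definition regular_seq :: "('a, 'b) ring_scheme \<Rightarrow> 'a list \<Rightarrow> bool" where
  "regular_seq R xs \<longleftrightarrow> set xs \<subseteq> max_ideal R \<and>
     Idl\<^bsub>R\<^esub> (set xs) \<noteq> carrier R \<and>
     (\<forall>i < length xs. \<forall>a \<in> carrier R.
        a \<otimes>\<^bsub>R\<^esub> (xs ! i) \<in> Idl\<^bsub>R\<^esub> (set (take i xs)) \<longrightarrow> a \<in> Idl\<^bsub>R\<^esub> (set (take i xs)))"

definition depth :: "('a, 'b) ring_scheme \<Rightarrow> enat" where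
  "depth R = Sup {enat (length xs) | xs. regular_seq R xs}"

definition cohen_macaulay_local :: "('a, 'b) ring_scheme \<Rightarrow> bool" where
  "cohen_macaulay_local R \<longleftrightarrow> local_ring R \<and> depth R = krull_dim R"

definition cohen_macaulay :: "('a, 'b) ring_scheme \<Rightarrow> bool" where
  "cohen_macaulay R \<longleftrightarrow> cring R \<and> noetherian_ring R \<and>
     (\<forall>M. maximalideal M R \<longrightarrow> cohen_macaulay_local (localize_at R M))"

definition system_of_parameters :: "('a, 'b) ring_scheme \<Rightarrow> 'a list \<Rightarrow> bool" where
  "system_of_parameters R xs \<longleftrightarrow> set xs \<subseteq> carrier R \<and> enat (length xs) = krull_dim R \<and>
     radical_ideal R (Idl\<^bsub>R\<^esub> (set xs)) = max_ideal R"

definition weak_seq :: "('a, 'b) ring_scheme \<Rightarrow> 'a list \<Rightarrow> bool" where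
  "weak_seq R xs \<longleftrightarrow> (\<forall>i < length xs.
     colon_ideal R (Idl\<^bsub>R\<^esub> (set (take i xs))) {xs ! i}
       \<subseteq> colon_ideal R (Idl\<^bsub>R\<^esub> (set (take i xs))) (max_ideal R))"

definition buchsbaum_local :: "('a, 'b) ring_scheme \<Rightarrow> bool" where
  "buchsbaum_local R \<longleftrightarrow> local_ring R \<and> (\<forall>xs. system_of_parameters R xs \<longrightarrow> weak_seq R xs)"

text \<open>A graded ring is Buchsbaum if its localization at the irrelevant ideal m is.\<close>
definition graded_buchsbaum :: "('a, 'b) ring_scheme \<Rightarrow> 'a set \<Rightarrow> bool" where
  "graded_buchsbaum R m \<longleftrightarrow> cring R \<and> noetherian_ring R \<and> buchsbaum_local (localize_at R m)"

definition monomials :: "'h set \<Rightarrow> 'h multiset set" where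
  "monomials H = {\<mu>. set_mset \<mu> \<subseteq> H}"

definition monomial_ideal :: "'h set \<Rightarrow> 'h multiset set \<Rightarrow> bool" where
  "monomial_ideal H Sig \<longleftrightarrow> Sig \<subseteq> monomials H \<and> (\<forall>\<mu>\<in>Sig. \<forall>\<nu>\<in>monomials H. \<mu> + \<nu> \<in> Sig)"

definition min_gen :: "'h multiset set \<Rightarrow> 'h multiset \<Rightarrow> bool" where
  "min_gen Sig \<mu> \<longleftrightarrow> \<mu> \<in> Sig \<and> (\<forall>\<nu>\<in>Sig. \<nu> \<subseteq># \<mu> \<longrightarrow> \<nu> = \<mu>)"

definition standard_monomials :: "'h set \<Rightarrow> 'h multiset set \<Rightarrow> 'h multiset set" where
  "standard_monomials H Sig = monomials H - Sig"

definition square_free :: "'h multiset set \<Rightarrow> bool" where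
  "square_free Sig \<longleftrightarrow> (\<forall>\<mu>. min_gen Sig \<mu> \<longrightarrow> (\<forall>h. count \<mu> h \<le> 1))"

definition core_set :: "'h multiset set \<Rightarrow> 'h set" where
  "core_set Sig = \<Union> {set_mset \<mu> | \<mu>. min_gen Sig \<mu>}"

definition poly_ring :: "'h set \<Rightarrow> ('h multiset \<Rightarrow> 'k::field) ring" where
  "poly_ring H = \<lparr>carrier = {p. finite {m. p m \<noteq> 0} \<and> (\<forall>m. p m \<noteq> 0 \<longrightarrow> set_mset m \<subseteq> H)},
     monoid.mult = (\<lambda>p q m. \<Sum>\<alpha>\<in>{\<alpha>. \<alpha> \<subseteq># m}. p \<alpha> * q (m - \<alpha>)),
     monoid.one = (\<lambda>m. if m = {#} then 1 else 0),
     ring.zero = (\<lambda>_. 0),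
     ring.add = (\<lambda>p q m. p m + q m)\<rparr>"

definition pmono :: "'h multiset \<Rightarrow> ('h multiset \<Rightarrow> 'k::field)" where
  "pmono \<mu> = (\<lambda>m. if m = \<mu> then 1 else 0)"

definition pvar :: "'h \<Rightarrow> ('h multiset \<Rightarrow> 'k::field)" where
  "pvar h = pmono {#h#}"

definition Adis_ideal :: "'h set \<Rightarrow> 'h multiset set \<Rightarrow> ('h multiset \<Rightarrow> 'k::field) set" where
  "Adis_ideal H Sig = Idl\<^bsub>poly_ring H\<^esub> (pmono ` Sig)"

definition Adis :: "'h set \<Rightarrow> 'h multiset set \<Rightarrow> ('h multiset \<Rightarrow> 'k::field) set ring" where
  "Adis H Sig = poly_ring H Quot Adis_ideal H Sig"

definition dvar :: "'h set \<Rightarrow> 'h multiset set \<Rightarrow> 'h \<Rightarrow> ('h multiset \<Rightarrow> 'k::field) set" where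
  "dvar H Sig h = a_r_coset (poly_ring H) (Adis_ideal H Sig) (pvar h)"

definition core_ideal :: "'h set \<Rightarrow> 'h multiset set \<Rightarrow> ('h multiset \<Rightarrow> 'k::field) set set" where
  "core_ideal H Sig = Idl\<^bsub>Adis H Sig\<^esub> (dvar H Sig ` (H - core_set Sig))"

definition core_Adis :: "'h set \<Rightarrow> 'h multiset set \<Rightarrow> ('h multiset \<Rightarrow> 'k::field) set set ring" where
  "core_Adis H Sig = Adis H Sig Quot core_ideal H Sig"

definition core_irrelevant :: "'h set \<Rightarrow> 'h multiset set \<Rightarrow> ('h multiset \<Rightarrow> 'k::field) set set set" where
  "core_irrelevant H Sig = Idl\<^bsub>core_Adis H Sig\<^esub>
     ((\<lambda>h. a_r_coset (Adis H Sig) (core_ideal H Sig) (dvar H Sig h)) ` H)"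

definition partial_order_on_set :: "'h set \<Rightarrow> ('h \<Rightarrow> 'h \<Rightarrow> bool) \<Rightarrow> bool" where
  "partial_order_on_set H leq \<longleftrightarrow> (\<forall>a\<in>H. leq a a) \<and>
     (\<forall>a\<in>H. \<forall>b\<in>H. leq a b \<and> leq b a \<longrightarrow> a = b) \<and>
     (\<forall>a\<in>H. \<forall>b\<in>H. \<forall>c\<in>H. leq a b \<and> leq b c \<longrightarrow> leq a c)"

text \<open>Value of a monomial in A, where x : H -> A is the inclusion of H in A.\<close>
definition mon_eval :: "'a ring \<Rightarrow> ('h \<Rightarrow> 'a) \<Rightarrow> 'h multiset \<Rightarrow> 'a" where
  "mon_eval A x \<mu> = finprod A (\<lambda>h. x h [^]\<^bsub>A\<^esub> count \<mu> h) (set_mset \<mu>)"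

text \<open>c gives an expansion of a as a k-linear combination of standard monomials
  (iota : k -> A is the structure map of the k-algebra A).\<close>
definition std_expansion :: "'a ring \<Rightarrow> ('k::field \<Rightarrow> 'a) \<Rightarrow> 'h set \<Rightarrow> ('h \<Rightarrow> 'a)
    \<Rightarrow> 'h multiset set \<Rightarrow> 'a \<Rightarrow> ('h multiset \<Rightarrow> 'k) \<Rightarrow> bool" where
  "std_expansion A \<iota> H x Sig a c \<longleftrightarrow>
     finite {\<mu>. c \<mu> \<noteq> 0} \<and> (\<forall>\<mu>. c \<mu> \<noteq> 0 \<longrightarrow> \<mu> \<in> standard_monomials H Sig) \<and>
     a = finsum A (\<lambda>\<mu>. \<iota> (c \<mu>) \<otimes>\<^bsub>A\<^esub> mon_eval A x \<mu>) {\<mu>. c \<mu> \<noteq> 0}"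

definition hodge_algebra :: "'a ring \<Rightarrow> ('k::field \<Rightarrow> 'a) \<Rightarrow> 'h set \<Rightarrow> ('h \<Rightarrow> 'h \<Rightarrow> bool)
    \<Rightarrow> ('h \<Rightarrow> 'a) \<Rightarrow> 'h multiset set \<Rightarrow> bool" where
  "hodge_algebra A \<iota> H leq x Sig \<longleftrightarrow>
     cring A \<and> \<iota> \<in> ring_hom type_ring A \<and>
     finite H \<and> partial_order_on_set H leq \<and>
     inj_on x H \<and> x ` H \<subseteq> carrier A \<and>
     monomial_ideal H Sig \<and>
     \<comment> \<open>(i) the standard monomials form a k-basis of A\<close>
     (\<forall>a\<in>carrier A. \<exists>!c. std_expansion A \<iota> H x Sig a c) \<and>
     \<comment> \<open>(ii) straightening condition\<close>
     (\<forall>\<mu> c. min_gen Sig \<mu> \<longrightarrow> std_expansion A \<iota> H x Sig (mon_eval A x \<mu>) c \<longrightarrow>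
        (\<forall>\<nu>. c \<nu> \<noteq> 0 \<longrightarrow> (\<forall>z\<in>H. z \<in># \<mu> \<longrightarrow> (\<exists>y. y \<in># \<nu> \<and> leq y z \<and> y \<noteq> z))))"

definition graded_algebra :: "'a ring \<Rightarrow> ('k::field \<Rightarrow> 'a) \<Rightarrow> 'h set \<Rightarrow> ('h \<Rightarrow> 'a)
    \<Rightarrow> (nat \<Rightarrow> 'a set) \<Rightarrow> bool" where
  "graded_algebra A \<iota> H x Agr \<longleftrightarrow>
     (\<forall>n. Agr n \<subseteq> carrier A \<and> subgroup (Agr n) (add_monoid A) \<and>
          (\<forall>c a. a \<in> Agr n \<longrightarrow> \<iota> c \<otimes>\<^bsub>A\<^esub> a \<in> Agr n)) \<and>
     (\<forall>m n a b. a \<in> Agr m \<longrightarrow> b \<in> Agr n \<longrightarrow> a \<otimes>\<^bsub>A\<^esub> b \<in> Agr (m + n)) \<and>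
     Agr 0 = range \<iota> \<and>
     (\<forall>a\<in>carrier A. \<exists>!f. (\<forall>n. f n \<in> Agr n) \<and> finite {n. f n \<noteq> \<zero>\<^bsub>A\<^esub>} \<and>
                          a = finsum A f {n. f n \<noteq> \<zero>\<^bsub>A\<^esub>}) \<and>
     (\<forall>h\<in>H. \<exists>n>0. x h \<in> Agr n)"

end

theory Submission
  imports Defs "HOL-Library.Poly_Mapping"
begin

text \<open>
  All rings are viewed as quotients of one polynomial ring S with a variable for every element
  of the type of H. Write C for the core and d for the largest cardinality of a face inside C.
  The variables outside C are cone points: they form a regular sequence modulo A, so that Cohen-
  Macaulayness of A makes the local cohomology of A / (H - C), computed by the stable Koszul
  complex on C, vanish below d. Weighting the elements of H such that straightening strictly
  increases the weight, one can lift simplicial cocycles of the complex of faces to Koszul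
  cocycles over A / (H - C), solve there, and read off the lowest weight; hence the simplicial
  complex of the core has no reduced cohomology below its dimension. For the core of the
  discrete algebra, the Buchsbaum property says that the irrelevant ideal kills the local
  cohomology below d, which concentrates it in multidegree 0, where it is the simplicial
  cohomology just shown to vanish. Thus powers of the elementary symmetric functions on C form a
  regular sequence; adding powers of the cone variables gives one for the discrete algebra. At
  an arbitrary maximal ideal, Zariski's lemma provides monic polynomials in these elements lying
  in the ideal, and they form a regular sequence because their leading forms do.
\<close>

text \<open>A degenerates to its discrete counterpart, and along a degeneration Cohen-Macaulayness
  passes in general only from the special fibre to A. The opposite direction needs a reason why no
  new cohomology appears in the special fibre; what the Buchsbaum property leaves lives in the only
  multidegree of total degree 0 without a positive entry, and just there a comparison with A is
  possible. Local cohomology is never built as a module. A class is a cochain c with an exponent n,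
  standing for the fractions c F / x_F^n, and it vanishes if it becomes a coboundary after n is
  raised. Localization is absorbed in the same way into a multiplicative set U of permitted
  multipliers: the complement of \<open>irr\<close> for statements at the irrelevant ideal,
  \<open>{1}\<close> for global ones; homogeneity leads from the first to the second. Dimension
  theory is replaced by counting standard monomials, which bounds chains of primes from above and
  forces long regular sequences in A.\<close>

section \<open>Ideals, primes and regular sequences in a ring given as a type\<close>

definition is_ideal :: "'r::comm_ring_1 set \<Rightarrow> bool" where
  "is_ideal I \<longleftrightarrow> 0 \<in> I \<and> (\<forall>a\<in>I. \<forall>b\<in>I. a + b \<in> I) \<and> (\<forall>a\<in>I. \<forall>r. r * a \<in> I)"

lemma ideal_zero: "is_ideal I \<Longrightarrow> 0 \<in> I"
  and ideal_add: "is_ideal I \<Longrightarrow> a \<in> I \<Longrightarrow> b \<in> I \<Longrightarrow> a + b \<in> I"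
  and ideal_mult_left: "is_ideal I \<Longrightarrow> a \<in> I \<Longrightarrow> r * a \<in> I"
  by (auto simp: is_ideal_def)

lemma ideal_mult_right: "is_ideal I \<Longrightarrow> a \<in> I \<Longrightarrow> a * r \<in> I"
  using ideal_mult_left[of I a r] by (simp add: mult.commute)

lemma ideal_uminus: "is_ideal I \<Longrightarrow> a \<in> I \<Longrightarrow> - a \<in> I"
  using ideal_mult_left[of I a "-1"] by simp

lemma ideal_diff: "is_ideal I \<Longrightarrow> a \<in> I \<Longrightarrow> b \<in> I \<Longrightarrow> a - b \<in> I"
  using ideal_add[of I a "-b"] ideal_uminus[of I b] by simp

lemma ideal_sum: "is_ideal I \<Longrightarrow> (\<And>k. k \<in> K \<Longrightarrow> f k \<in> I) \<Longrightarrow> (\<Sum>k\<in>K. f k) \<in> I"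
  by (induction K rule: infinite_finite_induct) (auto intro: ideal_zero ideal_add)

lemma ideal_cong: "is_ideal I \<Longrightarrow> a - b \<in> I \<Longrightarrow> a \<in> I \<longleftrightarrow> b \<in> I"
  using ideal_add[of I "a - b" b] ideal_diff[of I a "a - b"] by auto

lemma ideal_trans: "is_ideal I \<Longrightarrow> a - b \<in> I \<Longrightarrow> b - c \<in> I \<Longrightarrow> a - c \<in> I"
  using ideal_add[of I "a - b" "b - c"] by simp

lemma ideal_sym: "is_ideal I \<Longrightarrow> a - b \<in> I \<Longrightarrow> b - a \<in> I"
  using ideal_uminus[of I "a - b"] by simp

definition is_prime :: "'r::comm_ring_1 set \<Rightarrow> bool" where
  "is_prime P \<longleftrightarrow> is_ideal P \<and> 1 \<notin> P \<and> (\<forall>a b. a * b \<in> P \<longrightarrow> a \<in> P \<or> b \<in> P)"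

lemma is_primeD: "is_prime P \<Longrightarrow> is_ideal P" "is_prime P \<Longrightarrow> 1 \<notin> P"
    "is_prime P \<Longrightarrow> a * b \<in> P \<Longrightarrow> a \<in> P \<or> b \<in> P"
  by (auto simp: is_prime_def)

lemma prime_power: "is_prime P \<Longrightarrow> a ^ n \<in> P \<Longrightarrow> a \<in> P"
  by (induction n) (auto dest: is_primeD)

definition adjoin :: "'r::comm_ring_1 set \<Rightarrow> 'r \<Rightarrow> 'r set" where
  "adjoin I y = {i + c * y | i c. i \<in> I}"

definition adjoins :: "'r::comm_ring_1 set \<Rightarrow> 'r list \<Rightarrow> 'r set" where
  "adjoins J us = foldl adjoin J us"

lemma adjoins_simps [simp]: "adjoins J [] = J" "adjoins J (u # us) = adjoins (adjoin J u) us"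
    "adjoins J (us @ vs) = adjoins (adjoins J us) vs"
  by (auto simp: adjoins_def)

lemma in_adjoin: "a \<in> adjoin I y \<longleftrightarrow> (\<exists>c. a - c * y \<in> I)"
proof
  assume "\<exists>c. a - c * y \<in> I"
  then obtain c where "a - c * y \<in> I" by auto
  then show "a \<in> adjoin I y" unfolding adjoin_def by (intro CollectI exI[of _ "a - c * y"] exI[of _ c]) auto
next
  assume "a \<in> adjoin I y"
  then obtain i c where "i \<in> I" "a = i + c * y" by (auto simp: adjoin_def)
  then show "\<exists>c. a - c * y \<in> I" by (intro exI[of _ c]) simp
qed

lemma ideal_adjoin: assumes "is_ideal I" shows "is_ideal (adjoin I y)"
  unfolding is_ideal_def
proof (intro conjI ballI allI)
  show "0 \<in> adjoin I y" using assms by (auto simp: in_adjoin intro!: exI[of _ 0] ideal_zero)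
next
  fix a b assume "a \<in> adjoin I y" "b \<in> adjoin I y"
  then obtain c e where "a - c * y \<in> I" "b - e * y \<in> I" by (auto simp: in_adjoin)
  then have "(a - c * y) + (b - e * y) \<in> I" using assms by (rule_tac ideal_add)
  then have "a + b - (c + e) * y \<in> I" by (simp add: algebra_simps)
  then show "a + b \<in> adjoin I y" by (auto simp: in_adjoin)
next
  fix a r assume "a \<in> adjoin I y"
  then obtain c where "a - c * y \<in> I" by (auto simp: in_adjoin)
  then have "r * (a - c * y) \<in> I" using assms by (rule_tac ideal_mult_left)
  then have "r * a - (r * c) * y \<in> I" by (simp add: algebra_simps)
  then show "r * a \<in> adjoin I y" by (auto simp: in_adjoin)
qed

lemma ideal_adjoins: "is_ideal J \<Longrightarrow> is_ideal (adjoins J us)"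
  by (induction us arbitrary: J) (auto intro: ideal_adjoin)

lemma adjoin_subset: "I \<subseteq> adjoin I y"
  by (auto simp: in_adjoin intro!: exI[of _ 0])

lemma adjoin_self: "is_ideal I \<Longrightarrow> y \<in> adjoin I y"
  by (auto simp: in_adjoin intro!: exI[of _ 1] ideal_zero)

lemma adjoins_subset: "J \<subseteq> adjoins J us"
  using adjoin_subset by (induction us arbitrary: J) (fastforce)+

lemma adjoins_mem: "is_ideal J \<Longrightarrow> u \<in> set us \<Longrightarrow> u \<in> adjoins J us"
proof (induction us arbitrary: J)
  case (Cons v us)
  then show ?case using adjoin_self[of J v] adjoins_subset[of "adjoin J v" us] ideal_adjoin[of J v] by auto
qed auto

lemma adjoin_least: "is_ideal K \<Longrightarrow> I \<subseteq> K \<Longrightarrow> y \<in> K \<Longrightarrow> adjoin I y \<subseteq> K"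
  by (auto simp: adjoin_def intro!: ideal_add ideal_mult_left)

lemma adjoins_least: "is_ideal K \<Longrightarrow> J \<subseteq> K \<Longrightarrow> set us \<subseteq> K \<Longrightarrow> adjoins J us \<subseteq> K"
  by (induction us arbitrary: J) (auto dest: adjoin_least)

lemma adjoins_mono: "is_ideal J \<Longrightarrow> is_ideal J' \<Longrightarrow> J \<subseteq> J' \<Longrightarrow> set us \<subseteq> adjoins J' vs \<Longrightarrow> adjoins J us \<subseteq> adjoins J' vs"
  using adjoins_subset[of J' vs] by (intro adjoins_least ideal_adjoins) auto

text \<open>Allows a congruence of cochains modulo \<open>adjoin I y\<close> to be divided by y: the
  coefficients of y, chosen face by face, form a cochain \<open>e\<close> again.\<close>

lemma adjoin_choice:
  assumes "\<And>F. Q F \<Longrightarrow> f F \<in> adjoin I y" obtains e where "\<forall>F. Q F \<longrightarrow> f F - e F * y \<in> I"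
proof (rule that[of "\<lambda>F. SOME c. f F - c * y \<in> I"], intro allI impI)
  fix F assume "Q F"
  then have "\<exists>c. f F - c * y \<in> I" using assms by (simp add: in_adjoin)
  then show "f F - (SOME c. f F - c * y \<in> I) * y \<in> I" by (rule someI_ex)
qed

text \<open>U is the set of elements regarded as invertible. For U the complement of P this says
  that y is a nonzerodivisor on the localization at P of the quotient by I, for
  \<open>U = {1}\<close> on the quotient itself.\<close>

definition regular_on :: "'r::comm_ring_1 set \<Rightarrow> 'r set \<Rightarrow> 'r \<Rightarrow> bool" where
  "regular_on U I y \<longleftrightarrow> (\<forall>a. a * y \<in> I \<longrightarrow> (\<exists>s\<in>U. s * a \<in> I))"

text \<open>Properness of the generated ideal is kept apart; at a prime P it is expressed by
  requiring the entries to lie in P.\<close>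

fun reg_list :: "'r::comm_ring_1 set \<Rightarrow> 'r set \<Rightarrow> 'r list \<Rightarrow> bool" where
  "reg_list U J [] = True"
| "reg_list U J (u # us) = (regular_on U J u \<and> reg_list U (adjoin J u) us)"

lemma reg_list_append: "reg_list U J (us @ vs) \<longleftrightarrow> reg_list U J us \<and> reg_list U (adjoins J us) vs"
  by (induction us arbitrary: J) auto

lemma reg_list_nth: "reg_list U J us \<longleftrightarrow> (\<forall>i<length us. regular_on U (adjoins J (take i us)) (us ! i))"
proof (induction us arbitrary: J)
  case (Cons u us)
  show ?case unfolding reg_list.simps Cons.IH
    by (auto simp: less_Suc_eq_0_disj nth_Cons' take_Cons' split: if_splits)
qed auto

lemma reg_list_mono: "U \<subseteq> U' \<Longrightarrow> reg_list U J us \<Longrightarrow> reg_list U' J us"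
  by (induction us arbitrary: J) (auto simp: regular_on_def, blast)

text \<open>An ideal maximal among those containing I and missing T is prime: adjoining either of
  two elements outside it meets T, and the product of the two meeting points would lie in the ideal
  as soon as the product of the elements does.\<close>

lemma exists_prime_avoiding:
  assumes I: "is_ideal I" and T: "1 \<in> T" "\<And>a b. a \<in> T \<Longrightarrow> b \<in> T \<Longrightarrow> a * b \<in> T" and dis: "I \<inter> T = {}"
  shows "\<exists>P. is_prime P \<and> I \<subseteq> P \<and> P \<inter> T = {}"
proof -
  define F where "F = {K. is_ideal K \<and> I \<subseteq> K \<and> K \<inter> T = {}}"
  have max: "\<exists>M\<in>F. \<forall>Y\<in>F. M \<subseteq> Y \<longrightarrow> Y = M"
  proof (rule subset_Zorn_nonempty)
    show "F \<noteq> {}" using I dis by (auto simp: F_def)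
    fix CC assume CC: "CC \<noteq> {}" "subset.chain F CC"
    have sub: "\<And>K. K \<in> CC \<Longrightarrow> K \<in> F" and tot: "\<And>K L. K \<in> CC \<Longrightarrow> L \<in> CC \<Longrightarrow> K \<subseteq> L \<or> L \<subseteq> K"
      using CC by (auto simp: subset.chain_def)
    have "is_ideal (\<Union>CC)"
      unfolding is_ideal_def
    proof (intro conjI ballI allI)
      show "0 \<in> \<Union>CC" using CC sub by (auto simp: F_def is_ideal_def)
    next
      fix a b assume "a \<in> \<Union>CC" "b \<in> \<Union>CC"
      then obtain K L where KL: "K \<in> CC" "L \<in> CC" "a \<in> K" "b \<in> L" by auto
      then obtain Z where "Z \<in> CC" "a \<in> Z" "b \<in> Z" using tot[of K L] by blast
      then show "a + b \<in> \<Union>CC" using sub[of Z] by (auto simp: F_def intro: ideal_add)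
    next
      fix a r assume "a \<in> \<Union>CC"
      then obtain K where "K \<in> CC" "a \<in> K" by auto
      then show "r * a \<in> \<Union>CC" using sub[of K] by (auto simp: F_def intro: ideal_mult_left)
    qed
    moreover have "I \<subseteq> \<Union>CC" using CC sub by (fastforce simp: F_def)
    ultimately show "\<Union>CC \<in> F" using sub by (fastforce simp: F_def)
  qed
  obtain M where M: "is_ideal M" "I \<subseteq> M" "M \<inter> T = {}"
    and mx: "\<And>Y. is_ideal Y \<Longrightarrow> M \<subseteq> Y \<Longrightarrow> Y \<inter> T = {} \<Longrightarrow> Y = M"
  proof -
    obtain M where "M \<in> F" "\<forall>Y\<in>F. M \<subseteq> Y \<longrightarrow> Y = M" using max by blast
    then show ?thesis by (intro that[of M]) (auto simp: F_def)
  qed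
  have "a \<in> M \<or> b \<in> M" if ab: "a * b \<in> M" for a b
  proof (rule ccontr)
    assume n: "\<not> (a \<in> M \<or> b \<in> M)"
    have ne: "\<exists>t\<in>T. \<exists>c. t - c * z \<in> M" if "z \<notin> M" for z
    proof -
      have "adjoin M z \<noteq> M" using that adjoin_self[OF M(1), of z] by auto
      then have "adjoin M z \<inter> T \<noteq> {}" using mx[OF ideal_adjoin[OF M(1)] adjoin_subset] by auto
      then show ?thesis by (auto simp: in_adjoin)
    qed
    obtain t c where t: "t \<in> T" "t - c * a \<in> M" using ne[of a] n by auto
    obtain u e where u: "u \<in> T" "u - e * b \<in> M" using ne[of b] n by auto
    have "(t - c * a) * u + c * a * (u - e * b) + (c * e) * (a * b) \<in> M"
      using t u ab M(1) by (intro ideal_add) (auto intro: ideal_mult_left ideal_mult_right)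
    then have "t * u \<in> M" by (simp add: algebra_simps)
    then show False using M(3) T(2)[OF t(1) u(1)] by auto
  qed
  then have "is_prime M" using M T(1) by (auto simp: is_prime_def)
  then show ?thesis using M by auto
qed

text \<open>The primes between J and P are those of the localization at P of the quotient by J; n
  counts the strict inclusions.\<close>

definition prime_chain :: "'r::comm_ring_1 set \<Rightarrow> 'r set \<Rightarrow> nat \<Rightarrow> bool" where
  "prime_chain J P n \<longleftrightarrow> (\<exists>Q. (\<forall>i\<le>n. is_prime (Q i) \<and> J \<subseteq> Q i \<and> Q i \<subseteq> P) \<and> (\<forall>i<n. Q i \<subset> Q (Suc i)))"

text \<open>A nonzerodivisor lies in no minimal prime. The multiplicative set consists of powers of
  y times elements outside Q; it misses I because factors y can be cancelled one by one at the cost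
  of a multiplier outside P, hence outside Q.\<close>

lemma prime_below_regular:
  assumes I: "is_ideal I" and Q: "is_prime Q" "I \<subseteq> Q" "Q \<subseteq> P" and y: "y \<in> Q" and r: "regular_on (- P) I y"
  shows "\<exists>P'. is_prime P' \<and> I \<subseteq> P' \<and> P' \<subset> Q"
proof -
  define T where "T = {y ^ k * s | k s. s \<notin> Q}"
  have red: "\<exists>s'. s' \<notin> Q \<and> s' \<in> I" if "y ^ k * s \<in> I" "s \<notin> Q" for k s
    using that
  proof (induction k arbitrary: s)
    case (Suc k)
    from Suc.prems have "(y ^ k * s) * y \<in> I" by (simp add: mult_ac)
    then obtain t where t: "t \<notin> P" "t * (y ^ k * s) \<in> I" using r by (auto simp: regular_on_def)
    then have "y ^ k * (t * s) \<in> I" by (simp add: mult_ac)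
    moreover have "t * s \<notin> Q" using t Suc.prems Q is_primeD(3)[OF Q(1)] by blast
    ultimately show ?case using Suc.IH by blast
  qed auto
  have "\<exists>P'. is_prime P' \<and> I \<subseteq> P' \<and> P' \<inter> T = {}"
  proof (rule exists_prime_avoiding[OF I])
    show "1 \<in> T" unfolding T_def using is_primeD(2)[OF Q(1)] by (force intro: exI[of _ 0])
    show "I \<inter> T = {}" using red Q(2) by (fastforce simp: T_def)
    fix a b assume "a \<in> T" "b \<in> T"
    then obtain k s l t where *: "a = y ^ k * s" "b = y ^ l * t" "s \<notin> Q" "t \<notin> Q" by (auto simp: T_def)
    then have "a * b = y ^ (k + l) * (s * t)" "s * t \<notin> Q"
      using is_primeD(3)[OF Q(1)] by (auto simp: power_add mult_ac)
    then show "a * b \<in> T" unfolding T_def by blast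
  qed
  then obtain P' where P': "is_prime P'" "I \<subseteq> P'" "P' \<inter> T = {}" by auto
  have "P' \<subseteq> Q"
  proof
    fix a assume "a \<in> P'"
    show "a \<in> Q"
    proof (rule ccontr)
      assume "a \<notin> Q" then have "a \<in> T" unfolding T_def by (force intro: exI[of _ 0])
      then show False using P' \<open>a \<in> P'\<close> by auto
    qed
  qed
  moreover have "y \<in> T" unfolding T_def using is_primeD(2)[OF Q(1)] by (force intro: exI[of _ 1])
  ultimately show ?thesis using P' y by blast
qed

text \<open>Depth is at most dimension: each regular element contributes one strict inclusion below
  the smallest prime found for the rest of the list.\<close>

lemma prime_chain_of_regular:
  assumes "is_ideal J" "reg_list (- P) J us" "is_prime Q" "adjoins J us \<subseteq> Q" "Q \<subseteq> P"
  shows "prime_chain J Q (length us)"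
  using assms
proof (induction us arbitrary: J)
  case Nil
  then show ?case by (auto simp: prime_chain_def intro!: exI[of _ "\<lambda>_. Q"])
next
  case (Cons u us)
  have "prime_chain (adjoin J u) Q (length us)"
    using Cons.prems by (intro Cons.IH ideal_adjoin) auto
  then obtain R where R: "\<And>i. i \<le> length us \<Longrightarrow> is_prime (R i) \<and> adjoin J u \<subseteq> R i \<and> R i \<subseteq> Q"
    "\<And>i. i < length us \<Longrightarrow> R i \<subset> R (Suc i)" unfolding prime_chain_def by blast
  have "\<exists>P'. is_prime P' \<and> J \<subseteq> P' \<and> P' \<subset> R 0"
    using R(1)[of 0] adjoin_self[OF Cons.prems(1), of u] adjoin_subset[of J u] Cons.prems
    by (intro prime_below_regular[of J _ P u]) auto
  then obtain P' where P': "is_prime P'" "J \<subseteq> P'" "P' \<subset> R 0" by auto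
  show ?case unfolding prime_chain_def
  proof (intro exI[of _ "case_nat P' R"] conjI allI impI)
    fix i assume "i \<le> length (u # us)"
    then show "is_prime (case_nat P' R i)" "J \<subseteq> case_nat P' R i" "case_nat P' R i \<subseteq> Q"
      using P' R(1)[of "i - 1"] R(1)[of 0] adjoin_subset[of J u] by (cases i; force)+
  next
    fix i assume "i < length (u # us)"
    then show "case_nat P' R i \<subset> case_nat P' R (Suc i)" using P' R(2) by (cases i) auto
  qed
qed

subsection \<open>Koszul cochains\<close>

definition ksgn :: "('h \<Rightarrow> nat) \<Rightarrow> 'h \<Rightarrow> 'h set \<Rightarrow> 'r::comm_ring_1" where
  "ksgn idx h G = (-1) ^ card {g \<in> G. idx g < idx h}"

text \<open>For \<open>t h = x h ^ n\<close> this is the cohomological Koszul differential on the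
  n-th powers, for \<open>t h = 1\<close> the simplicial coboundary.\<close>

definition kdiff :: "('h \<Rightarrow> nat) \<Rightarrow> ('h \<Rightarrow> 'r::comm_ring_1) \<Rightarrow> ('h set \<Rightarrow> 'r) \<Rightarrow> 'h set \<Rightarrow> 'r" where
  "kdiff idx t c G = (\<Sum>h\<in>G. ksgn idx h G * t h * c (G - {h}))"

text \<open>Interior multiplication by v, the homotopy that makes \<open>t v\<close> act as zero on
  cohomology.\<close>

definition contract :: "('h \<Rightarrow> nat) \<Rightarrow> 'h \<Rightarrow> ('h set \<Rightarrow> 'r::comm_ring_1) \<Rightarrow> 'h set \<Rightarrow> 'r" where
  "contract idx v c F = (if v \<in> F then 0 else ksgn idx v (insert v F) * c (insert v F))"

lemma ksgn_square [simp]: "ksgn idx h G * ksgn idx h G = 1" "ksgn idx h G * (ksgn idx h G * a) = a"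
  by (simp_all add: ksgn_def flip: power_add mult.assoc)

lemma ksgn_remove_greater: "idx h < idx g \<Longrightarrow> ksgn idx h (G - {g}) = ksgn idx h G"
  unfolding ksgn_def by (rule arg_cong[where f = "\<lambda>S. (-1) ^ card S"]) auto

lemma ksgn_remove_less: assumes "idx h < idx g" "finite G" "h \<in> G"
  shows "ksgn idx g (G - {h}) = - (ksgn idx g G :: 'r::comm_ring_1)"
proof -
  have "{a \<in> G. idx a < idx g} = insert h {a \<in> G - {h}. idx a < idx g}" using assms by auto
  then have "card {a \<in> G. idx a < idx g} = Suc (card {a \<in> G - {h}. idx a < idx g})"
    using assms by (simp add: card_insert_if)
  then show ?thesis by (simp add: ksgn_def)
qed

lemma ksgn_remove_both:
  assumes "finite G" "inj_on idx G" "h \<in> G" "g \<in> G" "h \<noteq> g"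
  shows "ksgn idx h (G - {g}) * ksgn idx g (G - {h}) = - (ksgn idx h G * ksgn idx g G :: 'r::comm_ring_1)"
proof -
  have "idx h \<noteq> idx g" using assms by (auto dest: inj_onD)
  then consider "idx h < idx g" | "idx g < idx h" by linarith
  then show ?thesis
    by cases (use assms in \<open>simp_all add: ksgn_remove_greater ksgn_remove_less\<close>)
qed

lemma ksgn_remove_swap:
  assumes "finite G" "inj_on idx G" "h \<in> G" "g \<in> G" "h \<noteq> g"
  shows "ksgn idx h G * ksgn idx g (G - {h}) = - (ksgn idx g G * ksgn idx h (G - {g}) :: 'r::comm_ring_1)"
proof -
  have "idx h \<noteq> idx g" using assms by (auto dest: inj_onD)
  then consider "idx h < idx g" | "idx g < idx h" by linarith
  then show ?thesis
    by cases (use assms in \<open>simp_all add: ksgn_remove_greater ksgn_remove_less mult.commute\<close>)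
qed

text \<open>Deleting h and then g, or g and then h, gives opposite signs; the ordered pairs are
  split by \<open>idx\<close> and the two halves exchanged by swapping.\<close>

lemma kdiff_kdiff:
  assumes G: "finite G" "inj_on idx G"
  shows "kdiff idx t (kdiff idx t c) G = (0::'r::comm_ring_1)"
proof -
  define f where "f = (\<lambda>(h, g). ksgn idx h G * ksgn idx g (G - {h}) * t h * t g * c (G - {h} - {g}))"
  define A where "A = {(h, g). h \<in> G \<and> g \<in> G \<and> idx h < idx g}"
  define B where "B = {(h, g). h \<in> G \<and> g \<in> G \<and> idx g < idx h}"
  have fin: "finite A" "finite B" 
    by (rule finite_subset[of _ "G \<times> G"]; use G(1) in \<open>auto simp: A_def B_def\<close>)+
  have "kdiff idx t (kdiff idx t c) G = (\<Sum>h\<in>G. \<Sum>g\<in>G - {h}. f (h, g))"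
    unfolding kdiff_def f_def by (simp add: sum_distrib_left mult_ac)
  also have "\<dots> = sum f (SIGMA h:G. G - {h})" using G(1) by (subst sum.Sigma) auto
  also have "(SIGMA h:G. G - {h}) = A \<union> B"
  proof -
    have "h = g" if "h \<in> G" "g \<in> G" "\<not> idx h < idx g" "\<not> idx g < idx h" for h g
      using inj_onD[OF G(2), of h g] that by auto
    then show ?thesis unfolding A_def B_def by (auto; meson)
  qed
  also have "sum f (A \<union> B) = sum f A + sum f B" 
    by (rule sum.union_disjoint[OF fin]) (auto simp: A_def B_def)
  also have "sum f B = (\<Sum>p\<in>A. f (prod.swap p))"
    by (rule sum.reindex_bij_witness[of _ prod.swap prod.swap]) (auto simp: A_def B_def)
  also have "\<dots> = (\<Sum>p\<in>A. - f p)"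
  proof (rule sum.cong[OF refl])
    fix p assume "p \<in> A"
    then obtain h g where p: "p = (h, g)" "h \<in> G" "g \<in> G" "idx h < idx g" by (auto simp: A_def)
    then have "h \<noteq> g" by auto
    moreover have "G - {h} - {g} = G - {g} - {h}" by auto
    ultimately show "f (prod.swap p) = - f p"
      using ksgn_remove_swap[OF G, of g h, where 'r = 'r] p
      by (simp add: f_def mult.commute[of "t h"] mult.assoc[symmetric])
  qed
  finally show ?thesis by (simp add: sum_negf)
qed

text \<open>Cartan's homotopy formula. If v is in F, only the summand deleting v survives. Otherwise
  the summand h = v of the differential at \<open>insert v F\<close> gives \<open>t v * c F\<close>,
  and the remaining ones cancel in pairs by sign.\<close>

lemma kdiff_contract:
  assumes F: "finite F" "inj_on idx (insert v F)"
  shows "kdiff idx t (contract idx v c) F + contract idx v (kdiff idx t c) F = t v * (c F :: 'r::comm_ring_1)"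
proof (cases "v \<in> F")
  case True
  have "kdiff idx t (contract idx v c) F = (\<Sum>h\<in>F. if h = v then t v * c F else 0)"
    unfolding kdiff_def using True
    by (intro sum.cong refl) (auto simp: contract_def insert_absorb mult_ac)
  then show ?thesis using True F by (simp add: contract_def)
next
  case False
  let ?G = "insert v F"
  have a: "kdiff idx t (contract idx v c) F = (\<Sum>h\<in>F. ksgn idx h F * ksgn idx v (?G - {h}) * t h * c (?G - {h}))"
    unfolding kdiff_def contract_def using False
    by (intro sum.cong refl) (auto simp: mult_ac insert_Diff_if)
  have Gv: "?G - {v} = F" using False by auto
  have "contract idx v (kdiff idx t c) F = ksgn idx v ?G * (\<Sum>h\<in>?G. ksgn idx h ?G * t h * c (?G - {h}))"
    using False by (simp add: contract_def kdiff_def)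
  also have "\<dots> = t v * c F + (\<Sum>h\<in>F. ksgn idx v ?G * ksgn idx h ?G * t h * c (?G - {h}))"
    using False F(1) Gv by (simp add: sum_distrib_left distrib_left mult.assoc)
  also have "(\<Sum>h\<in>F. ksgn idx v ?G * ksgn idx h ?G * t h * c (?G - {h})) =
     (\<Sum>h\<in>F. - (ksgn idx h F * ksgn idx v (?G - {h}) * t h * c (?G - {h})))"
  proof (rule sum.cong[OF refl])
    fix h assume h: "h \<in> F"
    then have "v \<noteq> h" using False by auto
    then have "ksgn idx v ?G * ksgn idx h ?G = - (ksgn idx h F * ksgn idx v (?G - {h}) :: 'r)"
      using ksgn_remove_both[of ?G idx h v, where 'r = 'r] F h Gv by (simp add: mult.commute)
    then show "ksgn idx v ?G * ksgn idx h ?G * t h * c (?G - {h}) =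
        - (ksgn idx h F * ksgn idx v (?G - {h}) * t h * c (?G - {h}))" by simp
  qed
  finally show ?thesis using a by (simp add: sum_negf)
qed

lemma kdiff_add: "kdiff idx t (\<lambda>F. a F + b F) G = kdiff idx t a G + kdiff idx t b G"
  by (simp add: kdiff_def distrib_left sum.distrib)

lemma kdiff_diff: "kdiff idx t (\<lambda>F. a F - b F) G = kdiff idx t a G - kdiff idx t b G"
  by (simp add: kdiff_def right_diff_distrib sum_subtractf)

lemma kdiff_scale: "kdiff idx t (\<lambda>F. r * a F) G = r * kdiff idx t a G"
  by (simp add: kdiff_def sum_distrib_left mult_ac)

lemma kdiff_sum: "kdiff idx t (\<lambda>F. \<Sum>k\<in>K. a k F) G = (\<Sum>k\<in>K. kdiff idx t (a k) G)"
  unfolding kdiff_def by (subst sum.swap) (simp add: sum_distrib_left)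

lemma kdiff_cong: "(\<And>h. h \<in> G \<Longrightarrow> a (G - {h}) = b (G - {h})) \<Longrightarrow> kdiff idx t a G = kdiff idx t b G"
  by (simp add: kdiff_def)

lemma kdiff_in_ideal:
  "is_ideal I \<Longrightarrow> (\<And>h. h \<in> G \<Longrightarrow> a (G - {h}) \<in> I) \<Longrightarrow> kdiff idx t a G \<in> I"
  unfolding kdiff_def by (intro ideal_sum ideal_mult_left)

lemma kdiff_ideal_cong:
  assumes "is_ideal I" "\<And>h. h \<in> G \<Longrightarrow> a (G - {h}) - b (G - {h}) \<in> I"
  shows "kdiff idx t a G - kdiff idx t b G \<in> I"
  using kdiff_in_ideal[of I G "\<lambda>F. a F - b F" idx t] assms by (simp add: kdiff_diff)

text \<open>Multiplication by the N-th power of the product over F is a chain map from exponent n to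
  exponent n + N. These are the transition maps of the direct system whose limit is the stable
  Koszul complex.\<close>

lemma kdiff_raise:
  fixes x :: "'h \<Rightarrow> 'r::comm_ring_1"
  assumes "finite G"
  shows "kdiff idx (\<lambda>h. x h ^ (n + N)) (\<lambda>F. (\<Prod>h\<in>F. x h) ^ N * c F) G = (\<Prod>h\<in>G. x h) ^ N * kdiff idx (\<lambda>h. x h ^ n) c G"
proof -
  have "(\<Prod>g\<in>G. x g) = x h * (\<Prod>g\<in>G - {h}. x g)" if "h \<in> G" for h
    using assms that by (rule prod.remove)
  then show ?thesis unfolding kdiff_def sum_distrib_left
    by (intro sum.cong refl) (simp add: power_mult_distrib power_add mult_ac)
qed

section \<open>Local cohomology as a limit of Koszul cohomology\<close>

locale koszul =
  fixes idx :: "'h \<Rightarrow> nat" and x :: "'h \<Rightarrow> 'r::comm_ring_1" and C :: "'h set"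
  assumes finC: "finite C" and inj: "inj_on idx C"
begin

abbreviation d :: "nat \<Rightarrow> ('h set \<Rightarrow> 'r) \<Rightarrow> 'h set \<Rightarrow> 'r" where
  "d n c G \<equiv> kdiff idx (\<lambda>h. x h ^ n) c G"

abbreviation xp :: "'h set \<Rightarrow> 'r" where "xp F \<equiv> (\<Prod>h\<in>F. x h)"

definition cocycle :: "'r set \<Rightarrow> nat \<Rightarrow> nat \<Rightarrow> ('h set \<Rightarrow> 'r) \<Rightarrow> bool" where
  "cocycle I i n c \<longleftrightarrow> (\<forall>G. G \<subseteq> C \<and> card G = Suc i \<longrightarrow> d n c G \<in> I)"

text \<open>The class of c at exponent n dies in the direct limit, up to a multiplier s. One s and
  one N serve all F at once, which is no restriction as there are finitely many.\<close>

definition trivial :: "'r set \<Rightarrow> 'r set \<Rightarrow> nat \<Rightarrow> nat \<Rightarrow> ('h set \<Rightarrow> 'r) \<Rightarrow> bool" where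
  "trivial U I i n c \<longleftrightarrow> (\<exists>N b. \<exists>s\<in>U. \<forall>F. F \<subseteq> C \<and> card F = i \<longrightarrow> s * (xp F ^ N * c F) - d (n + N) b F \<in> I)"

text \<open>Vanishing of the i-th local cohomology of the quotient by I, localized at U, with
  support in the ideal of the \<open>x h\<close>.\<close>

definition vanish :: "'r set \<Rightarrow> 'r set \<Rightarrow> nat \<Rightarrow> bool" where
  "vanish U I i \<longleftrightarrow> (\<forall>n c. cocycle I i n c \<longrightarrow> trivial U I i n c)"

text \<open>The ideal generated by I and the n-th powers of the \<open>x h\<close>.\<close>

definition kgen :: "nat \<Rightarrow> 'r set \<Rightarrow> 'r set" where
  "kgen n I = {z. \<exists>r. z - (\<Sum>h\<in>C. x h ^ n * r h) \<in> I}"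

lemma subD: "F \<subseteq> C \<Longrightarrow> finite F" "F \<subseteq> C \<Longrightarrow> inj_on idx F"
  using finC inj by (auto intro: finite_subset inj_on_subset)

lemma finite_faces: "finite {F. F \<subseteq> C \<and> card F = i}"
  using finC by auto

lemma trivialI: "s \<in> U \<Longrightarrow> (\<And>F. F \<subseteq> C \<Longrightarrow> card F = i \<Longrightarrow> s * (xp F ^ N * c F) - d (n + N) b F \<in> I) \<Longrightarrow> trivial U I i n c"
  unfolding trivial_def by blast

lemma trivialE:
  assumes "trivial U I i n c"
  obtains s N b where "s \<in> U" "\<forall>F. F \<subseteq> C \<and> card F = i \<longrightarrow> s * (xp F ^ N * c F) - d (n + N) b F \<in> I"
  using assms unfolding trivial_def by auto

lemma trivial_mono: assumes "I \<subseteq> I'" "trivial U I i n c" shows "trivial U I' i n c"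
proof -
  obtain s N b where "s \<in> U" and s: "\<forall>F. F \<subseteq> C \<and> card F = i \<longrightarrow> s * (xp F ^ N * c F) - d (n + N) b F \<in> I"
    using assms(2) by (rule trivialE)
  then show ?thesis using assms(1) by (intro trivialI[of s]) auto
qed

lemma vanishD: "vanish U I i \<Longrightarrow> cocycle I i n c \<Longrightarrow> trivial U I i n c"
  by (simp add: vanish_def)

lemma raise_eq:
  assumes "is_ideal I" "F \<subseteq> C" "s * (xp F ^ N * c F) - d (n + N) b F \<in> I"
  shows "s * (xp F ^ (N + M) * c F) - d (n + (N + M)) (\<lambda>F. xp F ^ M * b F) F \<in> I"
proof -
  have "d (n + (N + M)) (\<lambda>F. xp F ^ M * b F) F = xp F ^ M * d (n + N) b F"
    using kdiff_raise[OF subD(1)[OF assms(2)], where x = x and n = "n + N" and N = M] by (simp add: add.assoc)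
  then have "s * (xp F ^ (N + M) * c F) - d (n + (N + M)) (\<lambda>F. xp F ^ M * b F) F = xp F ^ M * (s * (xp F ^ N * c F) - d (n + N) b F)"
    by (simp add: power_add algebra_simps)
  then show ?thesis using assms by (simp add: ideal_mult_left)
qed

lemma trivial_cong:
  assumes I: "is_ideal I" and "trivial U I i n c" and eq: "\<And>F. F \<subseteq> C \<Longrightarrow> card F = i \<Longrightarrow> c F - c' F \<in> I"
  shows "trivial U I i n c'"
proof -
  obtain N b s where s[rule_format]: "s \<in> U" "\<forall>F. F \<subseteq> C \<and> card F = i \<longrightarrow> s * (xp F ^ N * c F) - d (n + N) b F \<in> I"
    using assms(2) by (rule trivialE)
  show ?thesis
  proof (rule trivialI[OF s(1)])
    fix F assume F: "F \<subseteq> C" "card F = i"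
    have "(s * (xp F ^ N * c F) - d (n + N) b F) - s * xp F ^ N * (c F - c' F) \<in> I"
      by (intro ideal_diff ideal_mult_left s(2) eq conjI F I)
    then show "s * (xp F ^ N * c' F) - d (n + N) b F \<in> I" by (simp add: algebra_simps)
  qed
qed

lemma trivial_add:
  assumes I: "is_ideal I" and U: "\<And>a b. a \<in> U \<Longrightarrow> b \<in> U \<Longrightarrow> a * b \<in> U"
    and "trivial U I i n c" "trivial U I i n c'"
  shows "trivial U I i n (\<lambda>F. c F + c' F)"
proof -
  obtain N b s where s[rule_format]: "s \<in> U" "\<forall>F. F \<subseteq> C \<and> card F = i \<longrightarrow> s * (xp F ^ N * c F) - d (n + N) b F \<in> I"
    using assms(3) by (rule trivialE)
  obtain M e t where t[rule_format]: "t \<in> U" "\<forall>F. F \<subseteq> C \<and> card F = i \<longrightarrow> t * (xp F ^ M * c' F) - d (n + M) e F \<in> I"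
    using assms(4) by (rule trivialE)
  define b' where "b' = (\<lambda>F. xp F ^ M * b F)"
  define e' where "e' = (\<lambda>F. xp F ^ N * e F)"
  show ?thesis
  proof (rule trivialI[where N = "N + M" and b = "\<lambda>F. t * b' F + s * e' F", OF U[OF s(1) t(1)]])
    fix F assume F: "F \<subseteq> C" "card F = i"
    have 1: "s * (xp F ^ (N + M) * c F) - d (n + (N + M)) b' F \<in> I"
      unfolding b'_def by (rule raise_eq[where c = c and b = b, OF I F(1) s(2)[OF conjI[OF F]]])
    have 2: "t * (xp F ^ (N + M) * c' F) - d (n + (N + M)) e' F \<in> I"
      using raise_eq[where c = c' and b = e and M = N, OF I F(1) t(2)[OF conjI[OF F]]] unfolding e'_def by (simp add: add.commute)
    have "t * (s * (xp F ^ (N + M) * c F) - d (n + (N + M)) b' F) + s * (t * (xp F ^ (N + M) * c' F) - d (n + (N + M)) e' F) \<in> I"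
      by (intro ideal_add ideal_mult_left 1 2 I)
    then show "s * t * (xp F ^ (N + M) * (c F + c' F)) - d (n + (N + M)) (\<lambda>F. t * b' F + s * e' F) F \<in> I"
      by (simp add: kdiff_add kdiff_scale algebra_simps)
  qed
qed

lemma trivial_zero: "is_ideal I \<Longrightarrow> 1 \<in> U \<Longrightarrow> trivial U I i n (\<lambda>_. 0)"
  by (rule trivialI[where s = 1 and N = 0 and b = "\<lambda>_. 0"]) (auto simp: kdiff_def ideal_zero)

lemma trivial_sum:
  assumes I: "is_ideal I" and U: "1 \<in> U" "\<And>a b. a \<in> U \<Longrightarrow> b \<in> U \<Longrightarrow> a * b \<in> U"
    and "finite K" "\<And>k. k \<in> K \<Longrightarrow> trivial U I i n (c k)"
  shows "trivial U I i n (\<lambda>F. \<Sum>k\<in>K. c k F)"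
  using assms(4,5)
proof (induction K rule: finite_induct)
  case (insert k K)
  have "trivial U I i n (\<lambda>F. c k F + (\<Sum>k\<in>K. c k F))"
    using insert by (intro trivial_add[OF I U(2)]) auto
  then show ?case using insert.hyps by simp
qed (simp add: trivial_zero I U)

text \<open>A cochain at exponent n and its raised version at exponent n + N are the same element of
  the limit.\<close>

lemma trivial_shift:
  assumes "trivial U I i (n + N) (\<lambda>F. xp F ^ N * c F)" shows "trivial U I i n c"
proof -
  obtain M b s where s[rule_format]: "s \<in> U" "\<forall>F. F \<subseteq> C \<and> card F = i \<longrightarrow> s * (xp F ^ M * (xp F ^ N * c F)) - d (n + N + M) b F \<in> I"
    using assms by (rule trivialE)
  then show ?thesis
    by (intro trivialI[where N = "N + M" and b = b and s = s]) (auto simp: power_add mult_ac add.assoc)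
qed

lemma trivial_unit:
  assumes U: "\<And>a b. a \<in> U \<Longrightarrow> b \<in> U \<Longrightarrow> a * b \<in> U" and "r \<in> U" "trivial U I i n (\<lambda>F. r * c F)"
  shows "trivial U I i n c"
proof -
  obtain M b s where s[rule_format]: "s \<in> U" "\<forall>F. F \<subseteq> C \<and> card F = i \<longrightarrow> s * (xp F ^ M * (r * c F)) - d (n + M) b F \<in> I"
    using assms(3) by (rule trivialE)
  then show ?thesis using U[OF s(1) assms(2)]
    by (intro trivialI[where N = "M" and b = b and s = "s * r"]) (auto simp: mult_ac)
qed

lemma common_unit:
  assumes I: "is_ideal I" and U: "1 \<in> U" "\<And>a b. a \<in> U \<Longrightarrow> b \<in> U \<Longrightarrow> a * b \<in> U"
    and "finite K" "\<And>k. k \<in> K \<Longrightarrow> \<exists>s\<in>U. s * f k \<in> I"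
  shows "\<exists>s\<in>U. \<forall>k\<in>K. s * f k \<in> I"
  using assms(4,5)
proof (induction K rule: finite_induct)
  case (insert k K)
  then obtain s where "s \<in> U" "\<forall>k\<in>K. s * f k \<in> I" by auto
  moreover obtain t where "t \<in> U" "t * f k \<in> I" using insert.prems[of k] by auto
  ultimately show ?case using U(2)[of s t] ideal_mult_left[OF I, of _ t] ideal_mult_left[OF I, of "t * f k" s]
    by (intro bexI[of _ "s * t"]) (auto simp: mult.assoc mult.left_commute[of s t])
qed (use U in auto)

text \<open>By Cartan's formula contraction with h shows that \<open>x h ^ n\<close> acts as zero on
  cohomology at exponent n; the cobounding cochain is the combination of contractions with the
  coefficients that express y.\<close>

lemma kgen_torsion:
  assumes I: "is_ideal I" and c: "cocycle I i n c" and y: "y \<in> kgen n I"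
  shows "\<exists>b. \<forall>F. F \<subseteq> C \<and> card F = i \<longrightarrow> y * c F - d n b F \<in> I"
proof -
  obtain r where r: "y - (\<Sum>h\<in>C. x h ^ n * r h) \<in> I" using y by (auto simp: kgen_def)
  define b where "b = (\<lambda>F. \<Sum>h\<in>C. r h * contract idx h c F)"
  have "y * c F - d n b F \<in> I" if F: "F \<subseteq> C" "card F = i" for F
  proof -
    have "x h ^ n * c F - d n (contract idx h c) F \<in> I" if h: "h \<in> C" for h
    proof -
      have "contract idx h (kdiff idx (\<lambda>h. x h ^ n) c) F \<in> I"
        using c F h I subD(1)[OF F(1)] unfolding contract_def cocycle_def
        by (auto intro!: ideal_mult_left ideal_zero)
      moreover have "inj_on idx (insert h F)" using F h subD(2)[of "insert h F"] by auto
      ultimately show ?thesis using kdiff_contract[OF subD(1)[OF F(1)], of idx h "\<lambda>h. x h ^ n" c]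
        by (metis add_diff_cancel_left')
    qed
    then have "(y - (\<Sum>h\<in>C. x h ^ n * r h)) * c F + (\<Sum>h\<in>C. r h * (x h ^ n * c F - d n (contract idx h c) F)) \<in> I"
      using r I by (intro ideal_add ideal_sum ideal_mult_right[of I "y - _"] ideal_mult_left) auto
    then show ?thesis
      by (simp add: b_def kdiff_sum kdiff_scale algebra_simps sum_subtractf sum_distrib_left sum_distrib_right)
  qed
  then show ?thesis by auto
qed

text \<open>The long exact cohomology sequence of multiplication by y, written with cochains: a
  class killed by y comes from degree i - 1 of the quotient by y, where it is trivial by
  hypothesis.\<close>

lemma trivial_of_regular_multiple:
  assumes I: "is_ideal I" and U: "1 \<in> U" "\<And>a b. a \<in> U \<Longrightarrow> b \<in> U \<Longrightarrow> a * b \<in> U"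
    and y: "regular_on U I y" and IH: "\<And>j. i = Suc j \<Longrightarrow> vanish U (adjoin I y) j"
    and b: "\<And>F. F \<subseteq> C \<Longrightarrow> card F = i \<Longrightarrow> y * c F - d n b F \<in> I"
  shows "trivial U I i n c"
proof -
  have "\<exists>N. \<exists>s\<in>U. \<exists>e. \<forall>F. F \<subseteq> C \<and> card F = i \<longrightarrow> y * (s * (xp F ^ N * c F) - d (n + N) e F) \<in> I"
  proof (cases i)
    case 0
    have "y * c F \<in> I" if "F \<subseteq> C" "card F = 0" for F
    proof -
      have "F = {}" using that subD(1) by auto
      then show ?thesis using b[OF that(1)] 0 by (simp add: kdiff_def)
    qed
    then show ?thesis using 0 U(1)
      by (intro exI[of _ 0] bexI[of _ 1] exI[of _ "\<lambda>_. 0"]) (auto simp: kdiff_def)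
  next
    case (Suc j)
    \<comment> \<open>Since d b is y * c modulo I, the cochain b becomes a cocycle once y is
      adjoined.\<close>
    have "cocycle (adjoin I y) j n b" unfolding cocycle_def
    proof (intro allI impI)
      fix G assume G: "G \<subseteq> C \<and> card G = Suc j"
      then have "d n b G - c G * y \<in> I" using ideal_sym[OF I b[of G]] Suc by (simp add: mult.commute)
      then show "d n b G \<in> adjoin I y" by (auto simp: in_adjoin)
    qed
    from vanishD[OF IH[OF Suc] this] obtain N b' s where s[rule_format]: "s \<in> U"
      "\<forall>F. F \<subseteq> C \<and> card F = j \<longrightarrow> s * (xp F ^ N * b F) - d (n + N) b' F \<in> adjoin I y"
      by (rule trivialE)
    from s(2) obtain e where e[rule_format]: "\<forall>F. F \<subseteq> C \<and> card F = j \<longrightarrow> s * (xp F ^ N * b F) - d (n + N) b' F - e F * y \<in> I"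
      by (rule adjoin_choice)
    have "y * (s * (xp G ^ N * c G) - d (n + N) e G) \<in> I" if G: "G \<subseteq> C" "card G = i" for G
    proof -
      \<comment> \<open>Applying d to the relation just found eliminates \<open>b'\<close> and turns
        b into y * c. What remains is y times the desired relation, and y is cancelled by regularity
        at the end.\<close>
      have "d (n + N) (\<lambda>F. s * (xp F ^ N * b F) - d (n + N) b' F - y * e F) G \<in> I"
        using I
      proof (rule kdiff_in_ideal)
        fix h assume "h \<in> G"
        then show "s * (xp (G - {h}) ^ N * b (G - {h})) - d (n + N) b' (G - {h}) - y * e (G - {h}) \<in> I"
          using G Suc subD(1)[OF G(1)] e[of "G - {h}"] by (auto simp: mult.commute)
      qed
      then have "s * (xp G ^ N * d n b G) - y * d (n + N) e G \<in> I"
        using kdiff_kdiff[of G idx "\<lambda>h. x h ^ (n + N)" b'] subD[OF G(1)]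
        by (simp add: kdiff_diff kdiff_scale kdiff_raise)
      moreover have "s * xp G ^ N * (y * c G - d n b G) \<in> I" using G b I by (intro ideal_mult_left) auto
      ultimately have "s * xp G ^ N * (y * c G - d n b G) + (s * (xp G ^ N * d n b G) - y * d (n + N) e G) \<in> I"
        using I by (intro ideal_add)
      then show ?thesis by (simp add: algebra_simps)
    qed
    then show ?thesis using s(1) by blast
  qed
  then obtain N s e where s: "s \<in> U"
    and e: "\<And>F. F \<subseteq> C \<Longrightarrow> card F = i \<Longrightarrow> y * (s * (xp F ^ N * c F) - d (n + N) e F) \<in> I" by blast
  have "\<exists>t\<in>U. \<forall>F\<in>{F. F \<subseteq> C \<and> card F = i}. t * (s * (xp F ^ N * c F) - d (n + N) e F) \<in> I"
  proof (rule common_unit[OF I U finite_faces])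
    fix F assume "F \<in> {F. F \<subseteq> C \<and> card F = i}"
    then have "(s * (xp F ^ N * c F) - d (n + N) e F) * y \<in> I" using e[of F] by (simp add: mult.commute[of _ y])
    then show "\<exists>t\<in>U. t * (s * (xp F ^ N * c F) - d (n + N) e F) \<in> I" using y unfolding regular_on_def by blast
  qed
  then obtain t where t: "t \<in> U" "\<And>F. F \<subseteq> C \<Longrightarrow> card F = i \<Longrightarrow> t * (s * (xp F ^ N * c F) - d (n + N) e F) \<in> I" by auto
  show ?thesis
    by (rule trivialI[OF U(2)[OF t(1) s], where N = N and b = "\<lambda>F. t * e F"])
       (use t(2) in \<open>simp add: kdiff_scale algebra_simps\<close>)
qed

text \<open>At exponent n a power of y kills every class by \<open>kgen_torsion\<close>; the factors
  y are then removed one at a time.\<close>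

lemma vanish_of_regular:
  assumes I: "is_ideal I" and U: "1 \<in> U" "\<And>a b. a \<in> U \<Longrightarrow> b \<in> U \<Longrightarrow> a * b \<in> U"
    and y: "regular_on U I y" and tors: "\<And>n. \<exists>m. y ^ m \<in> kgen n I"
    and IH: "\<And>j. i = Suc j \<Longrightarrow> vanish U (adjoin I y) j"
  shows "vanish U I i"
  unfolding vanish_def
proof (intro allI impI)
  fix n c assume c: "cocycle I i n c"
  obtain m where "y ^ m \<in> kgen n I" using tors by blast
  from kgen_torsion[OF I c this] obtain b where
    b: "\<And>F. F \<subseteq> C \<Longrightarrow> card F = i \<Longrightarrow> y ^ m * c F - d n b F \<in> I" by blast
  have "trivial U I i n (\<lambda>F. y ^ m * c F)"
    by (rule trivialI[OF U(1), where N = 0 and b = b]) (use b in simp)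
  then show "trivial U I i n c"
  proof (induction m)
    case (Suc m)
    obtain N b s where s[rule_format]: "s \<in> U"
      "\<forall>F. F \<subseteq> C \<and> card F = i \<longrightarrow> s * (xp F ^ N * (y ^ Suc m * c F)) - d (n + N) b F \<in> I"
      using Suc.prems by (rule trivialE)
    \<comment> \<open>The witness for \<open>y ^ Suc m * c\<close> says that y times this cochain is
      a coboundary; up to the multiplier s the cochain represents \<open>y ^ m * c\<close> at the
      larger exponent.\<close>
    have "trivial U I i (n + N) (\<lambda>F. s * (xp F ^ N * (y ^ m * c F)))"
      by (rule trivial_of_regular_multiple[OF I U y IH, where b = b]) (use s(2) in \<open>auto simp: mult_ac\<close>)
    from trivial_shift[OF trivial_unit[OF U(2) s(1) this]]
    have "trivial U I i n (\<lambda>F. y ^ m * c F)" by simp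
    then show ?case by (rule Suc.IH)
  qed simp
qed

text \<open>Depth sensitivity of local cohomology, by induction along the sequence: vanishing modulo
  the first entry gives vanishing one degree higher.\<close>

lemma vanish_of_reg_list:
  assumes "is_ideal J" and U: "1 \<in> U" "\<And>a b. a \<in> U \<Longrightarrow> b \<in> U \<Longrightarrow> a * b \<in> U"
    and "reg_list U J us" and "\<And>u n. u \<in> set us \<Longrightarrow> \<exists>m. u ^ m \<in> kgen n J" and "i < length us"
  shows "vanish U J i"
  using assms(1,4-)
proof (induction us arbitrary: J i)
  case (Cons u us)
  have "kgen n J \<subseteq> kgen n (adjoin J u)" for n using adjoin_subset by (fastforce simp: kgen_def)
  then have "vanish U (adjoin J u) j" if "j < length us" for j
    using Cons.prems that by (intro Cons.IH ideal_adjoin) (auto, blast)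
  then show ?case using Cons.prems by (intro vanish_of_regular[OF _ U, of J u]) auto
qed auto

text \<open>The other half of the long exact sequence. The coboundary of a cocycle modulo y has the
  form y * e, and e represents the connecting class in degree i + 1, which is trivial by
  hypothesis.\<close>

lemma vanish_adjoin:
  assumes I: "is_ideal I" and U: "1 \<in> U" "\<And>a b. a \<in> U \<Longrightarrow> b \<in> U \<Longrightarrow> a * b \<in> U"
    and y: "regular_on U I y" and v: "vanish U I i" "vanish U I (Suc i)"
  shows "vanish U (adjoin I y) i"
  unfolding vanish_def
proof (intro allI impI)
  fix n c assume "cocycle (adjoin I y) i n c"
  then have "d n c G \<in> adjoin I y" if "G \<subseteq> C \<and> card G = Suc i" for G using that by (simp add: cocycle_def)
  then obtain e where e[rule_format]: "\<forall>G. G \<subseteq> C \<and> card G = Suc i \<longrightarrow> d n c G - e G * y \<in> I"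
    by (rule adjoin_choice[of "\<lambda>G. G \<subseteq> C \<and> card G = Suc i" "\<lambda>G. d n c G"])
  have "d n e G * y \<in> I" if G: "G \<subseteq> C" "card G = Suc (Suc i)" for G
  proof -
    have "d n (\<lambda>G. d n c G - y * e G) G \<in> I"
      using I
    proof (rule kdiff_in_ideal)
      fix h assume "h \<in> G"
      then show "d n c (G - {h}) - y * e (G - {h}) \<in> I"
        using e[of "G - {h}"] G subD(1)[OF G(1)] by (auto simp: mult.commute)
    qed
    then have "0 - y * d n e G \<in> I" using subD[OF G(1)] by (simp add: kdiff_diff kdiff_scale kdiff_kdiff)
    then show ?thesis using ideal_uminus[OF I] by (fastforce simp: mult.commute)
  qed
  then have "\<exists>t\<in>U. \<forall>G\<in>{G. G \<subseteq> C \<and> card G = Suc (Suc i)}. t * d n e G \<in> I"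
    using y by (intro common_unit[OF I U] finite_faces) (auto simp: regular_on_def)
  then obtain t where t: "t \<in> U" "\<And>G. G \<subseteq> C \<Longrightarrow> card G = Suc (Suc i) \<Longrightarrow> t * d n e G \<in> I" by auto
  have "cocycle I (Suc i) n (\<lambda>G. t * e G)" using t(2) by (simp add: cocycle_def kdiff_scale)
  from vanishD[OF v(2) this] obtain N b s where s[rule_format]: "s \<in> U"
    "\<forall>F. F \<subseteq> C \<and> card F = Suc i \<longrightarrow> s * (xp F ^ N * (t * e F)) - d (n + N) b F \<in> I"
    by (rule trivialE)
  \<comment> \<open>Subtracting y * b turns the cocycle modulo y into a genuine cocycle modulo I;
    modulo y it is still the old class, apart from the multiplier s * t.\<close>
  define c' where "c' = (\<lambda>F. s * t * (xp F ^ N * c F) - y * b F)"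
  have "cocycle I i (n + N) c'" unfolding cocycle_def
  proof (intro allI impI)
    fix G assume G: "G \<subseteq> C \<and> card G = Suc i"
    have "d (n + N) c' G = s * t * (xp G ^ N * d n c G) - y * d (n + N) b G"
      using subD(1)[of G] G by (simp add: c'_def kdiff_diff kdiff_scale kdiff_raise)
    also have "\<dots> = s * t * xp G ^ N * (d n c G - e G * y) + y * (s * (xp G ^ N * (t * e G)) - d (n + N) b G)"
      by (simp add: algebra_simps)
    also have "\<dots> \<in> I" using G by (intro ideal_add[OF I] ideal_mult_left[OF I] e s) auto
    finally show "d (n + N) c' G \<in> I" .
  qed
  then have "trivial U I i (n + N) c'" using v(1) by (auto simp: vanish_def)
  then have "trivial U (adjoin I y) i (n + N) c'"
    by (rule trivial_mono[OF adjoin_subset])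
  then have "trivial U (adjoin I y) i (n + N) (\<lambda>F. s * t * (xp F ^ N * c F))"
  proof (rule trivial_cong[OF ideal_adjoin[OF I]])
    fix F show "c' F - s * t * (xp F ^ N * c F) \<in> adjoin I y"
      using ideal_zero[OF I] by (auto simp: c'_def in_adjoin intro!: exI[of _ "- b F"])
  qed
  then show "trivial U (adjoin I y) i n c"
    by (rule trivial_shift[OF trivial_unit[OF U(2) U(2)[OF s(1) t(1)]], rotated 2])
qed

lemma vanish_adjoins:
  assumes "is_ideal J" and U: "1 \<in> U" "\<And>a b. a \<in> U \<Longrightarrow> b \<in> U \<Longrightarrow> a * b \<in> U"
    and "reg_list U J us" and "\<And>i. i < D + length us \<Longrightarrow> vanish U J i" and "i < D"
  shows "vanish U (adjoins J us) i"
  using assms(1,4-)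
proof (induction us arbitrary: J)
  case (Cons u us)
  have "vanish U (adjoin J u) i" if "i < D + length us" for i
    using Cons.prems that by (intro vanish_adjoin[OF _ U]) auto
  then show ?case using Cons.prems by (auto intro!: Cons.IH ideal_adjoin)
qed auto

text \<open>The connecting argument for an element y that is regular only up to elements killed by
  all \<open>x h\<close>. After multiplication by \<open>x v\<close>, dividing by y leaves a cochain
  u with y * u in I, and such a u dies in the limit.\<close>

lemma trivial_of_weak_multiple:
  assumes I: "is_ideal I" and c: "cocycle I i n c" and v: "v \<in> C"
    and y: "y \<in> kgen n I" and weak: "\<And>a h. a * y \<in> I \<Longrightarrow> h \<in> C \<Longrightarrow> x h * a \<in> I"
    and IH: "\<And>j m b. i = Suc j \<Longrightarrow> cocycle (adjoin I y) j m b \<Longrightarrow> trivial {1} (adjoin I y) j m (\<lambda>F. x v * b F)"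
  shows "trivial {1} I i n (\<lambda>F. x v * c F)"
proof -
  obtain b where b: "\<And>F. F \<subseteq> C \<Longrightarrow> card F = i \<Longrightarrow> y * c F - d n b F \<in> I"
    using kgen_torsion[OF I c y] by blast
  show ?thesis
  proof (cases i)
    case 0
    \<comment> \<open>In degree 0 raising the exponent multiplies by an empty product and achieves
      nothing; here it is the factor \<open>x v\<close> that kills c.\<close>
    have "x v * c F \<in> I" if "F \<subseteq> C" "card F = 0" for F
      using b[OF that(1)] that subD(1)[of F] 0 weak[OF _ v, of "c F"] by (auto simp: kdiff_def mult.commute)
    then show ?thesis using 0 subD(1)
      by (intro trivialI[where s = 1 and N = 0 and b = "\<lambda>_. 0"]) (auto simp: kdiff_def)
  next
    case (Suc j)
    have "cocycle (adjoin I y) j n b" unfolding cocycle_def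
    proof (intro allI impI)
      fix G assume G: "G \<subseteq> C \<and> card G = Suc j"
      then have "d n b G - c G * y \<in> I" using ideal_sym[OF I b[of G]] Suc by (simp add: mult.commute)
      then show "d n b G \<in> adjoin I y" by (auto simp: in_adjoin)
    qed
    from IH[OF Suc this] obtain N b' s where one[rule_format]:
      "s \<in> {1}" "\<forall>F. F \<subseteq> C \<and> card F = j \<longrightarrow> s * (xp F ^ N * (x v * b F)) - d (n + N) b' F \<in> adjoin I y"
      by (rule trivialE)
    then have "\<And>F. F \<subseteq> C \<and> card F = j \<Longrightarrow> xp F ^ N * (x v * b F) - d (n + N) b' F \<in> adjoin I y" using one by simp
    then obtain e where e[rule_format]: "\<forall>F. F \<subseteq> C \<and> card F = j \<longrightarrow> xp F ^ N * (x v * b F) - d (n + N) b' F - e F * y \<in> I"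
      by (rule adjoin_choice)
    define u where "u = (\<lambda>G. xp G ^ N * (x v * c G) - d (n + N) e G)"
    have "u G * y \<in> I" if G: "G \<subseteq> C" "card G = i" for G
    proof -
      have "d (n + N) (\<lambda>F. x v * (xp F ^ N * b F) - d (n + N) b' F - y * e F) G \<in> I"
        using I
      proof (rule kdiff_in_ideal)
        fix h assume "h \<in> G"
        then show "x v * (xp (G - {h}) ^ N * b (G - {h})) - d (n + N) b' (G - {h}) - y * e (G - {h}) \<in> I"
          using G Suc subD(1)[OF G(1)] e[of "G - {h}"] by (auto simp: mult_ac)
      qed
      then have "x v * (xp G ^ N * d n b G) - y * d (n + N) e G \<in> I"
        using kdiff_kdiff[of G idx "\<lambda>h. x h ^ (n + N)" b'] subD[OF G(1)]
        by (simp add: kdiff_diff kdiff_scale kdiff_raise)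
      moreover have "x v * xp G ^ N * (y * c G - d n b G) \<in> I" using G b I by (intro ideal_mult_left) auto
      ultimately have "x v * xp G ^ N * (y * c G - d n b G) + (x v * (xp G ^ N * d n b G) - y * d (n + N) e G) \<in> I"
        using I by (intro ideal_add)
      then show ?thesis by (simp add: u_def algebra_simps)
    qed
    \<comment> \<open>A set of cardinality i > 0 has an element h, and \<open>x h\<close> already
      kills u at this set, so one step in the direct system suffices.\<close>
    then have "xp G * u G \<in> I" if G: "G \<subseteq> C" "card G = i" for G
    proof -
      obtain h where h: "h \<in> G" using G Suc by fastforce
      then have "xp G = xp (G - {h}) * x h" using prod.remove[OF subD(1)[OF G(1)], of h x] by (simp add: mult.commute)
      moreover have "x h * u G \<in> I" using weak h G \<open>\<And>G. G \<subseteq> C \<Longrightarrow> card G = i \<Longrightarrow> u G * y \<in> I\<close>[OF G] by auto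
      ultimately show ?thesis using ideal_mult_left[OF I] by (simp add: mult.assoc)
    qed
    then have "trivial {1} I i (n + N) u"
      by (intro trivialI[where s = 1 and N = 1 and b = "\<lambda>_. 0"]) (auto simp: kdiff_def)
    moreover have "trivial {1} I i (n + N) (\<lambda>F. d (n + N) e F)"
      by (intro trivialI[where s = 1 and N = 0 and b = e]) (auto simp: ideal_zero[OF I])
    ultimately have "trivial {1} I i (n + N) (\<lambda>F. u F + d (n + N) e F)"
      by (intro trivial_add[OF I]) auto
    then have "trivial {1} I i (n + N) (\<lambda>F. xp F ^ N * (x v * c F))" by (simp add: u_def)
    then show ?thesis by (rule trivial_shift)
  qed
qed

text \<open>\<open>map2\<close> stops at the shorter list, so a list of fewer exponents stands for
  powers of an initial segment of \<open>ts\<close>.\<close>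

definition powers :: "'r list \<Rightarrow> nat list \<Rightarrow> 'r list" where
  "powers ts ms = map2 (\<lambda>t m. t ^ m) ts ms"

text \<open>The Buchsbaum property forces the cohomology below the top to be annihilated by the x's:
  each class is killed by a power of a parameter, and so comes from the quotient by that power.\<close>

lemma weak_list_annihilates:
  assumes J: "is_ideal J"
    and weak: "\<And>ms m a h. length ms < length ts \<Longrightarrow> 0 \<notin> set ms \<Longrightarrow> 0 < m \<Longrightarrow> h \<in> C \<Longrightarrow>
        a * (ts ! length ms) ^ m \<in> adjoins J (powers ts ms) \<Longrightarrow> x h * a \<in> adjoins J (powers ts ms)"
    and tors: "\<And>t n. t \<in> set ts \<Longrightarrow> \<exists>m>0. t ^ m \<in> kgen n J"
    and v: "v \<in> C"
  shows "0 \<notin> set ms \<Longrightarrow> i + length ms < length ts \<Longrightarrow> cocycle (adjoins J (powers ts ms)) i n c \<Longrightarrow>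
     trivial {1} (adjoins J (powers ts ms)) i n (\<lambda>F. x v * c F)"
proof (induction i arbitrary: ms n c)
  case 0
  obtain m where m: "m > 0" "(ts ! length ms) ^ m \<in> kgen n J" using tors 0 by (metis add_0 nth_mem)
  have "kgen n J \<subseteq> kgen n (adjoins J (powers ts ms))"
    using adjoins_subset by (fastforce simp: kgen_def)
  then show ?case using m weak[OF _ 0(1)] 0
    by (intro trivial_of_weak_multiple[OF ideal_adjoins[OF J] 0(3) v, where y = "(ts ! length ms) ^ m"]) auto
next
  case (Suc i)
  obtain m where m: "m > 0" "(ts ! length ms) ^ m \<in> kgen n J"
    using tors Suc.prems(2) by (metis add_lessD1 add.commute nth_mem)
  have "kgen n J \<subseteq> kgen n (adjoins J (powers ts ms))"
    using adjoins_subset by (fastforce simp: kgen_def)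
  moreover have "powers ts (ms @ [m]) = powers ts ms @ [(ts ! length ms) ^ m]"
    using Suc.prems(2) by (intro nth_equalityI) (auto simp: powers_def nth_append less_Suc_eq)
  then have "adjoins J (powers ts (ms @ [m])) = adjoin (adjoins J (powers ts ms)) ((ts ! length ms) ^ m)" by simp
  ultimately show ?case using m weak[OF _ Suc.prems(1)] Suc.prems Suc.IH[of "ms @ [m]"]
    by (intro trivial_of_weak_multiple[OF ideal_adjoins[OF J] Suc.prems(3) v, where y = "(ts ! length ms) ^ m"]) auto
qed

text \<open>Whatever u annihilates modulo J is killed by the \<open>x h\<close>, hence is local
  cohomology of degree 0, which vanishes. Passing to the quotient by u costs one degree of vanishing
  and one entry of the list.\<close>

lemma reg_list_of_weak_vanish:
  assumes "is_ideal J"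
    and "\<And>i a h. i < length us \<Longrightarrow> h \<in> C \<Longrightarrow>
        a * us ! i \<in> adjoins J (take i us) \<Longrightarrow> x h * a \<in> adjoins J (take i us)"
    and "\<And>i. i < length us \<Longrightarrow> vanish {1} J i"
  shows "reg_list {1} J us"
  using assms
proof (induction us arbitrary: J)
  case (Cons u us)
  have reg: "regular_on {1} J u" unfolding regular_on_def
  proof (intro allI impI)
    fix a assume "a * u \<in> J"
    then have a: "x h * a \<in> J" if "h \<in> C" for h using Cons.prems(2)[of 0 h a] that by auto
    \<comment> \<open>At exponent 1 the constant cochain a is a cocycle because every
      \<open>x h * a\<close> lies in J; on the empty set triviality then means that a itself lies in
      J.\<close>
    have "cocycle J 0 1 (\<lambda>_. a)" unfolding cocycle_def kdiff_def
    proof (intro allI impI ideal_sum[OF Cons.prems(1)])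
      fix G h assume "G \<subseteq> C \<and> card G = Suc 0" "h \<in> G"
      then show "ksgn idx h G * x h ^ 1 * a \<in> J"
        using ideal_mult_left[OF Cons.prems(1) a[of h], of "ksgn idx h G"] by (auto simp: mult.assoc)
    qed
    then have "trivial {1} J 0 1 (\<lambda>_. a)" using Cons.prems(3)[of 0] by (auto simp: vanish_def)
    then show "\<exists>s\<in>{1}. s * a \<in> J" by (auto simp: trivial_def kdiff_def)
  qed
  have "reg_list {1} (adjoin J u) us"
  proof (rule Cons.IH)
    show "vanish {1} (adjoin J u) i" if "i < length us" for i
      using that Cons.prems(3) by (intro vanish_adjoin[OF Cons.prems(1) _ _ reg]) auto
    show "x h * a \<in> adjoins (adjoin J u) (take i us)"
      if "i < length us" "h \<in> C" "a * us ! i \<in> adjoins (adjoin J u) (take i us)" for i h a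
      using Cons.prems(2)[of "Suc i" h a] that by simp
  qed (rule ideal_adjoin[OF Cons.prems(1)])
  then show ?case using reg by simp
qed simp

end

section \<open>Localization at a prime\<close>

text \<open>Only the calculus of fractions of the quotient by J at P is recorded: numerators and
  denominators stay in the ambient type, and equality is tested modulo J. The arguments are thus
  independent of the construction of the localization.\<close>

locale locring =
  fixes J P :: "'r::comm_ring_1 set" and L :: "('a, 'b) ring_scheme" (structure) and fr :: "'r \<Rightarrow> 'r \<Rightarrow> 'a"
  assumes J: "is_ideal J" and P: "is_prime P" and JP: "J \<subseteq> P"
    and carr: "carrier L = {fr a s | a s. s \<notin> P}"
    and fr_eq: "s \<notin> P \<Longrightarrow> t \<notin> P \<Longrightarrow> fr a s = fr b t \<longleftrightarrow> (\<exists>u. u \<notin> P \<and> u * (a * t - b * s) \<in> J)"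
    and fr_mult: "s \<notin> P \<Longrightarrow> t \<notin> P \<Longrightarrow> fr a s \<otimes> fr b t = fr (a * b) (s * t)"
    and fr_add: "s \<notin> P \<Longrightarrow> t \<notin> P \<Longrightarrow> fr a s \<oplus> fr b t = fr (a * t + b * s) (s * t)"
    and fr_one: "\<one> = fr 1 1" and fr_zero: "\<zero> = fr 0 1"
begin

lemma one_notin [simp]: "1 \<notin> P" using P by (auto dest: is_primeD)

lemma mult_notin [simp]: "s \<notin> P \<Longrightarrow> t \<notin> P \<Longrightarrow> s * t \<notin> P" using P by (auto dest: is_primeD)

lemma power_notin [simp]: "s \<notin> P \<Longrightarrow> s ^ n \<notin> P" by (induction n) auto

lemma fr_in [simp]: "s \<notin> P \<Longrightarrow> fr a s \<in> carrier L" using carr by auto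

lemma frE: assumes "z \<in> carrier L" obtains a s where "s \<notin> P" "z = fr a s" using assms carr by auto

lemma fr_eqI: "s \<notin> P \<Longrightarrow> t \<notin> P \<Longrightarrow> a * t = b * s \<Longrightarrow> fr a s = fr b t"
  by (subst fr_eq) (auto intro!: exI[of _ 1] ideal_zero[OF J])

lemma cring_L: "cring L"
proof (rule cringI)
  show "abelian_group L"
  proof (rule abelian_groupI)
    fix u v w assume "u \<in> carrier L" "v \<in> carrier L" "w \<in> carrier L"
    then obtain a s b t c r where *: "s \<notin> P" "u = fr a s" "t \<notin> P" "v = fr b t" "r \<notin> P" "w = fr c r" by (metis frE)
    show "u \<oplus> v \<in> carrier L" using * by (simp add: fr_add)
    show "u \<oplus> v \<oplus> w = u \<oplus> (v \<oplus> w)" using * by (simp add: fr_add) (auto intro!: fr_eqI simp: algebra_simps)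
    show "u \<oplus> v = v \<oplus> u" using * by (simp add: fr_add) (auto intro!: fr_eqI simp: algebra_simps)
    show "\<zero> \<oplus> u = u" using * by (simp add: fr_add fr_zero)
    have "fr (- a) s \<oplus> u = \<zero>" using * by (simp add: fr_add fr_zero) (auto intro!: fr_eqI simp: algebra_simps)
    then show "\<exists>y\<in>carrier L. y \<oplus> u = \<zero>" using * by (auto intro!: bexI[of _ "fr (-a) s"])
  qed (simp add: fr_zero)
  show "comm_monoid L"
  proof (rule comm_monoidI)
    fix u v w assume "u \<in> carrier L" "v \<in> carrier L" "w \<in> carrier L"
    then obtain a s b t c r where *: "s \<notin> P" "u = fr a s" "t \<notin> P" "v = fr b t" "r \<notin> P" "w = fr c r" by (metis frE)
    show "u \<otimes> v \<in> carrier L" using * by (simp add: fr_mult)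
    show "u \<otimes> v \<otimes> w = u \<otimes> (v \<otimes> w)" using * by (simp add: fr_mult mult.assoc)
    show "u \<otimes> v = v \<otimes> u" using * by (simp add: fr_mult mult.commute)
    show "\<one> \<otimes> u = u" using * by (simp add: fr_mult fr_one)
  qed (simp add: fr_one)
  fix u v w assume "u \<in> carrier L" "v \<in> carrier L" "w \<in> carrier L"
  then obtain a s b t c r where *: "s \<notin> P" "u = fr a s" "t \<notin> P" "v = fr b t" "r \<notin> P" "w = fr c r" by (metis frE)
  show "(u \<oplus> v) \<otimes> w = u \<otimes> w \<oplus> v \<otimes> w"
    using * by (simp add: fr_add fr_mult) (auto intro!: fr_eqI simp: algebra_simps)
qed

sublocale cring L by (rule cring_L)

definition con :: "'a set \<Rightarrow> 'r set" where "con K = {a. fr a 1 \<in> K}"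

definition ex :: "'r set \<Rightarrow> 'a set" where "ex I = {fr a s | a s. a \<in> I \<and> s \<notin> P}"

lemma exI_L: "a \<in> I \<Longrightarrow> s \<notin> P \<Longrightarrow> fr a s \<in> ex I"
  by (auto simp: ex_def)

lemma ex_subset: "ex I \<subseteq> carrier L"
  by (auto simp: ex_def)

lemma ex_mono: "I \<subseteq> I' \<Longrightarrow> ex I \<subseteq> ex I'"
  by (auto simp: ex_def)

lemma mem_con: assumes K: "ideal K L" and s: "s \<notin> P" shows "fr a s \<in> K \<longleftrightarrow> a \<in> con K"
proof
  assume "fr a s \<in> K"
  then have "fr s 1 \<otimes> fr a s \<in> K" using K s by (simp add: ideal.I_l_closed)
  moreover have "fr s 1 \<otimes> fr a s = fr a 1" using s by (auto simp: fr_mult intro!: fr_eqI)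
  ultimately show "a \<in> con K" by (simp add: con_def)
next
  assume "a \<in> con K"
  then have "fr 1 s \<otimes> fr a 1 \<in> K" using K s by (simp add: ideal.I_l_closed con_def)
  then show "fr a s \<in> K" using s by (simp add: fr_mult)
qed

lemma ideal_con: assumes K: "ideal K L" shows "is_ideal (con K)"
  unfolding is_ideal_def
proof (intro conjI ballI allI)
  interpret K: ideal K L by (rule K)
  show "0 \<in> con K" using K.zero_closed by (simp add: con_def fr_zero)
  fix a assume a: "a \<in> con K"
  { fix b assume "b \<in> con K"
    then have "fr a 1 \<oplus> fr b 1 \<in> K" using a by (auto simp: con_def intro: K.a_closed)
    then show "a + b \<in> con K" by (simp add: fr_add con_def) }
  fix r
  have "fr r 1 \<otimes> fr a 1 \<in> K" using a by (intro K.I_l_closed) (auto simp: con_def)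
  then show "r * a \<in> con K" by (simp add: fr_mult con_def)
qed

lemma J_con: "ideal K L \<Longrightarrow> J \<subseteq> con K"
proof
  fix j assume K: "ideal K L" and j: "j \<in> J"
  have "fr j 1 = fr 0 1" using j by (subst fr_eq) (auto intro!: exI[of _ 1])
  then show "j \<in> con K" using ideal_zero[OF ideal_con[OF K]] by (simp add: con_def)
qed

lemma mem_ex: assumes I: "is_ideal I" "J \<subseteq> I" and s: "s \<notin> P" shows "fr a s \<in> ex I \<longleftrightarrow> (\<exists>u. u \<notin> P \<and> u * a \<in> I)"
proof
  assume "fr a s \<in> ex I"
  then obtain b t where b: "fr a s = fr b t" "b \<in> I" "t \<notin> P" by (auto simp: ex_def)
  then obtain u where u: "u \<notin> P" "u * (a * t - b * s) \<in> J" using fr_eq s by blast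
  then have "u * (a * t - b * s) + (u * s) * b \<in> I" using I b by (intro ideal_add ideal_mult_left[of I b]) auto
  then have "(u * t) * a \<in> I" by (simp add: algebra_simps)
  then show "\<exists>u. u \<notin> P \<and> u * a \<in> I" using u b by (intro exI[of _ "u * t"]) auto
next
  assume "\<exists>u. u \<notin> P \<and> u * a \<in> I"
  then obtain u where u: "u \<notin> P" "u * a \<in> I" by auto
  then have "fr a s = fr (u * a) (u * s)" using s by (intro fr_eqI) (auto simp: mult_ac)
  then show "fr a s \<in> ex I" using u s by (simp add: exI_L)
qed

lemma ideal_ex: assumes I: "is_ideal I" "J \<subseteq> I" shows "ideal (ex I) L"
proof (rule idealI[OF ring_axioms])
  show "subgroup (ex I) (add_monoid L)"
  proof (rule subgroup.intro)
    show "ex I \<subseteq> carrier (add_monoid L)" by (auto simp: ex_def)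
    fix u v assume "u \<in> ex I" "v \<in> ex I"
    then obtain a s b t where *: "u = fr a s" "a \<in> I" "s \<notin> P" "v = fr b t" "b \<in> I" "t \<notin> P" by (auto simp: ex_def)
    then have "u \<oplus> v = fr (a * t + b * s) (s * t)" "a * t + b * s \<in> I"
      using I by (auto simp: fr_add intro!: ideal_add ideal_mult_right)
    then show "u \<otimes>\<^bsub>add_monoid L\<^esub> v \<in> ex I" using * by (simp add: exI_L)
  next
    show "\<one>\<^bsub>add_monoid L\<^esub> \<in> ex I" using exI_L[OF ideal_zero[OF I(1)] one_notin] by (simp add: fr_zero)
  next
    fix u assume "u \<in> ex I"
    then obtain a s where *: "u = fr a s" "a \<in> I" "s \<notin> P" by (auto simp: ex_def)
    have "fr (- a) s \<oplus> u = \<zero>" using * by (simp add: fr_add fr_zero) (auto intro!: fr_eqI simp: algebra_simps)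
    then have "\<ominus> u = fr (- a) s" using * by (intro minus_equality) auto
    moreover have "inv\<^bsub>add_monoid L\<^esub> u = \<ominus> u" by (simp add: a_inv_def)
    ultimately show "inv\<^bsub>add_monoid L\<^esub> u \<in> ex I" using * ideal_uminus[OF I(1)] by (simp add: exI_L)
  qed
  fix u v assume "u \<in> ex I" "v \<in> carrier L"
  then obtain a s b t where *: "u = fr a s" "a \<in> I" "s \<notin> P" "v = fr b t" "t \<notin> P" by (auto simp: ex_def elim!: frE)
  have "b * a \<in> I" "a * b \<in> I" using * I by (auto intro: ideal_mult_left ideal_mult_right)
  then show "v \<otimes> u \<in> ex I" "u \<otimes> v \<in> ex I" using * by (simp_all add: fr_mult exI_L)
qed

lemma ex_con: assumes K: "ideal K L" shows "ex (con K) = K"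
proof -
  have "K \<subseteq> carrier L" using ideal.Icarr[OF K] by auto
  then have "z \<in> ex (con K)" if "z \<in> K" for z
    using that mem_con[OF K] exI_L by (metis frE subsetD)
  moreover have "z \<in> K" if "z \<in> ex (con K)" for z using that mem_con[OF K] unfolding ex_def by auto
  ultimately show ?thesis by auto
qed

lemma con_subset_P: assumes K: "ideal K L" "K \<noteq> carrier L" shows "con K \<subseteq> P"
proof
  fix a assume a: "a \<in> con K"
  show "a \<in> P"
  proof (rule ccontr)
    assume "a \<notin> P"
    then have "fr a a \<in> K" using mem_con[OF K(1)] a by auto
    moreover have "fr a a = \<one>" using \<open>a \<notin> P\<close> by (auto simp: fr_one intro!: fr_eqI)
    ultimately show False using K ideal.one_imp_carrier[OF K(1)] by auto
  qed
qed

lemma prime_con: assumes K: "primeideal K L" shows "is_prime (con K)"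
proof -
  interpret K: primeideal K L by (rule K)
  have i: "ideal K L" by (rule K.is_ideal)
  have "1 \<notin> con K" using K.one_imp_carrier K.I_notcarr by (auto simp: con_def fr_one[symmetric])
  moreover have "a \<in> con K \<or> b \<in> con K" if "a * b \<in> con K" for a b
    using K.I_prime[of "fr a 1" "fr b 1"] that by (auto simp: con_def fr_mult)
  ultimately show ?thesis using ideal_con[OF i] by (auto simp: is_prime_def)
qed

lemma mem_ex_prime: assumes "is_prime Q" "J \<subseteq> Q" "Q \<subseteq> P" "s \<notin> P" shows "fr a s \<in> ex Q \<longleftrightarrow> a \<in> Q"
  using mem_ex[of Q s a] assms is_primeD[OF assms(1)] by (metis one_notin mult_1 subsetD)

lemma prime_ex: assumes Q: "is_prime Q" "J \<subseteq> Q" "Q \<subseteq> P" shows "primeideal (ex Q) L"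
proof (rule primeidealI[OF ideal_ex cring_L])
  show "is_ideal Q" "J \<subseteq> Q" using Q by (auto dest: is_primeD)
  have "fr 1 1 \<notin> ex Q" using mem_ex_prime[OF Q, of 1 1] is_primeD(2)[OF Q(1)] by simp
  then show "carrier L \<noteq> ex Q" using fr_in[OF one_notin] by metis
  fix u v assume uv: "u \<in> carrier L" "v \<in> carrier L" "u \<otimes> v \<in> ex Q"
  then obtain a s b t where *: "u = fr a s" "s \<notin> P" "v = fr b t" "t \<notin> P" by (auto elim!: frE)
  then have "a * b \<in> Q" using uv mem_ex_prime[OF Q, of "s * t" "a * b"] by (simp add: fr_mult)
  then show "u \<in> ex Q \<or> v \<in> ex Q" using * mem_ex_prime[OF Q] is_primeD(3)[OF Q(1), of a b] by simp
qed

lemma maximal_ex: "maximalideal (ex P) L"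
proof (rule maximalidealI)
  show "ideal (ex P) L" using P JP by (intro ideal_ex) (auto dest: is_primeD)
  show "carrier L \<noteq> ex P" using primeideal.I_notcarr[OF prime_ex[OF P JP]] by auto
  fix K assume K: "ideal K L" "ex P \<subseteq> K" "K \<subseteq> carrier L"
  show "K = ex P \<or> K = carrier L"
  proof (cases "K = carrier L")
    case False
    then have "ex (con K) \<subseteq> ex P" using con_subset_P[OF K(1)] by (intro ex_mono) auto
    then show ?thesis using K ex_con by auto
  qed auto
qed

lemma maximal_unique: assumes "maximalideal K L" shows "K = ex P"
proof -
  interpret K: maximalideal K L by (rule assms)
  have i: "ideal K L" by (rule K.is_ideal)
  have "ex (con K) \<subseteq> ex P" using con_subset_P[OF i] K.I_notcarr by (intro ex_mono) auto
  then have "K \<subseteq> ex P" by (simp add: ex_con i)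
  moreover have "ideal (ex P) L" "ex P \<noteq> carrier L"
    using maximalideal.axioms(1)[OF maximal_ex] maximalideal.I_notcarr[OF maximal_ex] by auto
  ultimately show ?thesis using K.I_maximal[of "ex P"] ex_subset[of P] by auto
qed

lemma max_ideal_L: "max_ideal L = ex P"
  unfolding max_ideal_def using maximal_ex maximal_unique by (rule the_equality)

text \<open>Denominators are units, so fractions generate the extension of the ideal generated by J
  and their numerators.\<close>

lemma Idl_eq:
  assumes "list_all2 (\<lambda>z u. \<exists>s. s \<notin> P \<and> z = fr u s) xs us"
  shows "Idl (set xs) = ex (adjoins J us)"
proof
  have I: "is_ideal (adjoins J us)" "J \<subseteq> adjoins J us" using J by (auto intro: ideal_adjoins simp: adjoins_subset)
  have xs: "\<exists>u\<in>set us. \<exists>s. s \<notin> P \<and> z = fr u s" if "z \<in> set xs" for z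
    using assms that unfolding in_set_conv_nth list_all2_conv_all_nth by (metis nth_mem)
  have us: "\<exists>s. s \<notin> P \<and> fr u s \<in> set xs" if "u \<in> set us" for u
    using assms that unfolding in_set_conv_nth list_all2_conv_all_nth by metis
  show "Idl (set xs) \<subseteq> ex (adjoins J us)"
  proof (rule genideal_minimal[OF ideal_ex[OF I]])
    show "set xs \<subseteq> ex (adjoins J us)" using xs adjoins_mem[OF J] exI_L by (metis subsetI)
  qed
  have sub: "set xs \<subseteq> carrier L" using xs by force
  have K: "ideal (Idl (set xs)) L" using genideal_ideal[OF sub] .
  have "set us \<subseteq> con (Idl (set xs))"
  proof
    fix u assume "u \<in> set us"
    then obtain s where "s \<notin> P" "fr u s \<in> set xs" using us by auto
    then show "u \<in> con (Idl (set xs))" using mem_con[OF K] genideal_self[OF sub] by blast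
  qed
  then have "adjoins J us \<subseteq> con (Idl (set xs))" using ideal_con[OF K] J_con[OF K] by (intro adjoins_least)
  then have "ex (adjoins J us) \<subseteq> ex (con (Idl (set xs)))" by (rule ex_mono)
  then show "ex (adjoins J us) \<subseteq> Idl (set xs)" using ex_con[OF K] by simp
qed

text \<open>Denominators do not affect regularity either, and properness of the generated ideal
  follows from the numerators lying in P.\<close>

lemma regular_seq_iff:
  assumes l: "list_all2 (\<lambda>z u. \<exists>s. s \<notin> P \<and> z = fr u s) xs us"
  shows "regular_seq L xs \<longleftrightarrow> set us \<subseteq> P \<and> reg_list (- P) J us"
proof -
  have len: "length us = length xs" using l by (simp add: list_all2_lengthD)
  have ids: "is_ideal (adjoins J vs)" "J \<subseteq> adjoins J vs" for vs
    using J by (auto intro: ideal_adjoins simp: adjoins_subset)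
  have nth: "\<exists>s. s \<notin> P \<and> xs ! i = fr (us ! i) s" if "i < length xs" for i
    using l that by (simp add: list_all2_conv_all_nth)
  have m: "fr a s \<in> ex P \<longleftrightarrow> a \<in> P" if "s \<notin> P" for a s using mem_ex_prime[OF P JP] that by simp
  have inP: "set xs \<subseteq> max_ideal L \<longleftrightarrow> set us \<subseteq> P"
    unfolding max_ideal_L subset_code(1) all_set_conv_all_nth len using nth m by metis
  have reg: "(\<forall>a\<in>carrier L. a \<otimes> xs ! i \<in> Idl (set (take i xs)) \<longrightarrow> a \<in> Idl (set (take i xs))) \<longleftrightarrow>
     regular_on (- P) (adjoins J (take i us)) (us ! i)" if i: "i < length xs" for i
  proof -
    obtain s where s: "s \<notin> P" "xs ! i = fr (us ! i) s" using nth i by auto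
    let ?I = "adjoins J (take i us)"
    have Idl: "Idl (set (take i xs)) = ex ?I" using l by (intro Idl_eq list_all2_takeI)
    show ?thesis
    proof
      assume r: "\<forall>a\<in>carrier L. a \<otimes> xs ! i \<in> Idl (set (take i xs)) \<longrightarrow> a \<in> Idl (set (take i xs))"
      show "regular_on (- P) ?I (us ! i)" unfolding regular_on_def
      proof (intro allI impI)
        fix a assume "a * us ! i \<in> ?I"
        then have "fr a 1 \<otimes> xs ! i \<in> ex ?I" using s by (simp add: fr_mult exI_L)
        then have "fr a 1 \<in> ex ?I" using r Idl by auto
        then show "\<exists>s\<in>- P. s * a \<in> ?I" using mem_ex[OF ids, of 1 a] by auto
      qed
    next
      assume r: "regular_on (- P) ?I (us ! i)"
      show "\<forall>a\<in>carrier L. a \<otimes> xs ! i \<in> Idl (set (take i xs)) \<longrightarrow> a \<in> Idl (set (take i xs))"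
      proof (intro ballI impI)
        fix z assume "z \<in> carrier L" and z: "z \<otimes> xs ! i \<in> Idl (set (take i xs))"
        then obtain a t where t: "t \<notin> P" "z = fr a t" by (metis frE)
        then have "fr (a * us ! i) (t * s) \<in> ex ?I" using z s Idl by (simp add: fr_mult)
        then obtain w where w: "w \<notin> P" "w * (a * us ! i) \<in> ?I" using mem_ex[OF ids] t s by auto
        then have "(w * a) * us ! i \<in> ?I" by (simp add: mult.assoc)
        then obtain q where "q \<notin> P" "q * (w * a) \<in> ?I" using r by (auto simp: regular_on_def)
        then have "q * w \<notin> P" "(q * w) * a \<in> ?I" using w by (auto simp: mult.assoc)
        then show "z \<in> Idl (set (take i xs))" using mem_ex[OF ids] t Idl by auto
      qed
    qed
  qed
  have proper: "Idl (set xs) \<noteq> carrier L" if "set us \<subseteq> P"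
  proof -
    have "adjoins J us \<subseteq> P" using that P JP by (intro adjoins_least) (auto dest: is_primeD)
    then have "Idl (set xs) \<subseteq> ex P" using Idl_eq[OF l] ex_mono by simp
    then show ?thesis using maximalideal.I_notcarr[OF maximal_ex] ex_subset[of P] by auto
  qed
  show ?thesis unfolding regular_seq_def reg_list_nth len using inP reg proper by blast
qed

lemma num_list:
  assumes "set xs \<subseteq> carrier L" obtains us where "list_all2 (\<lambda>z u. \<exists>s. s \<notin> P \<and> z = fr u s) xs us"
proof -
  have "\<exists>us. list_all2 (\<lambda>z u. \<exists>s. s \<notin> P \<and> z = fr u s) xs us" using assms
  proof (induction xs)
    case (Cons z xs)
    then obtain us where us: "list_all2 (\<lambda>z u. \<exists>s. s \<notin> P \<and> z = fr u s) xs us" by auto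
    obtain a s where "s \<notin> P" "z = fr a s" using Cons.prems by (auto elim: frE)
    then show ?case using us by (auto intro!: exI[of _ "a # us"])
  qed auto
  then show ?thesis using that by blast
qed

lemma frs_list: "list_all2 (\<lambda>z u. \<exists>s. s \<notin> P \<and> z = fr u s) (map (\<lambda>u. fr u 1) us) us"
  by (induction us) (auto intro!: exI[of _ 1])

lemma depth_L: "depth L = Sup (enat ` {length us | us. set us \<subseteq> P \<and> reg_list (- P) J us})"
proof -
  have "{enat (length xs) | xs. regular_seq L xs} = enat ` {length us | us. set us \<subseteq> P \<and> reg_list (- P) J us}"
  proof (intro equalityI subsetI)
    fix n assume "n \<in> {enat (length xs) | xs. regular_seq L xs}"
    then obtain xs where xs: "n = enat (length xs)" "regular_seq L xs" by auto
    then have "set xs \<subseteq> carrier L"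
      using ex_subset[of P] by (auto simp: regular_seq_def max_ideal_L)
    then obtain us where "list_all2 (\<lambda>z u. \<exists>s. s \<notin> P \<and> z = fr u s) xs us" by (rule num_list)
    then show "n \<in> enat ` {length us | us. set us \<subseteq> P \<and> reg_list (- P) J us}"
      using xs regular_seq_iff list_all2_lengthD by blast
  next
    fix n assume "n \<in> enat ` {length us | us. set us \<subseteq> P \<and> reg_list (- P) J us}"
    then obtain us where us: "n = enat (length us)" "set us \<subseteq> P" "reg_list (- P) J us" by auto
    then have "regular_seq L (map (\<lambda>u. fr u 1) us)" using regular_seq_iff[OF frs_list] by auto
    then show "n \<in> {enat (length xs) | xs. regular_seq L xs}" using us by (auto intro!: exI[of _ "map (\<lambda>u. fr u 1) us"])
  qed
  then show ?thesis by (simp add: depth_def)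
qed

lemma krull_dim_L: "krull_dim L = Sup (enat ` {n. prime_chain J P n})"
proof -
  have "(\<exists>Q. (\<forall>i\<le>n. primeideal (Q i) L) \<and> (\<forall>i<n. Q i \<subset> Q (Suc i))) \<longleftrightarrow> prime_chain J P n" for n
  proof
    assume "\<exists>Q. (\<forall>i\<le>n. primeideal (Q i) L) \<and> (\<forall>i<n. Q i \<subset> Q (Suc i))"
    then obtain Q where Q: "\<And>i. i \<le> n \<Longrightarrow> primeideal (Q i) L" "\<And>i. i < n \<Longrightarrow> Q i \<subset> Q (Suc i)" by auto
    have id: "ideal (Q i) L" if "i \<le> n" for i using Q(1)[OF that] primeideal.axioms(1) by blast
    show "prime_chain J P n" unfolding prime_chain_def
    proof (intro exI[of _ "\<lambda>i. con (Q i)"] conjI allI impI)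
      fix i assume i: "i \<le> n"
      show "is_prime (con (Q i))" "J \<subseteq> con (Q i)" using prime_con Q i J_con id by auto
      show "con (Q i) \<subseteq> P" using con_subset_P[OF id[OF i]] primeideal.I_notcarr[OF Q(1)[OF i]] by auto
    next
      fix i assume i: "i < n"
      then have "con (Q i) \<subseteq> con (Q (Suc i))" using Q(2)[of i] by (auto simp: con_def)
      moreover have "con (Q i) \<noteq> con (Q (Suc i))"
      proof
        assume "con (Q i) = con (Q (Suc i))"
        then have "Q i = Q (Suc i)" using ex_con[OF id[of i]] ex_con[OF id[of "Suc i"]] i by (metis Suc_leI less_imp_le)
        then show False using Q(2)[OF i] by blast
      qed
      ultimately show "con (Q i) \<subset> con (Q (Suc i))" by auto
    qed
  next
    assume "prime_chain J P n"
    then obtain Q where Q: "\<And>i. i \<le> n \<Longrightarrow> is_prime (Q i) \<and> J \<subseteq> Q i \<and> Q i \<subseteq> P" "\<And>i. i < n \<Longrightarrow> Q i \<subset> Q (Suc i)"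
      unfolding prime_chain_def by blast
    show "\<exists>Q. (\<forall>i\<le>n. primeideal (Q i) L) \<and> (\<forall>i<n. Q i \<subset> Q (Suc i))"
    proof (intro exI[of _ "\<lambda>i. ex (Q i)"] conjI allI impI)
      fix i assume "i \<le> n" then show "primeideal (ex (Q i)) L" using Q(1) prime_ex by blast
    next
      fix i assume i: "i < n"
      then have "ex (Q i) \<subseteq> ex (Q (Suc i))" using Q(2)[of i] by (intro ex_mono) auto
      moreover obtain a where "a \<in> Q (Suc i)" "a \<notin> Q i" using Q(2)[OF i] by auto
      then have "fr a 1 \<in> ex (Q (Suc i))" "fr a 1 \<notin> ex (Q i)"
        using mem_ex_prime[of "Q i" 1 a] mem_ex_prime[of "Q (Suc i)" 1 a] Q(1)[of i] Q(1)[of "Suc i"] i by auto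
      ultimately show "ex (Q i) \<subset> ex (Q (Suc i))" by auto
    qed
  qed
  then have "{enat n | n. \<exists>Q. (\<forall>i\<le>n. primeideal (Q i) L) \<and> (\<forall>i<n. Q i \<subset> Q (Suc i))} = enat ` {n. prime_chain J P n}"
    by auto
  then show ?thesis by (simp add: krull_dim_def)
qed

text \<open>Avoids suprema in \<open>enat\<close>: if no regular sequence has length at least m, a
  longest one exists, and equality of depth and dimension excludes any longer chain of
  primes.\<close>

lemma regular_of_cohen_macaulay:
  assumes "cohen_macaulay_local L"
  shows "(\<exists>us. length us = m \<and> set us \<subseteq> P \<and> reg_list (- P) J us) \<or>
    (\<exists>us. length us < m \<and> set us \<subseteq> P \<and> reg_list (- P) J us \<and> \<not> prime_chain J P (Suc (length us)))"
proof (cases "\<exists>us. length us \<ge> m \<and> set us \<subseteq> P \<and> reg_list (- P) J us")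
  case True
  then obtain us where us: "length us \<ge> m" "set us \<subseteq> P" "reg_list (- P) J us" by auto
  then have "reg_list (- P) J (take m us)" using reg_list_append[of "- P" J "take m us" "drop m us"] by simp
  then show ?thesis using us set_take_subset[of m us] by (intro disjI1 exI[of _ "take m us"]) auto
next
  case False
  let ?D = "{length us | us. set us \<subseteq> P \<and> reg_list (- P) J us}"
  have "?D \<subseteq> {..<m}" using False by (force simp: not_le)
  then have fin: "finite ?D" by (rule finite_subset) simp
  have "0 \<in> ?D" by (auto intro!: exI[of _ "[]"])
  then have mx: "Max ?D \<in> ?D" using Max_in[OF fin] by blast
  then obtain us where us: "length us = Max ?D" "set us \<subseteq> P" "reg_list (- P) J us" by auto
  have "Sup (enat ` ?D) \<le> enat (length us)" 
  proof (rule Sup_least)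
    fix n assume "n \<in> enat ` ?D"
    then show "n \<le> enat (length us)" using Max_ge[OF fin] us(1) by fastforce
  qed
  then have "Sup (enat ` {n. prime_chain J P n}) \<le> enat (length us)"
    using assms unfolding cohen_macaulay_local_def depth_L krull_dim_L by simp
  then have "\<not> prime_chain J P (Suc (length us))"
    using Sup_upper[of "enat (Suc (length us))" "enat ` {n. prime_chain J P n}"] order_trans by fastforce
  moreover have "length us < m" using False us by (auto simp: not_le)
  ultimately show ?thesis using us by blast
qed

lemma local_ring_L:
  assumes fg: "\<And>I. is_ideal I \<Longrightarrow> J \<subseteq> I \<Longrightarrow> \<exists>us. I = adjoins J us"
  shows "local_ring L"
  unfolding local_ring_def
proof (intro conjI)
  show "noetherian_ring L"
  proof (rule noetherian_ringI)
    fix K assume K: "ideal K L"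
    obtain us where us: "con K = adjoins J us" using fg[OF ideal_con[OF K] J_con[OF K]] by auto
    then have "K = Idl (set (map (\<lambda>u. fr u 1) us))" using Idl_eq[OF frs_list, of us] ex_con[OF K] by simp
    then show "\<exists>A\<subseteq>carrier L. finite A \<and> K = Idl A"
      by (intro exI[of _ "set (map (\<lambda>u. fr u 1) us)"]) auto
  qed
  show "\<exists>!M. maximalideal M L" using maximal_ex maximal_unique by blast
qed (rule cring_L)

text \<open>A regular sequence as long as the bound on chains determines both invariants, since
  every regular sequence produces a chain of primes of its own length.\<close>

lemma cohen_macaulay_localI:
  assumes fg: "\<And>I. is_ideal I \<Longrightarrow> J \<subseteq> I \<Longrightarrow> \<exists>us. I = adjoins J us"
    and us: "set us \<subseteq> P" "reg_list (- P) J us" and bound: "\<And>n. prime_chain J P n \<Longrightarrow> n \<le> length us"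
  shows "cohen_macaulay_local L"
proof -
  have "length vs \<le> length us" if "set vs \<subseteq> P" "reg_list (- P) J vs" for vs
  proof -
    have "adjoins J vs \<subseteq> P" using that P JP by (intro adjoins_least) (auto dest: is_primeD)
    then have "prime_chain J P (length vs)" using that P J by (intro prime_chain_of_regular) auto
    then show ?thesis by (rule bound)
  qed
  then have "depth L = enat (length us)" unfolding depth_L using us
    by (intro antisym Sup_least Sup_upper) auto
  moreover have "adjoins J us \<subseteq> P" using us P JP by (intro adjoins_least) (auto dest: is_primeD)
  then have "prime_chain J P (length us)" using us P J by (intro prime_chain_of_regular) auto
  then have "krull_dim L = enat (length us)" unfolding krull_dim_L using bound
    by (intro antisym Sup_least Sup_upper) auto
  ultimately show ?thesis using local_ring_L[OF fg] by (simp add: cohen_macaulay_local_def)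
qed

lemma fr_pow: "s \<notin> P \<Longrightarrow> fr a s [^] (n::nat) = fr (a ^ n) (s ^ n)"
  by (induction n) (simp_all add: fr_one fr_mult mult.commute)

text \<open>The fractions \<open>fr u 1\<close> form a system of parameters: their number is the
  dimension, and a power of each element of P lies in the ideal they generate. The weak sequence
  property is then read off on numerators.\<close>

lemma weak_of_buchsbaum:
  assumes B: "buchsbaum_local L"
    and chain: "prime_chain J P (length us)" "\<And>n. prime_chain J P n \<Longrightarrow> n \<le> length us"
    and us: "set us \<subseteq> P" "\<And>p. p \<in> P \<Longrightarrow> \<exists>k. p ^ k \<in> adjoins J us"
    and i: "i < length us" and a: "a * us ! i \<in> adjoins J (take i us)" and p: "p \<in> P"
  shows "\<exists>s. s \<notin> P \<and> s * (a * p) \<in> adjoins J (take i us)"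
proof -
  let ?xs = "map (\<lambda>u. fr u 1) us"
  have ids: "is_ideal (adjoins J vs)" "J \<subseteq> adjoins J vs" for vs
    using J by (auto intro: ideal_adjoins simp: adjoins_subset)
  have sub: "adjoins J us \<subseteq> P" using us P JP by (intro adjoins_least) (auto dest: is_primeD)
  have "radical_ideal L (Idl (set ?xs)) = ex P"
  proof (intro equalityI subsetI)
    fix z assume "z \<in> radical_ideal L (Idl (set ?xs))"
    then obtain n :: nat and b t where z: "t \<notin> P" "z = fr b t" "z [^] n \<in> Idl (set ?xs)"
      unfolding radical_ideal_def mem_Collect_eq by (metis frE)
    then have "fr (b ^ n) (t ^ n) \<in> ex (adjoins J us)" using Idl_eq[OF frs_list, of us] by (simp add: fr_pow)
    then obtain u where "u \<notin> P" "u * b ^ n \<in> adjoins J us" using mem_ex[OF ids power_notin[OF z(1)]] by blast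
    then have "b ^ n \<in> P" using sub is_primeD(3)[OF P, of u "b ^ n"] by blast
    then have "b \<in> P" by (rule prime_power[OF P])
    then show "z \<in> ex P" using z by (simp add: exI_L)
  next
    fix z assume "z \<in> ex P"
    then obtain b t where z: "t \<notin> P" "z = fr b t" "b \<in> P" by (auto simp: ex_def)
    obtain k where "b ^ k \<in> adjoins J us" using us(2) z by auto
    then have "z [^] k \<in> Idl (set ?xs)" using z Idl_eq[OF frs_list, of us] by (simp add: fr_pow exI_L)
    then show "z \<in> radical_ideal L (Idl (set ?xs))" using z by (auto simp: radical_ideal_def)
  qed
  moreover have "krull_dim L = enat (length us)" unfolding krull_dim_L using chain
    by (intro antisym Sup_least Sup_upper) auto
  ultimately have "system_of_parameters L ?xs" by (auto simp: system_of_parameters_def max_ideal_L)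
  then have "weak_seq L ?xs" using B by (auto simp: buchsbaum_local_def)
  moreover have "Idl (set (take i ?xs)) = ex (adjoins J (take i us))"
    using Idl_eq[OF frs_list, of "take i us"] by (simp add: take_map)
  ultimately have "colon_ideal L (ex (adjoins J (take i us))) {fr (us ! i) 1} \<subseteq> colon_ideal L (ex (adjoins J (take i us))) (ex P)"
    using i unfolding weak_seq_def max_ideal_L by (metis length_map nth_map)
  moreover have "fr a 1 \<in> colon_ideal L (ex (adjoins J (take i us))) {fr (us ! i) 1}"
    using a by (simp add: colon_ideal_def fr_mult exI_L)
  ultimately have "fr a 1 \<otimes> fr p 1 \<in> ex (adjoins J (take i us))"
    using exI_L[OF p one_notin] unfolding colon_ideal_def by blast
  then show ?thesis using mem_ex[OF ids, of 1 "a * p"] by (simp add: fr_mult)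
qed

end

section \<open>Carrier rings as images of a ring given as a type\<close>

text \<open>A carrier ring is seen only through a surjection from a type class ring; its ideals
  correspond to their preimages, the ideals that contain \<open>ker\<close>.\<close>

locale surj_hom =
  fixes R :: "('c, 'd) ring_scheme" (structure) and \<phi> :: "'r::comm_ring_1 \<Rightarrow> 'c"
  assumes carrR: "carrier R = range \<phi>"
    and hom_add: "\<phi> (a + b) = \<phi> a \<oplus> \<phi> b" and hom_mult: "\<phi> (a * b) = \<phi> a \<otimes> \<phi> b"
    and hom_one: "\<phi> 1 = \<one>" and hom_zero: "\<phi> 0 = \<zero>"
begin

lemma cring_R: "cring R"
proof (rule cringI)
  show "abelian_group R"
  proof (rule abelian_groupI)
    fix u assume "u \<in> carrier R"
    then obtain a where a: "u = \<phi> a" by (auto simp: carrR)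
    then have "\<phi> (- a) \<oplus> u = \<zero>" by (simp flip: hom_add hom_zero)
    then show "\<exists>y\<in>carrier R. y \<oplus> u = \<zero>" by (auto simp: carrR)
  qed (auto simp: carrR add_ac simp flip: hom_add hom_zero)
  show "comm_monoid R"
    by (rule comm_monoidI) (auto simp: carrR mult_ac simp flip: hom_mult hom_one)
qed (auto simp: carrR algebra_simps simp flip: hom_mult hom_add)

sublocale cring R by (rule cring_R)

definition ker :: "'r set" where "ker = {a. \<phi> a = \<zero>}"

lemma hom_minus: "\<phi> (a - b) = \<phi> a \<ominus> \<phi> b"
proof -
  have "\<phi> (- b) \<oplus> \<phi> b = \<zero>" by (simp flip: hom_add hom_zero)
  then have "\<ominus> \<phi> b = \<phi> (- b)" by (intro minus_equality) (auto simp: carrR)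
  then show ?thesis by (simp add: a_minus_def flip: hom_add)
qed

lemma hom_in [simp]: "\<phi> a \<in> carrier R" by (simp add: carrR)

lemma hom_eq: "\<phi> a = \<phi> b \<longleftrightarrow> a - b \<in> ker"
  by (simp add: ker_def hom_minus)

lemma ideal_ker: "is_ideal ker"
  by (auto simp: is_ideal_def ker_def hom_zero hom_add hom_mult)

lemma ideal_vimage: assumes K: "ideal K R" shows "is_ideal (\<phi> -` K)" "ker \<subseteq> \<phi> -` K" "\<phi> ` (\<phi> -` K) = K"
proof -
  interpret K: ideal K R by (rule K)
  show "is_ideal (\<phi> -` K)"
    by (auto simp: is_ideal_def hom_zero hom_add hom_mult K.I_l_closed intro: K.a_closed)
  show "ker \<subseteq> \<phi> -` K" by (auto simp: ker_def)
  show "\<phi> ` (\<phi> -` K) = K" using K.Icarr by (auto simp: carrR)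
qed

lemma ideal_image: assumes I: "is_ideal I" shows "ideal (\<phi> ` I) R"
proof (rule idealI[OF ring_axioms])
  show "subgroup (\<phi> ` I) (add_monoid R)"
  proof (rule subgroup.intro)
    show "\<phi> ` I \<subseteq> carrier (add_monoid R)" by auto
    fix u v assume "u \<in> \<phi> ` I" "v \<in> \<phi> ` I"
    then show "u \<otimes>\<^bsub>add_monoid R\<^esub> v \<in> \<phi> ` I" using ideal_add[OF I] by (auto simp flip: hom_add)
  next
    show "\<one>\<^bsub>add_monoid R\<^esub> \<in> \<phi> ` I" using ideal_zero[OF I] by (auto simp flip: hom_zero)
  next
    fix u assume "u \<in> \<phi> ` I"
    then obtain a where a: "a \<in> I" "u = \<phi> a" by auto
    have "\<ominus> u = \<phi> (- a)" using a by (intro minus_equality) (auto simp flip: hom_add hom_zero)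
    then show "inv\<^bsub>add_monoid R\<^esub> u \<in> \<phi> ` I" using a ideal_uminus[OF I] by (simp add: a_inv_def)
  qed
  fix u v assume "u \<in> \<phi> ` I" "v \<in> carrier R"
  then show "v \<otimes> u \<in> \<phi> ` I" "u \<otimes> v \<in> \<phi> ` I"
    using ideal_mult_left[OF I] ideal_mult_right[OF I] by (auto simp: carrR simp flip: hom_mult)
qed

lemma image_mem: "is_ideal I \<Longrightarrow> ker \<subseteq> I \<Longrightarrow> \<phi> a \<in> \<phi> ` I \<longleftrightarrow> a \<in> I"
  using ideal_cong by (fastforce simp: hom_eq)

lemma maximal_vimage: assumes M: "maximalideal M R" shows "is_prime (\<phi> -` M)" "1 \<notin> \<phi> -` M"
  "\<And>a. a \<notin> \<phi> -` M \<Longrightarrow> \<exists>b. a * b - 1 \<in> \<phi> -` M"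
proof -
  interpret M: maximalideal M R by (rule M)
  have id: "ideal M R" by (rule M.is_ideal)
  show one: "1 \<notin> \<phi> -` M" using M.one_imp_carrier M.I_notcarr by (auto simp: hom_one)
  have "primeideal M R" using maximalideal_prime[OF M] .
  then show "is_prime (\<phi> -` M)" using ideal_vimage(1)[OF id] one
    unfolding is_prime_def using primeideal.I_prime[of M R] by (metis hom_in hom_mult vimageD vimageI2)
  fix a assume a: "a \<notin> \<phi> -` M"
  let ?K = "adjoin (\<phi> -` M) a"
  have K: "is_ideal ?K" "\<phi> -` M \<subseteq> ?K" "a \<in> ?K"
    by (rule ideal_adjoin adjoin_subset adjoin_self ideal_vimage(1)[OF id])+
  then have kK: "ker \<subseteq> ?K" using ideal_vimage(2)[OF id] by auto
  have "M \<subseteq> \<phi> ` ?K" using K(2) ideal_vimage(3)[OF id] by (metis image_mono)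
  then have "\<phi> ` ?K = M \<or> \<phi> ` ?K = carrier R" using M.I_maximal[OF ideal_image[OF K(1)]] hom_in by blast
  moreover have "\<phi> ` ?K \<noteq> M" using K(3) a by auto
  ultimately have "\<phi> 1 \<in> \<phi> ` ?K" by auto
  then have "1 \<in> ?K" using image_mem[OF K(1) kK] by simp
  then obtain c where "1 - c * a \<in> \<phi> -` M" by (auto simp: in_adjoin)
  then show "\<exists>b. a * b - 1 \<in> \<phi> -` M"
    using ideal_sym[OF ideal_vimage(1)[OF id]] by (metis mult.commute)
qed

lemma maximal_image:
  assumes I: "is_ideal I" "ker \<subseteq> I" "1 \<notin> I" and mx: "\<And>a. a \<notin> I \<Longrightarrow> \<exists>b. a * b - 1 \<in> I"
  shows "maximalideal (\<phi> ` I) R"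
proof (rule maximalidealI[OF ideal_image[OF I(1)]])
  show "carrier R \<noteq> \<phi> ` I" using image_mem[OF I(1,2), of 1] I(3) hom_in[of 1] by metis
  fix K assume K: "ideal K R" "\<phi> ` I \<subseteq> K" "K \<subseteq> carrier R"
  show "K = \<phi> ` I \<or> K = carrier R"
  proof (cases "\<phi> -` K \<subseteq> I")
    case True
    then have "K \<subseteq> \<phi> ` I" using ideal_vimage(3)[OF K(1)] by (metis image_mono)
    then show ?thesis using K by auto
  next
    case False
    then obtain a where a: "\<phi> a \<in> K" "a \<notin> I" by auto
    then obtain b where "a * b - 1 \<in> I" using mx by auto
    then have "a * b - 1 \<in> \<phi> -` K" "a * b \<in> \<phi> -` K"
      using K(2) a ideal_mult_right[OF ideal_vimage(1)[OF K(1)], of a b] by auto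
    then have "1 \<in> \<phi> -` K" using ideal_diff[OF ideal_vimage(1)[OF K(1)], of "a * b" "a * b - 1"] by simp
    then have "\<one> \<in> K" by (simp add: hom_one)
    then show ?thesis using ideal.one_imp_carrier[OF K(1)] by auto
  qed
qed

lemma noetherian_R:
  assumes fg: "\<And>I. is_ideal I \<Longrightarrow> ker \<subseteq> I \<Longrightarrow> \<exists>us. I = adjoins ker us"
  shows "noetherian_ring R"
proof (rule noetherian_ringI)
  fix K assume K: "ideal K R"
  obtain us where us: "\<phi> -` K = adjoins ker us" using fg[OF ideal_vimage(1,2)[OF K]] by auto
  have sub: "\<phi> ` set us \<subseteq> carrier R" by auto
  have K': "ideal (Idl (\<phi> ` set us)) R" using genideal_ideal[OF sub] .
  have "set us \<subseteq> \<phi> -` (Idl (\<phi> ` set us))" using genideal_self[OF sub] by auto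
  then have "\<phi> -` K \<subseteq> \<phi> -` (Idl (\<phi> ` set us))" unfolding us
    using ideal_vimage(1,2)[OF K'] by (intro adjoins_least) auto
  then have "K \<subseteq> Idl (\<phi> ` set us)" using ideal_vimage(3)[OF K] ideal_vimage(3)[OF K'] by (metis image_mono)
  moreover have "\<phi> ` set us \<subseteq> K" using adjoins_mem[OF ideal_ker, of _ us] us by auto
  then have "Idl (\<phi> ` set us) \<subseteq> K" using genideal_minimal[OF K] by auto
  ultimately show "\<exists>A\<subseteq>carrier R. finite A \<and> K = Idl A" using sub by (intro exI[of _ "\<phi> ` set us"]) auto
qed

text \<open>The operations of \<open>localization\<close> go through representatives picked by
  \<open>SOME\<close>, so the rules for fractions require independence of the representative, for
  which \<open>rep\<close> prepares.\<close>

lemma locring_localize: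
  assumes P: "is_prime P" and kP: "ker \<subseteq> P"
  shows "locring ker P (localize_at R (\<phi> ` P)) (\<lambda>a s. loc_rel R (carrier R - \<phi> ` P) `` {(\<phi> a, \<phi> s)})"
proof -
  define T where "T = carrier R - \<phi> ` P"
  define rel where "rel = loc_rel R T"
  define fr where "fr = (\<lambda>a s. rel `` {(\<phi> a, \<phi> s)})"
  have k: "is_ideal ker" by (rule ideal_ker)
  have T: "\<phi> s \<in> T \<longleftrightarrow> s \<notin> P" for s using image_mem[OF is_primeD(1)[OF P] kP] by (auto simp: T_def)
  have TE: "\<exists>s. t = \<phi> s \<and> s \<notin> P" if "t \<in> T" for t using that T by (auto simp: T_def carrR)
  have nm: "s * t \<notin> P" if "s \<notin> P" "t \<notin> P" for s t using that P by (auto dest: is_primeD)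
  have n1: "1 \<notin> P" using P by (auto dest: is_primeD)
  have rel: "((\<phi> a, \<phi> s), (\<phi> b, \<phi> t)) \<in> rel \<longleftrightarrow> s \<notin> P \<and> t \<notin> P \<and> (\<exists>u. u \<notin> P \<and> u * (a * t - b * s) \<in> ker)"
    for a s b t
  proof -
    have "(\<exists>u\<in>T. u \<otimes> (\<phi> a \<otimes> \<phi> t \<ominus> \<phi> b \<otimes> \<phi> s) = \<zero>) \<longleftrightarrow> (\<exists>u. u \<notin> P \<and> u * (a * t - b * s) \<in> ker)"
    proof
      assume "\<exists>u\<in>T. u \<otimes> (\<phi> a \<otimes> \<phi> t \<ominus> \<phi> b \<otimes> \<phi> s) = \<zero>"
      then show "\<exists>u. u \<notin> P \<and> u * (a * t - b * s) \<in> ker" using TE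
        by (fastforce simp: ker_def simp flip: hom_mult hom_minus)
    next
      assume "\<exists>u. u \<notin> P \<and> u * (a * t - b * s) \<in> ker"
      then obtain u where "u \<notin> P" "\<phi> (u * (a * t - b * s)) = \<zero>" by (auto simp: ker_def)
      then show "\<exists>u\<in>T. u \<otimes> (\<phi> a \<otimes> \<phi> t \<ominus> \<phi> b \<otimes> \<phi> s) = \<zero>" using T
        by (intro bexI[of _ "\<phi> u"]) (simp_all add: hom_mult hom_minus)
    qed
    then show ?thesis unfolding rel_def loc_rel_def using T by auto
  qed
  have sub: "rel \<subseteq> (carrier R \<times> T) \<times> (carrier R \<times> T)" by (auto simp: rel_def loc_rel_def)
  have pairE: "\<exists>a s. z = (\<phi> a, \<phi> s) \<and> s \<notin> P" if "z \<in> carrier R \<times> T" for z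
    using that TE by (auto simp: carrR)
  have equiv: "equiv (carrier R \<times> T) rel"
  proof (rule equivI)
    show "rel \<subseteq> (carrier R \<times> T) \<times> (carrier R \<times> T)" by (rule sub)
    show "refl_on (carrier R \<times> T) rel"
    proof (rule refl_onI)
      fix z assume "z \<in> carrier R \<times> T"
      then obtain a s where z: "z = (\<phi> a, \<phi> s)" "s \<notin> P" using pairE by blast
      have "\<exists>u. u \<notin> P \<and> u * (a * s - a * s) \<in> ker" using n1 ideal_zero[OF k] by (intro exI[of _ 1]) auto
      then show "(z, z) \<in> rel" using rel[of a s a s] z by blast
    qed
    show "sym rel"
    proof (rule symI)
      fix y z assume yz: "(y, z) \<in> rel"
      then have "y \<in> carrier R \<times> T" "z \<in> carrier R \<times> T" using sub by auto
      from pairE[OF this(1)] pairE[OF this(2)]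
      obtain a s b t where *: "y = (\<phi> a, \<phi> s)" "z = (\<phi> b, \<phi> t)" by blast
      then obtain u where u: "s \<notin> P" "t \<notin> P" "u \<notin> P" "u * (a * t - b * s) \<in> ker" using rel yz by auto
      then have "u * (b * s - a * t) \<in> ker" using ideal_uminus[OF k, of "u * (a * t - b * s)"] by (simp add: algebra_simps)
      then show "(z, y) \<in> rel" using * rel u by auto
    qed
    show "trans rel"
    proof (rule transI)
      fix y z w assume yz: "(y, z) \<in> rel" "(z, w) \<in> rel"
      then have "y \<in> carrier R \<times> T" "z \<in> carrier R \<times> T" "w \<in> carrier R \<times> T" using sub by auto
      from pairE[OF this(1)] pairE[OF this(2)] pairE[OF this(3)]
      obtain a s b t c r where *: "y = (\<phi> a, \<phi> s)" "z = (\<phi> b, \<phi> t)" "w = (\<phi> c, \<phi> r)" by blast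
      obtain u where u: "s \<notin> P" "t \<notin> P" "u \<notin> P" "u * (a * t - b * s) \<in> ker" using rel yz * by auto
      obtain v where v: "r \<notin> P" "v \<notin> P" "v * (b * r - c * t) \<in> ker" using rel yz * by auto
      have "(v * r) * (u * (a * t - b * s)) + (u * s) * (v * (b * r - c * t)) \<in> ker"
        using u v k by (intro ideal_add ideal_mult_left[OF k u(4)] ideal_mult_left[OF k v(3)])
      then have "(u * v * t) * (a * r - c * s) \<in> ker" by (simp add: algebra_simps)
      then show "(y, w) \<in> rel" using * rel u v nm by metis
    qed
  qed
  have fr_eq: "fr a s = fr b t \<longleftrightarrow> (\<exists>u. u \<notin> P \<and> u * (a * t - b * s) \<in> ker)" if "s \<notin> P" "t \<notin> P" for a s b t
  proof -
    have "(\<phi> a, \<phi> s) \<in> carrier R \<times> T" "(\<phi> b, \<phi> t) \<in> carrier R \<times> T" using T that by auto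
    then show ?thesis using eq_equiv_class_iff[OF equiv, of "(\<phi> a, \<phi> s)" "(\<phi> b, \<phi> t)"] rel that
      by (simp add: fr_def)
  qed
  have rep: "\<exists>a' s'. s' \<notin> P \<and> loc_rep (fr a s) = (\<phi> a', \<phi> s') \<and> (\<exists>u. u \<notin> P \<and> u * (a * s' - a' * s) \<in> ker)"
    if "s \<notin> P" for a s
  proof -
    have "(\<phi> a, \<phi> s) \<in> carrier R \<times> T" using T that by auto
    then have "(\<phi> a, \<phi> s) \<in> fr a s" unfolding fr_def using equiv_class_self[OF equiv] by auto
    then have r: "loc_rep (fr a s) \<in> fr a s" unfolding loc_rep_def by (rule someI)
    then have "((\<phi> a, \<phi> s), loc_rep (fr a s)) \<in> rel" by (auto simp: fr_def)
    moreover from this obtain a' s' where "loc_rep (fr a s) = (\<phi> a', \<phi> s')" "s' \<notin> P" using sub pairE by blast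
    ultimately show ?thesis using rel by metis
  qed
  have "locring ker P (localize_at R (\<phi> ` P)) fr"
  proof (unfold_locales, goal_cases)
    case 4
    have "carrier R \<times> T = {(\<phi> a, \<phi> s) | a s. s \<notin> P}" using pairE T by (auto simp: carrR)
    then show ?case unfolding localize_at_def localization_def T_def[symmetric] rel_def[symmetric]
      by (auto simp: quotient_def fr_def)
  next
    case (5 s t a b) then show ?case by (rule fr_eq)
  next
    case (6 s t a b)
    obtain a' s' u where 1: "s' \<notin> P" "loc_rep (fr a s) = (\<phi> a', \<phi> s')" "u \<notin> P" "u * (a * s' - a' * s) \<in> ker"
      using rep[OF 6(1)] by blast
    obtain b' t' v where 2: "t' \<notin> P" "loc_rep (fr b t) = (\<phi> b', \<phi> t')" "v \<notin> P" "v * (b * t' - b' * t) \<in> ker"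
      using rep[OF 6(2)] by blast
    \<comment> \<open>The two relations are combined so that the mixed terms cancel and the common
      multiplier becomes u * v.\<close>
    have "(v * b * t') * (u * (a * s' - a' * s)) + (u * a' * s) * (v * (b * t' - b' * t)) \<in> ker"
      by (intro ideal_add[OF k] ideal_mult_left[OF k 1(4)] ideal_mult_left[OF k 2(4)])
    then have "(u * v) * (a * b * (s' * t') - a' * b' * (s * t)) \<in> ker" by (simp add: algebra_simps)
    then have "fr (a * b) (s * t) = fr (a' * b') (s' * t')" using 1 2 6 nm fr_eq by metis
    then show ?case unfolding localize_at_def localization_def T_def[symmetric]
      by (simp add: loc_mult_def 1(2) 2(2) flip: hom_mult rel_def) (simp add: fr_def)
  next
    case (7 s t a b)
    obtain a' s' u where 1: "s' \<notin> P" "loc_rep (fr a s) = (\<phi> a', \<phi> s')" "u \<notin> P" "u * (a * s' - a' * s) \<in> ker"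
      using rep[OF 7(1)] by blast
    obtain b' t' v where 2: "t' \<notin> P" "loc_rep (fr b t) = (\<phi> b', \<phi> t')" "v \<notin> P" "v * (b * t' - b' * t) \<in> ker"
      using rep[OF 7(2)] by blast
    have "(v * t * t') * (u * (a * s' - a' * s)) + (u * s * s') * (v * (b * t' - b' * t)) \<in> ker"
      by (intro ideal_add[OF k] ideal_mult_left[OF k 1(4)] ideal_mult_left[OF k 2(4)])
    then have "(u * v) * ((a * t + b * s) * (s' * t') - (a' * t' + b' * s') * (s * t)) \<in> ker" by (simp add: algebra_simps)
    then have "fr (a * t + b * s) (s * t) = fr (a' * t' + b' * s') (s' * t')" using 1 2 7 nm fr_eq by metis
    then show ?case unfolding localize_at_def localization_def T_def[symmetric]
      by (simp add: loc_add_def 1(2) 2(2) flip: hom_mult hom_add rel_def) (simp add: fr_def)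
  qed (use P kP k in \<open>auto simp: localize_at_def localization_def fr_def rel_def T_def hom_one hom_zero\<close>)
  then show ?thesis by (simp add: fr_def rel_def T_def)
qed

end

section \<open>Polynomials on all elements of a type, and their gradings\<close>

type_synonym ('h, 'k) mpoly = "'h multiset \<Rightarrow>\<^sub>0 'k"

abbreviation coef :: "('m \<Rightarrow>\<^sub>0 'k::zero) \<Rightarrow> 'm \<Rightarrow> 'k" where "coef \<equiv> Poly_Mapping.lookup"
abbreviation keys :: "('m \<Rightarrow>\<^sub>0 'k::zero) \<Rightarrow> 'm set" where "keys \<equiv> Poly_Mapping.keys"
abbreviation term_of :: "'m \<Rightarrow> 'k::zero \<Rightarrow> 'm \<Rightarrow>\<^sub>0 'k" where "term_of \<equiv> Poly_Mapping.single"
abbreviation mon :: "'m \<Rightarrow> 'm \<Rightarrow>\<^sub>0 'k::field" where "mon m \<equiv> Poly_Mapping.single m 1"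
abbreviation cst :: "'k::field \<Rightarrow> ('h, 'k) mpoly" where "cst c \<equiv> Poly_Mapping.single {#} c"
abbreviation var :: "'h \<Rightarrow> ('h, 'k::field) mpoly" where "var h \<equiv> Poly_Mapping.single {#h#} 1"

lemma poly_expand: "p = (\<Sum>m\<in>keys p. term_of m (coef p m))"
  by (rule poly_mapping_eqI) (simp add: lookup_sum lookup_single when_def not_in_keys_iff_lookup_eq_zero)

lemma coef_term_mult:
  fixes p :: "('h, 'k::field) mpoly"
  shows "coef (term_of m c * p) n = (if m \<subseteq># n then c * coef p (n - m) else 0)"
proof -
  have "coef (term_of m c * p) n = (\<Sum>q\<in>keys p. coef (term_of (m + q) (c * coef p q)) n)"
    by (subst poly_expand[of p]) (simp add: sum_distrib_left mult_single lookup_sum)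
  also have "\<dots> = (\<Sum>q\<in>keys p. if m \<subseteq># n \<and> q = n - m then c * coef p q else 0)"
    by (intro sum.cong refl) (auto simp: lookup_single when_def)
  also have "\<dots> = (if m \<subseteq># n then c * coef p (n - m) else 0)"
    by (auto simp: in_keys_iff)
  finally show ?thesis .
qed

lemma coef_mult:
  fixes p q :: "('h, 'k::field) mpoly"
  shows "coef (p * q) n = (\<Sum>m\<in>keys p. if m \<subseteq># n then coef p m * coef q (n - m) else 0)"
  by (subst poly_expand[of p]) (simp add: sum_distrib_right lookup_sum coef_term_mult)

lemma coef_cst_mult: "coef (cst c * p) n = c * coef (p :: ('h, 'k::field) mpoly) n"
  by (simp add: coef_term_mult)

lemma keys_multE:
  fixes p q :: "('h, 'k::field) mpoly"
  assumes "n \<in> keys (p * q)" obtains a b where "a \<in> keys p" "b \<in> keys q" "n = a + b"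
  using keys_mult[of p q] assms by auto

lemma keys_sumE: assumes "n \<in> keys (\<Sum>i\<in>K. f i)" obtains i where "i \<in> K" "n \<in> keys (f i)"
  using assms keys_sum[of f K] by auto

lemma mon_add: "(mon (m + n) :: ('h, 'k::field) mpoly) = mon m * mon n"
  by (simp add: mult_single)

lemma term_eq: "(term_of m c :: ('h, 'k::field) mpoly) = cst c * mon m"
  by (simp add: mult_single)

lemma cst_mult: "(cst (a * b) :: ('h, 'k::field) mpoly) = cst a * cst b"
  by (simp add: mult_single)

lemma cst_one [simp]: "(cst 1 :: ('h, 'k::field) mpoly) = 1"
  using single_one by simp

lemma var_power: "(var h :: ('h, 'k::field) mpoly) ^ n = mon (replicate_mset n h)"
  by (induction n) (auto simp: mult_single)

lemma cst_inv: "c \<noteq> 0 \<Longrightarrow> cst (inverse c) * (cst c * p) = (p :: ('h, 'k::field) mpoly)"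
  by (simp add: mult.assoc[symmetric] flip: cst_mult)

lemma cst_in_ideal: assumes "is_ideal I" "cst c * p \<in> I" "c \<noteq> (0::'k::field)" shows "(p :: ('h, 'k) mpoly) \<in> I"
  using ideal_mult_left[OF assms(1,2), of "cst (inverse c)"] unfolding cst_inv[OF assms(3)] .

lemma ideal_of_terms:
  assumes "is_ideal (I :: ('h, 'k::field) mpoly set)" "\<And>m. m \<in> keys p \<Longrightarrow> mon m \<in> I" shows "p \<in> I"
proof -
  have "(\<Sum>m\<in>keys p. term_of m (coef p m)) \<in> I"
  proof (rule ideal_sum[OF assms(1)])
    fix m assume "m \<in> keys p"
    then have "cst (coef p m) * mon m \<in> I" using assms by (intro ideal_mult_left)
    then show "term_of m (coef p m) \<in> I" by (metis term_eq)
  qed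
  then show ?thesis using poly_expand[of p] by simp
qed

definition part :: "('m \<Rightarrow> bool) \<Rightarrow> ('m \<Rightarrow>\<^sub>0 'k::field) \<Rightarrow> 'm \<Rightarrow>\<^sub>0 'k" where
  "part Q p = (\<Sum>m\<in>{m \<in> keys p. Q m}. term_of m (coef p m))"

lemma coef_part: "coef (part Q p) m = (if Q m then coef p m else 0)"
  by (auto simp: part_def lookup_sum lookup_single when_def in_keys_iff)

lemma keys_part: "keys (part Q p) = {m \<in> keys p. Q m}"
  by (auto simp: in_keys_iff coef_part split: if_splits)

lemma part_add: "part Q (p + q) = part Q p + part Q q"
  and part_diff: "part Q (p - q) = part Q p - part Q q"
  and part_split: "part Q p + part (\<lambda>m. \<not> Q m) p = p"
  by (rule poly_mapping_eqI; simp add: coef_part lookup_add lookup_minus)+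

lemma part_sum: "part Q (\<Sum>i\<in>K. f i) = (\<Sum>i\<in>K. part Q (f i))"
  by (rule poly_mapping_eqI) (simp add: coef_part lookup_sum)

lemma part_all: "(\<And>m. m \<in> keys p \<Longrightarrow> Q m) \<Longrightarrow> part Q p = p"
  and part_none: "(\<And>m. m \<in> keys p \<Longrightarrow> \<not> Q m) \<Longrightarrow> part Q p = 0"
  by (rule poly_mapping_eqI, auto simp: coef_part in_keys_iff)+

definition wt :: "('h \<Rightarrow> nat) \<Rightarrow> 'h multiset \<Rightarrow> nat" where "wt w m = (\<Sum>h\<in>#m. w h)"

lemma wt_add [simp]: "wt w (m + n) = wt w m + wt w n" by (simp add: wt_def)
lemma wt_empty [simp]: "wt w {#} = 0" "wt w {#h#} = w h" "wt w (add_mset h m) = w h + wt w m" by (simp_all add: wt_def)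
lemma wt_diff: "m \<subseteq># n \<Longrightarrow> wt w (n - m) = wt w n - wt w m"
  by (metis add_diff_cancel_left' subset_mset.add_diff_inverse wt_add)
lemma wt_one: "wt (\<lambda>_. 1) m = size m" by (simp add: wt_def)

lemma size_le_wt: "(\<And>h. h \<in># m \<Longrightarrow> 1 \<le> w h) \<Longrightarrow> size m \<le> wt w m"
proof (induction m)
  case (add h m)
  then have "1 \<le> w h" "size m \<le> wt w m" by auto
  then show ?case by simp
qed simp

abbreviation hpart :: "('h \<Rightarrow> nat) \<Rightarrow> nat \<Rightarrow> ('h, 'k::field) mpoly \<Rightarrow> ('h, 'k) mpoly" where
  "hpart w k p \<equiv> part (\<lambda>m. wt w m = k) p"

definition homog :: "('h \<Rightarrow> nat) \<Rightarrow> nat \<Rightarrow> ('h, 'k::field) mpoly \<Rightarrow> bool" where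
  "homog w k p \<longleftrightarrow> (\<forall>m\<in>keys p. wt w m = k)"

definition homog_ideal :: "('h \<Rightarrow> nat) \<Rightarrow> ('h, 'k::field) mpoly set \<Rightarrow> bool" where
  "homog_ideal w I \<longleftrightarrow> (\<forall>p\<in>I. \<forall>k. hpart w k p \<in> I)"

lemma homog_mult: "homog w j p \<Longrightarrow> homog w k q \<Longrightarrow> homog w (j + k) (p * q)"
  unfolding homog_def by (auto elim!: keys_multE)

lemma homog_power: "homog w j p \<Longrightarrow> homog w (j * n) (p ^ n)"
proof (induction n)
  case (Suc n) then show ?case using homog_mult[of w j p "j * n" "p ^ n"] by simp
qed (simp add: homog_def)

lemma homog_hpart: "homog w k (hpart w k p)" by (auto simp: homog_def keys_part)

lemma hpart_homog: "homog w k p \<Longrightarrow> hpart w j p = (if j = k then p else 0)"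
  by (auto simp: homog_def intro!: part_all part_none)

lemma sum_hpart: "(\<Sum>k\<in>wt w ` keys p. hpart w k p) = p"
  by (rule poly_mapping_eqI) (auto simp: lookup_sum coef_part in_keys_iff)

lemma hpart_mult_homog:
  assumes "homog w e z" shows "hpart w k (a * z) = (if e \<le> k then hpart w (k - e) a * z else 0)"
proof -
  have "hpart w k (a * z) = (\<Sum>j\<in>wt w ` keys a. hpart w k (hpart w j a * z))"
    by (subst (1) sum_hpart[of w a, symmetric]) (simp add: sum_distrib_right part_sum)
  also have "\<dots> = (\<Sum>j\<in>wt w ` keys a. if j + e = k then hpart w j a * z else 0)"
    using hpart_homog[OF homog_mult[OF homog_hpart assms]] by (intro sum.cong refl) auto
  also have "\<dots> = (if e \<le> k then hpart w (k - e) a * z else 0)"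
  proof (cases "e \<le> k \<and> k - e \<in> wt w ` keys a")
    case True
    then have "(\<Sum>j\<in>wt w ` keys a. if j + e = k then hpart w j a * z else 0) =
      (\<Sum>j\<in>wt w ` keys a. if j = k - e then hpart w j a * z else 0)" by (intro sum.cong) auto
    then show ?thesis using True by simp
  next
    case False
    then have "(\<Sum>j\<in>wt w ` keys a. if j + e = k then hpart w j a * z else 0) = 0" by (intro sum.neutral) auto
    moreover have "hpart w (k - e) a = 0" if "e \<le> k" using False that by (intro part_none) (metis imageI)
    ultimately show ?thesis by auto
  qed
  finally show ?thesis .
qed

lemma homog_ideal_adjoin:
  assumes "is_ideal I" "homog_ideal w I" "homog w e y" shows "homog_ideal w (adjoin I y)"
  unfolding homog_ideal_def
proof (intro ballI allI)
  fix p k assume "p \<in> adjoin I y"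
  then obtain c where "p - c * y \<in> I" by (auto simp: in_adjoin)
  then have "hpart w k p - hpart w k (c * y) \<in> I" using assms by (auto simp: homog_ideal_def simp flip: part_diff)
  moreover have "hpart w k (c * y) = (if e \<le> k then hpart w (k - e) c else 0) * y"
    using hpart_mult_homog[OF assms(3)] by simp
  ultimately show "hpart w k p \<in> adjoin I y" unfolding in_adjoin by metis
qed

lemma homog_ideal_adjoins:
  assumes "is_ideal I" "homog_ideal w I" "\<And>u. u \<in> set us \<Longrightarrow> \<exists>e. homog w e u" shows "homog_ideal w (adjoins I us)"
  using assms
proof (induction us arbitrary: I)
  case (Cons u us)
  then obtain e where "homog w e u" by auto
  then show ?case using Cons by (auto intro!: Cons.IH ideal_adjoin homog_ideal_adjoin)
qed auto

definition irr :: "('h, 'k::field) mpoly set" where "irr = {p. coef p {#} = 0}"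

lemma coef_mult_zero: "coef (p * q) {#} = coef p {#} * coef (q :: ('h, 'k::field) mpoly) {#}"
proof -
  have "coef (p * q) {#} = (\<Sum>m\<in>keys p. if m = {#} then coef p m * coef q {#} else 0)"
    by (subst coef_mult) (intro sum.cong, auto)
  then show ?thesis by (auto simp: in_keys_iff)
qed

lemma prime_irr: "is_prime (irr :: ('h, 'k::field) mpoly set)"
  by (auto simp: is_prime_def is_ideal_def irr_def coef_mult_zero lookup_add lookup_one)

lemma irr_maximal: "a \<notin> irr \<Longrightarrow> \<exists>b. a * b - 1 \<in> (irr :: ('h, 'k::field) mpoly set)"
  by (intro exI[of _ "cst (inverse (coef a {#}))"]) (auto simp: irr_def coef_mult_zero lookup_minus lookup_one)

lemma mon_in_irr: "mon m \<in> irr \<longleftrightarrow> m \<noteq> {#}"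
  by (auto simp: irr_def lookup_single when_def)

text \<open>An element outside \<open>irr\<close> has a nonzero constant term, and the degree e part
  of s * z is this constant times z.\<close>

lemma homog_unit_cancel:
  assumes I: "is_ideal I" "homog_ideal w I" and w: "\<And>h. 0 < w h" and z: "homog w e z"
    and s: "s \<notin> irr" "s * z \<in> I"
  shows "z \<in> I"
proof -
  have "wt w m = 0 \<longleftrightarrow> m = {#}" for m using size_le_wt[of m w] w by (auto simp: Suc_le_eq)
  then have "hpart w 0 s = cst (coef s {#})"
    by (intro poly_mapping_eqI) (auto simp: coef_part lookup_single when_def)
  moreover have "hpart w e (s * z) = hpart w 0 s * z" using hpart_mult_homog[OF z, of e s] by simp
  ultimately have "cst (coef s {#}) * z \<in> I" using I(2) s(2) by (metis homog_ideal_def)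
  then show ?thesis using s(1) cst_in_ideal[OF I(1)] by (auto simp: irr_def)
qed

lemma homog_ideal_memI: "is_ideal I \<Longrightarrow> (\<And>k. hpart w k p \<in> I) \<Longrightarrow> p \<in> I"
  using sum_hpart[of w p] ideal_sum[of I "wt w ` keys p" "\<lambda>k. hpart w k p"] by simp

text \<open>A weak regularity statement local at \<open>irr\<close> becomes global for homogeneous
  data: it is applied to each homogeneous component of a, where the multiplier s can be
  cancelled.\<close>

lemma homog_ideal_weak:
  assumes I: "is_ideal I" "homog_ideal w I" and w: "\<And>h. 0 < w h" and y: "homog w e y"
    and weak: "\<And>a. a * y \<in> I \<Longrightarrow> \<exists>s. s \<notin> irr \<and> s * (a * var v) \<in> I" and a: "a * y \<in> I"
  shows "var v * a \<in> I"
proof (rule homog_ideal_memI[OF I(1), of w])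
  fix k
  have v: "homog w (w v) (var v)" by (simp add: homog_def)
  have *: "hpart w j a * var v \<in> I" for j
  proof -
    have "hpart w (j + e) (a * y) \<in> I" using I(2) a by (auto simp: homog_ideal_def)
    then have "hpart w j a * y \<in> I" using hpart_mult_homog[OF y, of "j + e" a] by simp
    then obtain s where "s \<notin> irr" "s * (hpart w j a * var v) \<in> I" using weak by blast
    then show ?thesis using homog_unit_cancel[OF I w homog_mult[OF homog_hpart v]] by blast
  qed
  show "hpart w k (var v * a) \<in> I"
    using hpart_mult_homog[OF v, of k a] * by (simp add: mult.commute[of "var v"] ideal_zero[OF I(1)])
qed

subsection \<open>Monomial ideals\<close>

text \<open>M is the set of monomials that survive in the quotient, not a set of generators; the
  ideal property amounts to M being closed under divisors.\<close>

definition mideal :: "'h multiset set \<Rightarrow> ('h, 'k::field) mpoly set" where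
  "mideal M = {p. keys p \<inter> M = {}}"

lemma ideal_mideal: assumes "\<And>m n. m + n \<in> M \<Longrightarrow> n \<in> M" shows "is_ideal (mideal M :: ('h, 'k::field) mpoly set)"
  unfolding is_ideal_def mideal_def using keys_add assms by (fastforce elim!: keys_multE)

lemma mon_in_mideal: "mon m \<in> mideal M \<longleftrightarrow> m \<notin> M" by (auto simp: mideal_def)

lemma homog_ideal_mideal: "homog_ideal w (mideal M)" by (auto simp: homog_ideal_def mideal_def keys_part)

lemma mideal_coef: "p \<in> mideal M \<longleftrightarrow> (\<forall>m\<in>M. coef p m = 0)" by (auto simp: mideal_def in_keys_iff)

subsection \<open>Dimension\<close>

text \<open>Gaussian elimination on the coordinates: unless all vectors vanish at s, a pivot vector
  a clears this coordinate from the others.\<close>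

lemma linear_dependence:
  fixes v :: "'b \<Rightarrow> 's \<Rightarrow> 'k::field"
  assumes "finite S" "finite B" "card S < card B"
  shows "\<exists>c. (\<exists>b\<in>B. c b \<noteq> 0) \<and> (\<forall>s\<in>S. (\<Sum>b\<in>B. c b * v b s) = 0)"
  using assms
proof (induction S arbitrary: B v rule: finite_induct)
  case empty
  then show ?case by (auto intro!: exI[of _ "\<lambda>_. 1"] simp: card_gt_0_iff)
next
  case (insert s S)
  show ?case
  proof (cases "\<forall>b\<in>B. v b s = 0")
    case True
    obtain c where "\<exists>b\<in>B. c b \<noteq> 0" "\<forall>s\<in>S. (\<Sum>b\<in>B. c b * v b s) = 0" 
      using insert.IH[of B v] insert.prems insert.hyps by (metis Suc_lessD card_insert_disjoint)
    then show ?thesis using True by (auto intro!: exI[of _ c])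
  next
    case False
    then obtain a where a: "a \<in> B" "v a s \<noteq> 0" by auto
    let ?B = "B - {a}"
    define u where "u = (\<lambda>b t. v b t - v b s / v a s * v a t)"
    have "card S < card ?B" using insert a by simp
    then have "\<exists>c. (\<exists>b\<in>?B. c b \<noteq> 0) \<and> (\<forall>t\<in>S. (\<Sum>b\<in>?B. c b * u b t) = 0)"
      using insert.prems by (intro insert.IH) auto
    then obtain c where c: "\<exists>b\<in>?B. c b \<noteq> 0" "\<forall>t\<in>S. (\<Sum>b\<in>?B. c b * u b t) = 0" by blast
    \<comment> \<open>The coefficient of the pivot is chosen so that the relation among the reduced
      vectors becomes one among the original vectors.\<close>
    define c' where "c' = c(a := - (\<Sum>b\<in>?B. c b * v b s) / v a s)"
    have "(\<Sum>b\<in>B. c' b * v b t) = (\<Sum>b\<in>?B. c b * u b t)" for t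
    proof -
      have "(\<Sum>b\<in>B. c' b * v b t) = c' a * v a t + (\<Sum>b\<in>?B. c' b * v b t)"
        using a(1) insert.prems(1) by (intro sum.remove) auto
      also have "(\<Sum>b\<in>?B. c' b * v b t) = (\<Sum>b\<in>?B. c b * v b t)" by (intro sum.cong) (auto simp: c'_def)
      also have "c' a * v a t = - (\<Sum>b\<in>?B. c b * (v b s / v a s * v a t))"
        by (simp add: c'_def sum_distrib_left sum_distrib_right sum_divide_distrib mult_ac)
      finally show ?thesis by (simp add: u_def right_diff_distrib sum_subtractf)
    qed
    moreover have "u b s = 0" for b using a by (simp add: u_def)
    ultimately have "\<forall>t\<in>insert s S. (\<Sum>b\<in>B. c' b * v b t) = 0" using c(2) by simp
    moreover have "\<exists>b\<in>B. c' b \<noteq> 0" using c(1) by (auto simp: c'_def)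
    ultimately show ?thesis by auto
  qed
qed

text \<open>The lowest power of \<open>z 0\<close> is cancelled modulo the prime \<open>Q 0\<close>,
  to which \<open>z 0\<close> does not belong. Modulo \<open>Q 1\<close> only the terms with this
  lowest power remain, and the induction continues with \<open>z 1\<close>.\<close>

lemma chain_independent:
  fixes z :: "nat \<Rightarrow> 'r::comm_ring_1"
  assumes "\<And>i. i \<le> n \<Longrightarrow> is_prime (Q i)" "\<And>i. i < n \<Longrightarrow> Q i \<subseteq> Q (Suc i)"
    "\<And>i. i < n \<Longrightarrow> z i \<in> Q (Suc i) \<and> z i \<notin> Q i"
    "finite E" "E \<noteq> {}" "\<And>\<beta> i. \<beta> \<in> E \<Longrightarrow> n \<le> i \<Longrightarrow> \<beta> i = 0" "\<And>\<beta> i. \<beta> \<in> E \<Longrightarrow> i \<le> n \<Longrightarrow> g \<beta> \<notin> Q i"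
  shows "(\<Sum>\<beta>\<in>E. g \<beta> * (\<Prod>i<n. z i ^ \<beta> i)) \<notin> Q 0"
  using assms
proof (induction n arbitrary: Q z E g)
  case 0
  then have "E = {\<lambda>_. 0}" by (metis bot_nat_0.extremum ext is_singletonI' is_singleton_the_elem singletonD singletonI)
  then show ?case using 0 by auto
next
  case (Suc n)
  define m where "m = Min ((\<lambda>\<beta>. \<beta> 0) ` E)"
  have m: "m \<le> \<beta> 0" if "\<beta> \<in> E" for \<beta> using that Suc.prems by (auto simp: m_def)
  obtain \<beta>0 where b0: "\<beta>0 \<in> E" "\<beta>0 0 = m" 
  proof -
    have "m \<in> (\<lambda>\<beta>. \<beta> 0) ` E" unfolding m_def using Suc.prems(4,5) by (intro Min_in) auto
    then show ?thesis using that by blast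
  qed
  define E1 where "E1 = {\<beta> \<in> E. \<beta> 0 = m}"
  define sh where "sh = (\<lambda>\<beta> :: nat \<Rightarrow> nat. \<lambda>i. \<beta> (Suc i))"
  define rest where "rest = (\<lambda>\<beta> :: nat \<Rightarrow> nat. \<Prod>i<n. z (Suc i) ^ \<beta> (Suc i))"
  show ?case
  proof
    assume A: "(\<Sum>\<beta>\<in>E. g \<beta> * (\<Prod>i<Suc n. z i ^ \<beta> i)) \<in> Q 0"
    have pr: "(\<Prod>i<Suc n. z i ^ \<beta> i) = z 0 ^ m * (z 0 ^ (\<beta> 0 - m) * rest \<beta>)" if "\<beta> \<in> E" for \<beta>
      using m[OF that] unfolding rest_def prod.lessThan_Suc_shift
      by (simp add: mult.assoc[symmetric] flip: power_add)
    have "(\<Sum>\<beta>\<in>E. g \<beta> * (\<Prod>i<Suc n. z i ^ \<beta> i)) = z 0 ^ m * (\<Sum>\<beta>\<in>E. g \<beta> * (z 0 ^ (\<beta> 0 - m) * rest \<beta>))"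
      unfolding sum_distrib_left using pr by (intro sum.cong refl) (simp add: mult_ac)
    then have "(\<Sum>\<beta>\<in>E. g \<beta> * (z 0 ^ (\<beta> 0 - m) * rest \<beta>)) \<in> Q 0"
      using A is_primeD(3)[of "Q 0" "z 0 ^ m"] prime_power[of "Q 0" "z 0" m] Suc.prems(1)[of 0] Suc.prems(3)[of 0] by auto
    then have in1: "(\<Sum>\<beta>\<in>E. g \<beta> * (z 0 ^ (\<beta> 0 - m) * rest \<beta>)) \<in> Q 1" using Suc.prems(2)[of 0] by auto
    have q1: "is_ideal (Q 1)" using Suc.prems(1)[of 1] by (auto dest: is_primeD)
    have "(\<Sum>\<beta>\<in>E. g \<beta> * (z 0 ^ (\<beta> 0 - m) * rest \<beta>)) = (\<Sum>\<beta>\<in>E - E1. g \<beta> * (z 0 ^ (\<beta> 0 - m) * rest \<beta>)) + (\<Sum>\<beta>\<in>E1. g \<beta> * (z 0 ^ (\<beta> 0 - m) * rest \<beta>))"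
      using Suc.prems(4) by (intro sum.subset_diff) (auto simp: E1_def)
    moreover have "(\<Sum>\<beta>\<in>E - E1. g \<beta> * (z 0 ^ (\<beta> 0 - m) * rest \<beta>)) \<in> Q 1"
    proof (rule ideal_sum[OF q1])
      fix \<beta> assume b: "\<beta> \<in> E - E1"
      then have "\<beta> 0 - m = Suc (\<beta> 0 - m - 1)" using m[of \<beta>] by (auto simp: E1_def)
      then have "g \<beta> * (z 0 ^ (\<beta> 0 - m) * rest \<beta>) = (g \<beta> * z 0 ^ (\<beta> 0 - m - 1) * rest \<beta>) * z 0"
        by (metis (no_types, lifting) mult.assoc mult.commute power_Suc2)
      then show "g \<beta> * (z 0 ^ (\<beta> 0 - m) * rest \<beta>) \<in> Q 1" using ideal_mult_left[OF q1] Suc.prems(3)[of 0] by simp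
    qed
    ultimately have "(\<Sum>\<beta>\<in>E1. g \<beta> * (z 0 ^ (\<beta> 0 - m) * rest \<beta>)) \<in> Q 1"
      using in1 ideal_diff[OF q1, of "_ + (\<Sum>\<beta>\<in>E1. g \<beta> * (z 0 ^ (\<beta> 0 - m) * rest \<beta>))"] by fastforce
    then have fin: "(\<Sum>\<beta>\<in>E1. g \<beta> * rest \<beta>) \<in> Q 1" by (simp add: E1_def)
    have inj: "inj_on sh E1"
    proof (rule inj_onI, rule ext)
      fix \<alpha> \<beta> i assume "\<alpha> \<in> E1" "\<beta> \<in> E1" "sh \<alpha> = sh \<beta>"
      then show "\<alpha> i = \<beta> i" by (cases i) (auto simp: sh_def E1_def dest: fun_cong)
    qed
    have "(\<Sum>\<beta>\<in>sh ` E1. g (inv_into E1 sh \<beta>) * (\<Prod>i<n. z (Suc i) ^ \<beta> i)) = (\<Sum>\<beta>\<in>E1. g \<beta> * rest \<beta>)"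
    proof (subst sum.reindex[OF inj], rule sum.cong[OF refl])
      fix \<beta> assume "\<beta> \<in> E1"
      then have "inv_into E1 sh (sh \<beta>) = \<beta>" using inj by (rule_tac inv_into_f_f)
      then show "((\<lambda>\<beta>. g (inv_into E1 sh \<beta>) * (\<Prod>i<n. z (Suc i) ^ \<beta> i)) \<circ> sh) \<beta> = g \<beta> * rest \<beta>"
        by (simp add: rest_def) (simp add: sh_def)
    qed
    moreover have "(\<Sum>\<beta>\<in>sh ` E1. g (inv_into E1 sh \<beta>) * (\<Prod>i<n. z (Suc i) ^ \<beta> i)) \<notin> Q (Suc 0)"
    proof (rule Suc.IH[of "\<lambda>i. Q (Suc i)" "\<lambda>i. z (Suc i)" "sh ` E1" "\<lambda>\<beta>. g (inv_into E1 sh \<beta>)"])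
      show "finite (sh ` E1)" using Suc.prems(4) by (auto simp: E1_def)
      show "sh ` E1 \<noteq> {}" using b0 by (auto simp: E1_def)
      show "\<beta> i = 0" if "\<beta> \<in> sh ` E1" "n \<le> i" for \<beta> i using that Suc.prems(6) by (auto simp: E1_def sh_def)
      show "g (inv_into E1 sh \<beta>) \<notin> Q (Suc i)" if "\<beta> \<in> sh ` E1" "i \<le> n" for \<beta> i
        using that Suc.prems(7)[of _ "Suc i"] inj by (auto simp: E1_def)
    qed (use Suc.prems in auto)
    ultimately show False using fin by simp
  qed
qed

lemma size_keys_power:
  assumes "\<And>m. m \<in> keys (p :: ('h, 'k::field) mpoly) \<Longrightarrow> size m \<le> E" "m \<in> keys (p ^ n)" shows "size m \<le> n * E"
  using assms(2)
proof (induction n arbitrary: m)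
  case (Suc n)
  then obtain a b where ab: "a \<in> keys p" "b \<in> keys (p ^ n)" "m = a + b" by (auto elim: keys_multE)
  then show ?case using assms(1)[OF ab(1)] Suc.IH[OF ab(2)] by simp
qed simp

lemma size_keys_prod:
  assumes "finite K" "\<And>i m. i \<in> K \<Longrightarrow> m \<in> keys (f i :: ('h, 'k::field) mpoly) \<Longrightarrow> size m \<le> E i" "m \<in> keys (\<Prod>i\<in>K. f i)"
  shows "size m \<le> (\<Sum>i\<in>K. E i)"
  using assms
proof (induction K arbitrary: m rule: finite_induct)
  case (insert k K)
  then obtain a b where ab: "a \<in> keys (f k)" "b \<in> keys (\<Prod>i\<in>K. f i)" "m = a + b" by (auto elim: keys_multE)
  then show ?case using insert.prems(1)[of k a] insert.IH[OF _ ab(2)] insert by fastforce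
qed auto

lemma card_monomials:
  assumes "finite F" shows "finite {m. set_mset m \<subseteq> F \<and> size m \<le> E}" "card {m. set_mset m \<subseteq> F \<and> size m \<le> E} \<le> (E + 1) ^ card F"
proof -
  let ?M = "{m. set_mset m \<subseteq> F \<and> size m \<le> E}"
  let ?f = "\<lambda>m. restrict (count m) F"
  have fin: "finite (PiE F (\<lambda>_. {..E}))" using assms by (intro finite_PiE) auto
  have inj: "inj_on ?f ?M"
  proof (rule inj_onI, rule multiset_eqI)
    fix a b h assume ab: "a \<in> ?M" "b \<in> ?M" "?f a = ?f b"
    show "count a h = count b h"
    proof (cases "h \<in> F")
      case True then show ?thesis using fun_cong[OF ab(3), of h] by simp
    next
      case False
      then have "h \<notin># a" "h \<notin># b" using ab by auto
      then show ?thesis by (simp add: not_in_iff)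
    qed
  qed
  have sub: "?f ` ?M \<subseteq> PiE F (\<lambda>_. {..E})"
  proof (intro image_subsetI PiE_I)
    fix m h assume "m \<in> ?M" "h \<in> F"
    then show "restrict (count m) F h \<in> {..E}" using count_le_size[of m h] by simp
  qed simp
  show "finite ?M" using inj sub fin by (meson finite_imageD finite_subset)
  have "card ?M = card (?f ` ?M)" using inj by (simp add: card_image)
  also have "\<dots> \<le> card (PiE F (\<lambda>_. {..E}))" using sub fin by (intro card_mono)
  also have "\<dots> = (E + 1) ^ card F" using assms by (simp add: card_PiE)
  finally show "card ?M \<le> (E + 1) ^ card F" .
qed

text \<open>Any D + 1 elements of the quotient by a monomial ideal whose faces have at most D elements are
  algebraically dependent, since the number of standard monomials grows like a polynomial of degree D;
  the lexicographically smallest monomial of a relation contradicts a longer chain of primes.\<close>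

lemma dim_le_faces:
  fixes J :: "('h, 'k::field) mpoly set"
  assumes H: "finite H" and M: "\<And>m. m \<in> M \<Longrightarrow> set_mset m \<subseteq> H" "\<And>m. m \<in> M \<Longrightarrow> card (set_mset m) \<le> D"
    and J: "mideal M \<subseteq> J" and chain: "prime_chain J P n"
  shows "n \<le> D"
proof (rule ccontr)
  assume "\<not> n \<le> D"
  then have n: "Suc D \<le> n" by simp
  obtain Q where Q: "\<And>i. i \<le> n \<Longrightarrow> is_prime (Q i) \<and> J \<subseteq> Q i" "\<And>i. i < n \<Longrightarrow> Q i \<subset> Q (Suc i)"
    using chain unfolding prime_chain_def by blast
  have "\<exists>z. z \<in> Q (Suc i) \<and> z \<notin> Q i" if "i < n" for i using Q(2)[OF that] by auto
  then obtain z where z: "\<And>i. i < n \<Longrightarrow> z i \<in> Q (Suc i) \<and> z i \<notin> Q i" by metis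
  define W where "W = (\<Sum>i<Suc D. \<Sum>m\<in>keys (z i). size m)"
  have W: "size m \<le> W" if "i < Suc D" "m \<in> keys (z i)" for i m
  proof -
    have "size m \<le> (\<Sum>m\<in>keys (z i). size m)" using that by (intro member_le_sum) auto
    also have "\<dots> \<le> W" unfolding W_def using that by (intro member_le_sum) auto
    finally show ?thesis .
  qed
  \<comment> \<open>K makes the count work: the standard monomials of size at most K * (Suc D * W)
    number at most 2^card H * ((K + 1) * (Suc D * W + 1))^D = K * (K + 1)^D, fewer than the (K +
    1)^(D + 1) exponent vectors.\<close>
  define K where "K = 2 ^ card H * (Suc D * W + 1) ^ D"
  define E where "E = {\<beta>. (\<forall>i<Suc D. \<beta> i \<le> K) \<and> (\<forall>i\<ge>Suc D. \<beta> i = (0::nat))}"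
  define T where "T = {m \<in> M. size m \<le> K * (Suc D * W)}"
  have T: "T \<subseteq> (\<Union>F\<in>{F. F \<subseteq> H \<and> card F \<le> D}. {m. set_mset m \<subseteq> F \<and> size m \<le> K * (Suc D * W)})" (is "_ \<subseteq> ?U")
    using M by (auto simp: T_def)
  have finF: "finite {F. F \<subseteq> H \<and> card F \<le> D}" using H by auto
  have finF': "finite F" if "F \<in> {F. F \<subseteq> H \<and> card F \<le> D}" for F using that H by (auto intro: finite_subset)
  have finT: "finite T" 
  proof (rule finite_subset[OF T], rule finite_UN_I[OF finF])
    fix F assume "F \<in> {F. F \<subseteq> H \<and> card F \<le> D}"
    then show "finite {m. set_mset m \<subseteq> F \<and> size m \<le> K * (Suc D * W)}" by (rule card_monomials(1)[OF finF'])
  qed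
  have "card T \<le> card ?U" 
  proof (rule card_mono[OF _ T], rule finite_UN_I[OF finF])
    fix F assume "F \<in> {F. F \<subseteq> H \<and> card F \<le> D}"
    then show "finite {m. set_mset m \<subseteq> F \<and> size m \<le> K * (Suc D * W)}" by (rule card_monomials(1)[OF finF'])
  qed
  also have "\<dots> \<le> (\<Sum>F\<in>{F. F \<subseteq> H \<and> card F \<le> D}. card {m. set_mset m \<subseteq> F \<and> size m \<le> K * (Suc D * W)})"
    using finF by (rule card_UN_le)
  also have "\<dots> \<le> (\<Sum>F\<in>{F. F \<subseteq> H \<and> card F \<le> D}. (K * (Suc D * W) + 1) ^ D)"
  proof (rule sum_mono)
    fix F assume F: "F \<in> {F. F \<subseteq> H \<and> card F \<le> D}"
    have "card {m. set_mset m \<subseteq> F \<and> size m \<le> K * (Suc D * W)} \<le> (K * (Suc D * W) + 1) ^ card F"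
      by (rule card_monomials(2)[OF finF'[OF F]])
    also have "\<dots> \<le> (K * (Suc D * W) + 1) ^ D" using F by (intro power_increasing) auto
    finally show "card {m. set_mset m \<subseteq> F \<and> size m \<le> K * (Suc D * W)} \<le> (K * (Suc D * W) + 1) ^ D" .
  qed
  also have "\<dots> \<le> 2 ^ card H * (K * (Suc D * W) + 1) ^ D"
  proof -
    have "card {F. F \<subseteq> H \<and> card F \<le> D} \<le> card (Pow H)" using H by (intro card_mono) auto
    then show ?thesis using H by (simp add: card_Pow)
  qed
  also have "\<dots> \<le> 2 ^ card H * ((K + 1) * (Suc D * W + 1)) ^ D"
    by (intro mult_left_mono power_mono) (auto simp: algebra_simps)
  also have "\<dots> = K * (K + 1) ^ D" 
    unfolding power_mult_distrib by (simp only: mult.commute[of "(K + 1) ^ D"] mult.assoc[symmetric]) (simp only: K_def)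
  also have "\<dots> < (K + 1) ^ Suc D" by simp
  finally have cT: "card T < (K + 1) ^ Suc D" .
  let ?r = "\<lambda>\<beta>. restrict \<beta> {..<Suc D}"
  have bij: "bij_betw ?r E (PiE {..<Suc D} (\<lambda>_. {..K}))"
  proof (rule bij_betwI[where g = "\<lambda>f i. if i < Suc D then f i else 0"])
    show "?r \<in> E \<rightarrow> PiE {..<Suc D} (\<lambda>_. {..K})" by (auto simp: E_def)
    show "(\<lambda>f i. if i < Suc D then f i else 0) \<in> PiE {..<Suc D} (\<lambda>_. {..K}) \<rightarrow> E" by (auto simp: E_def PiE_def Pi_def)
  qed (auto simp: E_def PiE_def extensional_def restrict_def fun_eq_iff)
  have finE: "finite E" using bij_betw_finite[OF bij] by (simp add: finite_PiE)
  have "card E = (K + 1) ^ Suc D" using bij_betw_same_card[OF bij] by (simp add: card_PiE)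
  then obtain c where c: "\<exists>b\<in>E. c b \<noteq> 0" "\<forall>m\<in>T. (\<Sum>b\<in>E. c b * coef (\<Prod>i<Suc D. z i ^ b i) m) = 0"
    using linear_dependence[OF finT finE, of "\<lambda>b m. coef (\<Prod>i<Suc D. z i ^ b i) m"] cT by auto
  define E' where "E' = {b \<in> E. c b \<noteq> 0}"
  have E': "(\<Sum>b\<in>E'. cst (c b) * (\<Prod>i<Suc D. z i ^ b i)) \<in> mideal M"
    unfolding mideal_coef
  proof
    fix m assume m: "m \<in> M"
    have eq: "coef (\<Sum>b\<in>E'. cst (c b) * (\<Prod>i<Suc D. z i ^ b i)) m = (\<Sum>b\<in>E. c b * coef (\<Prod>i<Suc D. z i ^ b i) m)"
      unfolding E'_def lookup_sum coef_cst_mult using finE by (intro sum.mono_neutral_left) auto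
    show "coef (\<Sum>b\<in>E'. cst (c b) * (\<Prod>i<Suc D. z i ^ b i)) m = 0"
    proof (cases "m \<in> T")
      case True then show ?thesis using eq c(2) by simp
    next
      case False
      have "coef (\<Prod>i<Suc D. z i ^ b i) m = 0" if b: "b \<in> E" for b
      proof (rule ccontr)
        assume "coef (\<Prod>i<Suc D. z i ^ b i) m \<noteq> 0"
        then have "m \<in> keys (\<Prod>i<Suc D. z i ^ b i)" by (simp add: in_keys_iff)
        then have "size m \<le> (\<Sum>i<Suc D. b i * W)"
          using W by (intro size_keys_prod[of "{..<Suc D}" "\<lambda>i. z i ^ b i"]) (auto intro!: size_keys_power)
        also have "\<dots> \<le> (\<Sum>i<Suc D. K * W)" using b by (intro sum_mono mult_right_mono) (auto simp: E_def)
        also have "\<dots> = K * (Suc D * W)" by (simp add: algebra_simps)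
        finally show False using False m by (auto simp: T_def)
      qed
      then show ?thesis using eq by simp
    qed
  qed
  have "(\<Sum>b\<in>E'. cst (c b) * (\<Prod>i<Suc D. z i ^ b i)) \<notin> Q 0"
  proof (rule chain_independent)
    show "finite E'" "E' \<noteq> {}" using finE c(1) by (auto simp: E'_def)
    show "cst (c b) \<notin> Q i" if "b \<in> E'" "i \<le> Suc D" for b i
    proof
      assume "cst (c b) \<in> Q i"
      then have "cst (c b) * 1 \<in> Q i" by simp
      moreover have p: "is_prime (Q i)" "c b \<noteq> 0" using that n Q(1)[of i] by (auto simp: E'_def)
      ultimately have "1 \<in> Q i" using cst_in_ideal[OF is_primeD(1)[OF p(1)]] by blast
      then show False using is_primeD(2)[OF p(1)] by blast
    qed
    show "Q i \<subseteq> Q (Suc i)" if "i < Suc D" for i using Q(2)[of i] that n by auto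
  qed (use Q z n in \<open>auto simp: E'_def E_def\<close>)
  moreover have "mideal M \<subseteq> Q 0" using J Q(1)[of 0] by auto
  ultimately show False using E' by auto
qed

section \<open>Lower bound for maximal regular sequences by growth of the Hilbert function\<close>

lemma prime_chain_extend:
  assumes "prime_chain J Q n" "Q \<subset> P" "is_prime P" "J \<subseteq> P" shows "prime_chain J P (Suc n)"
proof -
  obtain R where R: "\<forall>i\<le>n. is_prime (R i) \<and> J \<subseteq> R i \<and> R i \<subseteq> Q" "\<forall>i<n. R i \<subset> R (Suc i)"
    using assms(1) unfolding prime_chain_def by blast
  show ?thesis unfolding prime_chain_def
  proof (intro exI[of _ "\<lambda>i. if i \<le> n then R i else P"] conjI allI impI)
    fix i assume "i \<le> Suc n"
    show "is_prime (if i \<le> n then R i else P)" "J \<subseteq> (if i \<le> n then R i else P)" "(if i \<le> n then R i else P) \<subseteq> P"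
      using R(1) assms(2-4) by (cases "i \<le> n"; auto)+
  next
    fix i assume i: "i < Suc n"
    show "(if i \<le> n then R i else P) \<subset> (if Suc i \<le> n then R (Suc i) else P)"
    proof (cases "i = n")
      case True then show ?thesis using R(1) assms(2) by auto
    next
      case False then show ?thesis using R(2) i by auto
    qed
  qed
qed

lemma prime_chain_mono: "prime_chain J' P n \<Longrightarrow> J \<subseteq> J' \<Longrightarrow> prime_chain J P n"
  unfolding prime_chain_def by (meson order_trans)

text \<open>The n-th power of the irrelevant ideal.\<close>

definition size_ge :: "nat \<Rightarrow> ('h, 'k::field) mpoly set" where "size_ge n = {p. \<forall>m\<in>keys p. n \<le> size m}"

lemma size_ge_mult: "p \<in> size_ge a \<Longrightarrow> q \<in> size_ge b \<Longrightarrow> p * q \<in> size_ge (a + b)"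
  by (auto simp: size_ge_def elim!: keys_multE intro!: add_mono)

lemma size_ge_power: "p \<in> size_ge a \<Longrightarrow> p ^ n \<in> size_ge (n * a)"
  by (induction n) (auto intro: size_ge_mult, simp add: size_ge_def)

lemma irr_size_ge: "irr = (size_ge 1 :: ('h, 'k::field) mpoly set)"
proof -
  have "coef p {#} = 0 \<longleftrightarrow> (\<forall>m\<in>keys p. 1 \<le> size m)" for p :: "('h, 'k) mpoly"
  proof
    assume "coef p {#} = 0"
    then show "\<forall>m\<in>keys p. 1 \<le> size m" by (metis One_nat_def Suc_leI in_keys_iff nonempty_has_size)
  next
    assume "\<forall>m\<in>keys p. 1 \<le> size m"
    then show "coef p {#} = 0" by (metis in_keys_iff not_one_le_zero size_empty)
  qed
  then show ?thesis by (auto simp: irr_def size_ge_def)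
qed

lemma ideal_size_ge: "is_ideal (size_ge n :: ('h, 'k::field) mpoly set)"
proof -
  have "size_ge n = (mideal {m. size m < n} :: ('h, 'k) mpoly set)" by (auto simp: size_ge_def mideal_def not_less)
  moreover have "is_ideal (mideal {m. size m < n} :: ('h, 'k) mpoly set)" by (rule ideal_mideal) simp
  ultimately show ?thesis by simp
qed

definition lspan :: "('h, 'k::field) mpoly set \<Rightarrow> ('h, 'k) mpoly set \<Rightarrow> ('h, 'k) mpoly set" where
  "lspan V I = {p. \<exists>c. p - (\<Sum>v\<in>V. cst (c v) * v) \<in> I}"

lemma lspan_add: assumes "is_ideal I" "p \<in> lspan V I" "q \<in> lspan V I" shows "p + q \<in> lspan V I"
proof -
  obtain c e where "p - (\<Sum>v\<in>V. cst (c v) * v) \<in> I" "q - (\<Sum>v\<in>V. cst (e v) * v) \<in> I" using assms by (auto simp: lspan_def)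
  then have "(p - (\<Sum>v\<in>V. cst (c v) * v)) + (q - (\<Sum>v\<in>V. cst (e v) * v)) \<in> I" using assms(1) by (intro ideal_add)
  then have "p + q - (\<Sum>v\<in>V. cst (c v + e v) * v) \<in> I"
    by (simp add: single_add distrib_right sum.distrib algebra_simps)
  then show ?thesis unfolding lspan_def by (intro CollectI exI[of _ "\<lambda>v. c v + e v"])
qed

lemma lspan_ideal: "p \<in> I \<Longrightarrow> p \<in> lspan V I"
  by (auto simp: lspan_def intro!: exI[of _ "\<lambda>_. 0"])

lemma lspan_base: "is_ideal I \<Longrightarrow> finite V \<Longrightarrow> v \<in> V \<Longrightarrow> cst a * v \<in> lspan V I"
proof -
  assume I: "is_ideal I" and V: "finite V" "v \<in> V"
  have "(\<Sum>u\<in>V. cst (if u = v then a else 0) * u) = (\<Sum>u\<in>V. if u = v then cst a * v else 0)" by (intro sum.cong) auto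
  then have "cst a * v - (\<Sum>u\<in>V. cst (if u = v then a else 0) * u) = 0" using V by simp
  then have "cst a * v - (\<Sum>u\<in>V. cst (if u = v then a else 0) * u) \<in> I" using ideal_zero[OF I] by metis
  then show ?thesis unfolding lspan_def by (intro CollectI exI[of _ "\<lambda>u. if u = v then a else 0"])
qed

lemma lspan_sum: assumes "is_ideal I" "\<And>k. k \<in> K \<Longrightarrow> f k \<in> lspan V I" shows "(\<Sum>k\<in>K. f k) \<in> lspan V I"
  using assms(2)
  by (induction K rule: infinite_finite_induct) (auto intro: lspan_add[OF assms(1)] lspan_ideal ideal_zero[OF assms(1)])

text \<open>Expanding repeatedly in powers of u stops at \<open>u ^ n\<close>, so the products of
  \<open>u ^ j\<close>, j < n, with the old spanning set suffice.\<close>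

lemma lspan_adjoin:
  assumes I: "is_ideal I" and V: "finite V" and u: "u ^ n \<in> I" and sp: "lspan V (adjoin I u) = UNIV"
  shows "\<exists>V'. finite V' \<and> card V' \<le> n * card V \<and> lspan V' I = UNIV"
proof -
  define V' where "V' = (\<lambda>(j, v). u ^ j * v) ` ({..<n} \<times> V)"
  have fin: "finite V'" using V by (auto simp: V'_def)
  have "card V' \<le> card ({..<n} \<times> V)" unfolding V'_def using V by (intro card_image_le) auto
  then have card: "card V' \<le> n * card V" by (simp add: card_cartesian_product)
  have step: "\<exists>r. p - u ^ k * r \<in> lspan V' I" if "k \<le> n" for p k
    using that
  proof (induction k)
    case 0 show ?case by (intro exI[of _ p] lspan_ideal) (simp add: ideal_zero[OF I])
  next
    case (Suc k)
    then obtain r where r: "p - u ^ k * r \<in> lspan V' I" by auto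
    have "r \<in> lspan V (adjoin I u)" using sp by auto
    then obtain c e where e: "r - (\<Sum>v\<in>V. cst (c v) * v) - e * u \<in> I" by (auto simp: lspan_def in_adjoin)
    have eq: "p - u ^ Suc k * e = (p - u ^ k * r) + (\<Sum>v\<in>V. cst (c v) * (u ^ k * v)) + u ^ k * (r - (\<Sum>v\<in>V. cst (c v) * v) - e * u)"
      by (simp add: algebra_simps sum_distrib_left)
    have 1: "(\<Sum>v\<in>V. cst (c v) * (u ^ k * v)) \<in> lspan V' I"
    proof (intro lspan_sum[OF I] lspan_base[OF I fin])
      fix v assume "v \<in> V" then show "u ^ k * v \<in> V'" using Suc.prems unfolding V'_def by force
    qed
    have 2: "u ^ k * (r - (\<Sum>v\<in>V. cst (c v) * v) - e * u) \<in> lspan V' I"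
      by (intro lspan_ideal ideal_mult_left I e)
    have "p - u ^ Suc k * e \<in> lspan V' I" unfolding eq by (intro lspan_add[OF I] r 1 2)
    then show ?case by blast
  qed
  have "p \<in> lspan V' I" for p
  proof -
    obtain r where r: "p - u ^ n * r \<in> lspan V' I" using step[of n p] by auto
    have "u ^ n * r \<in> lspan V' I" by (intro lspan_ideal ideal_mult_right I u)
    then have "(p - u ^ n * r) + u ^ n * r \<in> lspan V' I" using r by (intro lspan_add[OF I])
    then show ?thesis by simp
  qed
  then show ?thesis using fin card by blast
qed

lemma lspan_adjoins:
  assumes "is_ideal I" "finite V" "\<And>u. u \<in> set us \<Longrightarrow> u ^ n \<in> I" "lspan V (adjoins I us) = UNIV"
  shows "\<exists>V'. finite V' \<and> card V' \<le> n ^ length us * card V \<and> lspan V' I = UNIV"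
  using assms
proof (induction us arbitrary: I)
  case Nil then show ?case by auto
next
  case (Cons u us)
  have "\<exists>V'. finite V' \<and> card V' \<le> n ^ length us * card V \<and> lspan V' (adjoin I u) = UNIV"
    using Cons.prems adjoin_subset[of I u] by (intro Cons.IH ideal_adjoin) auto
  then obtain V1 where V1: "finite V1" "card V1 \<le> n ^ length us * card V" "lspan V1 (adjoin I u) = UNIV" by blast
  obtain V2 where V2: "finite V2" "card V2 \<le> n * card V1" "lspan V2 I = UNIV"
    using lspan_adjoin[OF Cons.prems(1) V1(1) _ V1(3), of n] Cons.prems(3) by auto
  then have "card V2 \<le> n * (n ^ length us * card V)" using V1(2) by (meson mult_le_mono2 order_trans)
  then show ?case using V2 by (auto simp: mult.assoc)
qed

definition ideal_plus :: "'r::comm_ring_1 set \<Rightarrow> 'r set \<Rightarrow> 'r set" where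
  "ideal_plus I K = {p. \<exists>j\<in>I. p - j \<in> K}"

lemma ideal_plus: assumes "is_ideal I" "is_ideal K" shows "is_ideal (ideal_plus I K)" "I \<subseteq> ideal_plus I K" "K \<subseteq> ideal_plus I K"
proof -
  show "I \<subseteq> ideal_plus I K" "K \<subseteq> ideal_plus I K"
    using ideal_zero[OF assms(1)] ideal_zero[OF assms(2)] by (force simp: ideal_plus_def)+
  show "is_ideal (ideal_plus I K)" unfolding is_ideal_def
  proof (intro conjI ballI allI)
    show "0 \<in> ideal_plus I K" using \<open>I \<subseteq> ideal_plus I K\<close> ideal_zero[OF assms(1)] by auto
    fix a assume "a \<in> ideal_plus I K"
    then obtain i where i: "i \<in> I" "a - i \<in> K" by (auto simp: ideal_plus_def)
    { fix b assume "b \<in> ideal_plus I K"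
      then obtain j where j: "j \<in> I" "b - j \<in> K" by (auto simp: ideal_plus_def)
      have "(a - i) + (b - j) \<in> K" using i j assms by (intro ideal_add)
      then have "(a + b) - (i + j) \<in> K" by (simp add: algebra_simps)
      then show "a + b \<in> ideal_plus I K" using ideal_add[OF assms(1) i(1) j(1)] by (auto simp: ideal_plus_def) }
    fix r
    have "r * a - r * i \<in> K" using ideal_mult_left[OF assms(2) i(2), of r] by (simp add: right_diff_distrib)
    then show "r * a \<in> ideal_plus I K" using ideal_mult_left[OF assms(1) i(1)] by (auto simp: ideal_plus_def)
  qed
qed

lemma size_big_count:
  assumes "finite H" "set_mset m \<subseteq> H" "card H * N < size m" shows "\<exists>h\<in>H. N \<le> count m h"
proof (rule ccontr)
  assume "\<not> ?thesis"
  then have "\<And>h. h \<in> set_mset m \<Longrightarrow> count m h \<le> N" using assms(2) by (meson in_mono le_cases)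
  then have "size m \<le> card (set_mset m) * N" unfolding size_multiset_overloaded_eq
    using sum_bounded_above[of "set_mset m" "count m" N] by simp
  also have "\<dots> \<le> card H * N" using assms by (intro mult_right_mono card_mono) auto
  finally show False using assms by simp
qed

lemma mon_split_replicate: assumes "N \<le> count m h"
  shows "(mon m :: ('h, 'k::field) mpoly) = mon (m - replicate_mset N h) * var h ^ N"
proof -
  have "replicate_mset N h \<subseteq># m" using assms by (simp add: count_le_replicate_mset_subset_eq)
  then have "m = (m - replicate_mset N h) + replicate_mset N h" by simp
  then show ?thesis unfolding var_power mult_single by simp
qed

lemma mon_in_ideal:
  assumes "is_ideal I" "var h \<in> I" "h \<in># m" shows "(mon m :: ('h, 'k::field) mpoly) \<in> I"
proof -
  have "mon (m - {#h#}) * var h \<in> I" using assms by (intro ideal_mult_left)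
  moreover have "mon (m - {#h#}) * var h = (mon m :: ('h, 'k) mpoly)" using assms(3) by (simp add: mult_single)
  ultimately show ?thesis by simp
qed

text \<open>If a Cohen-Macaulay local ring had dimension e < D, a maximal regular sequence would generate an
  ideal primary to the irrelevant one, so the Hilbert function would grow at most like a polynomial of degree e.\<close>

lemma depth_ge_faces:
  fixes J :: "('h, 'k::field) mpoly set"
  assumes H: "finite H" and J: "is_ideal J" "J \<subseteq> irr" "homog_ideal dg J" and dg: "\<And>h. 0 < dg h"
    and out: "\<And>h. h \<notin> H \<Longrightarrow> var h \<in> J"
    and F: "F \<subseteq> H" "card F = D" and indep: "\<And>p. p \<in> J \<Longrightarrow> (\<And>m. m \<in> keys p \<Longrightarrow> set_mset m \<subseteq> F) \<Longrightarrow> p = 0"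
    and us: "set us \<subseteq> irr" "reg_list (- irr) J us" "\<not> prime_chain J irr (Suc (length us))"
  shows "D \<le> length us"
proof (rule ccontr)
  assume "\<not> D \<le> length us"
  define e where "e = length us"
  have e: "e < D" using \<open>\<not> D \<le> length us\<close> by (simp add: e_def)
  define I where "I = adjoins J us"
  have I: "is_ideal I" "J \<subseteq> I" using J by (auto simp: I_def ideal_adjoins adjoins_subset)
  have nirr: "a * b \<notin> irr" if "a \<notin> irr" "b \<notin> (irr :: ('h, 'k) mpoly set)" for a b
    using that is_primeD(3)[OF prime_irr] by blast
  have one: "(1 :: ('h, 'k) mpoly) \<notin> irr" using is_primeD(2)[OF prime_irr] .
  \<comment> \<open>Otherwise a prime over I avoids some variable and lies strictly inside
    \<open>irr\<close>; the chain of primes belonging to \<open>us\<close> could be extended by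
    \<open>irr\<close> beyond the permitted length.\<close>
  have nil: "\<exists>N s. s \<notin> irr \<and> s * var h ^ N \<in> I" for h
  proof (rule ccontr)
    assume n: "\<not> ?thesis"
    define T :: "('h, 'k) mpoly set" where "T = {s * var h ^ N | s N. s \<notin> irr}"
    have "\<exists>Q. is_prime Q \<and> I \<subseteq> Q \<and> Q \<inter> T = {}"
    proof (rule exists_prime_avoiding[OF I(1)])
      show "1 \<in> T" unfolding T_def using one by (intro CollectI exI[of _ 1] exI[of _ 0]) auto
      show "I \<inter> T = {}" using n by (auto simp: T_def)
      fix a b assume "a \<in> T" "b \<in> T"
      then obtain s N t K where *: "a = s * var h ^ N" "b = t * var h ^ K" "s \<notin> irr" "t \<notin> irr" by (auto simp: T_def)
      then have "a * b = (s * t) * var h ^ (N + K)" by (simp add: power_add mult_ac)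
      then show "a * b \<in> T" unfolding T_def using nirr[OF *(3,4)] by blast
    qed
    then obtain Q where Q: "is_prime Q" "I \<subseteq> Q" "Q \<inter> T = {}" by blast
    have "a \<in> irr" if "a \<in> Q" for a
    proof (rule ccontr)
      assume "a \<notin> irr"
      then have "a \<in> T" unfolding T_def by (intro CollectI exI[of _ a] exI[of _ 0]) auto
      then show False using Q(3) that by auto
    qed
    moreover have "1 * var h ^ 1 \<in> T" unfolding T_def using one by blast
    then have "var h \<notin> Q" using Q(3) by auto
    moreover have "var h \<in> irr" by (simp add: mon_in_irr)
    ultimately have "Q \<subset> irr" by blast
    moreover from this have "prime_chain J Q (length us)" using Q us(2) J(1) unfolding I_def
      by (intro prime_chain_of_regular[where P = irr]) auto
    ultimately show False using prime_chain_extend[OF _ _ prime_irr J(2)] us(3) by blast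
  qed
  have "\<exists>N s. s \<notin> irr \<and> (\<forall>h\<in>H. s * var h ^ N \<in> I)" using H
  proof (induction H rule: finite_induct)
    case empty then show ?case using one by auto
  next
    case (insert h H)
    then obtain N s where s: "s \<notin> irr" "\<forall>h\<in>H. s * var h ^ N \<in> I" by auto
    obtain K t where t: "t \<notin> irr" "t * var h ^ K \<in> I" using nil by blast
    have "s * t * var g ^ (N + K) \<in> I" if g: "g \<in> insert h H" for g
    proof (cases "g = h")
      case True
      have "s * t * var g ^ (N + K) = (s * var h ^ N) * (t * var h ^ K)" using True by (simp add: power_add mult_ac)
      then show ?thesis using ideal_mult_left[OF I(1) t(2)] by simp
    next
      case False
      have "s * t * var g ^ (N + K) = (t * var g ^ K) * (s * var g ^ N)" by (simp add: power_add mult_ac)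
      then show ?thesis using ideal_mult_left[OF I(1)] s False g by auto
    qed
    then show ?case using nirr[OF s(1) t(1)] by blast
  qed
  then obtain N s where s: "s \<notin> irr" "\<And>h. h \<in> H \<Longrightarrow> s * var h ^ N \<in> I" by blast
  \<comment> \<open>A monomial on H of size at least B contains some variable with exponent at least
    N, so s sends all of \<open>size_ge B\<close> into I.\<close>
  define B where "B = card H * N + 1"
  have sB: "s * p \<in> I" if p: "p \<in> size_ge B" for p
  proof -
    have "s * mon m \<in> I" if m: "m \<in> keys p" for m
    proof (cases "set_mset m \<subseteq> H")
      case True
      moreover have "card H * N < size m" using p m by (auto simp: size_ge_def B_def)
      ultimately obtain h where h: "h \<in> H" "N \<le> count m h" using size_big_count[OF H] by blast
      have "s * mon m = mon (m - replicate_mset N h) * (s * var h ^ N)"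
        unfolding mon_split_replicate[OF h(2)] by (simp only: mult_ac)
      then show ?thesis using ideal_mult_left[OF I(1) s(2)[OF h(1)]] by simp
    next
      case False
      then obtain h where h: "h \<in># m" "h \<notin> H" by auto
      then have "mon m \<in> J" by (intro mon_in_ideal[OF J(1) out])
      then show ?thesis using I ideal_mult_left[OF I(1)] by auto
    qed
    then have "cst (coef p m) * (s * mon m) \<in> I" if "m \<in> keys p" for m using that ideal_mult_left[OF I(1)] by blast
    then have "(\<Sum>m\<in>keys p. cst (coef p m) * (s * mon m)) \<in> I" by (rule ideal_sum[OF I(1)])
    moreover have "(\<Sum>m\<in>keys p. cst (coef p m) * (s * mon m)) = s * (\<Sum>m\<in>keys p. term_of m (coef p m))"
      unfolding sum_distrib_left by (intro sum.cong refl) (metis term_eq mult.left_commute)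
    ultimately show ?thesis using poly_expand[of p] by simp
  qed
  \<comment> \<open>Normalizing the constant term of s to 1 puts t into \<open>irr\<close>. As s
    kills \<open>size_ge B\<close>, multiplication by t is the identity there modulo I, so such
    polynomials are congruent to elements of arbitrarily high order.\<close>
  define t where "t = 1 - cst (inverse (coef s {#})) * s"
  have "t \<in> irr" using s(1) by (simp add: t_def irr_def lookup_minus lookup_one coef_cst_mult)
  then have tK: "t ^ K \<in> size_ge K" for K using size_ge_power[of t 1 K] irr_size_ge[where 'h = 'h and 'k = 'k] by simp
  have red: "p - t ^ K * p \<in> I" if p: "p \<in> size_ge B" for p K
  proof (induction K)
    case 0 then show ?case by (simp add: ideal_zero[OF I(1)])
  next
    case (Suc K)
    have eq: "p - t ^ Suc K * p = (p - t ^ K * p) + (t ^ K * cst (inverse (coef s {#}))) * (s * p)"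
      by (simp add: t_def algebra_simps)
    show ?case unfolding eq by (intro ideal_add[OF I(1)] Suc ideal_mult_left[OF I(1) sB[OF p]])
  qed
  define G where "G = {m. set_mset m \<subseteq> H \<and> size m \<le> B}"
  have finG: "finite G" unfolding G_def by (rule card_monomials(1)[OF H])
  define VG where "VG = (mon ` G :: ('h, 'k) mpoly set)"
  have finVG: "finite VG" using finG by (simp add: VG_def)
  define W where "W = (\<Sum>h\<in>F. dg h)"
  \<comment> \<open>The constants are tied so that (L * W + 1)^e * card VG is at most L * (L + 1)^e,
    which is less than the number (L + 1)^D of exponent vectors on F, while n exceeds the weighted
    degree of every monomial on F with exponents at most L.\<close>
  define L where "L = (W + 1) ^ e * card VG"
  define n where "n = L * W + 1"
  \<comment> \<open>Modulo \<open>size_ge n\<close> the n-th power of each entry of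
    \<open>us\<close> is zero, so the finite spanning set modulo \<open>us\<close> lifts to one with
    at most n^e * card VG elements.\<close>
  define Jn where "Jn = ideal_plus J (size_ge n)"
  have Jn: "is_ideal Jn" "J \<subseteq> Jn" "size_ge n \<subseteq> Jn" using ideal_plus[OF J(1) ideal_size_ge] by (auto simp: Jn_def)
  have An: "is_ideal (adjoins Jn us)" "Jn \<subseteq> adjoins Jn us" using Jn by (auto simp: ideal_adjoins adjoins_subset)
  have IA: "I \<subseteq> adjoins Jn us" unfolding I_def
    using adjoins_mem[OF Jn(1), of _ us] by (intro adjoins_mono J Jn) auto
  have "p \<in> lspan VG (adjoins Jn us)" for p
  proof -
    have 1: "part (\<lambda>m. set_mset m \<subseteq> H \<and> size m \<le> B) p \<in> lspan VG (adjoins Jn us)"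
      unfolding part_def
    proof (rule lspan_sum[OF An(1)])
      fix m assume "m \<in> {m \<in> keys p. set_mset m \<subseteq> H \<and> size m \<le> B}"
      then have "mon m \<in> VG" by (auto simp: VG_def G_def)
      then have "cst (coef p m) * mon m \<in> lspan VG (adjoins Jn us)" by (rule lspan_base[OF An(1) finVG])
      then show "term_of m (coef p m) \<in> lspan VG (adjoins Jn us)" by (metis term_eq)
    qed
    define q where "q = part (\<lambda>m. \<not> (set_mset m \<subseteq> H \<and> size m \<le> B)) p"
    define q1 where "q1 = part (\<lambda>m. size m \<le> B) q"
    define q2 where "q2 = part (\<lambda>m. \<not> size m \<le> B) q"
    have "q1 \<in> J"
    proof (rule ideal_of_terms[OF J(1)])
      fix m assume "m \<in> keys q1"
      then have "\<not> set_mset m \<subseteq> H" by (auto simp: q1_def q_def keys_part)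
      then obtain h where h: "h \<in># m" "h \<notin> H" by auto
      then show "mon m \<in> J" by (intro mon_in_ideal[OF J(1) out])
    qed
    then have q1: "q1 \<in> adjoins Jn us" using Jn(2) An(2) by blast
    have q2B: "q2 \<in> size_ge B" by (auto simp: q2_def keys_part size_ge_def)
    have "t ^ n * q2 \<in> size_ge n" using ideal_mult_right[OF ideal_size_ge tK] .
    then have "t ^ n * q2 \<in> adjoins Jn us" using Jn(3) An(2) by blast
    moreover have "q2 - t ^ n * q2 \<in> adjoins Jn us" using red[OF q2B] IA by blast
    ultimately have "(q2 - t ^ n * q2) + t ^ n * q2 \<in> adjoins Jn us" using An(1) by (intro ideal_add)
    then have "q2 \<in> adjoins Jn us" by simp
    then have "q1 + q2 \<in> adjoins Jn us" using q1 An(1) by (intro ideal_add)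
    then have "q \<in> adjoins Jn us" unfolding q1_def q2_def by (simp only: part_split)
    then have "q \<in> lspan VG (adjoins Jn us)" by (rule lspan_ideal)
    then have "part (\<lambda>m. set_mset m \<subseteq> H \<and> size m \<le> B) p + q \<in> lspan VG (adjoins Jn us)" using 1 lspan_add[OF An(1)] by blast
    then show ?thesis unfolding q_def by (simp only: part_split)
  qed
  then have sp: "lspan VG (adjoins Jn us) = UNIV" by auto
  have "u ^ n \<in> Jn" if "u \<in> set us" for u
    using size_ge_power[of u 1 n] that us(1) irr_size_ge[where 'h = 'h and 'k = 'k] Jn(3) by auto
  then obtain V where V: "finite V" "card V \<le> n ^ e * card VG" "lspan V Jn = UNIV"
    using lspan_adjoins[OF Jn(1) finVG _ sp, of n] unfolding e_def by auto
  have finF: "finite F" using F H finite_subset by auto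
  define mk where "mk = (\<lambda>f. \<Sum>h\<in>F. replicate_mset (f h) h)"
  have count_mk: "count (mk f) g = (if g \<in> F then f g else 0)" for f g
    unfolding mk_def count_sum using finF by (simp add: sum.delta)
  define E where "E = PiE F (\<lambda>_. {..L})"
  have finE: "finite E" unfolding E_def using finF by (intro finite_PiE) auto
  have cE: "card E = (L + 1) ^ D" unfolding E_def using finF F by (simp add: card_PiE)
  have "\<forall>f. \<exists>c. mon (mk f) - (\<Sum>v\<in>V. cst (c v) * v) \<in> Jn" using V(3) by (auto simp: lspan_def)
  then obtain c where c: "\<And>f. mon (mk f) - (\<Sum>v\<in>V. cst (c f v) * v) \<in> Jn" by metis
  have "card V < card E"
  proof -
    have "card V \<le> (L * W + 1) ^ e * card VG" using V(2) by (simp add: n_def)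
    also have "\<dots> \<le> ((L + 1) * (W + 1)) ^ e * card VG" by (intro mult_right_mono power_mono) auto
    also have "\<dots> = L * (L + 1) ^ e" unfolding power_mult_distrib
      by (simp only: mult.assoc) (simp only: L_def mult_ac)
    also have "\<dots> < (L + 1) ^ Suc e" by simp
    also have "\<dots> \<le> (L + 1) ^ D" using e by (intro power_increasing) auto
    finally show ?thesis by (simp add: cE)
  qed
  then obtain a where a: "\<exists>f\<in>E. a f \<noteq> 0" "\<forall>v\<in>V. (\<Sum>f\<in>E. a f * c f v) = 0"
    using linear_dependence[OF V(1) finE, of c] by blast
  define p where "p = (\<Sum>f\<in>E. cst (a f) * mon (mk f))"
  have "(\<Sum>f\<in>E. cst (a f) * (mon (mk f) - (\<Sum>v\<in>V. cst (c f v) * v))) \<in> Jn"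
    using c by (intro ideal_sum[OF Jn(1)] ideal_mult_left[OF Jn(1)])
  also have "(\<Sum>f\<in>E. cst (a f) * (mon (mk f) - (\<Sum>v\<in>V. cst (c f v) * v))) = p - (\<Sum>f\<in>E. \<Sum>v\<in>V. cst (a f * c f v) * v)"
    unfolding p_def by (simp add: right_diff_distrib sum_subtractf sum_distrib_left cst_mult mult.assoc)
  also have "(\<Sum>f\<in>E. \<Sum>v\<in>V. cst (a f * c f v) * v) = (\<Sum>v\<in>V. \<Sum>f\<in>E. cst (a f * c f v) * v)" by (rule sum.swap)
  also have "\<dots> = (\<Sum>v\<in>V. cst (\<Sum>f\<in>E. a f * c f v) * v)"
  proof (rule sum.cong[OF refl])
    fix v
    have "cst (\<Sum>f\<in>E. a f * c f v) = (\<Sum>f\<in>E. cst (a f * c f v) :: ('h, 'k) mpoly)"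
      by (rule poly_mapping_eqI) (simp add: lookup_sum lookup_single when_def)
    then show "(\<Sum>f\<in>E. cst (a f * c f v) * v) = cst (\<Sum>f\<in>E. a f * c f v) * v" by (simp add: sum_distrib_right)
  qed
  also have "\<dots> = 0" using a(2) by simp
  finally have "p \<in> Jn" by simp
  then obtain j where j: "j \<in> J" "p - j \<in> size_ge n" by (auto simp: Jn_def ideal_plus_def)
  have keysp: "\<exists>f\<in>E. m = mk f" if "m \<in> keys p" for m
    using that unfolding p_def by (elim keys_sumE) (auto simp: coef_cst_mult in_keys_iff lookup_single when_def split: if_splits)
  have wtmk: "wt dg (mk f) < n" if "f \<in> E" for f
  proof -
    have "wt dg (mk f) = (\<Sum>h\<in>F. wt dg (replicate_mset (f h) h))"
      unfolding mk_def using finF by (induction F rule: finite_induct) auto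
    also have "\<dots> = (\<Sum>h\<in>F. f h * dg h)" by (simp add: wt_def)
    also have "\<dots> \<le> (\<Sum>h\<in>F. L * dg h)" using that by (intro sum_mono mult_right_mono) (auto simp: E_def PiE_def Pi_def)
    also have "\<dots> = L * W" by (simp add: W_def sum_distrib_left)
    finally show ?thesis by (simp add: n_def)
  qed
  \<comment> \<open>The weighted degree of p is below n, while p - j has only monomials of size,
    hence weight, at least n. So p is a sum of homogeneous components of j and lies in the
    homogeneous ideal J.\<close>
  have "p = part (\<lambda>m. wt dg m < n) j"
  proof (rule poly_mapping_eqI)
    fix m
    show "coef p m = coef (part (\<lambda>m. wt dg m < n) j) m"
    proof (cases "wt dg m < n")
      case True
      then have "size m < n" using size_le_wt[of m dg] dg by (auto simp: Suc_le_eq intro: le_less_trans)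
      then have "m \<notin> keys (p - j)" using j(2) by (auto simp: size_ge_def)
      then show ?thesis using True by (simp add: coef_part in_keys_iff lookup_minus)
    next
      case False
      then have "m \<notin> keys p" using keysp wtmk by blast
      then show ?thesis using False by (simp add: coef_part in_keys_iff)
    qed
  qed
  also have "\<dots> = (\<Sum>k<n. hpart dg k j)"
    by (rule poly_mapping_eqI) (auto simp: lookup_sum coef_part)
  also have "\<dots> \<in> J" using J(3) j(1) by (intro ideal_sum[OF J(1)]) (auto simp: homog_ideal_def)
  finally have "p \<in> J" .
  then have "p = 0"
  proof (rule indep)
    fix m assume "m \<in> keys p"
    then obtain f where "m = mk f" using keysp by auto
    then show "set_mset m \<subseteq> F" using count_mk[of f] by (auto simp: set_mset_def split: if_splits)
  qed
  obtain f0 where f0: "f0 \<in> E" "a f0 \<noteq> 0" using a(1) by auto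
  have "f = f0" if "f \<in> E" "mk f = mk f0" for f
  proof
    fix h show "f h = f0 h"
    proof (cases "h \<in> F")
      case True then show ?thesis using count_mk[of f h] count_mk[of f0 h] that(2) by simp
    next
      case False then show ?thesis using that(1) f0(1) by (simp add: E_def PiE_def extensional_def)
    qed
  qed
  then have "coef p (mk f0) = (\<Sum>f\<in>E. if f = f0 then a f0 else 0)"
    unfolding p_def lookup_sum coef_cst_mult lookup_single when_def by (intro sum.cong) auto
  then have "coef p (mk f0) = a f0" using finE f0 by simp
  then show False using \<open>p = 0\<close> f0 by simp
qed

lemma adjoin_var_support:
  assumes "h \<in> G"
  shows "adjoin (mideal {m. set_mset m \<subseteq> G}) (var h) = (mideal {m. set_mset m \<subseteq> G - {h}} :: ('h, 'k::field) mpoly set)"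
proof -
  have id: "is_ideal (mideal {m. set_mset m \<subseteq> K} :: ('h, 'k) mpoly set)" for K by (rule ideal_mideal) auto
  show ?thesis
  proof (intro equalityI adjoin_least[OF id] subsetI)
    fix p :: "('h, 'k) mpoly" assume p: "p \<in> mideal {m. set_mset m \<subseteq> G - {h}}"
    show "p \<in> adjoin (mideal {m. set_mset m \<subseteq> G}) (var h)"
    proof (rule ideal_of_terms[OF ideal_adjoin[OF id]])
      fix m assume "m \<in> keys p"
      then have m: "\<not> set_mset m \<subseteq> G - {h}" using p by (auto simp: mideal_def)
      show "(mon m :: ('h, 'k) mpoly) \<in> adjoin (mideal {m. set_mset m \<subseteq> G}) (var h)"
      proof (cases "set_mset m \<subseteq> G")
        case True
        then have "h \<in># m" using m by auto
        then show ?thesis by (rule mon_in_ideal[OF ideal_adjoin[OF id] adjoin_self[OF id]])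
      next
        case False
        then have "mon m \<in> mideal {m. set_mset m \<subseteq> G}" by (simp add: mon_in_mideal)
        then show ?thesis using adjoin_subset by blast
      qed
    qed
  qed (auto simp: mideal_def)
qed

text \<open>The quotient is the polynomial ring on F, whose variables form a regular sequence; that
  sequence produces the chain.\<close>

lemma prime_chain_face:
  assumes "finite F" shows "prime_chain (mideal {m. set_mset m \<subseteq> F} :: ('h, 'k::field) mpoly set) irr (card F)"
proof -
  obtain xs where xs: "set xs = F" "distinct xs" using assms finite_distinct_list by blast
  have id: "is_ideal (mideal {m. set_mset m \<subseteq> K} :: ('h, 'k) mpoly set)" for K by (rule ideal_mideal) auto
  have "reg_list {1} (mideal {m. set_mset m \<subseteq> G} :: ('h, 'k) mpoly set) (map var ys)" if "distinct ys" "set ys \<subseteq> G" for ys G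
    using that
  proof (induction ys arbitrary: G)
    case (Cons h ys)
    have "reg_list {1} (mideal {m. set_mset m \<subseteq> G - {h}} :: ('h, 'k) mpoly set) (map var ys)" using Cons by (intro Cons.IH) auto
    moreover have "regular_on {1} (mideal {m. set_mset m \<subseteq> G} :: ('h, 'k) mpoly set) (var h)"
      unfolding regular_on_def
    proof (intro allI impI)
      fix a :: "('h, 'k) mpoly" assume "a * var h \<in> mideal {m. set_mset m \<subseteq> G}"
      then have *: "coef (var h * a) m = 0" if "set_mset m \<subseteq> G" for m using that by (auto simp: mideal_coef mult.commute)
      have "coef a m = 0" if "set_mset m \<subseteq> G" for m
        using *[of "add_mset h m"] that Cons.prems by (simp add: coef_term_mult)
      then show "\<exists>s\<in>{1}. s * a \<in> mideal {m. set_mset m \<subseteq> G}" by (simp add: mideal_coef)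
    qed
    ultimately show ?case using adjoin_var_support[of h G, where 'k = 'k] Cons.prems by (simp del: mult_single)
  qed simp
  then have "reg_list {1} (mideal {m. set_mset m \<subseteq> F} :: ('h, 'k) mpoly set) (map var xs)" using xs by auto
  then have "reg_list (- irr) (mideal {m. set_mset m \<subseteq> F} :: ('h, 'k) mpoly set) (map var xs)"
    by (rule reg_list_mono[rotated]) (use is_primeD(2)[OF prime_irr] in auto)
  moreover have "mideal {m. set_mset m \<subseteq> F} \<subseteq> (irr :: ('h, 'k) mpoly set)" by (auto simp: mideal_coef irr_def)
  then have "adjoins (mideal {m. set_mset m \<subseteq> F}) (map var xs) \<subseteq> (irr :: ('h, 'k) mpoly set)"
    by (intro adjoins_least is_primeD(1)[OF prime_irr]) (auto simp: mon_in_irr)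
  ultimately have "prime_chain (mideal {m. set_mset m \<subseteq> F} :: ('h, 'k) mpoly set) irr (length (map (var :: 'h \<Rightarrow> ('h, 'k) mpoly) xs))"
    by (rule prime_chain_of_regular[OF id _ prime_irr _ order_refl])
  then show ?thesis using xs distinct_card by fastforce
qed

subsection \<open>Elementary symmetric parameters\<close>

definition esum :: "nat \<Rightarrow> 'h set \<Rightarrow> ('h, 'k::field) mpoly" where
  "esum j A = (\<Sum>F\<in>{F. F \<subseteq> A \<and> card F = j}. mon (mset_set F))"

lemma esum_0: "finite A \<Longrightarrow> esum 0 A = 1"
proof -
  assume "finite A"
  then have "{F. F \<subseteq> A \<and> card F = 0} = {{}}" by (auto simp: finite_subset)
  then show ?thesis by (simp add: esum_def)
qed

lemma esum_insert:
  assumes "finite A" "v \<notin> A"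
  shows "(esum (Suc j) (insert v A) :: ('h, 'k::field) mpoly) = esum (Suc j) A + var v * esum j A"
proof -
  let ?S = "{F. F \<subseteq> A \<and> card F = j}"
  have fin: "finite F" if "F \<subseteq> A" for F using that assms finite_subset by auto
  have "{F. F \<subseteq> insert v A \<and> card F = Suc j} = {F. F \<subseteq> A \<and> card F = Suc j} \<union> insert v ` ?S"
  proof (intro equalityI subsetI)
    fix F assume F: "F \<in> {F. F \<subseteq> insert v A \<and> card F = Suc j}"
    show "F \<in> {F. F \<subseteq> A \<and> card F = Suc j} \<union> insert v ` ?S"
    proof (cases "v \<in> F")
      case True
      then have "F = insert v (F - {v})" "F - {v} \<in> ?S" using F fin[of "F - {v}"] by auto
      then show ?thesis by blast
    qed (use F in auto)
  qed (use assms fin in \<open>auto simp: card_insert_if\<close>)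
  moreover have "(\<Sum>F\<in>insert v ` ?S. mon (mset_set F)) = (var v * esum j A :: ('h, 'k) mpoly)"
  proof -
    have "inj_on (insert v) ?S" using assms by (auto simp: inj_on_def)
    then have "(\<Sum>F\<in>insert v ` ?S. mon (mset_set F)) = (\<Sum>F\<in>?S. mon (mset_set (insert v F)) :: ('h, 'k) mpoly)"
      by (simp add: sum.reindex)
    also have "\<dots> = (\<Sum>F\<in>?S. var v * mon (mset_set F))"
    proof (rule sum.cong[OF refl])
      fix F assume "F \<in> ?S"
      then have "mset_set (insert v F) = {#v#} + mset_set F" using fin[of F] assms by (subst mset_set.insert) auto
      then show "mon (mset_set (insert v F)) = (var v * mon (mset_set F) :: ('h, 'k) mpoly)" by (simp only: mon_add)
    qed
    finally show ?thesis by (simp add: esum_def sum_distrib_left)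
  qed
  moreover have "{F. F \<subseteq> A \<and> card F = Suc j} \<inter> insert v ` ?S = {}" using assms by auto
  ultimately show ?thesis unfolding esum_def[of "Suc j"] using assms by (simp add: sum.union_disjoint)
qed

text \<open>By e_j(C) = e_j(C - v) + v e_(j-1)(C - v) the symmetric functions of C - v are congruent
  to the powers of - v, and the one of degree card C is zero.\<close>

lemma var_power_in_esum_ideal:
  assumes I: "is_ideal (I :: ('h, 'k::field) mpoly set)" and C: "finite C" "v \<in> C" and e: "\<And>j. 0 < j \<Longrightarrow> esum j C \<in> I"
  shows "var v ^ card C \<in> I"
proof -
  let ?A = "C - {v}"
  have ins: "insert v ?A = C" using C by auto
  have "esum j ?A - (- var v) ^ j \<in> I" for j
  proof (induction j)
    case 0 then show ?case using C by (simp add: esum_0 ideal_zero[OF I])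
  next
    case (Suc j)
    have "(esum (Suc j) ?A :: ('h, 'k) mpoly) = esum (Suc j) C - var v * esum j ?A" 
    proof -
      have "(esum (Suc j) C :: ('h, 'k) mpoly) = esum (Suc j) ?A + var v * esum j ?A" using esum_insert[of ?A v j] C unfolding ins by simp
      then show ?thesis by (simp add: algebra_simps)
    qed
    then have "(esum (Suc j) ?A :: ('h, 'k) mpoly) - (- var v) ^ Suc j = esum (Suc j) C - var v * (esum j ?A - (- var v) ^ j)"
      by (simp add: algebra_simps)
    then show ?case using ideal_diff[OF I e[of "Suc j"] ideal_mult_left[OF I Suc]] by simp
  qed
  from this[of "card C"] have "esum (card C) ?A - (- var v) ^ card C \<in> I" .
  moreover have "{F. F \<subseteq> ?A \<and> card F = card C} = {}"
    using C card_mono[of ?A] by (auto simp: card_gt_0_iff) (metis Diff_subset card_mono card_Diff1_less finite_Diff not_less)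
  then have "esum (card C) ?A = (0 :: ('h, 'k) mpoly)" unfolding esum_def by (simp only: sum.empty)
  ultimately have "- ((- var v) ^ card C) \<in> I" by simp
  then have "(-1) ^ card C * (- var v) ^ card C \<in> I" using ideal_mult_left[OF I, of "- ((- var v) ^ card C)" "- ((-1) ^ card C)"] by simp
  moreover have "(-1) ^ card C * (- var v) ^ card C = (var v :: ('h, 'k) mpoly) ^ card C"
    by (simp flip: power_mult_distrib)
  ultimately show ?thesis by simp
qed

lemma keys_esum: "m \<in> keys (esum j A) \<Longrightarrow> \<exists>F. F \<subseteq> A \<and> card F = j \<and> m = mset_set F"
  unfolding esum_def by (elim keys_sumE) (auto split: if_splits)

lemma homog_esum: assumes "finite A" shows "homog (\<lambda>_. 1) j (esum j A)"
  using keys_esum assms unfolding homog_def wt_one by (fastforce dest: finite_subset)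

subsection \<open>Finite generation of ideals\<close>

text \<open>Induction on the variables. A finite basis for the monomials with h deleted handles all
  large exponents of h; for each of the finitely many smaller exponents a separate basis is
  added.\<close>

lemma dickson:
  assumes "finite H" "\<And>m. m \<in> T \<Longrightarrow> set_mset m \<subseteq> H"
  shows "\<exists>T0. finite T0 \<and> T0 \<subseteq> T \<and> (\<forall>m\<in>T. \<exists>t\<in>T0. t \<subseteq># m)"
  using assms
proof (induction H arbitrary: T rule: finite_induct)
  case empty
  then have "T \<subseteq> {{#}}" by auto
  then show ?case by (intro exI[of _ T]) (auto intro: finite_subset)
next
  case (insert h H)
  define del where "del = (\<lambda>m. filter_mset (\<lambda>g. g \<noteq> h) m)"
  have split: "m = del m + replicate_mset (count m h) h" for m
    by (rule multiset_eqI) (auto simp: del_def)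
  have le: "a \<subseteq># b" if "del a \<subseteq># del b" "count a h \<le> count b h" for a b
    using that by (auto simp: subseteq_mset_def del_def) (metis)
  have delH: "set_mset (del m) \<subseteq> H" if "m \<in> T" for m using insert.prems[OF that] by (auto simp: del_def)
  have basis: "\<exists>T0. finite T0 \<and> T0 \<subseteq> S \<and> (\<forall>m\<in>S. \<exists>t\<in>T0. del t \<subseteq># del m)" if S: "S \<subseteq> T" for S
  proof -
    have "\<exists>D. finite D \<and> D \<subseteq> del ` S \<and> (\<forall>m\<in>del ` S. \<exists>t\<in>D. t \<subseteq># m)" using delH S by (intro insert.IH) auto
    then obtain D where D: "finite D" "D \<subseteq> del ` S" "\<forall>m\<in>del ` S. \<exists>t\<in>D. t \<subseteq># m" by blast
    obtain T0 where "T0 \<subseteq> S" "finite T0" "D = del ` T0" using finite_subset_image[OF D(1,2)] by blast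
    then show ?thesis using D(3) by (intro exI[of _ T0]) auto
  qed
  obtain T0 where T0: "finite T0" "T0 \<subseteq> T" "\<forall>m\<in>T. \<exists>t\<in>T0. del t \<subseteq># del m" using basis[of T] by auto
  \<comment> \<open>From exponent K on, no member of T0 is too large in h, so it divides as soon as
    the other variables allow it.\<close>
  define K where "K = (\<Sum>t\<in>T0. count t h)"
  have K: "count t h \<le> K" if "t \<in> T0" for t unfolding K_def using that T0(1) by (intro member_le_sum) auto
  have "\<forall>k. \<exists>S. finite S \<and> S \<subseteq> {m \<in> T. count m h = k} \<and> (\<forall>m\<in>{m \<in> T. count m h = k}. \<exists>t\<in>S. del t \<subseteq># del m)"
    by (intro allI basis) auto
  from choice[OF this] obtain S where S': "\<forall>k. finite (S k) \<and> S k \<subseteq> {m \<in> T. count m h = k} \<and>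
    (\<forall>m\<in>{m \<in> T. count m h = k}. \<exists>t\<in>S k. del t \<subseteq># del m)" by blast
  then have S: "\<And>k. finite (S k)" "\<And>k. S k \<subseteq> {m \<in> T. count m h = k}"
    "\<And>k. \<forall>m\<in>{m \<in> T. count m h = k}. \<exists>t\<in>S k. del t \<subseteq># del m" by simp_all
  have "\<exists>t\<in>T0 \<union> (\<Union>k<K. S k). t \<subseteq># m" if m: "m \<in> T" for m
  proof (cases "count m h < K")
    case True
    obtain t where t: "t \<in> S (count m h)" "del t \<subseteq># del m" using S(3) m by blast
    then have "count t h = count m h" using S(2) by auto
    then have "t \<subseteq># m" using le[OF t(2)] by simp
    then show ?thesis using t True by auto
  next
    case False
    obtain t where t: "t \<in> T0" "del t \<subseteq># del m" using T0(3) m by blast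
    then have "t \<subseteq># m" using le K False by (meson le_trans not_less)
    then show ?thesis using t by auto
  qed
  moreover have "(\<Union>k<K. S k) \<subseteq> T" using S(2) by blast
  moreover have "finite (T0 \<union> (\<Union>k<K. S k))" using T0(1) S(1) by blast
  ultimately show ?case using T0(2) by (metis Un_least)
qed

text \<open>Groebner bases: by Dickson's lemma finitely many leading monomials divide all the
  others, and division by the corresponding polynomials terminates because the order is
  well-founded. Monomials with a variable outside H already lie in J.\<close>

lemma ideals_finitely_generated:
  fixes J :: "('h, 'k::field) mpoly set"
  assumes H: "finite H" and J: "is_ideal J" and out: "\<And>h. h \<notin> H \<Longrightarrow> var h \<in> J"
    and I: "is_ideal I" "J \<subseteq> I"
  shows "\<exists>us. I = adjoins J us"
proof -
  obtain idx :: "'h \<Rightarrow> nat" where idx: "inj_on idx H" using finite_imp_inj_to_nat_seg[OF H] by auto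
  \<comment> \<open>The multiset extension of the order by \<open>idx\<close> serves as monomial
    order: well-founded, total on monomials on H and compatible with multiplication.\<close>
  define r where "r = mult (measure idx)"
  have tr: "trans (measure idx)" by (auto intro: transI)
  have irf: "irrefl_on A (measure idx)" for A by (auto simp: irrefl_on_def)
  have wf: "wf r" unfolding r_def by (rule wf_mult) simp
  have trr: "trans r" unfolding r_def by (rule trans_mult[OF tr])
  have tot: "a = b \<or> (a, b) \<in> r \<or> (b, a) \<in> r" if "set_mset a \<subseteq> H" "set_mset b \<subseteq> H" for a b
  proof -
    have "total_on H (measure idx)" using idx by (auto simp: total_on_def inj_on_def) (metis linorder_neqE_nat)
    then have "total_on {m. set_mset m \<subseteq> H} r" unfolding r_def by (intro total_on_mult[of H] tr) auto
    then show ?thesis using that by (auto simp: total_on_def)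
  qed
  have add: "(a + c, b + c) \<in> r" if "(a, b) \<in> r" for a b c using that mult_cancel[OF tr irf] by (auto simp: r_def)
  have mx: "\<exists>k\<in>K. \<forall>n\<in>K. n = k \<or> (n, k) \<in> r" if "finite K" "K \<noteq> {}" "\<forall>n\<in>K. set_mset n \<subseteq> H" for K
    using that
  proof (induction K rule: finite_ne_induct)
    case (insert a K)
    then obtain k where k: "k \<in> K" "\<forall>n\<in>K. n = k \<or> (n, k) \<in> r" by auto
    then have "a = k \<or> (a, k) \<in> r \<or> (k, a) \<in> r" using tot[of a k] insert.prems by auto
    then show ?case
    proof (elim disjE)
      assume "(k, a) \<in> r"
      then have "\<forall>n\<in>insert a K. n = a \<or> (n, a) \<in> r" 
        using k(2) \<open>(k, a) \<in> r\<close> by (metis insertE transD[OF trr])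
      then show ?thesis by blast
    qed (use k in auto)
  qed auto
  define top where "top = (\<lambda>(p :: ('h, 'k) mpoly) m. (\<forall>n\<in>keys p. set_mset n \<subseteq> H) \<and> coef p m = 1 \<and> (\<forall>n\<in>keys p. n = m \<or> (n, m) \<in> r))"
  define T where "T = {m. \<exists>p\<in>I. top p m}"
  have "\<exists>T0. finite T0 \<and> T0 \<subseteq> T \<and> (\<forall>m\<in>T. \<exists>t\<in>T0. t \<subseteq># m)"
  proof (rule dickson[OF H])
    fix m assume "m \<in> T"
    then obtain p where "top p m" by (auto simp: T_def)
    then have "m \<in> keys p" "\<forall>n\<in>keys p. set_mset n \<subseteq> H" by (auto simp: top_def in_keys_iff)
    then show "set_mset m \<subseteq> H" by blast
  qed
  then obtain T0 where T0: "finite T0" "T0 \<subseteq> T" "\<And>m. m \<in> T \<Longrightarrow> \<exists>t\<in>T0. t \<subseteq># m" by blast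
  have "\<forall>t\<in>T0. \<exists>p. p \<in> I \<and> top p t" using T0(2) by (auto simp: T_def)
  then obtain g where g: "\<And>t. t \<in> T0 \<Longrightarrow> g t \<in> I \<and> top (g t) t" by metis
  obtain ts where ts: "set ts = T0" using finite_list[OF T0(1)] by blast
  let ?us = "map g ts"
  have A: "is_ideal (adjoins J ?us)" "J \<subseteq> adjoins J ?us" using J by (auto simp: ideal_adjoins adjoins_subset)
  have main: "p \<in> adjoins J ?us" if "p \<in> I" "\<forall>n\<in>keys p. set_mset n \<subseteq> H" "\<forall>n\<in>keys p. n = m \<or> (n, m) \<in> r" for p m
    using wf that
  proof (induction m arbitrary: p rule: wf_induct_rule)
    case (less m)
    show ?case
    proof (cases "keys p = {}")
      case True then show ?thesis using ideal_zero[OF A(1)] by simp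
    next
      case False
      obtain k where k: "k \<in> keys p" "\<forall>n\<in>keys p. n = k \<or> (n, k) \<in> r"
        using mx[OF finite_keys False less.prems(2)] by blast
      define p1 where "p1 = cst (inverse (coef p k)) * p"
      have k0: "coef p k \<noteq> 0" using k(1) by (simp add: in_keys_iff)
      have kp1: "keys p1 = keys p" using k0 by (auto simp: p1_def in_keys_iff coef_cst_mult)
      have "p1 \<in> I" unfolding p1_def by (rule ideal_mult_left[OF I(1) less.prems(1)])
      moreover have "top p1 k" using k less.prems(2) k0 unfolding top_def kp1 by (simp add: p1_def coef_cst_mult)
      ultimately have "k \<in> T" by (auto simp: T_def)
      then obtain t where t: "t \<in> T0" "t \<subseteq># k" using T0(3) by blast
      define q where "q = p - cst (coef p k) * (mon (k - t) * g t)"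
      have gt: "g t \<in> I" "top (g t) t" using g[OF t(1)] by auto
      have kt: "k - t + t = k" using t(2) by simp
      have qI: "q \<in> I" unfolding q_def using gt less.prems(1) by (intro ideal_diff[OF I(1)] ideal_mult_left[OF I(1)])
      have keys2: "set_mset n \<subseteq> H \<and> (n = k \<or> (n, k) \<in> r)" if n: "n \<in> keys (mon (k - t) * g t)" for n
      proof -
        obtain b where b: "b \<in> keys (g t)" "n = (k - t) + b" using keys_mult[of "mon (k - t)" "g t"] n by auto
        have kH: "set_mset k \<subseteq> H" using k(1) less.prems(2) by auto
        have "set_mset (k - t) \<subseteq> H" using kH in_diffD by fastforce
        then have "set_mset n \<subseteq> H" using b gt(2) by (auto simp: top_def)
        moreover have "n = k \<or> (n, k) \<in> r"
          using b gt(2) kt add[of b t "k - t"] by (auto simp: top_def add.commute)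
        ultimately show ?thesis by blast
      qed
      have "k - (k - t) = t" using kt by (metis add_diff_cancel_left')
      then have ck: "coef q k = 0" using gt(2) t(2) by (simp add: q_def lookup_minus coef_cst_mult coef_term_mult top_def)
      have kq: "set_mset n \<subseteq> H \<and> (n, k) \<in> r" if "n \<in> keys q" for n
      proof -
        have "n \<in> keys p \<or> n \<in> keys (mon (k - t) * g t)"
          using that by (auto simp: q_def in_keys_iff lookup_minus coef_cst_mult)
        moreover have "n \<noteq> k" using that ck by (auto simp: in_keys_iff)
        ultimately show ?thesis using keys2 k less.prems(2) by blast
      qed
      have "q \<in> adjoins J ?us"
      proof (cases "keys q = {}")
        case True then show ?thesis using ideal_zero[OF A(1)] by simp
      next
        case False
        obtain k' where k': "k' \<in> keys q" "\<forall>n\<in>keys q. n = k' \<or> (n, k') \<in> r"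
          using mx[OF finite_keys False] kq by blast
        have "(k', m) \<in> r" using kq[OF k'(1)] k(1) less.prems(3) by (metis transD[OF trr])
        then show ?thesis using less.IH qI kq k'(2) by blast
      qed
      moreover have "cst (coef p k) * (mon (k - t) * g t) \<in> adjoins J ?us"
        using adjoins_mem[OF J, of "g t" ?us] t ts by (intro ideal_mult_left[OF A(1)]) auto
      ultimately have "q + cst (coef p k) * (mon (k - t) * g t) \<in> adjoins J ?us" using ideal_add[OF A(1)] by blast
      then show ?thesis by (simp add: q_def)
    qed
  qed
  have "p \<in> adjoins J ?us" if p: "p \<in> I" for p
  proof -
    let ?q = "part (\<lambda>m. set_mset m \<subseteq> H) p" and ?s = "part (\<lambda>m. \<not> set_mset m \<subseteq> H) p"
    have s: "?s \<in> J"
    proof (rule ideal_of_terms[OF J])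
      fix m assume "m \<in> keys ?s"
      then obtain h where h: "h \<in># m" "h \<notin> H" by (auto simp: keys_part)
      then show "mon m \<in> J" by (intro mon_in_ideal[OF J out])
    qed
    have eq: "?q + ?s = p" by (rule part_split)
    then have "?q = p - ?s" by (simp add: algebra_simps)
    then have q: "?q \<in> I" using ideal_diff[OF I(1) p] s I(2) by auto
    have "?q \<in> adjoins J ?us"
    proof (cases "keys ?q = {}")
      case True then show ?thesis using ideal_zero[OF A(1)] by simp
    next
      case False
      then obtain k where "\<forall>n\<in>keys ?q. n = k \<or> (n, k) \<in> r"
        using mx[OF finite_keys False] by (auto simp: keys_part)
      then show ?thesis using q by (intro main[of ?q k]) (auto simp: keys_part)
    qed
    then have "?q + ?s \<in> adjoins J ?us" using s A by (intro ideal_add[OF A(1)]) auto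
    then show ?thesis using eq by simp
  qed
  moreover have "adjoins J ?us \<subseteq> I" using I ts g by (intro adjoins_least) auto
  ultimately show ?thesis by blast
qed

section \<open>Multigraded analysis of the discrete algebra\<close>

lemma wt_repeat [simp]: "wt w (repeat_mset n m) = n * wt w m"
  by (induction n) auto

lemma wt_mset_set [simp]: "wt w (mset_set F) = (\<Sum>h\<in>F. w h)"
  by (simp add: wt_def sum_unfold_sum_mset)

lemma prod_var: "finite F \<Longrightarrow> (\<Prod>h\<in>F. var h) = (mon (mset_set F) :: ('h, 'k::field) mpoly)"
  by (induction F rule: finite_induct) (auto simp: mult_single)

lemma mon_power: "(mon m :: ('h, 'k::field) mpoly) ^ n = mon (repeat_mset n m)"
  by (induction n) (auto simp: mult_single)

lemma coef_ksgn_mult: "coef (ksgn idx h G * p) m = ksgn idx h G * coef (p :: ('h, 'k::field) mpoly) m"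
  by (cases "even (card {g \<in> G. idx g < idx h})") (simp_all add: ksgn_def)

text \<open>\<open>Phi\<close> is a cone with apex v and contraction with v its null homotopy:
  closure under inserting v makes the cocycle condition available at
  \<open>insert v F\<close>.\<close>

lemma kdiff_homotopy:
  assumes C: "finite C" "inj_on idx C" "v \<in> C" and Phi: "\<And>F. F \<in> Phi \<Longrightarrow> F \<subseteq> C" "\<And>F. F \<subseteq> C \<Longrightarrow> v \<notin> F \<Longrightarrow> insert v F \<in> Phi \<longleftrightarrow> F \<in> Phi"
    and g: "\<And>F. F \<notin> Phi \<Longrightarrow> g F = (0::'r::comm_ring_1)" "\<And>G. G \<in> Phi \<Longrightarrow> card G = Suc i \<Longrightarrow> kdiff idx t g G = 0"
    and F: "F \<in> Phi" "card F = i"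
  shows "kdiff idx t (contract idx v g) F = t v * g F"
proof -
  have fF: "finite F" "inj_on idx (insert v F)" 
    using Phi(1)[OF F(1)] C(3) by (auto intro: finite_subset[OF _ C(1)] simp del: inj_on_insert intro!: inj_on_subset[OF C(2)])
  have "contract idx v (kdiff idx t g) F = 0"
  proof (cases "v \<in> F")
    case False
    then have "insert v F \<in> Phi" using Phi F by auto
    then show ?thesis using g(2)[of "insert v F"] False fF(1) F(2) by (simp add: contract_def)
  qed (simp add: contract_def)
  then show ?thesis using kdiff_contract[OF fF, of t g] by simp
qed

text \<open>Membership in \<open>Std\<close> depends on the support only, so the quotient by the
  ideal it defines is the Stanley-Reisner ring of the complex of faces inside C.\<close>

locale srcomplex =
  fixes C :: "'h set" and idx :: "'h \<Rightarrow> nat" and Std :: "'h multiset set" and ktype :: "'k::field itself"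
  assumes finC: "finite C" and inj: "inj_on idx C"
    and StdC: "m \<in> Std \<Longrightarrow> set_mset m \<subseteq> C"
    and supp: "m \<in> Std \<Longrightarrow> set_mset n \<subseteq> set_mset m \<Longrightarrow> n \<in> Std"
begin

abbreviation vX :: "'h \<Rightarrow> ('h, 'k) mpoly" where "vX \<equiv> var"

sublocale koszul idx "vX" C by unfold_locales (rule finC, rule inj)

definition JS :: "('h, 'k) mpoly set" where "JS = mideal Std"

lemma ideal_JS: "is_ideal JS" unfolding JS_def
  by (rule ideal_mideal) (auto elim: supp)

text \<open>A monomial m of \<open>c F\<close> stands for m / x_F^n. Its multidegree, shifted by n
  in every variable of C to avoid negative entries, is \<open>m + mm n F\<close>; so
  \<open>mm n {}\<close> is multidegree 0, and an entry is positive if it exceeds n.\<close>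

definition mm :: "nat \<Rightarrow> 'h set \<Rightarrow> 'h multiset" where "mm n F = repeat_mset n (mset_set (C - F))"

definition comp :: "nat \<Rightarrow> 'h multiset \<Rightarrow> ('h set \<Rightarrow> ('h, 'k) mpoly) \<Rightarrow> 'h set \<Rightarrow> 'k" where
  "comp n \<mu> c F = (if mm n F \<subseteq># \<mu> then coef (c F) (\<mu> - mm n F) else 0)"

definition lift :: "nat \<Rightarrow> 'h multiset \<Rightarrow> ('h set \<Rightarrow> 'k) \<Rightarrow> 'h set \<Rightarrow> ('h, 'k) mpoly" where
  "lift n \<mu> g F = (if mm n F \<subseteq># \<mu> then term_of (\<mu> - mm n F) (g F) else 0)"

text \<open>The sets F at which the Koszul complex of the Stanley-Reisner ring at exponent n is
  nonzero in multidegree \<open>\<mu>\<close>.\<close>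

definition Phi :: "nat \<Rightarrow> 'h multiset \<Rightarrow> 'h set set" where
  "Phi n \<mu> = {F. F \<subseteq> C \<and> mm n F \<subseteq># \<mu> \<and> \<mu> - mm n F \<in> Std}"

abbreviation sd :: "('h set \<Rightarrow> 'k) \<Rightarrow> 'h set \<Rightarrow> 'k" where "sd g \<equiv> kdiff idx (\<lambda>_. 1) g"

lemma count_mm: "count (mm n F) h = (if h \<in> C - F then n else 0)"
  using finC by (simp add: mm_def count_mset_set')

lemma mm_remove: "G \<subseteq> C \<Longrightarrow> h \<in> G \<Longrightarrow> mm n (G - {h}) = mm n G + replicate_mset n h"
  by (rule multiset_eqI) (auto simp: count_mm)

text \<open>In a fixed multidegree the variables carry no information, and the Koszul differential
  becomes the simplicial coboundary \<open>sd\<close>.\<close>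

lemma coef_d:
  assumes G: "G \<subseteq> C"
  shows "coef (d n c G) m = sd (comp n (m + mm n G) c) G"
proof -
  have "coef (vX h ^ n * c (G - {h})) m = comp n (m + mm n G) c (G - {h})" if h: "h \<in> G" for h
  proof -
    have "replicate_mset n h \<subseteq># m \<longleftrightarrow> mm n (G - {h}) \<subseteq># m + mm n G"
      unfolding mm_remove[OF G h] by (simp add: add.commute)
    moreover have "m + mm n G - mm n (G - {h}) = m - replicate_mset n h" unfolding mm_remove[OF G h] by (simp add: add.commute)
    ultimately show ?thesis unfolding var_power coef_term_mult comp_def by simp
  qed
  then show ?thesis unfolding kdiff_def lookup_sum mult.assoc by (simp add: coef_ksgn_mult)
qed

lemma comp_lift: "comp n \<nu> (lift n \<mu> g) F = (if \<nu> = \<mu> \<and> mm n F \<subseteq># \<mu> then g F else 0)"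
proof -
  have "\<mu> - mm n F = \<nu> - mm n F \<longleftrightarrow> \<nu> = \<mu>" if "mm n F \<subseteq># \<mu>" "mm n F \<subseteq># \<nu>"
    using that by (metis subset_mset.diff_add)
  then show ?thesis by (auto simp: comp_def lift_def lookup_single when_def)
qed

lemma Phi_sub: "G \<in> Phi n \<mu> \<Longrightarrow> h \<in> G \<Longrightarrow> mm n (G - {h}) \<subseteq># \<mu> \<Longrightarrow> G - {h} \<in> Phi n \<mu>"
proof -
  assume G: "G \<in> Phi n \<mu>" and h: "h \<in> G" and s: "mm n (G - {h}) \<subseteq># \<mu>"
  have "mm n G \<subseteq># mm n (G - {h})" using mm_remove[of G h n] G h by (auto simp: Phi_def)
  then have "\<mu> - mm n (G - {h}) \<subseteq># \<mu> - mm n G" using s by (simp add: subseteq_mset_def diff_le_mono2)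
  then have "set_mset (\<mu> - mm n (G - {h})) \<subseteq> set_mset (\<mu> - mm n G)" by (rule set_mset_mono)
  then show ?thesis using G s supp by (auto simp: Phi_def)
qed

text \<open>\<open>comp\<close> may be nonzero at nonstandard monomials, which vanish modulo
  \<open>JS\<close>; discarding them makes the component supported on \<open>Phi\<close>.\<close>

definition trunc :: "nat \<Rightarrow> 'h multiset \<Rightarrow> ('h set \<Rightarrow> ('h, 'k) mpoly) \<Rightarrow> 'h set \<Rightarrow> 'k" where
  "trunc n \<mu> c F = (if F \<in> Phi n \<mu> then comp n \<mu> c F else 0)"

lemma sd_trunc: assumes G: "G \<in> Phi n \<mu>" shows "sd (trunc n \<mu> c) G = sd (comp n \<mu> c) G"
proof (rule kdiff_cong)
  fix h assume h: "h \<in> G"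
  show "trunc n \<mu> c (G - {h}) = comp n \<mu> c (G - {h})"
    using Phi_sub[OF G h] by (auto simp: trunc_def comp_def)
qed

lemma cocycle_trunc:
  assumes c: "cocycle JS i n c" and G: "G \<in> Phi n \<mu>" "card G = Suc i"
  shows "sd (trunc n \<mu> c) G = 0"
proof -
  have GC: "G \<subseteq> C" and m: "\<mu> - mm n G \<in> Std" "\<mu> - mm n G + mm n G = \<mu>" using G by (auto simp: Phi_def)
  have "d n c G \<in> JS" using c G GC by (auto simp: cocycle_def)
  then have "coef (d n c G) (\<mu> - mm n G) = 0" using m by (auto simp: JS_def mideal_coef)
  then show ?thesis using sd_trunc[OF G(1)] coef_d[OF GC, of n c "\<mu> - mm n G"] m by simp
qed

definition degs :: "nat \<Rightarrow> nat \<Rightarrow> ('h set \<Rightarrow> ('h, 'k) mpoly) \<Rightarrow> 'h multiset set" where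
  "degs i n c = {\<nu> + mm n F | \<nu> F. F \<subseteq> C \<and> card F = i \<and> \<nu> \<in> keys (c F) \<and> \<nu> \<in> Std}"

lemma finite_degs: "finite (degs i n c)"
proof -
  have "degs i n c \<subseteq> (\<Union>F\<in>{F. F \<subseteq> C \<and> card F = i}. (\<lambda>\<nu>. \<nu> + mm n F) ` keys (c F))" by (auto simp: degs_def)
  then show ?thesis by (rule finite_subset) (use finite_faces[of i] in auto)
qed

text \<open>Solving the coboundary equation in each of the finitely many multidegrees of c and
  adding the solutions solves it modulo \<open>JS\<close>.\<close>

lemma sum_lift_cong:
  assumes F: "F \<subseteq> C" "card F = i" and supp': "\<And>\<mu> F. F \<notin> Phi n \<mu> \<Longrightarrow> g \<mu> F = 0"
    and eq: "\<And>\<mu>. \<mu> \<in> degs i n c \<Longrightarrow> F \<in> Phi n \<mu> \<Longrightarrow> sd (g \<mu>) F = trunc n \<mu> c F"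
  shows "c F - d n (\<lambda>F. \<Sum>\<mu>\<in>degs i n c. lift n \<mu> (g \<mu>) F) F \<in> JS"
  unfolding JS_def mideal_coef
proof
  fix m assume m: "m \<in> Std"
  let ?\<mu> = "m + mm n F" and ?b = "\<lambda>F. \<Sum>\<mu>\<in>degs i n c. lift n \<mu> (g \<mu>) F"
  have P: "F \<in> Phi n ?\<mu>" using m F by (auto simp: Phi_def)
  have "comp n ?\<mu> ?b G = (if ?\<mu> \<in> degs i n c then g ?\<mu> G else 0)" for G
  proof -
    have "comp n ?\<mu> ?b G = (\<Sum>\<mu>\<in>degs i n c. comp n ?\<mu> (lift n \<mu> (g \<mu>)) G)" by (simp add: comp_def lookup_sum)
    also have "\<dots> = (\<Sum>\<mu>\<in>degs i n c. if \<mu> = ?\<mu> then (if mm n G \<subseteq># ?\<mu> then g ?\<mu> G else 0) else 0)"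
      by (intro sum.cong refl) (auto simp: comp_lift)
    also have "\<dots> = (if ?\<mu> \<in> degs i n c then (if mm n G \<subseteq># ?\<mu> then g ?\<mu> G else 0) else 0)"
      using finite_degs by simp
    also have "(if mm n G \<subseteq># ?\<mu> then g ?\<mu> G else 0) = g ?\<mu> G" using supp'[of G ?\<mu>] by (auto simp: Phi_def)
    finally show ?thesis .
  qed
  then have "coef (d n ?b F) m = (if ?\<mu> \<in> degs i n c then sd (g ?\<mu>) F else 0)"
    unfolding coef_d[OF F(1)] by (auto simp: kdiff_def)
  moreover have "trunc n ?\<mu> c F = coef (c F) m" using P by (simp add: trunc_def comp_def)
  moreover have "coef (c F) m = 0" if "?\<mu> \<notin> degs i n c"
    using that F m by (force simp: degs_def in_keys_iff)
  ultimately show "coef (c F - d n ?b F) m = 0" using eq[OF _ P] by (auto simp: lookup_minus)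
qed

text \<open>If the entry at v exceeds n, then v divides the remaining monomial whether or not it
  belongs to F, so inserting v changes neither its support nor its membership in
  \<open>Std\<close>.\<close>

lemma Phi_insert:
  assumes v: "v \<in> C" "n < count \<mu> v" and F: "F \<subseteq> C" "v \<notin> F"
  shows "insert v F \<in> Phi n \<mu> \<longleftrightarrow> F \<in> Phi n \<mu>"
proof -
  have s: "mm n (insert v F) \<subseteq># \<mu> \<longleftrightarrow> mm n F \<subseteq># \<mu>"
  proof -
    have "count (mm n (insert v F)) h \<le> count \<mu> h \<longleftrightarrow> count (mm n F) h \<le> count \<mu> h" for h
      using v by (cases "h = v") (auto simp: count_mm)
    then show ?thesis by (simp only: subseteq_mset_def)
  qed
  have "set_mset (\<mu> - mm n (insert v F)) = set_mset (\<mu> - mm n F)"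
  proof -
    have "count (mm n (insert v F)) h < count \<mu> h \<longleftrightarrow> count (mm n F) h < count \<mu> h" for h
      using v(2) by (cases "h = v") (auto simp: count_mm simp del: count_greater_zero_iff)
    then show ?thesis by (auto simp: in_diff_count)
  qed
  then have "\<mu> - mm n (insert v F) \<in> Std \<longleftrightarrow> \<mu> - mm n F \<in> Std" using supp by (metis order_refl)
  then show ?thesis using s v F by (auto simp: Phi_def)
qed

text \<open>A multidegree with a positive entry is a cone, hence acyclic. The monomials of b are
  controlled as well because the lifting argument has to know their weights.\<close>

lemma cocycle_positive:
  assumes c: "cocycle JS i n c" and pos: "\<And>\<mu>. \<mu> \<in> degs i n c \<Longrightarrow> \<exists>v\<in>C. n < count \<mu> v"
  shows "\<exists>b. (\<forall>F. F \<subseteq> C \<and> card F = i \<longrightarrow> c F - d n b F \<in> JS) \<and>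
    (\<forall>F. \<forall>\<kappa>\<in>keys (b F). \<kappa> \<in> Std \<and> \<kappa> + mm n F \<in> degs i n c)"
proof -
  obtain v where v: "\<And>\<mu>. \<mu> \<in> degs i n c \<Longrightarrow> v \<mu> \<in> C \<and> n < count \<mu> (v \<mu>)" using pos by metis
  define g where "g = (\<lambda>\<mu>. if \<mu> \<in> degs i n c then contract idx (v \<mu>) (trunc n \<mu> c) else (\<lambda>_. 0))"
  have t0: "F \<notin> Phi n \<mu> \<Longrightarrow> trunc n \<mu> c F = 0" for F \<mu> by (simp add: trunc_def)
  have g0: "g \<mu> F = 0" if "F \<notin> Phi n \<mu>" for \<mu> F
  proof (cases "\<mu> \<in> degs i n c \<and> v \<mu> \<notin> F \<and> insert (v \<mu>) F \<in> Phi n \<mu>")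
    case True
    then have "F \<subseteq> C" by (auto simp: Phi_def)
    then have "F \<in> Phi n \<mu>" using True v[of \<mu>] Phi_insert by blast
    then show ?thesis using that by blast
  next
    case False
    then show ?thesis using t0 by (auto simp: g_def contract_def)
  qed
  have gd: "sd (g \<mu>) F = trunc n \<mu> c F" if m: "\<mu> \<in> degs i n c" and F: "F \<in> Phi n \<mu>" "card F = i" for \<mu> F
  proof -
    have "sd (contract idx (v \<mu>) (trunc n \<mu> c)) F = 1 * trunc n \<mu> c F"
    proof (rule kdiff_homotopy[OF finC inj, where Phi = "Phi n \<mu>" and i = i])
      show "insert (v \<mu>) F \<in> Phi n \<mu> \<longleftrightarrow> F \<in> Phi n \<mu>" if "F \<subseteq> C" "v \<mu> \<notin> F" for F
        using Phi_insert v[OF m] that by blast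
    qed (use v[OF m] F t0 cocycle_trunc[OF c] in \<open>auto simp: Phi_def\<close>)
    then show ?thesis using m by (simp add: g_def)
  qed
  let ?b = "\<lambda>F. \<Sum>\<mu>\<in>degs i n c. lift n \<mu> (g \<mu>) F"
  have "c F - d n ?b F \<in> JS" if "F \<subseteq> C" "card F = i" for F
    using that g0 gd by (intro sum_lift_cong) auto
  moreover have "\<kappa> \<in> Std \<and> \<kappa> + mm n F \<in> degs i n c" if k: "\<kappa> \<in> keys (?b F)" for \<kappa> F
  proof -
    obtain \<mu> where mu: "\<mu> \<in> degs i n c" "\<kappa> \<in> keys (lift n \<mu> (g \<mu>) F)" using k by (rule keys_sumE)
    then have "mm n F \<subseteq># \<mu>" "\<kappa> = \<mu> - mm n F" "g \<mu> F \<noteq> 0" by (auto simp: lift_def split: if_splits)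
    then show ?thesis using g0[of F \<mu>] mu(1) by (auto simp: Phi_def)
  qed
  ultimately show ?thesis by (intro exI[of _ ?b]) blast
qed

lemma xp_eq: "F \<subseteq> C \<Longrightarrow> xp F ^ N = mon (repeat_mset N (mset_set F))"
  using finC by (simp add: prod_var finite_subset mon_power)

lemma repeat_mm: assumes "F \<subseteq> C" shows "repeat_mset N (mset_set F) + mm N F = mm N {}"
  using assms finC by (intro multiset_eqI) (auto simp: count_mm count_mset_set' finite_subset)

lemma raise_lift: assumes F: "F \<subseteq> C" shows "xp F ^ N * lift n \<mu> g F = lift (n + N) (\<mu> + mm N {}) g F"
proof -
  have s: "mm (n + N) F \<subseteq># \<mu> + mm N {} \<longleftrightarrow> mm n F \<subseteq># \<mu>"
  proof -
    have "mm (n + N) F = mm n F + mm N F" by (rule multiset_eqI) (auto simp: count_mm)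
    moreover have "\<mu> + mm N {} = (\<mu> + repeat_mset N (mset_set F)) + mm N F" using repeat_mm[OF F, of N] by (simp add: add.assoc)
    moreover have "count (mm n F) h \<le> count (\<mu> + repeat_mset N (mset_set F)) h \<longleftrightarrow> count (mm n F) h \<le> count \<mu> h" for h
      by (cases "h \<in> F") (auto simp: count_mm count_mset_set')
    then have "mm n F \<subseteq># \<mu> + repeat_mset N (mset_set F) \<longleftrightarrow> mm n F \<subseteq># \<mu>"
      by (simp only: subseteq_mset_def)
    ultimately show ?thesis by simp
  qed
  have "repeat_mset N (mset_set F) + (\<mu> - mm n F) = \<mu> + mm N {} - mm (n + N) F" if "mm n F \<subseteq># \<mu>"
  proof (rule multiset_eqI)
    fix h
    show "count (repeat_mset N (mset_set F) + (\<mu> - mm n F)) h = count (\<mu> + mm N {} - mm (n + N) F) h"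
      using that F finite_subset[OF F finC] by (auto simp: count_mm count_mset_set')
  qed
  then show ?thesis unfolding xp_eq[OF F] lift_def using s by (simp add: mult_single)
qed

lemma cocycle_lift:
  assumes "\<And>F. F \<notin> Phi n \<mu> \<Longrightarrow> g F = 0" "\<And>G. G \<in> Phi n \<mu> \<Longrightarrow> card G = Suc i \<Longrightarrow> sd g G = 0"
  shows "cocycle JS i n (lift n \<mu> g)"
  unfolding cocycle_def JS_def mideal_coef
proof (intro allI impI ballI)
  fix G m assume G: "G \<subseteq> C \<and> card G = Suc i" and m: "m \<in> Std"
  show "coef (d n (lift n \<mu> g) G) m = 0"
  proof (cases "m + mm n G = \<mu>")
    case True
    then have "G \<in> Phi n \<mu>" using G m by (auto simp: Phi_def)
    moreover have "comp n \<mu> (lift n \<mu> g) F = g F" for F using assms(1)[of F] by (auto simp: comp_lift Phi_def)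
    ultimately show ?thesis using assms(2) G True coef_d[of G n "lift n \<mu> g" m] by (simp add: kdiff_def)
  next
    case False
    then show ?thesis using G coef_d[of G n "lift n \<mu> g" m] by (simp add: comp_lift kdiff_def)
  qed
qed

text \<open>With a negative entry at v only sets containing v carry the component, and up to
  transition maps it is the variable v times a component whose entry at v is lowered by one. By W
  such multiples are trivial.\<close>

lemma trivial_negative:
  assumes W: "\<And>n c. cocycle JS i n c \<Longrightarrow> trivial {1} JS i n (\<lambda>F. vX v * c F)"
    and v: "v \<in> C" "count \<mu> v < n"
    and g: "\<And>F. F \<notin> Phi n \<mu> \<Longrightarrow> g F = 0" "\<And>G. G \<in> Phi n \<mu> \<Longrightarrow> card G = Suc i \<Longrightarrow> sd g G = 0"
  shows "trivial {1} JS i n (lift n \<mu> g)"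
proof -
  \<comment> \<open>Raising the exponents by 2 leaves room to take one factor v out of the
    multidegree.\<close>
  define \<mu>' where "\<mu>' = \<mu> + mm 2 {} - {#v#}"
  have cnt: "count \<mu>' h = count \<mu> h + (if h \<in> C then 2 else 0) - (if h = v then 1 else 0)" for h
    by (simp add: \<mu>'_def count_mm)
  have gv: "g F = 0" if "v \<notin> F" for F
  proof (rule ccontr)
    assume "g F \<noteq> 0"
    then have "mm n F \<subseteq># \<mu>" using g(1) by (auto simp: Phi_def)
    then have "count (mm n F) v \<le> count \<mu> v" by (rule mset_subset_eq_count)
    then show False using that v by (simp add: count_mm)
  qed
  have PP: "G \<in> Phi n \<mu>" if "G \<in> Phi (n + 2) \<mu>'" "v \<in> G" for G
  proof -
    have GC: "G \<subseteq> C" and s: "mm (n + 2) G \<subseteq># \<mu>'" and st: "\<mu>' - mm (n + 2) G \<in> Std" using that by (auto simp: Phi_def)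
    have "count (mm n G) h \<le> count \<mu> h" for h
      using mset_subset_eq_count[OF s, of h] that(2) by (auto simp: count_mm cnt split: if_splits)
    then have s': "mm n G \<subseteq># \<mu>" by (simp add: subseteq_mset_def)
    have "h \<in># \<mu>' - mm (n + 2) G" if "h \<in># \<mu> - mm n G" for h
    proof -
      have "count (mm n G) h < count \<mu> h" using that by (simp add: in_diff_count)
      then show ?thesis using GC \<open>v \<in> G\<close> by (auto simp: in_diff_count count_mm cnt split: if_splits)
    qed
    then have "set_mset (\<mu> - mm n G) \<subseteq> set_mset (\<mu>' - mm (n + 2) G)" by blast
    then show ?thesis using supp[OF st] s' GC by (auto simp: Phi_def)
  qed
  define g' where "g' = (\<lambda>F. if F \<in> Phi (n + 2) \<mu>' then g F else 0)"
  have "cocycle JS i (n + 2) (lift (n + 2) \<mu>' g')"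
  proof (rule cocycle_lift)
    fix G assume G: "G \<in> Phi (n + 2) \<mu>'" "card G = Suc i"
    have "sd g' G = sd g G"
    proof (rule kdiff_cong)
      fix h assume h: "h \<in> G"
      show "g' (G - {h}) = g (G - {h})"
      proof (cases "g (G - {h}) = 0")
        case False
        then have P: "G - {h} \<in> Phi n \<mu>" and "v \<in> G - {h}" using g(1) gv by blast+
        then have "mm n (G - {h}) \<subseteq># \<mu>" by (auto simp: Phi_def)
        then have "count (mm (n + 2) (G - {h})) a \<le> count \<mu>' a" for a
          using mset_subset_eq_count[of "mm n (G - {h})" \<mu> a] \<open>v \<in> G - {h}\<close> by (auto simp: count_mm cnt split: if_splits)
        then have "mm (n + 2) (G - {h}) \<subseteq># \<mu>'" by (simp add: subseteq_mset_def)
        then show ?thesis using Phi_sub[OF G(1) h] by (simp add: g'_def)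
      qed (simp add: g'_def)
    qed
    moreover have "sd g G = 0"
    proof (cases "v \<in> G")
      case True then show ?thesis using g(2) PP G by blast
    next
      case False then show ?thesis using gv by (simp add: kdiff_def)
    qed
    ultimately show "sd g' G = 0" by simp
  qed (simp add: g'_def)
  then have "trivial {1} JS i (n + 2) (\<lambda>F. vX v * lift (n + 2) \<mu>' g' F)" by (rule W)
  then have "trivial {1} JS i (n + 2) (\<lambda>F. xp F ^ 2 * lift n \<mu> g F)"
  proof (rule trivial_cong[OF ideal_JS])
    fix F assume F: "F \<subseteq> C"
    show "vX v * lift (n + 2) \<mu>' g' F - xp F ^ 2 * lift n \<mu> g F \<in> JS"
    proof (cases "g F = 0")
      case True then show ?thesis by (simp add: lift_def g'_def ideal_zero[OF ideal_JS])
    next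
      case False
      then have P: "F \<in> Phi n \<mu>" and vF: "v \<in> F" using g(1) gv by blast+
      have "mm n F \<subseteq># \<mu>" using P by (simp add: Phi_def)
      then have c1: "count (mm n F) h \<le> count \<mu> h" for h by (rule mset_subset_eq_count)
      have "count (mm (n + 2) F) h \<le> count \<mu>' h" for h using c1[of h] vF by (auto simp: count_mm cnt)
      then have s: "mm (n + 2) F \<subseteq># \<mu>'" by (simp add: subseteq_mset_def)
      have "count (mm (n + 2) F) h \<le> count (\<mu> + mm 2 {}) h" for h using c1[of h] by (auto simp: count_mm)
      then have s2: "mm (n + 2) F \<subseteq># \<mu> + mm 2 {}" unfolding subseteq_mset_def by blast
      have eq: "{#v#} + (\<mu>' - mm (n + 2) F) = \<mu> + mm 2 {} - mm (n + 2) F"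
      proof (rule multiset_eqI)
        fix h show "count ({#v#} + (\<mu>' - mm (n + 2) F)) h = count (\<mu> + mm 2 {} - mm (n + 2) F) h"
          using v vF by (auto simp: count_mm cnt)
      qed
      have "vX v * lift (n + 2) \<mu>' g' F - xp F ^ 2 * lift n \<mu> g F = term_of (\<mu> + mm 2 {} - mm (n + 2) F) (g' F) - term_of (\<mu> + mm 2 {} - mm (n + 2) F) (g F)"
        unfolding raise_lift[OF F] using s s2 eq by (simp add: lift_def mult_single)
      also have "\<dots> \<in> JS"
      proof (cases "F \<in> Phi (n + 2) \<mu>'")
        case True then show ?thesis by (simp add: g'_def ideal_zero[OF ideal_JS])
      next
        case False
        \<comment> \<open>Here \<open>g'\<close> was cut off to 0, but the monomial that carries g
          is nonstandard and vanishes modulo \<open>JS\<close>.\<close>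
        then have ns: "\<mu>' - mm (n + 2) F \<notin> Std" using s F by (auto simp: Phi_def)
        have "set_mset (\<mu>' - mm (n + 2) F) \<subseteq> set_mset (\<mu> + mm 2 {} - mm (n + 2) F)"
          using arg_cong[OF eq, of set_mset] by auto
        then have "\<mu> + mm 2 {} - mm (n + 2) F \<notin> Std" using ns supp by blast
        then show ?thesis by (auto simp: JS_def mideal_def g'_def keys_single dest!: subsetD[OF keys_diff] split: if_splits)
      qed
      finally show ?thesis .
    qed
  qed
  then show ?thesis by (rule trivial_shift)
qed

text \<open>In multidegree 0 the index set is the whole complex of faces; this is how its reduced
  simplicial cohomology enters.\<close>

lemma Phi_zero: "0 < n \<Longrightarrow> F \<in> Phi n (mm n {}) \<longleftrightarrow> F \<subseteq> C \<and> mset_set F \<in> Std"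
proof -
  assume n: "0 < n"
  have s: "mm n F \<subseteq># mm n {}" if "F \<subseteq> C" by (auto simp: subseteq_mset_def count_mm)
  have "set_mset (mm n {} - mm n F) = F" if "F \<subseteq> C"
    using n that by (auto simp: set_mset_def count_mm split: if_splits)
  moreover have "set_mset (mset_set F) = F" if "F \<subseteq> C" using finite_subset[OF that finC] by simp
  ultimately show ?thesis using supp s unfolding Phi_def by (smt (verit) mem_Collect_eq order_refl)
qed

text \<open>A cocycle is the sum of its multigraded pieces. A positive entry gives a cone, a
  negative one is handled by W, and what remains is multidegree 0, where Z applies.\<close>

lemma vanish_JS:
  assumes W: "\<And>n c v. v \<in> C \<Longrightarrow> cocycle JS i n c \<Longrightarrow> trivial {1} JS i n (\<lambda>F. vX v * c F)"
    and Z: "\<And>g. (\<And>F. \<not> (F \<subseteq> C \<and> mset_set F \<in> Std) \<Longrightarrow> g F = 0) \<Longrightarrow>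
      (\<And>G. G \<subseteq> C \<Longrightarrow> mset_set G \<in> Std \<Longrightarrow> card G = Suc i \<Longrightarrow> sd g G = 0) \<Longrightarrow>
      \<exists>b. \<forall>F. F \<subseteq> C \<and> mset_set F \<in> Std \<and> card F = i \<longrightarrow> sd b F = g F"
  shows "vanish {1} JS i"
proof -
  have pos: "trivial {1} JS i n c" if n: "0 < n" and c: "cocycle JS i n c" for n c
  proof -
    have t: "trivial {1} JS i n (lift n \<mu> (trunc n \<mu> c))" for \<mu>
    proof -
      have t0: "F \<notin> Phi n \<mu> \<Longrightarrow> trunc n \<mu> c F = 0" for F by (simp add: trunc_def)
      note t1 = cocycle_trunc[OF c]
      have cl: "cocycle JS i n (lift n \<mu> (trunc n \<mu> c))" by (rule cocycle_lift) (use t0 t1 in auto)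
      consider v where "v \<in> C" "n < count \<mu> v" | v where "v \<in> C" "count \<mu> v < n" | "\<And>v. v \<in> C \<Longrightarrow> count \<mu> v = n"
        by (meson linorder_neqE_nat)
      then show ?thesis
      proof cases
        case 1
        have "\<mu>' = \<mu>" if "\<mu>' \<in> degs i n (lift n \<mu> (trunc n \<mu> c))" for \<mu>'
          using that by (auto simp: degs_def lift_def split: if_splits)
        then obtain b where b: "\<forall>F. F \<subseteq> C \<and> card F = i \<longrightarrow> lift n \<mu> (trunc n \<mu> c) F - d n b F \<in> JS"
          using cocycle_positive[OF cl] 1 by blast
        show ?thesis by (rule trivialI[where s = 1 and N = 0 and b = b]) (use b in auto)
      next
        case 2
        show ?thesis by (rule trivial_negative[OF W[OF 2(1)] 2 t0 t1])
      next
        case 3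
        show ?thesis
        proof (cases "set_mset \<mu> \<subseteq> C")
          case True
          have mu: "\<mu> = mm n {}"
          proof (rule multiset_eqI)
            fix h show "count \<mu> h = count (mm n {}) h"
              using 3 True by (cases "h \<in> C") (auto simp: count_mm count_eq_zero_iff)
          qed
          obtain b where b: "\<forall>F. F \<subseteq> C \<and> mset_set F \<in> Std \<and> card F = i \<longrightarrow> sd b F = trunc n \<mu> c F"
          proof -
            have "\<exists>b. \<forall>F. F \<subseteq> C \<and> mset_set F \<in> Std \<and> card F = i \<longrightarrow> sd b F = trunc n \<mu> c F"
            proof (rule Z)
              show "trunc n \<mu> c F = 0" if "\<not> (F \<subseteq> C \<and> mset_set F \<in> Std)" for F
                using that t0 Phi_zero[OF n] by (auto simp: mu)
              show "sd (trunc n \<mu> c) G = 0" if "G \<subseteq> C" "mset_set G \<in> Std" "card G = Suc i" for G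
                using that t1[of G \<mu>] Phi_zero[OF n] by (auto simp: mu)
            qed
            then show ?thesis using that by blast
          qed
          show ?thesis
          proof (rule trivialI[where s = 1 and N = 0 and b = "lift n \<mu> b"])
            fix F assume F: "F \<subseteq> C" "card F = i"
            have "coef (lift n \<mu> (trunc n \<mu> c) F - d n (lift n \<mu> b) F) m = 0" if m: "m \<in> Std" for m
            proof (cases "m + mm n F = \<mu>")
              case True
              then have P: "F \<in> Phi n \<mu>" using F m by (auto simp: Phi_def)
              have "mm n G \<subseteq># \<mu>" for G by (auto simp: mu subseteq_mset_def count_mm)
              then have "comp n \<mu> (lift n \<mu> b) = b" by (auto simp: comp_lift)
              then have "coef (d n (lift n \<mu> b) F) m = sd b F" using coef_d[OF F(1), of n "lift n \<mu> b" m] True by simp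
              moreover have "sd b F = trunc n \<mu> c F" using b F P Phi_zero[OF n, of F] by (auto simp: mu)
              moreover have "coef (lift n \<mu> (trunc n \<mu> c) F) m = trunc n \<mu> c F" using True by (auto simp: lift_def)
              ultimately show ?thesis by (simp add: lookup_minus)
            next
              case False
              then have "coef (d n (lift n \<mu> b) F) m = 0" using coef_d[OF F(1), of n "lift n \<mu> b" m]
                by (simp add: comp_lift kdiff_def)
              moreover have "coef (lift n \<mu> (trunc n \<mu> c) F) m = 0" using False by (auto simp: lift_def lookup_single when_def)
              ultimately show ?thesis by (simp add: lookup_minus)
            qed
            then show "1 * (xp F ^ 0 * lift n \<mu> (trunc n \<mu> c) F) - d (n + 0) (lift n \<mu> b) F \<in> JS"
              by (simp add: JS_def mideal_coef)
          qed simp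
        next
          case False
          \<comment> \<open>On C the entries are those of multidegree 0, but a variable outside C
            occurs, so no set carries this multidegree.\<close>
          have "trunc n \<mu> c F = 0" for F
          proof (rule t0, rule notI)
            assume "F \<in> Phi n \<mu>"
            then have "set_mset (\<mu> - mm n F) \<subseteq> C" "mm n F \<subseteq># \<mu>" using StdC by (auto simp: Phi_def)
            moreover have "set_mset (mm n F) \<subseteq> C" by (auto simp: set_mset_def count_mm split: if_splits)
            ultimately have "set_mset (\<mu> - mm n F + mm n F) \<subseteq> C" by (simp only: set_mset_union) blast
            then show False using False \<open>mm n F \<subseteq># \<mu>\<close> by simp
          qed
          then have "lift n \<mu> (trunc n \<mu> c) = (\<lambda>_. 0)" by (auto simp: lift_def)
          then show ?thesis using trivial_zero[OF ideal_JS, of "{1}"] by simp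
        qed
      qed
    qed
    have "trivial {1} JS i n (\<lambda>F. \<Sum>\<mu>\<in>degs i n c. lift n \<mu> (trunc n \<mu> c) F)"
      by (rule trivial_sum[OF ideal_JS]) (use finite_degs t in auto)
    then show ?thesis
    proof (rule trivial_cong[OF ideal_JS])
      fix F assume F: "F \<subseteq> C" "card F = i"
      show "(\<Sum>\<mu>\<in>degs i n c. lift n \<mu> (trunc n \<mu> c) F) - c F \<in> JS" unfolding JS_def mideal_coef
      proof
        fix m assume m: "m \<in> Std"
        let ?\<mu> = "m + mm n F"
        have P: "F \<in> Phi n ?\<mu>" using m F by (auto simp: Phi_def)
        have "coef (lift n \<mu> (trunc n \<mu> c) F) m = (if \<mu> = ?\<mu> then trunc n ?\<mu> c F else 0)" for \<mu>
          by (auto simp: lift_def lookup_single when_def)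
        then have "coef (\<Sum>\<mu>\<in>degs i n c. lift n \<mu> (trunc n \<mu> c) F) m = (if ?\<mu> \<in> degs i n c then trunc n ?\<mu> c F else 0)"
          unfolding lookup_sum using finite_degs by simp
        moreover have "trunc n ?\<mu> c F = coef (c F) m" using P by (simp add: trunc_def comp_def)
        moreover have "coef (c F) m = 0" if "?\<mu> \<notin> degs i n c" using that F m by (force simp: degs_def in_keys_iff)
        ultimately show "coef ((\<Sum>\<mu>\<in>degs i n c. lift n \<mu> (trunc n \<mu> c) F) - c F) m = 0" by (auto simp: lookup_minus)
      qed
    qed
  qed
  show ?thesis unfolding vanish_def
  proof (intro allI impI)
    fix n c assume c: "cocycle JS i n c"
    \<comment> \<open>A class at exponent 0 is first raised to exponent 1, so that the case of
      positive exponents covers it.\<close>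
    have "cocycle JS i (n + 1) (\<lambda>F. xp F ^ 1 * c F)" unfolding cocycle_def
    proof (intro allI impI)
      fix G assume G: "G \<subseteq> C \<and> card G = Suc i"
      have "d (n + 1) (\<lambda>F. xp F ^ 1 * c F) G = xp G ^ 1 * d n c G"
        by (rule kdiff_raise) (use G finC finite_subset in auto)
      then show "d (n + 1) (\<lambda>F. xp F ^ 1 * c F) G \<in> JS" using c G ideal_mult_left[OF ideal_JS] by (simp add: cocycle_def)
    qed
    then have "trivial {1} JS i (n + 1) (\<lambda>F. xp F ^ 1 * c F)" by (intro pos) auto
    then show "trivial {1} JS i n c" by (rule trivial_shift)
  qed
qed

end

section \<open>Lifting cocycles along the weight filtration\<close>

text \<open>\<open>J1\<close> defines the algebra with straightening, \<open>JS\<close> its discrete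
  counterpart. Rewriting a nonstandard monomial keeps the degree \<open>dg\<close> and raises the
  weight \<open>ww\<close>; as \<open>ww\<close> is bounded by \<open>Wb\<close>, only finitely many
  weights occur in each degree.\<close>

locale straightening = srcomplex C idx Std ktype
  for C :: "'h set" and idx :: "'h \<Rightarrow> nat" and Std :: "'h multiset set" and ktype :: "'k::field itself" +
  fixes J1 :: "('h, 'k) mpoly set" and dg ww :: "'h \<Rightarrow> nat" and Wb :: nat
  assumes J1: "is_ideal J1" and homJ: "homog_ideal dg J1" and dgpos: "0 < dg h" and wwb: "ww h \<le> Wb"
    and basis: "p \<in> J1 \<Longrightarrow> keys p \<subseteq> Std \<Longrightarrow> p = 0"
    and straighten: "\<nu> \<notin> Std \<Longrightarrow> \<exists>q. mon \<nu> - q \<in> J1 \<and> (\<forall>\<kappa>\<in>keys q. wt dg \<kappa> = wt dg \<nu> \<and> wt ww \<nu> < wt ww \<kappa>)"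
begin

lemma wt_bound: "wt ww m \<le> Wb * wt dg m"
proof (induction m)
  case (add h m)
  have "ww h \<le> Wb * dg h" using wwb[of h] dgpos[of h] by (metis One_nat_def Suc_leI mult.right_neutral mult_le_mono2 order_trans)
  then show ?case using add by (simp add: distrib_left)
qed simp

text \<open>A normal form with a record of weights: they never drop, and they rise strictly for
  whatever comes from a nonstandard monomial.\<close>

definition reduces :: "('h, 'k) mpoly \<Rightarrow> ('h, 'k) mpoly \<Rightarrow> bool" where
  "reduces p q \<longleftrightarrow> p - q \<in> J1 \<and> keys q \<subseteq> Std \<and>
    (\<forall>\<kappa>\<in>keys q. \<exists>\<nu>\<in>keys p. wt dg \<kappa> = wt dg \<nu> \<and> wt ww \<nu> \<le> wt ww \<kappa> \<and> (\<nu> \<notin> Std \<longrightarrow> wt ww \<nu> < wt ww \<kappa>))"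

lemma reduces_sum:
  assumes r: "\<And>\<nu>. \<nu> \<in> keys p \<Longrightarrow> reduces (mon \<nu>) (r \<nu>)" shows "reduces p (\<Sum>\<nu>\<in>keys p. cst (coef p \<nu>) * r \<nu>)"
  unfolding reduces_def
proof (intro conjI ballI subsetI)
  have "(\<Sum>\<nu>\<in>keys p. cst (coef p \<nu>) * (mon \<nu> - r \<nu>)) \<in> J1"
    using r by (intro ideal_sum[OF J1] ideal_mult_left[OF J1]) (auto simp: reduces_def)
  also have "(\<Sum>\<nu>\<in>keys p. cst (coef p \<nu>) * (mon \<nu> - r \<nu>)) = (\<Sum>\<nu>\<in>keys p. term_of \<nu> (coef p \<nu>)) - (\<Sum>\<nu>\<in>keys p. cst (coef p \<nu>) * r \<nu>)"
    by (simp add: right_diff_distrib sum_subtractf mult_single)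
  finally show "p - (\<Sum>\<nu>\<in>keys p. cst (coef p \<nu>) * r \<nu>) \<in> J1" using poly_expand[of p] by simp
next
  fix \<kappa> assume "\<kappa> \<in> keys (\<Sum>\<nu>\<in>keys p. cst (coef p \<nu>) * r \<nu>)"
  then obtain \<nu> where n: "\<nu> \<in> keys p" "\<kappa> \<in> keys (cst (coef p \<nu>) * r \<nu>)" by (rule keys_sumE)
  then have k: "\<kappa> \<in> keys (r \<nu>)" by (auto simp: in_keys_iff coef_cst_mult)
  show "\<kappa> \<in> Std" using r[OF n(1)] k by (auto simp: reduces_def)
  show "\<exists>\<nu>\<in>keys p. wt dg \<kappa> = wt dg \<nu> \<and> wt ww \<nu> \<le> wt ww \<kappa> \<and> (\<nu> \<notin> Std \<longrightarrow> wt ww \<nu> < wt ww \<kappa>)"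
    using r[OF n(1)] k n(1) by (auto simp: reduces_def)
qed

text \<open>Rewriting terminates because the weight rises strictly but is bounded by Wb times the
  degree, which stays fixed.\<close>

lemma reduces_mon: "\<exists>q. reduces (mon \<nu>) q"
proof (induction "Wb * wt dg \<nu> - wt ww \<nu>" arbitrary: \<nu> rule: less_induct)
  case less
  show ?case
  proof (cases "\<nu> \<in> Std")
    case True
    then show ?thesis by (intro exI[of _ "mon \<nu>"]) (auto simp: reduces_def ideal_zero[OF J1])
  next
    case False
    obtain q where q: "mon \<nu> - q \<in> J1" "\<And>\<kappa>. \<kappa> \<in> keys q \<Longrightarrow> wt dg \<kappa> = wt dg \<nu> \<and> wt ww \<nu> < wt ww \<kappa>"
      using straighten[OF False] by blast
    have "\<exists>r. reduces (mon \<kappa>) r" if k: "\<kappa> \<in> keys q" for \<kappa>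
    proof (rule less)
      show "Wb * wt dg \<kappa> - wt ww \<kappa> < Wb * wt dg \<nu> - wt ww \<nu>" using q(2)[OF k] wt_bound[of \<kappa>] by auto
    qed
    then obtain r where r: "\<And>\<kappa>. \<kappa> \<in> keys q \<Longrightarrow> reduces (mon \<kappa>) (r \<kappa>)" by metis
    define s where "s = (\<Sum>\<kappa>\<in>keys q. cst (coef q \<kappa>) * r \<kappa>)"
    have s: "reduces q s" unfolding s_def by (rule reduces_sum[OF r])
    have "mon \<nu> - s \<in> J1" using ideal_trans[OF J1 q(1)] s by (auto simp: reduces_def)
    moreover have "wt dg \<kappa> = wt dg \<nu> \<and> wt ww \<nu> < wt ww \<kappa>" if "\<kappa> \<in> keys s" for \<kappa>
      using s that q(2) by (fastforce simp: reduces_def)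
    ultimately have "reduces (mon \<nu>) s" using s by (auto simp: reduces_def less_imp_le)
    then show ?thesis by blast
  qed
qed

lemma reduces_ex: "\<exists>q. reduces p q"
proof -
  obtain r where "\<And>\<nu>. reduces (mon \<nu>) (r \<nu>)" using reduces_mon by metis
  then show ?thesis using reduces_sum[of p r] by blast
qed

lemma keys_addD: "\<kappa> \<in> keys (p + q :: ('h, 'k) mpoly) \<Longrightarrow> \<kappa> \<in> keys p \<or> \<kappa> \<in> keys q"
  using keys_add[of p q] by blast

text \<open>Lowest weight forms of \<open>J1\<close> lie in the discrete ideal. Bringing the
  nonstandard part of r0 and all of r1 to normal form produces only higher weights, so the standard
  part of r0 is the lowest part of a standard element of \<open>J1\<close>, which is 0.\<close>

lemma leading_part:
  assumes r: "r0 + r1 \<in> J1" and r0: "\<And>\<kappa>. \<kappa> \<in> keys r0 \<Longrightarrow> wt ww \<kappa> = w0" and r1: "\<And>\<kappa>. \<kappa> \<in> keys r1 \<Longrightarrow> w0 < wt ww \<kappa>"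
  shows "r0 \<in> JS"
proof -
  let ?s = "part (\<lambda>m. m \<in> Std) r0" and ?t = "part (\<lambda>m. \<not> m \<in> Std) r0"
  have st: "?s + ?t = r0" by (rule part_split)
  obtain q where q: "reduces (?t + r1) q" using reduces_ex by blast
  have kq: "w0 < wt ww \<kappa>" if k: "\<kappa> \<in> keys q" for \<kappa>
  proof -
    obtain \<nu> where n: "\<nu> \<in> keys (?t + r1)" "wt ww \<nu> \<le> wt ww \<kappa>" "\<nu> \<notin> Std \<longrightarrow> wt ww \<nu> < wt ww \<kappa>"
      using q k by (auto simp: reduces_def)
    then consider "\<nu> \<in> keys ?t" | "\<nu> \<in> keys r1" using keys_add[of ?t r1] by auto
    then show ?thesis
    proof cases
      case 1 then show ?thesis using n r0[of \<nu>] by (auto simp: keys_part)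
    next
      case 2 then show ?thesis using n r1[of \<nu>] by auto
    qed
  qed
  have "(?t + r1) - q \<in> J1" using q by (simp add: reduces_def)
  then have "(r0 + r1) - ((?t + r1) - q) \<in> J1" by (rule ideal_diff[OF J1 r])
  also have "(r0 + r1) - ((?t + r1) - q) = (?s + ?t) - ?t + q" by (simp add: st algebra_simps)
  finally have "?s + q \<in> J1" by simp
  moreover have "keys (?s + q) \<subseteq> Std" using keys_add[of ?s q] q by (auto simp: keys_part reduces_def)
  ultimately have z: "?s + q = 0" by (rule basis)
  have "coef r0 m = 0" if m: "m \<in> Std" for m
  proof (rule ccontr)
    assume "coef r0 m \<noteq> 0"
    then have "wt ww m = w0" using r0[of m] by (simp add: in_keys_iff)
    then have "m \<notin> keys q" using kq[of m] by auto
    moreover have "coef ?s m + coef q m = 0" using arg_cong[OF z, of "\<lambda>p. coef p m"] by (simp add: lookup_add)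
    ultimately show False using \<open>coef r0 m \<noteq> 0\<close> m by (simp add: coef_part in_keys_iff)
  qed
  then show ?thesis by (simp add: JS_def mideal_coef)
qed

lemma leading_level:
  assumes r: "r0 + r1 \<in> J1" and r0: "\<And>\<kappa>. \<kappa> \<in> keys r0 \<Longrightarrow> wt ww (\<kappa> + m) = p"
    and r1: "\<And>\<kappa>. \<kappa> \<in> keys r1 \<Longrightarrow> p < wt ww (\<kappa> + m)"
  shows "r0 \<in> JS"
proof (cases "wt ww m \<le> p")
  case True
  have "wt ww \<kappa> = p - wt ww m" if "\<kappa> \<in> keys r0" for \<kappa> using r0[OF that] by simp
  moreover have "p - wt ww m < wt ww \<kappa>" if "\<kappa> \<in> keys r1" for \<kappa> using r1[OF that] True by simp
  ultimately show ?thesis by (rule leading_part[OF r])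
next
  case False
  then have "keys r0 = {}" using r0 by fastforce
  then show ?thesis by (simp add: JS_def mideal_def)
qed

text \<open>n * Dg and n * Wg are the degree and the weight of \<open>mm n {}\<close>, that is, of
  multidegree 0.\<close>

abbreviation "Dg \<equiv> (\<Sum>h\<in>C. dg h)"
abbreviation "Wg \<equiv> (\<Sum>h\<in>C. ww h)"

lemma wt_mm: "F \<subseteq> C \<Longrightarrow> wt w (mm n F) = n * (\<Sum>h\<in>C - F. w h)"
  by (simp add: mm_def)

lemma keys_d:
  assumes G: "G \<subseteq> C" and k: "\<kappa> \<in> keys (d n c G)"
  obtains h \<nu> where "h \<in> G" "\<nu> \<in> keys (c (G - {h}))" "\<kappa> + mm n G = \<nu> + mm n (G - {h})"
proof -
  have "sd (comp n (\<kappa> + mm n G) c) G \<noteq> 0" using k coef_d[OF G, of n c \<kappa>] by (simp add: in_keys_iff)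
  then obtain h where h: "h \<in> G" "comp n (\<kappa> + mm n G) c (G - {h}) \<noteq> 0" unfolding kdiff_def
    by (metis (no_types, lifting) mult_zero_right sum.neutral)
  let ?\<nu> = "\<kappa> + mm n G - mm n (G - {h})"
  have "?\<nu> \<in> keys (c (G - {h}))" "mm n (G - {h}) \<subseteq># \<kappa> + mm n G" using h(2) by (auto simp: comp_def in_keys_iff split: if_splits)
  then show ?thesis using that[of h ?\<nu>] h(1) by simp
qed

text \<open>A shifted multidegree without positive entry divides \<open>mm n {}\<close>; being of
  the same degree it is equal to it, since all variables have positive degree. The condition on the
  weight excludes this.\<close>

lemma degree_positive:
  assumes n: "\<nu> \<in> Std" "F \<subseteq> C" and dg: "wt dg (\<nu> + mm n F) = n * Dg" and ne: "wt ww (\<nu> + mm n F) \<noteq> n * Wg"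
  shows "\<exists>v\<in>C. n < count (\<nu> + mm n F) v"
proof (rule ccontr)
  assume a: "\<not> ?thesis"
  let ?\<mu> = "\<nu> + mm n F"
  have "count ?\<mu> h \<le> count (mm n {}) h" for h
  proof (cases "h \<in> C")
    case True then show ?thesis using a by (auto simp: count_mm not_less)
  next
    case False
    then have "h \<notin># \<nu>" using StdC[OF n(1)] by auto
    then show ?thesis using False by (simp add: count_mm not_in_iff)
  qed
  then have s: "?\<mu> \<subseteq># mm n {}" unfolding subseteq_mset_def by blast
  then have "wt dg (mm n {} - ?\<mu>) = 0" using dg by (simp add: wt_diff wt_mm)
  moreover have "size (mm n {} - ?\<mu>) \<le> wt dg (mm n {} - ?\<mu>)" using dgpos by (intro size_le_wt) (simp add: Suc_le_eq)
  ultimately have "mm n {} - ?\<mu> = {#}" by simp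
  then have "?\<mu> = mm n {}" using s by (metis add_0 subset_mset.diff_add)
  then have "wt ww ?\<mu> = n * Wg" using wt_mm[of "{}" ww n] by simp
  then show False using ne by simp
qed

lemma level_positive:
  assumes c: "cocycle JS i n c"
    and k: "\<And>F \<kappa>. F \<subseteq> C \<Longrightarrow> card F = i \<Longrightarrow> \<kappa> \<in> keys (c F) \<Longrightarrow> wt dg (\<kappa> + mm n F) = n * Dg \<and> wt ww (\<kappa> + mm n F) = w0"
    and w0: "w0 \<noteq> n * Wg"
  shows "\<exists>b. (\<forall>F. F \<subseteq> C \<and> card F = i \<longrightarrow> c F - d n b F \<in> JS) \<and>
    (\<forall>F. \<forall>\<kappa>\<in>keys (b F). \<kappa> \<in> Std \<and> wt dg (\<kappa> + mm n F) = n * Dg \<and> wt ww (\<kappa> + mm n F) = w0)"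
proof -
  have dd: "wt dg \<mu> = n * Dg \<and> wt ww \<mu> = w0" if "\<mu> \<in> degs i n c" for \<mu> using that k by (auto simp: degs_def)
  have "\<exists>v\<in>C. n < count \<mu> v" if m: "\<mu> \<in> degs i n c" for \<mu>
  proof -
    obtain \<nu> F where F: "\<mu> = \<nu> + mm n F" "\<nu> \<in> Std" "F \<subseteq> C" using m by (auto simp: degs_def)
    then show ?thesis using dd[OF m] w0 degree_positive[of \<nu> F n] by auto
  qed
  from cocycle_positive[OF c this] obtain b where
    b: "\<forall>F. F \<subseteq> C \<and> card F = i \<longrightarrow> c F - d n b F \<in> JS" "\<forall>F. \<forall>\<kappa>\<in>keys (b F). \<kappa> \<in> Std \<and> \<kappa> + mm n F \<in> degs i n c" by blast
  then show ?thesis using dd by (intro exI[of _ b]) blast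
qed

lemma d_J1_cong: assumes "G \<subseteq> C" "\<And>F. F \<subseteq> C \<Longrightarrow> Suc (card F) = card G \<Longrightarrow> a F - b F \<in> J1" shows "d n a G - d n b G \<in> J1"
proof (rule kdiff_ideal_cong[OF J1])
  fix h assume "h \<in> G"
  moreover have "finite G" using assms(1) finC finite_subset by auto
  ultimately show "a (G - {h}) - b (G - {h}) \<in> J1" using assms(1) card_Suc_Diff1[of G h] by (intro assms(2)) auto
qed

definition lpart :: "nat \<Rightarrow> nat \<Rightarrow> ('h set \<Rightarrow> ('h, 'k) mpoly) \<Rightarrow> 'h set \<Rightarrow> ('h, 'k) mpoly" where
  "lpart n p z F = part (\<lambda>\<kappa>. wt ww (\<kappa> + mm n F) = p) (z F)"

lemma keys_lpart: "\<kappa> \<in> keys (lpart n p z F) \<longleftrightarrow> \<kappa> \<in> keys (z F) \<and> wt ww (\<kappa> + mm n F) = p"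
  by (auto simp: lpart_def keys_part)

lemma keys_minus_lpart: "\<kappa> \<in> keys (z F - lpart n p z F) \<longleftrightarrow> \<kappa> \<in> keys (z F) \<and> wt ww (\<kappa> + mm n F) \<noteq> p"
  by (auto simp: lpart_def in_keys_iff lookup_minus coef_part)

text \<open>The lowest level p of z is a cocycle modulo \<open>JS\<close>, as y lives in higher
  levels. Away from the level of multidegree 0 it bounds in the discrete algebra, and the same b
  bounds it over \<open>J1\<close> up to an error that straightening moves above level p.\<close>

lemma level_improve:
  assumes dz: "\<And>G. G \<subseteq> C \<Longrightarrow> card G = Suc i \<Longrightarrow> d n z G - y G \<in> J1"
    and y: "\<And>G \<kappa>. G \<subseteq> C \<Longrightarrow> card G = Suc i \<Longrightarrow> \<kappa> \<in> keys (y G) \<Longrightarrow> p < wt ww (\<kappa> + mm n G)"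
    and z: "\<And>F \<kappa>. F \<subseteq> C \<Longrightarrow> card F = i \<Longrightarrow> \<kappa> \<in> keys (z F) \<Longrightarrow> wt dg (\<kappa> + mm n F) = n * Dg \<and> p \<le> wt ww (\<kappa> + mm n F)"
    and p: "p \<noteq> n * Wg"
  shows "\<exists>b z'. (\<forall>F. F \<subseteq> C \<and> card F = i \<longrightarrow> z F - d n b F - z' F \<in> J1) \<and>
    (\<forall>F. \<forall>\<kappa>\<in>keys (b F). \<kappa> \<in> Std \<and> wt dg (\<kappa> + mm n F) = n * Dg \<and> wt ww (\<kappa> + mm n F) = p) \<and>
    (\<forall>F. F \<subseteq> C \<and> card F = i \<longrightarrow> (\<forall>\<kappa>\<in>keys (z' F). wt dg (\<kappa> + mm n F) = n * Dg \<and> Suc p \<le> wt ww (\<kappa> + mm n F)))"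
proof -
  have "cocycle JS i n (lpart n p z)" unfolding cocycle_def
  proof (intro allI impI)
    fix G assume G: "G \<subseteq> C \<and> card G = Suc i"
    have fG: "finite G" using G finC finite_subset by auto
    have GC: "G \<subseteq> C" using G by auto
    define r1 where "r1 = d n (\<lambda>F. z F - lpart n p z F) G - y G"
    have "d n (lpart n p z) G + r1 = d n z G - y G" by (simp add: r1_def kdiff_diff)
    then have r: "d n (lpart n p z) G + r1 \<in> J1" using dz G by simp
    have GF: "G - {h} \<subseteq> C \<and> card (G - {h}) = i" if "h \<in> G" for h using that G fG by auto
    show "d n (lpart n p z) G \<in> JS"
    proof (rule leading_level[OF r, of "mm n G" p])
      fix \<kappa> assume k: "\<kappa> \<in> keys (d n (lpart n p z) G)"
      obtain h \<nu> where "h \<in> G" "\<nu> \<in> keys (lpart n p z (G - {h}))" "\<kappa> + mm n G = \<nu> + mm n (G - {h})"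
        using GC k by (rule keys_d)
      then show "wt ww (\<kappa> + mm n G) = p" by (simp only: keys_lpart)
    next
      fix \<kappa> assume "\<kappa> \<in> keys r1"
      then have "\<kappa> \<in> keys (d n (\<lambda>F. z F - lpart n p z F) G) \<or> \<kappa> \<in> keys (y G)"
        unfolding r1_def by (auto dest: subsetD[OF keys_diff])
      then show "p < wt ww (\<kappa> + mm n G)"
      proof
        assume k: "\<kappa> \<in> keys (d n (\<lambda>F. z F - lpart n p z F) G)"
        obtain h \<nu> where h: "h \<in> G" "\<nu> \<in> keys (z (G - {h}) - lpart n p z (G - {h}))" "\<kappa> + mm n G = \<nu> + mm n (G - {h})"
          using GC k by (rule keys_d)
        then show ?thesis using GF[OF h(1)] z[of "G - {h}" \<nu>] unfolding keys_minus_lpart h(3) by auto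
      qed (use y G in blast)
    qed
  qed
  from level_positive[OF this _ p] obtain b where
    b: "\<forall>F. F \<subseteq> C \<and> card F = i \<longrightarrow> lpart n p z F - d n b F \<in> JS"
    and kb: "\<forall>F. \<forall>\<kappa>\<in>keys (b F). \<kappa> \<in> Std \<and> wt dg (\<kappa> + mm n F) = n * Dg \<and> wt ww (\<kappa> + mm n F) = p"
    using z by (auto simp: keys_lpart)
  \<comment> \<open>On the sets F in question this difference lies in \<open>JS\<close>, so all its
    monomials are nonstandard and the weights of the normal form are strictly larger.\<close>
  have "\<forall>F. \<exists>q. reduces (lpart n p z F - d n b F) q" by (intro allI reduces_ex)
  then obtain q where q: "\<And>F. reduces (lpart n p z F - d n b F) (q F)" by metis
  define z' where "z' = (\<lambda>F. z F - lpart n p z F + q F)"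
  have "z F - d n b F - z' F \<in> J1" for F
  proof -
    have "z F - d n b F - z' F = (lpart n p z F - d n b F) - q F" by (simp add: z'_def)
    also have "\<dots> \<in> J1" using q[of F] by (simp add: reduces_def)
    finally show ?thesis .
  qed
  moreover have "wt dg (\<kappa> + mm n F) = n * Dg \<and> Suc p \<le> wt ww (\<kappa> + mm n F)"
    if F: "F \<subseteq> C" "card F = i" and k: "\<kappa> \<in> keys (z' F)" for F \<kappa>
  proof -
    have "\<kappa> \<in> keys (z F - lpart n p z F) \<or> \<kappa> \<in> keys (q F)" using k unfolding z'_def by (rule keys_addD)
    then show ?thesis
    proof
      assume "\<kappa> \<in> keys (z F - lpart n p z F)"
      then show ?thesis using z[OF F, of \<kappa>] unfolding keys_minus_lpart by auto
    next
      assume "\<kappa> \<in> keys (q F)"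
      then obtain \<nu> where n: "\<nu> \<in> keys (lpart n p z F - d n b F)" "wt dg \<kappa> = wt dg \<nu>" "\<nu> \<notin> Std \<longrightarrow> wt ww \<nu> < wt ww \<kappa>"
        using q[of F] by (auto simp: reduces_def)
      have "\<nu> \<notin> Std" using b F n(1) by (auto simp: JS_def mideal_def)
      moreover have "wt dg (\<nu> + mm n F) = n * Dg \<and> wt ww (\<nu> + mm n F) = p"
      proof -
        have "\<nu> \<in> keys (lpart n p z F) \<or> \<nu> \<in> keys (d n b F)" using n(1) by (auto dest: subsetD[OF keys_diff])
        then show ?thesis
        proof
          assume "\<nu> \<in> keys (lpart n p z F)" then show ?thesis using z[OF F, of \<nu>] by (simp add: keys_lpart)
        next
          assume "\<nu> \<in> keys (d n b F)"
          with F(1) obtain h \<nu>' where "h \<in> F" "\<nu>' \<in> keys (b (F - {h}))" "\<nu> + mm n F = \<nu>' + mm n (F - {h})" by (rule keys_d)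
          then show ?thesis using kb by metis
        qed
      qed
      ultimately show ?thesis using n by auto
    qed
  qed
  ultimately show ?thesis using kb by (intro exI[of _ b] exI[of _ z'] conjI) auto
qed

text \<open>The lift of g to multidegree 0 fails to be a cocycle over \<open>J1\<close> only by
  terms z of weight above Wg. Being congruent to a coboundary, z is itself a cocycle, so
  \<open>level_improve\<close> removes its lowest level in each round while changing c only above
  Wg.\<close>

lemma lift_cocycle:
  assumes g0: "\<And>F. \<not> (F \<subseteq> C \<and> mset_set F \<in> Std) \<Longrightarrow> g F = 0"
    and g1: "\<And>G. G \<subseteq> C \<Longrightarrow> mset_set G \<in> Std \<Longrightarrow> card G = Suc i \<Longrightarrow> sd g G = 0"
  shows "\<exists>c. cocycle J1 i 1 c \<and> (\<forall>F. \<forall>\<kappa>\<in>keys (c F - lift 1 (mm 1 {}) g F). wt dg (\<kappa> + mm 1 F) = Dg \<and> Wg < wt ww (\<kappa> + mm 1 F))"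
proof -
  let ?init = "lift 1 (mm 1 {}) g"
  have sub: "mm 1 F \<subseteq># mm 1 {}" for F by (auto simp: subseteq_mset_def count_mm)
  have mmF: "mm 1 {} - mm 1 F = mset_set F" if "F \<subseteq> C" for F
    using that finC finite_subset by (intro multiset_eqI) (auto simp: count_mm count_mset_set')
  define ok where "ok = (\<lambda>c. \<forall>F. \<forall>\<kappa>\<in>keys (c F - ?init F). wt dg (\<kappa> + mm 1 F) = Dg \<and> Wg < wt ww (\<kappa> + mm 1 F))"
  have "\<exists>c z. ok c \<and> (\<forall>G. G \<subseteq> C \<and> card G = Suc i \<longrightarrow> d 1 c G - z G \<in> J1 \<and>
      (\<forall>\<kappa>\<in>keys (z G). wt dg (\<kappa> + mm 1 G) = Dg \<and> Wg + Suc p \<le> wt ww (\<kappa> + mm 1 G)))" for p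
  proof (induction p)
    case 0
    \<comment> \<open>The cocycle condition on g removes the standard part of the coboundary of the
      lift, so its normal form starts above Wg.\<close>
    have "\<forall>G. \<exists>q. reduces (d 1 ?init G) q" by (intro allI reduces_ex)
    then obtain z where z: "\<And>G. reduces (d 1 ?init G) (z G)" by metis
    have "wt dg (\<kappa> + mm 1 G) = Dg \<and> Wg + Suc 0 \<le> wt ww (\<kappa> + mm 1 G)"
      if G: "G \<subseteq> C" "card G = Suc i" and k: "\<kappa> \<in> keys (z G)" for G \<kappa>
    proof -
      obtain \<nu> where n: "\<nu> \<in> keys (d 1 ?init G)" "wt dg \<kappa> = wt dg \<nu>" "\<nu> \<notin> Std \<longrightarrow> wt ww \<nu> < wt ww \<kappa>"
        using z[of G] k by (auto simp: reduces_def)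
      obtain h \<nu>' where h: "h \<in> G" "\<nu>' \<in> keys (?init (G - {h}))" "\<nu> + mm 1 G = \<nu>' + mm 1 (G - {h})"
        using G(1) n(1) by (rule keys_d)
      then have "\<nu>' + mm 1 (G - {h}) = mm 1 {}" using sub[of "G - {h}"] by (auto simp: lift_def split: if_splits)
      then have m: "\<nu> + mm 1 G = mm 1 {}" using h(3) by simp
      then have "\<nu> = mset_set G" using mmF[OF G(1)] by (metis add_diff_cancel_right')
      moreover have "comp 1 (mm 1 {}) ?init = g" using sub by (intro ext) (simp only: comp_lift simp_thms if_True)
      then have "coef (d 1 ?init G) \<nu> = sd g G" using coef_d[OF G(1), of 1 ?init \<nu>] m by (simp only:)
      then have "sd g G \<noteq> 0" using n(1) by (simp add: in_keys_iff)
      ultimately have "\<nu> \<notin> Std" using g1 G by auto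
      then have "wt ww (\<nu> + mm 1 G) < wt ww (\<kappa> + mm 1 G)" "wt dg (\<kappa> + mm 1 G) = wt dg (\<nu> + mm 1 G)" using n by auto
      then show ?thesis unfolding m using wt_mm[of "{}" _ 1] by simp
    qed
    moreover have "ok ?init" by (simp add: ok_def)
    ultimately show ?case using z by (intro exI[of _ ?init] exI[of _ z]) (auto simp: reduces_def)
  next
    case (Suc p)
    then obtain c z where c: "ok c" and z: "\<And>G. G \<subseteq> C \<Longrightarrow> card G = Suc i \<Longrightarrow> d 1 c G - z G \<in> J1"
      and zk: "\<And>G \<kappa>. G \<subseteq> C \<Longrightarrow> card G = Suc i \<Longrightarrow> \<kappa> \<in> keys (z G) \<Longrightarrow> wt dg (\<kappa> + mm 1 G) = Dg \<and> Wg + Suc p \<le> wt ww (\<kappa> + mm 1 G)"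
      by blast
    have coc: "d 1 z G - 0 \<in> J1" if G: "G \<subseteq> C" "card G = Suc (Suc i)" for G
    proof -
      have "d 1 (d 1 c) G - d 1 z G \<in> J1" using z G by (intro d_J1_cong) auto
      then show ?thesis
        using kdiff_kdiff[of G idx "\<lambda>h. vX h ^ 1" c] subD[of G] G ideal_uminus[OF J1, of "0 - d 1 z G"] by simp
    qed
    have "\<exists>b z'. (\<forall>F. F \<subseteq> C \<and> card F = Suc i \<longrightarrow> z F - d 1 b F - z' F \<in> J1) \<and>
      (\<forall>F. \<forall>\<kappa>\<in>keys (b F). \<kappa> \<in> Std \<and> wt dg (\<kappa> + mm 1 F) = 1 * Dg \<and> wt ww (\<kappa> + mm 1 F) = Wg + Suc p) \<and>
      (\<forall>F. F \<subseteq> C \<and> card F = Suc i \<longrightarrow> (\<forall>\<kappa>\<in>keys (z' F). wt dg (\<kappa> + mm 1 F) = 1 * Dg \<and> Suc (Wg + Suc p) \<le> wt ww (\<kappa> + mm 1 F)))"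
      by (rule level_improve[where y = "\<lambda>_. 0", OF coc]) (use zk in auto)
    then obtain b z' where b: "\<forall>F. F \<subseteq> C \<and> card F = Suc i \<longrightarrow> z F - d 1 b F - z' F \<in> J1"
      and kb: "\<forall>F. \<forall>\<kappa>\<in>keys (b F). \<kappa> \<in> Std \<and> wt dg (\<kappa> + mm 1 F) = 1 * Dg \<and> wt ww (\<kappa> + mm 1 F) = Wg + Suc p"
      and kz: "\<forall>F. F \<subseteq> C \<and> card F = Suc i \<longrightarrow> (\<forall>\<kappa>\<in>keys (z' F). wt dg (\<kappa> + mm 1 F) = 1 * Dg \<and> Suc (Wg + Suc p) \<le> wt ww (\<kappa> + mm 1 F))"
      by blast
    let ?cn = "\<lambda>F. c F - b F"
    have "wt dg (\<kappa> + mm 1 F) = Dg \<and> Wg < wt ww (\<kappa> + mm 1 F)" if k: "\<kappa> \<in> keys (c F - b F - ?init F)" for F \<kappa>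
    proof -
      from k have "\<kappa> \<in> keys ((c F - ?init F) - b F)" by (simp add: algebra_simps)
      then have "\<kappa> \<in> keys (c F - ?init F) \<or> \<kappa> \<in> keys (b F)" by (auto dest: subsetD[OF keys_diff])
      then show ?thesis using c kb unfolding ok_def by fastforce
    qed
    then have "ok ?cn" unfolding ok_def by blast
    moreover have "d 1 ?cn G - z' G \<in> J1" if G: "G \<subseteq> C" "card G = Suc i" for G
    proof -
      have "d 1 ?cn G - z' G = (d 1 c G - z G) + (z G - d 1 b G - z' G)" by (simp add: kdiff_diff)
      also have "\<dots> \<in> J1" using b G by (intro ideal_add[OF J1 z[OF G]]) blast
      finally show ?thesis .
    qed
    moreover have "wt dg (\<kappa> + mm 1 G) = Dg \<and> Wg + Suc (Suc p) \<le> wt ww (\<kappa> + mm 1 G)"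
      if "G \<subseteq> C \<and> card G = Suc i" "\<kappa> \<in> keys (z' G)" for G \<kappa>
      using kz that by fastforce
    ultimately show ?case by blast
  qed
  \<comment> \<open>In degree Dg no weight exceeds Wb * Dg, so after this many rounds the
    obstruction is zero.\<close>
  from this[of "Wb * Dg"] obtain c z where c: "ok c" and z: "\<And>G. G \<subseteq> C \<Longrightarrow> card G = Suc i \<Longrightarrow> d 1 c G - z G \<in> J1"
    and zk: "\<And>G \<kappa>. G \<subseteq> C \<Longrightarrow> card G = Suc i \<Longrightarrow> \<kappa> \<in> keys (z G) \<Longrightarrow> wt dg (\<kappa> + mm 1 G) = Dg \<and> Wg + Suc (Wb * Dg) \<le> wt ww (\<kappa> + mm 1 G)"
    by blast
  have "z G = 0" if G: "G \<subseteq> C" "card G = Suc i" for G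
  proof -
    have "keys (z G) = {}"
    proof (rule ccontr)
      assume "keys (z G) \<noteq> {}"
      then obtain \<kappa> where "\<kappa> \<in> keys (z G)" by blast
      then show False using zk[OF G] wt_bound[of "\<kappa> + mm 1 G"] by fastforce
    qed
    then show ?thesis by simp
  qed
  then have "cocycle J1 i 1 c" using z by (auto simp: cocycle_def)
  then show ?thesis using c unfolding ok_def by blast
qed

text \<open>In degree 0 the cohomology of the straightened algebra and of its discrete counterpart agree:
  a nonzero multidegree of total degree 0 has a positive entry, and there the complex is acyclic.\<close>

lemma simplicial_vanishing:
  assumes V: "vanish (- irr) J1 i"
    and g0: "\<And>F. \<not> (F \<subseteq> C \<and> mset_set F \<in> Std) \<Longrightarrow> g F = 0"
    and g1: "\<And>G. G \<subseteq> C \<Longrightarrow> mset_set G \<in> Std \<Longrightarrow> card G = Suc i \<Longrightarrow> sd g G = 0"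
  shows "\<exists>b. \<forall>F. F \<subseteq> C \<and> mset_set F \<in> Std \<and> card F = i \<longrightarrow> sd b F = g F"
proof -
  let ?init = "lift 1 (mm 1 {}) g"
  from lift_cocycle[OF g0 g1] obtain c where c: "cocycle J1 i 1 c"
    and ck: "\<forall>F. \<forall>\<kappa>\<in>keys (c F - ?init F). wt dg (\<kappa> + mm 1 F) = Dg \<and> Wg < wt ww (\<kappa> + mm 1 F)" by blast
  from vanishD[OF V c] obtain s N b where s: "s \<in> - irr"
    and b0[rule_format]: "\<forall>F. F \<subseteq> C \<and> card F = i \<longrightarrow> s * (xp F ^ N * c F) - d (1 + N) b F \<in> J1" by (rule trivialE)
  define n where "n = 1 + N"
  \<comment> \<open>Only the constant term of the multiplier s contributes in the degree considered
    below, where s is therefore replaced by this scalar.\<close>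
  define s0 where "s0 = coef s {#}"
  have s0: "s0 \<noteq> 0" using s by (simp add: s0_def irr_def)
  have n: "0 < n" by (simp add: n_def)
  define y where "y = (\<lambda>F. cst s0 * (xp F ^ N * c F))"
  have mmn: "repeat_mset N (mset_set F) + \<kappa> + mm n F = \<kappa> + mm 1 F + mm N {}" if "F \<subseteq> C" for F \<kappa>
    using that finC finite_subset by (intro multiset_eqI) (auto simp: count_mm count_mset_set' n_def)
  have mm1: "mm 1 {} + mm N {} = mm n {}" by (rule multiset_eqI) (auto simp: count_mm n_def)
  have sub: "mm k F \<subseteq># mm k {}" for F k by (auto simp: subseteq_mset_def count_mm)
  have y0: "y F - cst s0 * lift n (mm n {}) g F = cst s0 * (xp F ^ N * (c F - ?init F))" if "F \<subseteq> C" for F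
    using raise_lift[OF that, of N 1 "mm 1 {}" g] unfolding mm1 n_def[symmetric] by (simp add: y_def algebra_simps)
  have yk1: "wt dg (\<kappa> + mm n F) = n * Dg \<and> n * Wg < wt ww (\<kappa> + mm n F)"
    if F: "F \<subseteq> C" and k: "\<kappa> \<in> keys (y F - cst s0 * lift n (mm n {}) g F)" for F \<kappa>
  proof -
    have "\<kappa> \<in> keys (mon (repeat_mset N (mset_set F)) * (c F - ?init F))"
      using k unfolding y0[OF F] xp_eq[OF F] by (auto simp: in_keys_iff coef_cst_mult)
    then obtain \<nu> where v: "\<nu> \<in> keys (c F - ?init F)" "\<kappa> = repeat_mset N (mset_set F) + \<nu>" by (elim keys_multE) auto
    then have "\<kappa> + mm n F = \<nu> + mm 1 F + mm N {}" using mmn[OF F] by simp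
    then show ?thesis using ck v(1) wt_mm[of "{}" _ N] by (auto simp: n_def)
  qed
  have lk: "\<kappa> + mm n F = mm n {}" if "\<kappa> \<in> keys (cst s0 * lift n (mm n {}) g F)" for F \<kappa>
  proof -
    have "\<kappa> \<in> keys (lift n (mm n {}) g F)" using that by (auto simp: in_keys_iff coef_cst_mult)
    then show ?thesis using sub[of n F] by (auto simp: lift_def split: if_splits)
  qed
  have yk: "wt dg (\<kappa> + mm n F) = n * Dg \<and> n * Wg \<le> wt ww (\<kappa> + mm n F)" if F: "F \<subseteq> C" and k: "\<kappa> \<in> keys (y F)" for F \<kappa>
  proof -
    have "\<kappa> \<in> keys ((y F - cst s0 * lift n (mm n {}) g F) + cst s0 * lift n (mm n {}) g F)" using k by simp
    then have "\<kappa> \<in> keys (y F - cst s0 * lift n (mm n {}) g F) \<or> \<kappa> \<in> keys (cst s0 * lift n (mm n {}) g F)"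
      by (rule keys_addD)
    then show ?thesis
    proof
      assume "\<kappa> \<in> keys (cst s0 * lift n (mm n {}) g F)"
      then have e: "\<kappa> + mm n F = mm n {}" by (rule lk)
      show ?thesis unfolding e using wt_mm[of "{}" _ n] by simp
    qed (use yk1[OF F, of \<kappa>] in auto)
  qed
  \<comment> \<open>p is a lower bound for the levels in the cobounding cochain b; the aim is to
    raise it to n * Wg, the lowest level of y.\<close>
  define good where "good = (\<lambda>p b. (\<forall>F. F \<subseteq> C \<and> card F = i \<longrightarrow> y F - d n b F \<in> J1) \<and>
     (\<forall>F \<kappa>. F \<subseteq> C \<longrightarrow> Suc (card F) = i \<longrightarrow> \<kappa> \<in> keys (b F) \<longrightarrow> wt dg (\<kappa> + mm n F) = n * Dg \<and> p \<le> wt ww (\<kappa> + mm n F)))"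
  have mmdg: "wt dg (mm n F) = n * (\<Sum>h\<in>C - F. dg h)" "(\<Sum>h\<in>F. dg h) + (\<Sum>h\<in>C - F. dg h) = Dg" if "F \<subseteq> C" for F
    using wt_mm[OF that] sum.subset_diff[OF that finC, of dg] by simp_all
  \<comment> \<open>Taking the component of total degree 0 makes b homogeneous and turns s into its
    constant term.\<close>
  have "good 0 (\<lambda>F. hpart dg (n * (\<Sum>h\<in>F. dg h)) (b F))" (is "good 0 ?b")
    unfolding good_def
  proof (intro conjI allI impI)
    fix F assume F: "F \<subseteq> C \<and> card F = i"
    let ?e = "n * (\<Sum>h\<in>F. dg h)"
    let ?y = "xp F ^ N * c F"
    have hy: "homog dg ?e ?y" unfolding homog_def
    proof
      fix \<kappa> assume "\<kappa> \<in> keys ?y"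
      then have "\<kappa> \<in> keys (y F)" using s0 by (simp add: y_def in_keys_iff coef_cst_mult)
      then have "wt dg (\<kappa> + mm n F) = n * Dg" using yk F by blast
      then show "wt dg \<kappa> = ?e" using mmdg[of F] F by (simp add: algebra_simps) (metis add_left_cancel add.commute distrib_left)
    qed
    have "hpart dg ?e (s * ?y) = y F"
    proof -
      have "wt dg m = 0 \<longleftrightarrow> m = {#}" for m using size_le_wt[of m dg] dgpos by (auto simp: Suc_le_eq)
      then have "hpart dg 0 s = cst s0" by (intro poly_mapping_eqI) (auto simp: coef_part lookup_single when_def s0_def)
      then show ?thesis using hpart_mult_homog[OF hy, of ?e s] by (simp add: y_def)
    qed
    moreover have "hpart dg ?e (d n b F) = d n ?b F"
      unfolding kdiff_def part_sum
    proof (rule sum.cong[OF refl])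
      fix h assume h: "h \<in> F"
      have hv: "homog dg (n * dg h) (ksgn idx h F * vX h ^ n)"
        unfolding homog_def
        by (auto simp: in_keys_iff coef_ksgn_mult var_power lookup_single when_def wt_def split: if_splits)
      have "?e = n * dg h + n * (\<Sum>g\<in>F - {h}. dg g)" using h F finC finite_subset[of F C] sum.remove[of F h dg] by (simp add: distrib_left)
      then show "hpart dg ?e (ksgn idx h F * vX h ^ n * b (F - {h})) =
          ksgn idx h F * vX h ^ n * hpart dg (n * (\<Sum>g\<in>F - {h}. dg g)) (b (F - {h}))"
        using hpart_mult_homog[OF hv, of ?e "b (F - {h})"] by (simp add: mult.commute)
    qed
    moreover have "hpart dg ?e (s * ?y - d n b F) \<in> J1" using homJ b0[of F] F by (auto simp: homog_ideal_def n_def)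
    ultimately show "y F - d n ?b F \<in> J1" by (simp add: part_diff)
  next
    fix F \<kappa> assume F: "F \<subseteq> C" and k: "\<kappa> \<in> keys (?b F)"
    then show "wt dg (\<kappa> + mm n F) = n * Dg" using mmdg[OF F] by (auto simp: keys_part simp flip: distrib_left)
  qed simp
  then have start: "\<exists>b. good 0 b" by blast
  \<comment> \<open>Below level n * Wg the lowest part of b has no counterpart in y. Hence it can be
    removed by \<open>level_improve\<close>: changing b by a coboundary does not affect the
    equation.\<close>
  have "p \<le> n * Wg \<Longrightarrow> \<exists>b. good p b" for p
  proof (induction p)
    case 0 then show ?case using start by blast
  next
    case (Suc p)
    then obtain b where b: "good p b" by auto
    show ?case
    proof (cases i)
      case 0
      have "y F - d n (\<lambda>_. 0) F \<in> J1" if "F \<subseteq> C \<and> card F = i" for F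
        using b that 0 subD(1)[of F] by (auto simp: good_def kdiff_def)
      then show ?thesis using 0 by (intro exI[of _ "\<lambda>_. 0"]) (auto simp: good_def)
    next
      case (Suc j)
      have by': "y F - d n b F \<in> J1" if "F \<subseteq> C" "card F = i" for F using b that by (simp add: good_def)
      have bk: "wt dg (\<kappa> + mm n F) = n * Dg \<and> p \<le> wt ww (\<kappa> + mm n F)" if "F \<subseteq> C" "card F = j" "\<kappa> \<in> keys (b F)" for F \<kappa>
        using b that Suc by (auto simp: good_def)
      have dz: "d n b G - y G \<in> J1" if "G \<subseteq> C" "card G = Suc j" for G
        using ideal_sym[OF J1 by'[of G]] that Suc by simp
      have "\<exists>b' z'. (\<forall>F. F \<subseteq> C \<and> card F = j \<longrightarrow> b F - d n b' F - z' F \<in> J1) \<and>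
        (\<forall>F. \<forall>\<kappa>\<in>keys (b' F). \<kappa> \<in> Std \<and> wt dg (\<kappa> + mm n F) = n * Dg \<and> wt ww (\<kappa> + mm n F) = p) \<and>
        (\<forall>F. F \<subseteq> C \<and> card F = j \<longrightarrow> (\<forall>\<kappa>\<in>keys (z' F). wt dg (\<kappa> + mm n F) = n * Dg \<and> Suc p \<le> wt ww (\<kappa> + mm n F)))"
      proof (rule level_improve[where y = y, OF dz])
        show "p < wt ww (\<kappa> + mm n G)" if "G \<subseteq> C" "\<kappa> \<in> keys (y G)" for G \<kappa>
          using yk[OF that] \<open>Suc p \<le> n * Wg\<close> by linarith
        show "p \<noteq> n * Wg" using \<open>Suc p \<le> n * Wg\<close> by linarith
      qed (use bk in auto)
      then obtain b' z' where b': "\<forall>F. F \<subseteq> C \<and> card F = j \<longrightarrow> b F - d n b' F - z' F \<in> J1"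
        and z': "\<forall>F. F \<subseteq> C \<and> card F = j \<longrightarrow> (\<forall>\<kappa>\<in>keys (z' F). wt dg (\<kappa> + mm n F) = n * Dg \<and> Suc p \<le> wt ww (\<kappa> + mm n F))"
        by blast
      have "y G - d n z' G \<in> J1" if G: "G \<subseteq> C" "card G = i" for G
      proof -
        have "d n (\<lambda>F. b F - d n b' F) G - d n z' G \<in> J1" using G Suc b' by (intro d_J1_cong) auto
        moreover have "d n (\<lambda>F. b F - d n b' F) G = d n b G" using subD[OF G(1)] by (simp add: kdiff_diff kdiff_kdiff)
        ultimately show ?thesis using ideal_trans[OF J1 by'[OF G]] by simp
      qed
      then show ?thesis using z' Suc by (intro exI[of _ z']) (auto simp: good_def)
    qed
  qed
  then obtain b where b: "good (n * Wg) b" by blast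
  let ?p = "n * Wg"
  \<comment> \<open>The multidegree 0 part of b at level n * Wg is, up to the scalar s0, the
    simplicial cochain sought.\<close>
  define a where "a = comp n (mm n {}) (lpart n ?p b)"
  have "sd (\<lambda>F. inverse s0 * a F) F = g F" if F: "F \<subseteq> C" "mset_set F \<in> Std" "card F = i" for F
  proof -
    have fF: "finite F" using F finC finite_subset by auto
    \<comment> \<open>r0 collects the terms of lowest level n * Wg and r1 the others, so r0 vanishes
      in the discrete algebra. Its coefficient at the n-th power of the face monomial is the
      simplicial equation at F.\<close>
    define r0 where "r0 = cst s0 * lift n (mm n {}) g F - d n (lpart n ?p b) F"
    define r1 where "r1 = (y F - cst s0 * lift n (mm n {}) g F) - d n (\<lambda>F. b F - lpart n ?p b F) F"
    have "r0 + r1 = y F - d n b F" by (simp add: r0_def r1_def kdiff_diff)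
    then have r: "r0 + r1 \<in> J1" using b F by (simp add: good_def)
    have "r0 \<in> JS"
    proof (rule leading_level[OF r, of "mm n F" ?p])
      fix \<kappa> assume "\<kappa> \<in> keys r0"
      then have "\<kappa> \<in> keys (cst s0 * lift n (mm n {}) g F) \<or> \<kappa> \<in> keys (d n (lpart n ?p b) F)"
        unfolding r0_def by (auto dest: subsetD[OF keys_diff])
      then show "wt ww (\<kappa> + mm n F) = ?p"
      proof
        assume "\<kappa> \<in> keys (cst s0 * lift n (mm n {}) g F)"
        then show ?thesis using lk[of \<kappa> F] wt_mm[of "{}" ww n] by simp
      next
        assume k: "\<kappa> \<in> keys (d n (lpart n ?p b) F)"
        obtain h \<nu> where "h \<in> F" "\<nu> \<in> keys (lpart n ?p b (F - {h}))" "\<kappa> + mm n F = \<nu> + mm n (F - {h})"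
          using F(1) k by (rule keys_d)
        then show ?thesis by (simp only: keys_lpart)
      qed
    next
      fix \<kappa> assume "\<kappa> \<in> keys r1"
      then have "\<kappa> \<in> keys (y F - cst s0 * lift n (mm n {}) g F) \<or> \<kappa> \<in> keys (d n (\<lambda>F. b F - lpart n ?p b F) F)"
        unfolding r1_def by (auto dest: subsetD[OF keys_diff])
      then show "?p < wt ww (\<kappa> + mm n F)"
      proof
        assume "\<kappa> \<in> keys (y F - cst s0 * lift n (mm n {}) g F)" then show ?thesis using yk1[OF F(1)] by blast
      next
        assume k: "\<kappa> \<in> keys (d n (\<lambda>F. b F - lpart n ?p b F) F)"
        obtain h \<nu> where h: "h \<in> F" "\<nu> \<in> keys (b (F - {h}) - lpart n ?p b (F - {h}))" "\<kappa> + mm n F = \<nu> + mm n (F - {h})"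
          using F(1) k by (rule keys_d)
        have "Suc (card (F - {h})) = i" "F - {h} \<subseteq> C" using card_Suc_Diff1[OF fF h(1)] F by auto
        moreover have "\<nu> \<in> keys (b (F - {h}))" "wt ww (\<nu> + mm n (F - {h})) \<noteq> ?p" using h(2) by (simp_all add: keys_minus_lpart)
        ultimately have "?p \<le> wt ww (\<nu> + mm n (F - {h}))" using b unfolding good_def by blast
        then show ?thesis unfolding h(3) using \<open>wt ww (\<nu> + mm n (F - {h})) \<noteq> ?p\<close> by linarith
      qed
    qed
    moreover have "set_mset (repeat_mset n (mset_set F)) \<subseteq> set_mset (mset_set F)" by (auto simp flip: count_greater_zero_iff)
    then have "repeat_mset n (mset_set F) \<in> Std" using supp[OF F(2)] by blast
    ultimately have z: "coef r0 (repeat_mset n (mset_set F)) = 0" by (simp add: JS_def mideal_coef)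
    have "mm n {} - mm n F = repeat_mset n (mset_set F)" using repeat_mm[OF F(1), of n] by (metis add_diff_cancel_right')
    then have "coef (lift n (mm n {}) g F) (repeat_mset n (mset_set F)) = g F" using sub[of n F] by (simp add: lift_def)
    moreover have "coef (d n (lpart n ?p b) F) (repeat_mset n (mset_set F)) = sd a F"
      using coef_d[OF F(1), of n "lpart n ?p b" "repeat_mset n (mset_set F)"] repeat_mm[OF F(1), of n] by (simp add: a_def)
    ultimately have "s0 * g F = sd a F" using z by (simp add: r0_def lookup_minus coef_cst_mult)
    then have "inverse s0 * sd a F = g F" using s0 by (simp add: field_simps)
    then show ?thesis by (simp add: kdiff_scale)
  qed
  then show ?thesis by blast
qed

end

section \<open>Top components for the standard grading\<close>

abbreviation hp :: "nat \<Rightarrow> ('h, 'k::field) mpoly \<Rightarrow> ('h, 'k) mpoly" where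
  "hp k p \<equiv> part (\<lambda>m. wt (\<lambda>_. 1) m = k) p"

abbreviation size_le :: "nat \<Rightarrow> ('h, 'k::field) mpoly \<Rightarrow> bool" where
  "size_le k p \<equiv> (\<forall>m\<in>keys p. size m \<le> k)"

lemma wt_Suc_0 [simp]: "wt (\<lambda>_. Suc 0) m = size m"
  using wt_one[of m] by simp

lemma size_le_mult: assumes "size_le a p" "size_le b q" shows "size_le (a + b) (p * q)"
  using assms by (auto elim!: keys_multE intro!: add_mono)

lemma size_le_add: "size_le a p \<Longrightarrow> size_le a q \<Longrightarrow> size_le a (p + q)"
  by (auto dest: subsetD[OF keys_add])

lemma size_le_diff: "size_le a p \<Longrightarrow> size_le a q \<Longrightarrow> size_le a (p - q)"
  by (auto dest: subsetD[OF keys_diff])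

lemma size_le_hp: "size_le k (hp k p)" by (auto simp: keys_part wt_one)

lemma hp_zero: "size_le a p \<Longrightarrow> a < k \<Longrightarrow> hp k p = 0"
  by (rule part_none) (auto simp: wt_one)

lemma hp_mult_top:
  assumes p: "size_le a p" and q: "size_le b q" shows "hp (a + b) (p * q) = hp a p * hp b q"
proof -
  define q' where "q' = q - hp b q"
  have q': "m \<in> keys q' \<Longrightarrow> size m < b" for m
    using q by (auto simp: q'_def in_keys_iff lookup_minus coef_part wt_one le_less split: if_splits)
  have "p * q = p * hp b q + p * q'" by (simp add: q'_def algebra_simps)
  moreover have "hp (a + b) (p * q') = 0"
  proof (rule part_none)
    fix m assume "m \<in> keys (p * q')"
    then obtain x y where "x \<in> keys p" "y \<in> keys q'" "m = x + y" by (rule keys_multE)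
    then show "wt (\<lambda>_. 1) m \<noteq> a + b" using p q'[of y] by (fastforce simp: wt_one)
  qed
  moreover have "hp (a + b) (p * hp b q) = hp a p * hp b q" using hpart_mult_homog[OF homog_hpart, of "\<lambda>_. 1" "a + b" p b q] by simp
  ultimately show ?thesis by (simp add: part_add)
qed

lemma size_less_of_hp:
  assumes "size_le k p" "hp k p = 0" shows "\<forall>m\<in>keys p. size m < k"
proof
  fix m assume m: "m \<in> keys p"
  have "coef (hp k p) m = 0" using assms(2) by simp
  then have "size m \<noteq> k" using m by (auto simp: coef_part in_keys_iff)
  then show "size m < k" using assms(1) m by fastforce
qed

lemma size_le_ex: "\<exists>k. size_le k p"
proof -
  have "size_le (\<Sum>m\<in>keys p. size m) p" by (auto intro!: member_le_sum)
  then show ?thesis by blast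
qed

subsection \<open>Regularity of sequences with regular leading forms\<close>

text \<open>K is the ideal of leading forms of I. The bound k may exceed the degree of p, in which
  case \<open>hp k p\<close> is 0; conversely each homogeneous element of K is attained in its own
  degree.\<close>

definition leads :: "('h, 'k::field) mpoly set \<Rightarrow> ('h, 'k) mpoly set \<Rightarrow> bool" where
  "leads I K \<longleftrightarrow> (\<forall>p k. p \<in> I \<longrightarrow> size_le k p \<longrightarrow> hp k p \<in> K) \<and>
     (\<forall>B k. B \<in> K \<longrightarrow> homog (\<lambda>_. 1) k B \<longrightarrow> (\<exists>v\<in>I. size_le k v \<and> hp k v = B))"

text \<open>If a * g lies in I, the leading form of a lies in K by regularity of G and is cancelled
  by an element of I of the same degree; induction on the degree of a.\<close>

lemma leads_regular:
  assumes I: "is_ideal I" and K: "is_ideal K" "homog_ideal (\<lambda>_. 1) K" and L: "leads I K"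
    and G: "homog (\<lambda>_. 1) e G" "size_le e g" "hp e g = G" and reg: "regular_on {1} K G"
  shows "regular_on {1} I g"
proof -
  have "a \<in> I" if "\<forall>m\<in>keys a. size m < n" "a * g \<in> I" for a n
    using that
  proof (induction n arbitrary: a)
    case 0 then have "keys a = {}" by auto then show ?case using ideal_zero[OF I] by simp
  next
    case (Suc n)
    then have an: "size_le n a" by (auto simp: less_Suc_eq_le)
    have "hp (n + e) (a * g) \<in> K" using L Suc.prems(2) size_le_mult[OF an G(2)] by (simp add: leads_def)
    then have "hp n a * G \<in> K" using hp_mult_top[OF an G(2)] G(3) by simp
    then have "hp n a \<in> K" using reg by (auto simp: regular_on_def)
    then obtain v where v: "v \<in> I" "size_le n v" "hp n v = hp n a" using L homog_hpart unfolding leads_def by blast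
    have "hp n (a - v) = 0" using v(3) by (simp add: part_diff)
    then have "\<forall>m\<in>keys (a - v). size m < n" by (rule size_less_of_hp[OF size_le_diff[OF an v(2)]])
    moreover have "(a - v) * g \<in> I" unfolding left_diff_distrib
      by (intro ideal_diff[OF I] Suc.prems(2) ideal_mult_right[OF I v(1)])
    ultimately have "a - v \<in> I" by (rule Suc.IH)
    then show ?case using v(1) ideal_add[OF I, of "a - v" v] by simp
  qed
  moreover have "\<exists>n. \<forall>m\<in>keys a. size m < n" for a :: "'a multiset \<Rightarrow>\<^sub>0 'b" using size_le_ex[of a] by (meson le_imp_less_Suc)
  ultimately show ?thesis unfolding regular_on_def by (metis insertI1 mult_1)
qed

text \<open>Regularity of G prevents unexpected leading forms: if b * g reaches a degree above that
  of p, the leading form of b lies in K, and b can be replaced by a polynomial of smaller degree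
  with the same congruence p = b * g modulo I.\<close>

lemma leads_adjoin:
  assumes I: "is_ideal I" and K: "is_ideal K" "homog_ideal (\<lambda>_. 1) K" and L: "leads I K"
    and G: "homog (\<lambda>_. 1) e G" "size_le e g" "hp e g = G" and reg: "regular_on {1} K G"
  shows "leads (adjoin I g) (adjoin K G)"
  unfolding leads_def
proof (intro conjI allI impI)
  fix p k assume "p \<in> adjoin I g" and k: "size_le k p"
  then obtain b0 where b0: "p - b0 * g \<in> I" by (auto simp: in_adjoin)
  have "hp k p \<in> adjoin K G" if "\<forall>m\<in>keys b. size m < n" "p - b * g \<in> I" for b n
    using that
  proof (induction n arbitrary: b)
    case 0
    then have "keys b = {}" by auto
    then have "p \<in> I" using 0 by simp
    then show ?case using L k adjoin_subset[of K G] by (auto simp: leads_def)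
  next
    case (Suc n)
    then have bn: "size_le n b" by (auto simp: less_Suc_eq_le)
    let ?v = "p - b * g"
    show ?case
    proof (cases "n + e \<le> k")
      case True
      have bg: "size_le k (b * g)" using size_le_mult[OF bn G(2)] True by fastforce
      have "hp k ?v \<in> K" using L Suc.prems(2) size_le_diff[OF k bg] by (auto simp: leads_def)
      moreover have "hp k (b * g) = hp (k - e) b * G"
        using hp_mult_top[where a = "k - e" and p = b and b = e and q = g] bn G True by (fastforce simp: le_diff_conv2)
      ultimately have "hp k p - hp (k - e) b * G \<in> K" by (simp add: part_diff)
      then show ?thesis by (auto simp: in_adjoin)
    next
      case False
      have kn: "size_le (n + e) p" using k False by fastforce
      have "hp (n + e) ?v \<in> K" using L Suc.prems(2) size_le_diff[OF kn size_le_mult[OF bn G(2)]] by (auto simp: leads_def)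
      moreover have "hp (n + e) p = 0" using k False by (intro hp_zero) auto
      ultimately have "- (hp n b * G) \<in> K" using hp_mult_top[OF bn G(2)] G(3) by (simp add: part_diff)
      then have "hp n b * G \<in> K" using ideal_uminus[OF K(1)] by fastforce
      then have "hp n b \<in> K" using reg by (auto simp: regular_on_def)
      then obtain v where v: "v \<in> I" "size_le n v" "hp n v = hp n b" using L homog_hpart unfolding leads_def by blast
      have "p - (b - v) * g = (p - b * g) + v * g" by (simp add: algebra_simps)
      then have pv: "p - (b - v) * g \<in> I" using Suc.prems(2) ideal_mult_right[OF I v(1)] ideal_add[OF I] by metis
      have "hp n (b - v) = 0" using v(3) by (simp add: part_diff)
      then have "\<forall>m\<in>keys (b - v). size m < n" by (rule size_less_of_hp[OF size_le_diff[OF bn v(2)]])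
      then show ?thesis using Suc.IH pv by blast
    qed
  qed
  moreover obtain n where "\<forall>m\<in>keys b0. size m < n" using size_le_ex[of b0] by (meson le_imp_less_Suc)
  ultimately show "hp k p \<in> adjoin K G" using b0 by blast
next
  fix B k assume "B \<in> adjoin K G" and h: "homog (\<lambda>_. 1) k B"
  then obtain c where c: "B - c * G \<in> K" by (auto simp: in_adjoin)
  define c' where "c' = (if e \<le> k then hp (k - e) c else 0)"
  have cG: "hp k (c * G) = c' * G" using hpart_mult_homog[OF G(1), of k c] by (simp add: c'_def)
  have "hp k (B - c * G) \<in> K" using c K(2) by (auto simp: homog_ideal_def)
  then have "B - c' * G \<in> K" using hpart_homog[OF h, of k] cG by (simp add: part_diff)
  moreover have hc: "homog (\<lambda>_. 1) k (B - c' * G)"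
    using homog_hpart[of "\<lambda>_. 1" k "B - c * G"] hpart_homog[OF h, of k] cG by (simp add: part_diff)
  ultimately obtain v where v: "v \<in> I" "size_le k v" "hp k v = B - c' * G" using L unfolding leads_def by blast
  have cg: "size_le k (c' * g) \<and> hp k (c' * g) = c' * G"
  proof (cases "e \<le> k")
    case True
    have "size_le (k - e + e) (c' * g)" using size_le_mult[OF size_le_hp G(2), of "k - e" c] True by (simp add: c'_def)
    moreover have "hp (k - e + e) (c' * g) = hp (k - e) c' * G"
      using hp_mult_top[OF size_le_hp G(2), of "k - e" c] True G(3) by (simp add: c'_def)
    moreover have "hp (k - e) c' = c'" using True unfolding c'_def by (intro part_all) (auto simp: keys_part)
    ultimately show ?thesis using True by simp
  next
    case False
    have "hp k 0 = (0 :: 'a multiset \<Rightarrow>\<^sub>0 'b)" by (rule part_none) simp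
    then show ?thesis using False by (simp add: c'_def)
  qed
  have "v + c' * g \<in> adjoin I g" using v(1) by (auto simp: in_adjoin intro!: exI[of _ c'])
  moreover have "size_le k (v + c' * g)" using size_le_add v(2) cg by blast
  moreover have "hp k (v + c' * g) = B" using v(3) cg by (simp add: part_add)
  ultimately show "\<exists>v\<in>adjoin I g. size_le k v \<and> hp k v = B" by blast
qed

lemma reg_list_of_leading:
  assumes "is_ideal I" "is_ideal K" "homog_ideal (\<lambda>_. 1) K" "leads I K"
    and "list_all2 (\<lambda>g G. \<exists>e. homog (\<lambda>_. 1) e G \<and> size_le e g \<and> hp e g = G) gs Gs" "reg_list {1} K Gs"
  shows "reg_list {1} I gs"
  using assms
proof (induction gs arbitrary: I K Gs)
  case (Cons g gs)
  then obtain G Gs' e where G: "Gs = G # Gs'" "homog (\<lambda>_. 1) e G" "size_le e g" "hp e g = G"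
    "list_all2 (\<lambda>g G. \<exists>e. homog (\<lambda>_. 1) e G \<and> size_le e g \<and> hp e g = G) gs Gs'"
    by (auto simp: list_all2_Cons1)
  have reg: "regular_on {1} K G" using Cons.prems(6) G(1) by simp
  have "reg_list {1} (adjoin I g) gs"
  proof (rule Cons.IH)
    show "leads (adjoin I g) (adjoin K G)" by (rule leads_adjoin[OF Cons.prems(1-4) G(2-4) reg])
    show "homog_ideal (\<lambda>_. 1) (adjoin K G)" by (rule homog_ideal_adjoin[OF Cons.prems(2,3) G(2)])
    show "reg_list {1} (adjoin K G) Gs'" using Cons.prems(6) G(1) by simp
  qed (use Cons.prems ideal_adjoin G in auto)
  then show ?case using leads_regular[OF Cons.prems(1-4) G(2-4) reg] by simp
qed simp

lemma leads_refl: "is_ideal I \<Longrightarrow> homog_ideal (\<lambda>_. 1) I \<Longrightarrow> leads I I"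
  unfolding leads_def
proof (intro conjI allI impI)
  fix B k assume "B \<in> I" "homog (\<lambda>_. 1) k B"
  then show "\<exists>v\<in>I. size_le k v \<and> hp k v = B" using hpart_homog[of "\<lambda>_. 1" k B k]
    by (intro bexI[of _ B]) (auto simp: homog_def wt_one)
qed (auto simp: homog_ideal_def)

subsection \<open>Zariski's lemma\<close>

definition psub :: "'h set \<Rightarrow> ('h, 'k::field) mpoly set" where "psub B = {p. \<forall>m\<in>keys p. set_mset m \<subseteq> B}"

lemma psub_add: "p \<in> psub B \<Longrightarrow> q \<in> psub B \<Longrightarrow> p + q \<in> psub B"
  and psub_diff: "p \<in> psub B \<Longrightarrow> q \<in> psub B \<Longrightarrow> p - q \<in> psub B"
  by (auto simp: psub_def dest: subsetD[OF keys_add] subsetD[OF keys_diff])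

lemma psub_mult: "p \<in> psub B \<Longrightarrow> q \<in> psub B \<Longrightarrow> p * q \<in> psub B"
  by (fastforce simp: psub_def elim!: keys_multE)

lemma psub_simps [simp]: "0 \<in> psub B" "1 \<in> psub B" "cst c \<in> psub B" "var b \<in> psub B \<longleftrightarrow> b \<in> B"
  by (auto simp: psub_def)

lemma psub_power: "p \<in> psub B \<Longrightarrow> p ^ n \<in> psub B"
  by (induction n) (auto intro: psub_mult)

lemma psub_sum: "(\<And>i. i \<in> K \<Longrightarrow> f i \<in> psub B) \<Longrightarrow> (\<Sum>i\<in>K. f i) \<in> psub B"
  by (induction K rule: infinite_finite_induct) (auto intro: psub_add)

lemma psub_prod: "(\<And>i. i \<in> K \<Longrightarrow> f i \<in> psub B) \<Longrightarrow> (\<Prod>i\<in>K. f i) \<in> psub B"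
  by (induction K rule: infinite_finite_induct) (auto intro: psub_mult)

lemma psub_prod_nonzero:
  fixes f :: "'i \<Rightarrow> ('h, 'k::field) mpoly"
  assumes nz: "\<And>a b :: ('h, 'k) mpoly. a \<in> psub B \<Longrightarrow> b \<in> psub B \<Longrightarrow> a \<noteq> 0 \<Longrightarrow> b \<noteq> 0 \<Longrightarrow> a * b \<noteq> 0"
    and f: "\<And>i. i \<in> K \<Longrightarrow> f i \<in> psub B \<and> f i \<noteq> 0"
  shows "(\<Prod>i\<in>K. f i) \<noteq> 0"
  using f
proof (induction K rule: infinite_finite_induct)
  case (insert i K)
  have "(\<Prod>i\<in>K. f i) \<in> psub B" using insert.prems by (intro psub_prod) auto
  then show ?case using insert nz[of "f i" "\<Prod>i\<in>K. f i"] by auto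
qed auto

text \<open>Combinations of G with coefficients in the polynomial ring on B, taken modulo M.\<close>

definition dspan :: "'h set \<Rightarrow> ('h, 'k::field) mpoly set \<Rightarrow> ('h, 'k) mpoly set \<Rightarrow> ('h, 'k) mpoly set" where
  "dspan B M G = {p. \<exists>c. (\<forall>g. c g \<in> psub B) \<and> p - (\<Sum>g\<in>G. c g * g) \<in> M}"

lemma dspan_add: assumes M: "is_ideal M" and "p \<in> dspan B M G" "q \<in> dspan B M G" shows "p + q \<in> dspan B M G"
proof -
  obtain c e where c: "\<forall>g. c g \<in> psub B" "p - (\<Sum>g\<in>G. c g * g) \<in> M" and e: "\<forall>g. e g \<in> psub B" "q - (\<Sum>g\<in>G. e g * g) \<in> M"
    using assms by (auto simp: dspan_def)
  have "(p - (\<Sum>g\<in>G. c g * g)) + (q - (\<Sum>g\<in>G. e g * g)) \<in> M" by (rule ideal_add[OF M c(2) e(2)])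
  then have "p + q - (\<Sum>g\<in>G. (c g + e g) * g) \<in> M" by (simp add: distrib_right sum.distrib algebra_simps)
  then show ?thesis unfolding dspan_def using c(1) e(1) by (intro CollectI exI[of _ "\<lambda>g. c g + e g"]) (auto intro: psub_add)
qed

lemma dspan_mult: assumes M: "is_ideal M" and "p \<in> dspan B M G" "a \<in> psub B" shows "a * p \<in> dspan B M G"
proof -
  obtain c where c: "\<forall>g. c g \<in> psub B" "p - (\<Sum>g\<in>G. c g * g) \<in> M" using assms by (auto simp: dspan_def)
  have "a * (p - (\<Sum>g\<in>G. c g * g)) \<in> M" by (rule ideal_mult_left[OF M c(2)])
  then have "a * p - (\<Sum>g\<in>G. (a * c g) * g) \<in> M" by (simp add: right_diff_distrib sum_distrib_left mult.assoc)
  then show ?thesis unfolding dspan_def using c(1) assms(3) by (intro CollectI exI[of _ "\<lambda>g. a * c g"]) (auto intro: psub_mult)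
qed

lemma dspan_ideal: "p \<in> M \<Longrightarrow> p \<in> dspan B M G"
  by (auto simp: dspan_def intro!: exI[of _ "\<lambda>_. 0"])

lemma dspan_base: assumes "is_ideal M" "finite G" "g \<in> G" shows "g \<in> dspan B M G"
proof -
  have "(\<Sum>h\<in>G. (if h = g then 1 else 0) * h) = (\<Sum>h\<in>G. if h = g then g else 0)" by (intro sum.cong) auto
  then have "g - (\<Sum>h\<in>G. (if h = g then 1 else 0) * h) = 0" using assms by simp
  then have "g - (\<Sum>h\<in>G. (if h = g then 1 else 0) * h) \<in> M" using ideal_zero[OF assms(1)] by metis
  then show ?thesis unfolding dspan_def by (intro CollectI exI[of _ "\<lambda>h. if h = g then 1 else 0"]) auto
qed

lemma dspan_sum: assumes "is_ideal M" "\<And>k. k \<in> K \<Longrightarrow> f k \<in> dspan B M G" shows "(\<Sum>k\<in>K. f k) \<in> dspan B M G"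
  using assms(2) by (induction K rule: infinite_finite_induct) (auto intro: dspan_add[OF assms(1)] dspan_ideal ideal_zero[OF assms(1)])

lemma dspan_trans:
  assumes M: "is_ideal M" and p: "p \<in> dspan B M G" and g: "\<And>g. g \<in> G \<Longrightarrow> a * g \<in> dspan B M E"
  shows "a * p \<in> dspan B M E"
proof -
  obtain c where c: "\<forall>g. c g \<in> psub B" "p - (\<Sum>g\<in>G. c g * g) \<in> M" using p by (auto simp: dspan_def)
  have "c x * (a * x) \<in> dspan B M E" if "x \<in> G" for x using c(1) by (intro dspan_mult[OF M g[OF that]]) auto
  then have "(\<Sum>g\<in>G. c g * (a * g)) \<in> dspan B M E" by (rule dspan_sum[OF M])
  moreover have "a * (p - (\<Sum>g\<in>G. c g * g)) \<in> dspan B M E" by (intro dspan_ideal ideal_mult_left[OF M] c(2))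
  ultimately have "(\<Sum>g\<in>G. c g * (a * g)) + a * (p - (\<Sum>g\<in>G. c g * g)) \<in> dspan B M E" by (rule dspan_add[OF M])
  then show ?thesis by (simp add: algebra_simps sum_distrib_left)
qed

text \<open>The terms of p are sorted by the exponent of h. The top coefficient is nonzero, and its
  exponent is positive since otherwise p would be a relation in the variables B alone.\<close>

lemma algebraic_relation:
  assumes p: "p \<in> psub (insert h B)" "p \<in> M" "p \<noteq> 0" and h: "h \<notin> B"
    and M: "is_ideal (M :: ('h, 'k::field) mpoly set)" and BM: "\<And>q. q \<in> psub B \<Longrightarrow> q \<in> M \<Longrightarrow> q = 0"
  shows "\<exists>m l d. 0 < m \<and> l \<in> psub B \<and> l \<noteq> 0 \<and> (\<forall>i. d i \<in> psub B) \<and> l * var h ^ m - (\<Sum>i<m. d i * var h ^ i) \<in> M"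
proof -
  define dd where "dd = (\<lambda>i. \<Sum>\<kappa>\<in>{\<kappa> \<in> keys p. count \<kappa> h = i}. term_of (\<kappa> - replicate_mset i h) (coef p \<kappa>))"
  define m where "m = Max ((\<lambda>\<kappa>. count \<kappa> h) ` keys p)"
  have ne: "keys p \<noteq> {}" using p(3) by simp
  have mle: "count \<kappa> h \<le> m" if "\<kappa> \<in> keys p" for \<kappa> using that by (auto simp: m_def)
  obtain \<kappa>0 where k0: "\<kappa>0 \<in> keys p" "count \<kappa>0 h = m"
  proof -
    have "m \<in> (\<lambda>\<kappa>. count \<kappa> h) ` keys p" unfolding m_def using ne by (intro Max_in) auto
    then show ?thesis using that by blast
  qed
  have dB: "dd i \<in> psub B" for i unfolding dd_def
  proof (rule psub_sum)
    fix \<kappa> assume k: "\<kappa> \<in> {\<kappa> \<in> keys p. count \<kappa> h = i}"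
    have "set_mset (\<kappa> - replicate_mset i h) \<subseteq> B"
    proof
      fix g assume g: "g \<in># \<kappa> - replicate_mset i h"
      then have "g \<in># \<kappa>" by (rule in_diffD)
      then have "g \<in> insert h B" using k p(1) by (auto simp: psub_def)
      moreover have "g \<noteq> h" using g k by (auto simp: in_diff_count)
      ultimately show "g \<in> B" by simp
    qed
    then show "term_of (\<kappa> - replicate_mset i h) (coef p \<kappa>) \<in> psub B" by (auto simp: psub_def split: if_splits)
  qed
  have "dd i * var h ^ i = (\<Sum>\<kappa>\<in>{\<kappa> \<in> keys p. count \<kappa> h = i}. term_of \<kappa> (coef p \<kappa>))" for i
    unfolding dd_def var_power sum_distrib_right mult_single
    by (intro sum.cong refl) (auto simp: count_le_replicate_mset_subset_eq[symmetric])
  then have "(\<Sum>i\<le>m. dd i * var h ^ i) = (\<Sum>i\<le>m. \<Sum>\<kappa>\<in>{\<kappa> \<in> keys p. count \<kappa> h = i}. term_of \<kappa> (coef p \<kappa>))" by simp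
  also have "\<dots> = (\<Sum>\<kappa>\<in>keys p. term_of \<kappa> (coef p \<kappa>))"
    using mle by (intro sum.group) auto
  also have "\<dots> = p" using poly_expand[of p] by simp
  finally have "(\<Sum>i<m. dd i * var h ^ i) + dd m * var h ^ m = p" by (simp add: lessThan_Suc_atMost[symmetric])
  then have "dd m * var h ^ m - (\<Sum>i<m. - dd i * var h ^ i) = p" by (simp add: sum_negf add.commute)
  then have r: "dd m * var h ^ m - (\<Sum>i<m. - dd i * var h ^ i) \<in> M" using p(2) by simp
  have "coef (dd m) (\<kappa>0 - replicate_mset m h) = coef p \<kappa>0"
  proof -
    have inj: "\<kappa> - replicate_mset m h = \<kappa>0 - replicate_mset m h \<longleftrightarrow> \<kappa> = \<kappa>0" if "count \<kappa> h = m" for \<kappa>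
      using that k0(2) by (metis count_le_replicate_mset_subset_eq order_refl subset_mset.diff_add)
    have "coef (dd m) (\<kappa>0 - replicate_mset m h) = (\<Sum>\<kappa>\<in>{\<kappa> \<in> keys p. count \<kappa> h = m}. if \<kappa> = \<kappa>0 then coef p \<kappa>0 else 0)"
      unfolding dd_def lookup_sum lookup_single when_def using inj by (intro sum.cong) auto
    then show ?thesis using k0 by simp
  qed
  then have dm: "dd m \<noteq> 0" using k0(1) by (auto simp: in_keys_iff)
  have "0 < m"
  proof (rule ccontr)
    assume "\<not> 0 < m"
    then have "dd m \<in> M" using r by simp
    then show False using BM dB dm by blast
  qed
  moreover have "- dd i \<in> psub B" for i using psub_diff[OF psub_simps(1) dB] by simp
  ultimately show ?thesis using r dB dm by (intro exI[of _ m] exI[of _ "dd m"] exI[of _ "\<lambda>i. - dd i"]) auto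
qed

lemma mon_nonzero: "(mon \<mu> :: ('h, 'k::field) mpoly) \<noteq> 0"
  by (metis lookup_single_eq lookup_zero zero_neq_one)

text \<open>B is a transcendence basis, among the variables, of the domain S / M. Once the product L
  of the leading coefficients of the relations is inverted, the variables outside B are integral,
  and monomials with exponents below the degrees of the relations span.\<close>

lemma zariski_span:
  fixes M :: "('h, 'k::field) mpoly set"
  assumes H: "finite H" and M: "is_prime M" and out: "\<And>h. h \<notin> H \<Longrightarrow> var h \<in> M"
    and B: "B \<subseteq> H" "\<And>q. q \<in> psub B \<Longrightarrow> q \<in> M \<Longrightarrow> q = 0"
    and mx: "\<And>h. h \<in> H - B \<Longrightarrow> \<exists>q. q \<in> psub (insert h B) \<and> q \<in> M \<and> q \<noteq> 0"
  shows "\<exists>G L. finite G \<and> 1 \<in> G \<and> L \<in> psub B \<and> L \<noteq> 0 \<and> (\<forall>p. \<exists>k. L ^ k * p \<in> dspan B M G)"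
proof -
  have Mi: "is_ideal M" using M by (rule is_primeD)
  \<comment> \<open>\<open>psub B\<close> meets the prime M only in 0 and therefore is a
    domain.\<close>
  have nz: "a * b \<noteq> 0" if "a \<in> psub B" "b \<in> psub B" "a \<noteq> 0" "b \<noteq> 0" for a b :: "('h, 'k) mpoly"
    using that B(2) is_primeD(3)[OF M, of a b] ideal_zero[OF Mi] by metis
  have "\<forall>h. \<exists>m l d. h \<in> H - B \<longrightarrow> 0 < m \<and> l \<in> psub B \<and> l \<noteq> 0 \<and> (\<forall>i. d i \<in> psub B) \<and> l * var h ^ m - (\<Sum>i<m. d i * var h ^ i) \<in> M"
  proof
    fix h
    show "\<exists>m l d. h \<in> H - B \<longrightarrow> 0 < m \<and> l \<in> psub B \<and> l \<noteq> 0 \<and> (\<forall>i. d i \<in> psub B) \<and> l * var h ^ m - (\<Sum>i<m. d i * var h ^ i) \<in> M"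
    proof (cases "h \<in> H - B")
      case True
      then obtain q where "q \<in> psub (insert h B)" "q \<in> M" "q \<noteq> 0" "h \<notin> B" using mx by blast
      from algebraic_relation[OF this Mi B(2)] show ?thesis by blast
    qed blast
  qed
  then obtain m l dd where rel[rule_format]: "\<forall>h. h \<in> H - B \<longrightarrow> 0 < m h \<and> l h \<in> psub B \<and> l h \<noteq> 0 \<and> (\<forall>i. dd h i \<in> psub B) \<and>
      l h * var h ^ m h - (\<Sum>i<m h. dd h i * var h ^ i) \<in> M" by (elim choice[THEN exE]) (rule that)
  define L where "L = (\<Prod>h\<in>H - B. l h)"
  have L: "L \<in> psub B" unfolding L_def using rel by (intro psub_prod) auto
  have L0: "L \<noteq> 0" unfolding L_def using rel by (intro psub_prod_nonzero[OF nz]) auto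
  define Gm where "Gm = {\<alpha>. set_mset \<alpha> \<subseteq> H - B \<and> (\<forall>h\<in>H - B. count \<alpha> h < m h)}"
  define G where "G = (mon ` Gm :: ('h, 'k) mpoly set)"
  have "Gm \<subseteq> {\<alpha>. set_mset \<alpha> \<subseteq> H - B \<and> size \<alpha> \<le> (\<Sum>h\<in>H - B. m h)}"
  proof
    fix \<alpha> assume a: "\<alpha> \<in> Gm"
    have "size \<alpha> = (\<Sum>h\<in>set_mset \<alpha>. count \<alpha> h)" by (rule size_multiset_overloaded_eq)
    also have "\<dots> \<le> (\<Sum>h\<in>H - B. count \<alpha> h)" using a H by (intro sum_mono2) (auto simp: Gm_def)
    also have "\<dots> \<le> (\<Sum>h\<in>H - B. m h)" using a by (intro sum_mono) (auto simp: Gm_def less_imp_le)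
    finally show "\<alpha> \<in> {\<alpha>. set_mset \<alpha> \<subseteq> H - B \<and> size \<alpha> \<le> (\<Sum>h\<in>H - B. m h)}" using a by (auto simp: Gm_def)
  qed
  then have "finite Gm" using card_monomials(1)[of "H - B"] H finite_subset by blast
  then have finG: "finite G" by (simp add: G_def)
  have "{#} \<in> Gm" using rel by (auto simp: Gm_def)
  then have one: "1 \<in> G" unfolding G_def by (metis cst_one image_eqI)
  have step: "L * (var h * g) \<in> dspan B M G" if g: "g \<in> G" and h: "h \<in> H - B" for g h
  proof -
    obtain \<alpha> where a: "\<alpha> \<in> Gm" "g = mon \<alpha>" using g by (auto simp: G_def)
    show ?thesis
    proof (cases "count \<alpha> h + 1 < m h")
      case True
      then have "add_mset h \<alpha> \<in> Gm" using a h by (auto simp: Gm_def)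
      then have "var h * g \<in> G" using a by (auto simp: G_def mult_single)
      then show ?thesis by (intro dspan_mult[OF Mi dspan_base[OF Mi finG] L])
    next
      case False
      have "count \<alpha> h < m h" using a(1) h unfolding Gm_def by blast
      then have ch: "count \<alpha> h = m h - 1" "0 < m h" using False by linarith+
      define \<beta> where "\<beta> = \<alpha> - replicate_mset (count \<alpha> h) h"
      have ab: "\<alpha> = \<beta> + replicate_mset (count \<alpha> h) h" unfolding \<beta>_def by (simp add: count_le_replicate_mset_subset_eq[symmetric])
      have eq: "var h * g = mon \<beta> * var h ^ m h"
      proof -
        have "add_mset h \<alpha> = \<beta> + replicate_mset (m h) h" using ab ch by (metis Suc_diff_1 add_mset_add_single replicate_mset_Suc union_mset_add_mset_right)
        then show ?thesis using a(2) unfolding var_power by (simp add: mult_single)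
      qed
      have bG: "mon \<beta> * var h ^ i \<in> G" if "i < m h" for i
      proof -
        have "count (\<beta> + replicate_mset i h) g = (if g = h then i else count \<alpha> g)" for g by (simp add: \<beta>_def)
        moreover have "set_mset (\<beta> + replicate_mset i h) \<subseteq> H - B"
        proof
          fix g assume "g \<in># \<beta> + replicate_mset i h"
          then have "g \<in># \<alpha> \<or> g = h" unfolding \<beta>_def by (metis in_diffD in_replicate_mset union_iff)
          then show "g \<in> H - B" using a(1) h unfolding Gm_def by blast
        qed
        ultimately have "\<beta> + replicate_mset i h \<in> Gm" using a(1) that by (auto simp: Gm_def)
        then show ?thesis unfolding var_power by (auto simp: G_def mult_single)
      qed
      have "(\<Sum>i<m h. dd h i * (mon \<beta> * var h ^ i)) \<in> dspan B M G"
        using rel[OF h] bG by (intro dspan_sum[OF Mi] dspan_mult[OF Mi dspan_base[OF Mi finG]]) auto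
      moreover have "mon \<beta> * (l h * var h ^ m h - (\<Sum>i<m h. dd h i * var h ^ i)) \<in> dspan B M G"
        using rel[OF h] by (intro dspan_ideal ideal_mult_left[OF Mi]) auto
      ultimately have "(\<Sum>i<m h. dd h i * (mon \<beta> * var h ^ i)) + mon \<beta> * (l h * var h ^ m h - (\<Sum>i<m h. dd h i * var h ^ i)) \<in> dspan B M G"
        by (rule dspan_add[OF Mi])
      then have "l h * (var h * g) \<in> dspan B M G" unfolding eq by (simp add: algebra_simps sum_distrib_left)
      then have "(\<Prod>g\<in>H - B - {h}. l g) * (l h * (var h * g)) \<in> dspan B M G"
        by (rule dspan_mult[OF Mi _ psub_prod]) (use rel in auto)
      moreover have "L = l h * (\<Prod>g\<in>H - B - {h}. l g)" unfolding L_def using h H by (intro prod.remove) auto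
      ultimately show ?thesis by (simp add: mult_ac)
    qed
  qed
  have up: "L ^ (k + j) * p \<in> dspan B M G" if "L ^ k * p \<in> dspan B M G" for k j p
    using dspan_mult[OF Mi that psub_power[OF L, of j]] by (simp add: power_add mult_ac)
  have mon: "\<exists>k. L ^ k * mon \<mu> \<in> dspan B M G" for \<mu>
  proof (induction \<mu>)
    case empty
    have "L ^ 0 * mon {#} \<in> dspan B M G" using dspan_base[OF Mi finG one] by simp
    then show ?case by blast
  next
    case (add h \<mu>)
    then obtain k where k: "L ^ k * mon \<mu> \<in> dspan B M G" by auto
    have eq: "mon (add_mset h \<mu>) = (var h * mon \<mu> :: ('h, 'k) mpoly)" by (simp add: mult_single)
    consider "h \<notin> H" | "h \<in> B" | "h \<in> H - B" by auto
    then show ?case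
    proof cases
      case 1
      have "L ^ 0 * (var h * mon \<mu>) \<in> dspan B M G" using out[OF 1] by (intro dspan_ideal) (auto intro: ideal_mult_right[OF Mi])
      then show ?thesis unfolding eq by blast
    next
      case 2
      have "var h * (L ^ k * mon \<mu>) \<in> dspan B M G" using 2 by (intro dspan_mult[OF Mi k]) simp
      then show ?thesis unfolding eq by (metis mult.left_commute)
    next
      case 3
      have "L * var h * (L ^ k * mon \<mu>) \<in> dspan B M G" using step 3 by (intro dspan_trans[OF Mi k]) (simp add: mult.assoc)
      then have "L ^ Suc k * (var h * mon \<mu>) \<in> dspan B M G" by (simp add: mult_ac)
      then show ?thesis unfolding eq by blast
    qed
  qed
  have "\<exists>k. L ^ k * p \<in> dspan B M G" for p
  proof -
    obtain k where k: "\<And>\<mu>. L ^ k \<mu> * mon \<mu> \<in> dspan B M G" using mon by metis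
    define K where "K = (\<Sum>\<mu>\<in>keys p. k \<mu>)"
    have "L ^ K * mon \<mu> \<in> dspan B M G" if "\<mu> \<in> keys p" for \<mu>
    proof -
      have "k \<mu> \<le> K" unfolding K_def using that by (intro member_le_sum) auto
      then show ?thesis using up[OF k, of \<mu> "K - k \<mu>"] by simp
    qed
    then have "(\<Sum>\<mu>\<in>keys p. cst (coef p \<mu>) * (L ^ K * mon \<mu>)) \<in> dspan B M G"
      by (intro dspan_sum[OF Mi]) (auto intro: dspan_mult[OF Mi _ psub_simps(3)])
    also have "(\<Sum>\<mu>\<in>keys p. cst (coef p \<mu>) * (L ^ K * mon \<mu>)) = L ^ K * (\<Sum>\<mu>\<in>keys p. term_of \<mu> (coef p \<mu>))"
      unfolding sum_distrib_left by (intro sum.cong refl) (metis term_eq mult.left_commute)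
    finally show ?thesis using poly_expand[of p] by auto
  qed
  then show ?thesis using finG one L L0 by blast
qed

text \<open>A field cannot be finite over a polynomial ring with one element t inverted unless B is
  empty. For u divisible by t, the inverse of 1 + u in the field yields, by comparing coefficients
  at the basis element 1, that 1 + u is a unit of the polynomial ring on B, which its degree
  forbids.\<close>

lemma zariski_independent_empty:
  fixes M :: "('h, 'k::field) mpoly set"
  assumes H: "finite H" and M: "is_prime M" "\<And>a. a \<notin> M \<Longrightarrow> \<exists>b. a * b - 1 \<in> M" and out: "\<And>h. h \<notin> H \<Longrightarrow> var h \<in> M"
    and B: "B \<subseteq> H" "\<And>q. q \<in> psub B \<Longrightarrow> q \<in> M \<Longrightarrow> q = 0"
    and mx: "\<And>h. h \<in> H - B \<Longrightarrow> \<exists>q. q \<in> psub (insert h B) \<and> q \<in> M \<and> q \<noteq> 0"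
  shows "B = {}"
proof (rule ccontr)
  assume "B \<noteq> {}"
  then obtain b where b: "b \<in> B" by auto
  have Mi: "is_ideal M" using M(1) by (rule is_primeD)
  have nz: "a * b \<noteq> 0" if "a \<in> psub B" "b \<in> psub B" "a \<noteq> 0" "b \<noteq> 0" for a b :: "('h, 'k) mpoly"
    using that B(2) is_primeD(3)[OF M(1), of a b] ideal_zero[OF Mi] by metis
  obtain G L where G: "finite G" "1 \<in> G" "L \<in> psub B" "L \<noteq> 0" "\<And>p. \<exists>k. L ^ k * p \<in> dspan B M G"
    using zariski_span[OF H M(1) out B mx] by blast
  define ind where "ind = (\<lambda>E. \<forall>c. (\<forall>g. c g \<in> psub B) \<longrightarrow> (\<Sum>g\<in>E. c g * g) \<in> M \<longrightarrow> (\<forall>g\<in>E. c g = 0))"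
  have "ind {1}" unfolding ind_def using B(2) by auto
  then have ex: "\<exists>E. E \<subseteq> G \<and> 1 \<in> E \<and> ind E" using G(2) by (intro exI[of _ "{1}"]) auto
  \<comment> \<open>A maximal independent subset of G spans up to nonzero multipliers, later
    collected in T; the element 1 is kept in it so that coefficients at 1 can be compared.\<close>
  obtain E where E: "E \<subseteq> G" "1 \<in> E" "ind E" and Emax: "\<And>E'. E' \<subseteq> G \<Longrightarrow> 1 \<in> E' \<Longrightarrow> ind E' \<Longrightarrow> card E' \<le> card E"
  proof -
    have "\<exists>E. (E \<subseteq> G \<and> 1 \<in> E \<and> ind E) \<and> (\<forall>E'. (E' \<subseteq> G \<and> 1 \<in> E' \<and> ind E') \<longrightarrow> card E' \<le> card E)"
    proof -
      obtain E0 where "E0 \<subseteq> G \<and> 1 \<in> E0 \<and> ind E0" using ex by blast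
      then show ?thesis
        by (rule ex_has_greatest_nat[where b = "Suc (card G)"]) (use G(1) card_mono in \<open>auto simp: less_Suc_eq_le\<close>)
    qed
    then show ?thesis using that by blast
  qed
  have finE: "finite E" using E(1) G(1) finite_subset by auto
  have "\<exists>t. t \<in> psub B \<and> t \<noteq> 0 \<and> t * g \<in> dspan B M E" if g: "g \<in> G" for g
  proof (cases "g \<in> E")
    case True
    then show ?thesis using dspan_base[OF Mi finE True] by (intro exI[of _ 1]) auto
  next
    case False
    then have "\<not> ind (insert g E)" using Emax[of "insert g E"] g E finE by auto
    then obtain c where c: "\<forall>g. c g \<in> psub B" "(\<Sum>x\<in>insert g E. c x * x) \<in> M" "\<exists>x\<in>insert g E. c x \<noteq> 0"
      unfolding ind_def by blast
    have s: "(\<Sum>x\<in>insert g E. c x * x) = c g * g + (\<Sum>x\<in>E. c x * x)" using finE False by simp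
    have "c g \<noteq> 0"
    proof
      assume z: "c g = 0"
      then have "\<forall>x\<in>E. c x = 0" using E(3) c s unfolding ind_def by auto
      then show False using c(3) z by auto
    qed
    have "c g * g - (\<Sum>x\<in>E. - c x * x) \<in> M" using c(2) s by (simp add: sum_negf)
    moreover have "- c x \<in> psub B" for x using c(1) psub_diff[OF psub_simps(1), of "c x" B] by simp
    ultimately have "c g * g \<in> dspan B M E" unfolding dspan_def by (intro CollectI exI[of _ "\<lambda>x. - c x"]) blast
    then show ?thesis using c(1) \<open>c g \<noteq> 0\<close> by blast
  qed
  then obtain tt where tt: "\<And>g. g \<in> G \<Longrightarrow> tt g \<in> psub B \<and> tt g \<noteq> 0 \<and> tt g * g \<in> dspan B M E" by metis
  define T where "T = (\<Prod>g\<in>G. tt g)"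
  have T1: "T \<in> psub B" unfolding T_def by (intro psub_prod) (use tt in auto)
  have T2: "T \<noteq> 0" unfolding T_def by (rule psub_prod_nonzero[OF nz]) (use tt in auto)
  note T = T1 T2
  have Tg: "T * g \<in> dspan B M E" if g: "g \<in> G" for g
  proof -
    have "T = (\<Prod>x\<in>G - {g}. tt x) * tt g" unfolding T_def using prod.remove[OF G(1) g, of tt] by (simp add: mult.commute)
    moreover have "(\<Prod>x\<in>G - {g}. tt x) * (tt g * g) \<in> dspan B M E"
      by (rule dspan_mult[OF Mi _ psub_prod]) (use tt g in auto)
    ultimately show ?thesis by (simp add: mult.assoc)
  qed
  define t where "t = L * T"
  have t: "t \<in> psub B" "t \<noteq> 0" using G(3,4) T nz psub_mult by (auto simp: t_def)
  define u where "u = t * var b"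
  have u: "u \<in> psub B" "u \<noteq> 0" unfolding u_def
    using t b psub_mult[OF t(1), of "var b"] nz[OF t(1), of "var b"] mon_nonzero[of "{#b#}"] by simp_all
  have u0: "coef u {#} = 0" by (simp add: u_def coef_mult_zero lookup_single when_def)
  have q: "1 + u \<in> psub B" using u by (intro psub_add) auto
  have "1 + u \<notin> M"
  proof
    assume "1 + u \<in> M"
    then have "1 + u = 0" using B(2) q by blast
    then have "coef (1 + u) {#} = 0" by simp
    then show False using u0 by (simp add: lookup_add lookup_one)
  qed
  then obtain p where p: "(1 + u) * p - 1 \<in> M" using M(2) by blast
  obtain k where "L ^ k * p \<in> dspan B M G" using G(5) by blast
  then have "T * (L ^ k * p) \<in> dspan B M E" using Tg by (rule dspan_trans[OF Mi])
  then have "(T ^ k * L) * (T * (L ^ k * p)) \<in> dspan B M E" using T G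
    by (intro dspan_mult[OF Mi _ psub_mult[OF psub_power]]) auto
  then have "t ^ Suc k * p \<in> dspan B M E" by (simp add: t_def power_mult_distrib mult_ac)
  then obtain c where c: "\<forall>g. c g \<in> psub B" "t ^ Suc k * p - (\<Sum>g\<in>E. c g * g) \<in> M" by (auto simp: dspan_def)
  have "(1 + u) * (t ^ Suc k * p - (\<Sum>g\<in>E. c g * g)) - t ^ Suc k * ((1 + u) * p - 1) \<in> M"
    by (intro ideal_diff[OF Mi] ideal_mult_left[OF Mi] c p)
  then have m1: "t ^ Suc k - (\<Sum>g\<in>E. (1 + u) * c g * g) \<in> M" by (simp add: algebra_simps sum_distrib_left sum.distrib)
  \<comment> \<open>These are the coefficients of a relation on E saying that t^(k+1) is 1 + u times
    a combination; independence at the element 1 gives t^(k+1) = (1 + u) * c 1.\<close>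
  define e where "e = (\<lambda>g. (if g = 1 then t ^ Suc k else 0) - (1 + u) * c g)"
  have eB: "\<forall>g. e g \<in> psub B"
  proof
    fix g :: "('h, 'k) mpoly"
    have "(if g = 1 then t ^ Suc k else 0) \<in> psub B" using psub_power[OF t(1)] by (simp del: power_Suc)
    then show "e g \<in> psub B" unfolding e_def using c(1) q by (intro psub_diff psub_mult) auto
  qed
  have "(\<Sum>g\<in>E. e g * g) = (\<Sum>g\<in>E. if g = 1 then t ^ Suc k else 0) - (\<Sum>g\<in>E. (1 + u) * c g * g)"
    unfolding sum_subtractf[symmetric] by (intro sum.cong refl) (auto simp: e_def left_diff_distrib)
  then have "(\<Sum>g\<in>E. e g * g) = t ^ Suc k - (\<Sum>g\<in>E. (1 + u) * c g * g)" using finE E(2) by simp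
  then have "(\<Sum>g\<in>E. e g * g) \<in> M" using m1 by simp
  then have "e 1 = 0" using E(2,3) eB unfolding ind_def by blast
  then have tk: "t ^ Suc k = (1 + u) * c 1" by (simp add: e_def)
  have geo: "1 - (- u) ^ n = (1 + u) * (\<Sum>i<n. (- u) ^ i)" for n
    using one_diff_power_eq[of "- u" n] by simp
  have al: "(1 + u) * (s + e * (c1 * v)) = (1 + u) * s + e * (((1 + u) * c1) * v)" for s e c1 v
    by (simp add: algebra_simps)
  \<comment> \<open>As u = t * var b, the last relation makes u^(k+1) a multiple of 1 + u. Added to
    the geometric sum it gives an inverse of 1 + u with polynomial coefficients in B.\<close>
  define w where "w = (\<Sum>i<Suc k. (- u) ^ i) + (-1) ^ Suc k * (c 1 * var b ^ Suc k)"
  have "(1 + u) * w = (1 - (- u) ^ Suc k) + (-1) ^ Suc k * (t ^ Suc k * var b ^ Suc k)"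
    unfolding geo tk w_def by (rule al)
  also have "(-1) ^ Suc k * (t ^ Suc k * var b ^ Suc k) = (- u) ^ Suc k"
    unfolding u_def by (metis power_minus power_mult_distrib)
  finally have w1: "(1 + u) * w = 1" by simp
  have "- u \<in> psub B" using psub_diff[OF psub_simps(1) u(1)] by simp
  moreover have "-1 \<in> psub B" using psub_diff[OF psub_simps(1) psub_simps(2)] by simp
  ultimately have wB: "w \<in> psub B" unfolding w_def using c(1) b
    by (intro psub_add psub_sum psub_mult psub_power) auto
  have top: "\<exists>n. size_le n r \<and> hp n r \<noteq> 0" if "r \<noteq> 0" for r :: "('h, 'k) mpoly"
  proof -
    have "keys r \<noteq> {}" using that by simp
    then have "Max (size ` keys r) \<in> size ` keys r" by (intro Max_in) auto
    then obtain m where m: "m \<in> keys r" "size m = Max (size ` keys r)" by auto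
    have "coef (hp (size m) r) m \<noteq> 0" using m by (simp add: coef_part wt_one in_keys_iff)
    then have "hp (size m) r \<noteq> 0" by auto
    moreover have "size_le (size m) r" using m(2) by auto
    ultimately show ?thesis by blast
  qed
  have "w \<noteq> 0" using w1 by auto
  then obtain n' where n': "size_le n' w" "hp n' w \<noteq> 0" using top by blast
  have "1 + u \<noteq> 0" using w1 by auto
  then obtain n where n: "size_le n (1 + u)" "hp n (1 + u) \<noteq> 0" using top by blast
  obtain m where m: "m \<in> keys u" using u(2) by (meson all_not_in_conv keys_eq_empty)
  then have "m \<noteq> {#}" using u0 by (auto simp: in_keys_iff)
  then have "m \<in> keys (1 + u)" "0 < size m" using m by (auto simp: in_keys_iff lookup_add lookup_one nonempty_has_size)
  then have "0 < n" using n(1) by fastforce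
  have hpB: "hp j r \<in> psub B" if "r \<in> psub B" for j r using that by (auto simp: psub_def keys_part)
  have "hp (n + n') ((1 + u) * w) = hp n (1 + u) * hp n' w" by (rule hp_mult_top[OF n(1) n'(1)])
  moreover have "hp n (1 + u) * hp n' w \<noteq> 0" using n(2) n'(2) hpB q wB by (intro nz) auto
  moreover have "hp (n + n') (1 :: ('h, 'k) mpoly) = 0" using \<open>0 < n\<close> by (intro part_none) auto
  ultimately show False unfolding w1 by simp
qed

text \<open>With no independent variables left the quotient is a finite-dimensional vector space, so
  the powers of y up to the size of a spanning set are dependent; the relation is divided by its top
  coefficient.\<close>

lemma zariski:
  fixes M :: "('h, 'k::field) mpoly set"
  assumes H: "finite H" and M: "is_prime M" "\<And>a. a \<notin> M \<Longrightarrow> \<exists>b. a * b - 1 \<in> M" and out: "\<And>h. h \<notin> H \<Longrightarrow> var h \<in> M"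
  shows "\<exists>m c. 0 < m \<and> y ^ m + (\<Sum>i<m. cst (c i) * y ^ i) \<in> M"
proof -
  have Mi: "is_ideal M" using M(1) by (rule is_primeD)
  define ok where "ok = (\<lambda>B. B \<subseteq> H \<and> (\<forall>q. q \<in> psub B \<longrightarrow> q \<in> M \<longrightarrow> q = 0))"
  have cstM: "c = 0" if "cst c \<in> M" for c
  proof (rule ccontr)
    assume "c \<noteq> 0"
    then have "1 \<in> M" using cst_in_ideal[OF Mi, of c 1] that by simp
    then show False using is_primeD(2)[OF M(1)] by blast
  qed
  have psub0: "q = cst (coef q {#})" if "q \<in> psub {}" for q :: "('h, 'k) mpoly"
    using that by (intro poly_mapping_eqI) (auto simp: psub_def lookup_single when_def in_keys_iff)
  have "ok {}" unfolding ok_def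
  proof (intro conjI allI impI)
    fix q assume "q \<in> psub {}" "q \<in> M"
    then have "cst (coef q {#}) \<in> M" using psub0[of q] by simp
    then show "q = 0" using cstM psub0[of q] \<open>q \<in> psub {}\<close> by (metis single_zero)
  qed simp
  then have "\<exists>B. ok B \<and> (\<forall>B'. ok B' \<longrightarrow> card B' \<le> card B)"
    by (rule ex_has_greatest_nat[where b = "Suc (card H)"]) (use H card_mono in \<open>auto simp: ok_def less_Suc_eq_le\<close>)
  then obtain B where B: "ok B" "\<And>B'. ok B' \<Longrightarrow> card B' \<le> card B" by blast
  have mx: "\<exists>q. q \<in> psub (insert h B) \<and> q \<in> M \<and> q \<noteq> 0" if h: "h \<in> H - B" for h
  proof -
    have "finite B" using B(1) H finite_subset by (auto simp: ok_def)
    then have "\<not> card (insert h B) \<le> card B" using h by simp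
    then have "\<not> ok (insert h B)" using B(2) by blast
    then show ?thesis using h B(1) by (auto simp: ok_def)
  qed
  have B1: "B \<subseteq> H" "\<And>q. q \<in> psub B \<Longrightarrow> q \<in> M \<Longrightarrow> q = 0" using B(1) by (auto simp: ok_def)
  have Be: "B = {}" by (rule zariski_independent_empty[OF H M out B1 mx])
  obtain G L where G: "finite G" "L \<in> psub B" "L \<noteq> 0" "\<And>p. \<exists>k. L ^ k * p \<in> dspan B M G"
    using zariski_span[OF H M(1) out B1 mx] by blast
  obtain l where l: "L = cst l" "l \<noteq> 0" using psub0 G(2,3) Be by (metis single_zero)
  have sp: "\<exists>c. p - (\<Sum>g\<in>G. cst (c g) * g) \<in> M" for p
  proof -
    obtain k where "L ^ k * p \<in> dspan B M G" using G(4) by blast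
    moreover have Lk: "L ^ k = cst (l ^ k)" unfolding l(1) mon_power by (induction k) (auto simp: mult_single)
    ultimately have "cst (inverse (l ^ k)) * (cst (l ^ k) * p) \<in> dspan B M G" using dspan_mult[OF Mi, of _ B G "cst (inverse (l ^ k))"] by simp
    then have "p \<in> dspan B M G" using cst_inv[of "l ^ k" p] l(2) by simp
    then obtain c where c: "\<forall>g. c g \<in> psub B" "p - (\<Sum>g\<in>G. c g * g) \<in> M" by (auto simp: dspan_def)
    then have "c = (\<lambda>g. cst (coef (c g) {#}))" using psub0 Be by auto
    then have "(\<Sum>g\<in>G. c g * g) = (\<Sum>g\<in>G. cst (coef (c g) {#}) * g)" by metis
    then show ?thesis using c(2) by (intro exI[of _ "\<lambda>g. coef (c g) {#}"]) simp
  qed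
  obtain c where c: "\<And>i. y ^ i - (\<Sum>g\<in>G. cst (c i g) * g) \<in> M"
  proof -
    have "\<forall>i. \<exists>c. y ^ i - (\<Sum>g\<in>G. cst (c g) * g) \<in> M" using sp by blast
    then show ?thesis using that by metis
  qed
  let ?I = "{..card G}"
  obtain a where a: "\<exists>i\<in>?I. a i \<noteq> 0" "\<forall>g\<in>G. (\<Sum>i\<in>?I. a i * c i g) = 0"
    using linear_dependence[OF G(1), of ?I c] by auto
  have "(\<Sum>i\<in>?I. cst (a i) * (y ^ i - (\<Sum>g\<in>G. cst (c i g) * g))) \<in> M" using c by (intro ideal_sum[OF Mi] ideal_mult_left[OF Mi])
  also have "(\<Sum>i\<in>?I. cst (a i) * (y ^ i - (\<Sum>g\<in>G. cst (c i g) * g))) = (\<Sum>i\<in>?I. cst (a i) * y ^ i) - (\<Sum>i\<in>?I. \<Sum>g\<in>G. cst (a i * c i g) * g)"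
    by (simp add: right_diff_distrib sum_subtractf sum_distrib_left cst_mult mult.assoc)
  also have "(\<Sum>i\<in>?I. \<Sum>g\<in>G. cst (a i * c i g) * g) = (\<Sum>g\<in>G. \<Sum>i\<in>?I. cst (a i * c i g) * g)" by (rule sum.swap)
  also have "\<dots> = (\<Sum>g\<in>G. cst (\<Sum>i\<in>?I. a i * c i g) * g)"
  proof (rule sum.cong[OF refl])
    fix g
    have "cst (\<Sum>i\<in>?I. a i * c i g) = (\<Sum>i\<in>?I. cst (a i * c i g) :: ('h, 'k) mpoly)"
      by (rule poly_mapping_eqI) (simp add: lookup_sum lookup_single when_def)
    then show "(\<Sum>i\<in>?I. cst (a i * c i g) * g) = cst (\<Sum>i\<in>?I. a i * c i g) * g" by (simp add: sum_distrib_right)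
  qed
  also have "\<dots> = 0" using a(2) by simp
  finally have s: "(\<Sum>i\<in>?I. cst (a i) * y ^ i) \<in> M" by simp
  define m where "m = Max {i \<in> ?I. a i \<noteq> 0}"
  have mI: "m \<in> {i \<in> ?I. a i \<noteq> 0}" unfolding m_def using a(1) by (intro Max_in) auto
  have above: "a i = 0" if "m < i" "i \<in> ?I" for i
  proof (rule ccontr)
    assume "a i \<noteq> 0"
    then have "i \<le> m" unfolding m_def using that by (intro Max_ge) auto
    then show False using that by simp
  qed
  have "(\<Sum>i\<in>?I. cst (a i) * y ^ i) = (\<Sum>i\<in>{..m}. cst (a i) * y ^ i)"
    using above mI by (intro sum.mono_neutral_right) (auto simp: not_le)
  then have "(\<Sum>i\<in>{..m}. cst (a i) * y ^ i) \<in> M" using s by simp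
  then have "(\<Sum>i<m. cst (a i) * y ^ i) + cst (a m) * y ^ m \<in> M" by (simp add: lessThan_Suc_atMost[symmetric])
  then have "cst (inverse (a m)) * ((\<Sum>i<m. cst (a i) * y ^ i) + cst (a m) * y ^ m) \<in> M" by (rule ideal_mult_left[OF Mi])
  moreover have "cst (inverse (a m)) * ((\<Sum>i<m. cst (a i) * y ^ i) + cst (a m) * y ^ m) = y ^ m + (\<Sum>i<m. cst (inverse (a m) * a i) * y ^ i)"
    using mI by (simp add: distrib_left sum_distrib_left cst_mult mult.assoc cst_inv add.commute)
  ultimately have rel: "y ^ m + (\<Sum>i<m. cst (inverse (a m) * a i) * y ^ i) \<in> M" by simp
  have "0 < m"
  proof (rule ccontr)
    assume "\<not> 0 < m"
    then have "1 \<in> M" using rel by simp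
    then show False using is_primeD(2)[OF M(1)] by blast
  qed
  then show ?thesis using rel by (intro exI[of _ m] exI[of _ "\<lambda>i. inverse (a m) * a i"] conjI)
qed

subsection \<open>Cone variables\<close>

text \<open>For \<open>\<rho>\<close> supported off C this is the coefficient of
  \<open>\<rho>\<close> when p is regarded as a polynomial in the variables outside C over those in
  C.\<close>

definition slice :: "'h set \<Rightarrow> 'h multiset \<Rightarrow> ('h, 'k::field) mpoly \<Rightarrow> ('h, 'k) mpoly" where
  "slice C \<rho> p = Abs_poly_mapping (\<lambda>\<mu>. if set_mset \<mu> \<subseteq> C then coef p (\<mu> + \<rho>) else 0)"

lemma coef_slice: "coef (slice C \<rho> p) \<mu> = (if set_mset \<mu> \<subseteq> C then coef p (\<mu> + \<rho>) else 0)"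
proof -
  have "{\<mu>. (if set_mset \<mu> \<subseteq> C then coef p (\<mu> + \<rho>) else 0) \<noteq> 0} \<subseteq> (\<lambda>\<kappa>. \<kappa> - \<rho>) ` keys p"
  proof
    fix \<mu> assume "\<mu> \<in> {\<mu>. (if set_mset \<mu> \<subseteq> C then coef p (\<mu> + \<rho>) else 0) \<noteq> 0}"
    then have "\<mu> + \<rho> \<in> keys p" by (auto simp: in_keys_iff split: if_splits)
    then show "\<mu> \<in> (\<lambda>\<kappa>. \<kappa> - \<rho>) ` keys p" by (intro image_eqI[of _ _ "\<mu> + \<rho>"]) auto
  qed
  then have "finite {\<mu>. (if set_mset \<mu> \<subseteq> C then coef p (\<mu> + \<rho>) else 0) \<noteq> 0}" by (rule finite_subset) simp
  then show ?thesis unfolding slice_def by (simp only: Abs_poly_mapping_inverse[OF CollectI])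
qed

lemma slice_add: "slice C \<rho> (p + q) = slice C \<rho> p + slice C \<rho> q"
  by (rule poly_mapping_eqI) (simp add: coef_slice lookup_add)

lemma slice_slice: "slice C {#} (slice C \<rho> p) = slice C \<rho> p"
  by (rule poly_mapping_eqI) (simp add: coef_slice)

lemma slice_mult:
  assumes u: "u \<in> psub C" and r: "set_mset \<rho> \<inter> C = {}" shows "slice C \<rho> (p * u) = slice C \<rho> p * u"
proof (rule poly_mapping_eqI)
  fix \<mu>
  show "coef (slice C \<rho> (p * u)) \<mu> = coef (slice C \<rho> p * u) \<mu>"
  proof (cases "set_mset \<mu> \<subseteq> C")
    case True
    have "(if a \<subseteq># \<mu> + \<rho> then coef u a * coef p (\<mu> + \<rho> - a) else 0) = (if a \<subseteq># \<mu> then coef u a * coef (slice C \<rho> p) (\<mu> - a) else 0)"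
      if a: "a \<in> keys u" for a
    proof -
      have aC: "set_mset a \<subseteq> C" using u a by (auto simp: psub_def)
      then have "count \<rho> h = 0 \<or> count a h = 0" for h using r by (metis count_eq_zero_iff disjoint_iff subsetD)
      then have "count a h \<le> count \<mu> h + count \<rho> h \<longleftrightarrow> count a h \<le> count \<mu> h" for h by (metis add.right_neutral le0)
      then have iff: "a \<subseteq># \<mu> + \<rho> \<longleftrightarrow> a \<subseteq># \<mu>" by (simp add: subseteq_mset_def)
      have "set_mset (\<mu> - a) \<subseteq> C" using True by (meson in_diffD subset_iff)
      moreover have "\<mu> + \<rho> - a = (\<mu> - a) + \<rho>" if "a \<subseteq># \<mu>" using that by (simp add: multiset_diff_union_assoc union_commute)
      ultimately show ?thesis using iff by (auto simp: coef_slice)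
    qed
    then have "coef (u * p) (\<mu> + \<rho>) = coef (u * slice C \<rho> p) \<mu>" unfolding coef_mult by (intro sum.cong) auto
    then show ?thesis using True by (simp add: coef_slice mult.commute)
  next
    case False
    have "\<mu> \<notin> keys (slice C \<rho> p * u)"
    proof
      assume "\<mu> \<in> keys (slice C \<rho> p * u)"
      then obtain a b where "a \<in> keys (slice C \<rho> p)" "b \<in> keys u" "\<mu> = a + b" by (rule keys_multE)
      then show False using False u by (auto simp: in_keys_iff coef_slice psub_def split: if_splits)
    qed
    then show ?thesis using False by (simp add: coef_slice in_keys_iff)
  qed
qed

text \<open>\<open>Std\<close> is a product of \<open>StdC\<close> and R, so over the polynomial
  ring on C the quotient by J is a direct sum of copies of the quotient by JC, one for each member
  of R supported off C.\<close>

locale cone =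
  fixes C :: "'h set" and Std StdC R :: "'h multiset set" and ktype :: "'k::field itself"
  assumes cone_iff: "\<And>\<mu> \<rho>. set_mset \<mu> \<subseteq> C \<Longrightarrow> set_mset \<rho> \<inter> C = {} \<Longrightarrow> \<mu> + \<rho> \<in> Std \<longleftrightarrow> \<mu> \<in> StdC \<and> \<rho> \<in> R"
    and StdC_sub: "\<And>\<mu>. \<mu> \<in> StdC \<Longrightarrow> set_mset \<mu> \<subseteq> C"
    and down: "\<And>m n. m + n \<in> Std \<Longrightarrow> n \<in> Std" "\<And>m n. m + n \<in> StdC \<Longrightarrow> n \<in> StdC"
begin

abbreviation J :: "('h, 'k) mpoly set" where "J \<equiv> mideal Std"
abbreviation JC :: "('h, 'k) mpoly set" where "JC \<equiv> mideal StdC"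

lemma slice_adjoins:
  assumes "set us \<subseteq> psub C" "p \<in> adjoins J us" "\<rho> \<in> R" "set_mset \<rho> \<inter> C = {}"
  shows "slice C \<rho> p \<in> adjoins JC us"
  using assms
proof (induction us arbitrary: p rule: rev_induct)
  case Nil
  show ?case unfolding adjoins_simps mideal_coef
  proof
    fix \<mu> assume m: "\<mu> \<in> StdC"
    then have "\<mu> + \<rho> \<in> Std" using cone_iff[OF StdC_sub] Nil by blast
    then show "coef (slice C \<rho> p) \<mu> = 0" using Nil(2) by (simp add: coef_slice mideal_coef)
  qed
next
  case (snoc u us)
  from snoc.prems(2) obtain c where c: "p - c * u \<in> adjoins J us" by (auto simp: in_adjoin)
  have "slice C \<rho> p = slice C \<rho> (p - c * u) + slice C \<rho> (c * u)" unfolding slice_add[symmetric] by simp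
  also have "slice C \<rho> (c * u) = slice C \<rho> c * u" using snoc.prems by (intro slice_mult) auto
  finally have "slice C \<rho> p - slice C \<rho> c * u = slice C \<rho> (p - c * u)" by simp
  moreover have "slice C \<rho> (p - c * u) \<in> adjoins JC us" using snoc c by (intro snoc.IH) auto
  ultimately have "slice C \<rho> p \<in> adjoin (adjoins JC us) u" by (metis in_adjoin)
  then show ?case by simp
qed

lemma mon_mult_adjoins:
  assumes "set us \<subseteq> psub C" "q \<in> adjoins JC us" "set_mset \<rho> \<inter> C = {}"
  shows "mon \<rho> * slice C {#} q \<in> adjoins J us"
  using assms
proof (induction us arbitrary: q rule: rev_induct)
  case Nil
  show ?case unfolding adjoins_simps mideal_coef
  proof
    fix \<kappa> assume k: "\<kappa> \<in> Std"
    show "coef (mon \<rho> * slice C {#} q) \<kappa> = 0"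
    proof (cases "\<rho> \<subseteq># \<kappa> \<and> set_mset (\<kappa> - \<rho>) \<subseteq> C")
      case True
      then have "\<kappa> - \<rho> \<in> StdC" using cone_iff[of "\<kappa> - \<rho>" \<rho>] k Nil(3) by simp
      then show ?thesis using Nil(2) by (simp add: coef_term_mult coef_slice mideal_coef)
    qed (auto simp: coef_term_mult coef_slice)
  qed
next
  case (snoc u us)
  from snoc.prems(2) obtain c where c: "q - c * u \<in> adjoins JC us" by (auto simp: in_adjoin)
  have "slice C {#} q = slice C {#} (q - c * u) + slice C {#} (c * u)" unfolding slice_add[symmetric] by simp
  also have "slice C {#} (c * u) = slice C {#} c * u" using snoc.prems by (intro slice_mult) auto
  finally have "mon \<rho> * slice C {#} q - (mon \<rho> * slice C {#} c) * u = mon \<rho> * slice C {#} (q - c * u)"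
    by (simp add: algebra_simps)
  moreover have "mon \<rho> * slice C {#} (q - c * u) \<in> adjoins J us" using snoc c by (intro snoc.IH) auto
  ultimately have "mon \<rho> * slice C {#} q \<in> adjoin (adjoins J us) u" by (metis in_adjoin)
  then show ?case by simp
qed

text \<open>p is reassembled from its slices; those with an index outside R lie in J anyway.\<close>

lemma adjoins_of_slices:
  assumes us: "set us \<subseteq> psub C" and p: "\<And>\<rho>. \<rho> \<in> R \<Longrightarrow> set_mset \<rho> \<inter> C = {} \<Longrightarrow> slice C \<rho> p \<in> adjoins JC us"
  shows "p \<in> adjoins J us"
proof -
  let ?f = "\<lambda>\<kappa>. filter_mset (\<lambda>h. h \<notin> C) \<kappa>"
  have co: "coef (mon (?f \<sigma>) * slice C (?f \<sigma>) p) \<kappa> = (if ?f \<sigma> = ?f \<kappa> then coef p \<kappa> else 0)" for \<sigma> \<kappa>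
  proof -
    have "?f \<sigma> \<subseteq># \<kappa> \<and> set_mset (\<kappa> - ?f \<sigma>) \<subseteq> C \<longleftrightarrow> ?f \<sigma> = ?f \<kappa>"
    proof
      assume a: "?f \<sigma> \<subseteq># \<kappa> \<and> set_mset (\<kappa> - ?f \<sigma>) \<subseteq> C"
      then have "set_mset (?f (\<kappa> - ?f \<sigma>)) = {}" unfolding set_mset_filter by blast
      then have "?f (\<kappa> - ?f \<sigma>) = {#}" by (simp only: set_mset_eq_empty_iff)
      moreover have "?f (\<kappa> - ?f \<sigma> + ?f \<sigma>) = ?f (\<kappa> - ?f \<sigma>) + ?f \<sigma>" by (simp add: filter_filter_mset)
      ultimately show "?f \<sigma> = ?f \<kappa>" using a by simp
    next
      assume a: "?f \<sigma> = ?f \<kappa>"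
      have "\<kappa> - ?f \<kappa> = filter_mset (\<lambda>h. h \<in> C) \<kappa>" by (rule multiset_eqI) simp
      then show "?f \<sigma> \<subseteq># \<kappa> \<and> set_mset (\<kappa> - ?f \<sigma>) \<subseteq> C" unfolding a by auto
    qed
    then show ?thesis by (auto simp: coef_term_mult coef_slice)
  qed
  have eq: "p = (\<Sum>\<rho>\<in>?f ` keys p. mon \<rho> * slice C \<rho> p)"
  proof (rule poly_mapping_eqI)
    fix \<kappa>
    have "coef (\<Sum>\<rho>\<in>?f ` keys p. mon \<rho> * slice C \<rho> p) \<kappa> = (\<Sum>\<rho>\<in>?f ` keys p. if \<rho> = ?f \<kappa> then coef p \<kappa> else 0)"
      unfolding lookup_sum using co by (intro sum.cong refl) auto
    also have "\<dots> = coef p \<kappa>" by (auto simp: in_keys_iff)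
    finally show "coef p \<kappa> = coef (\<Sum>\<rho>\<in>?f ` keys p. mon \<rho> * slice C \<rho> p) \<kappa>" by simp
  qed
  have "mon \<rho> * slice C \<rho> p \<in> adjoins J us" if "\<rho> \<in> ?f ` keys p" for \<rho>
  proof -
    have r: "set_mset \<rho> \<inter> C = {}" using that by auto
    show ?thesis
    proof (cases "\<rho> \<in> R")
      case True
      show ?thesis using mon_mult_adjoins[OF us p[OF True r] r] by (simp add: slice_slice)
    next
      case False
      have "mon \<rho> * slice C \<rho> p \<in> J" unfolding mideal_coef
      proof
        fix \<kappa> assume k: "\<kappa> \<in> Std"
        have "\<not> (\<rho> \<subseteq># \<kappa> \<and> set_mset (\<kappa> - \<rho>) \<subseteq> C)" using cone_iff[of "\<kappa> - \<rho>" \<rho>] k r False by auto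
        then show "coef (mon \<rho> * slice C \<rho> p) \<kappa> = 0" by (auto simp: coef_term_mult coef_slice)
      qed
      then show ?thesis using adjoins_subset by blast
    qed
  qed
  then have "(\<Sum>\<rho>\<in>?f ` keys p. mon \<rho> * slice C \<rho> p) \<in> adjoins J us"
    by (intro ideal_sum ideal_adjoins ideal_mideal) (rule down(1))
  then show ?thesis using eq by metis
qed

lemma reg_list_cone:
  assumes "set us \<subseteq> psub C" "reg_list {1} JC us" shows "reg_list {1} J us"
  unfolding reg_list_nth
proof (intro allI impI)
  fix i assume i: "i < length us"
  have u: "us ! i \<in> psub C" "set (take i us) \<subseteq> psub C" using i assms(1) set_take_subset[of i us] by (auto dest: nth_mem)
  have r: "regular_on {1} (adjoins JC (take i us)) (us ! i)" using assms(2) i by (simp add: reg_list_nth)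
  show "regular_on {1} (adjoins J (take i us)) (us ! i)" unfolding regular_on_def
  proof (intro allI impI)
    fix a assume a: "a * us ! i \<in> adjoins J (take i us)"
    have "a \<in> adjoins J (take i us)"
    proof (rule adjoins_of_slices[OF u(2)])
      fix \<rho> assume \<rho>: "\<rho> \<in> R" "set_mset \<rho> \<inter> C = {}"
      have "slice C \<rho> a * us ! i \<in> adjoins JC (take i us)"
        using slice_adjoins[OF u(2) a \<rho>] slice_mult[OF u(1) \<rho>(2)] by metis
      then show "slice C \<rho> a \<in> adjoins JC (take i us)" using r by (auto simp: regular_on_def)
    qed
    then show "\<exists>s\<in>{1}. s * a \<in> adjoins J (take i us)" by simp
  qed
qed

end

text \<open>Multiplication by a cone variable preserves \<open>Std\<close>, hence is injective
  modulo the ideal, and the quotient by its power keeps the standard monomials of smaller exponent,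
  for which the other variables are still cone variables. The second conjunct identifies the
  quotient for the comparison with the core.\<close>

lemma reg_list_cone_powers:
  fixes Std :: "'h multiset set"
  assumes "distinct ns" "\<And>m n. m + n \<in> Std \<Longrightarrow> n \<in> Std"
    and "\<And>\<kappa> h. h \<in> set ns \<Longrightarrow> \<kappa> \<in> Std \<Longrightarrow> add_mset h \<kappa> \<in> Std"
  shows "reg_list {1} (mideal Std :: ('h, 'k::field) mpoly set) (map (\<lambda>h. var h ^ m h) ns) \<and>
    adjoins (mideal Std :: ('h, 'k) mpoly set) (map (\<lambda>h. var h ^ m h) ns) = mideal {\<kappa> \<in> Std. \<forall>h\<in>set ns. count \<kappa> h < m h}"
  using assms
proof (induction ns arbitrary: Std)
  case Nil
  show ?case by simp
next
  case (Cons h ns)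
  let ?S = "{\<kappa> \<in> Std. count \<kappa> h < m h}" and ?y = "var h ^ m h :: ('h, 'k) mpoly"
  have Ji: "is_ideal (mideal Std :: ('h, 'k) mpoly set)" by (rule ideal_mideal) (rule Cons.prems(2))
  have rep: "\<kappa> + replicate_mset j h \<in> Std" if "\<kappa> \<in> Std" for \<kappa> j
    using that Cons.prems(3)[of h] by (induction j) auto
  have reg: "regular_on {1} (mideal Std) ?y" unfolding regular_on_def
  proof (intro allI impI)
    fix a :: "('h, 'k) mpoly" assume a: "a * ?y \<in> mideal Std"
    have "coef a \<kappa> = 0" if k: "\<kappa> \<in> Std" for \<kappa>
    proof -
      have "coef (mon (replicate_mset (m h) h) * a) (\<kappa> + replicate_mset (m h) h) = 0"
        using a rep[OF k] by (simp add: mideal_coef var_power mult.commute)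
      then show ?thesis by (simp add: coef_term_mult)
    qed
    then show "\<exists>s\<in>{1}. s * a \<in> mideal Std" by (simp add: mideal_coef)
  qed
  have eq: "adjoin (mideal Std) ?y = mideal ?S"
  proof (intro equalityI subsetI)
    fix p :: "('h, 'k) mpoly" assume "p \<in> adjoin (mideal Std) ?y"
    then obtain c where c: "p - c * ?y \<in> mideal Std" by (auto simp: in_adjoin)
    show "p \<in> mideal ?S" unfolding mideal_coef
    proof
      fix \<kappa> assume k: "\<kappa> \<in> ?S"
      then have "\<not> replicate_mset (m h) h \<subseteq># \<kappa>" by (simp add: count_le_replicate_mset_subset_eq[symmetric])
      then have "coef (c * ?y) \<kappa> = 0" by (simp add: var_power mult.commute[of c] coef_term_mult)
      then show "coef p \<kappa> = 0" using c k by (simp add: mideal_coef lookup_minus)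
    qed
  next
    fix p :: "('h, 'k) mpoly" assume p: "p \<in> mideal ?S"
    show "p \<in> adjoin (mideal Std) ?y"
    proof (rule ideal_of_terms[OF ideal_adjoin[OF Ji]])
      fix \<kappa> assume "\<kappa> \<in> keys p"
      then have k: "\<kappa> \<notin> ?S" using p by (auto simp: mideal_def)
      show "mon \<kappa> \<in> adjoin (mideal Std) ?y"
      proof (cases "\<kappa> \<in> Std")
        case True
        then have "replicate_mset (m h) h \<subseteq># \<kappa>" using k by (simp add: count_le_replicate_mset_subset_eq[symmetric])
        then have "mon \<kappa> = mon (\<kappa> - replicate_mset (m h) h) * ?y" by (simp add: var_power mult_single)
        then show ?thesis using ideal_mult_left[OF ideal_adjoin[OF Ji] adjoin_self[OF Ji]] by simp
      next
        case False
        then show ?thesis using adjoin_subset mon_in_mideal by blast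
      qed
    qed
  qed
  have "reg_list {1} (mideal ?S :: ('h, 'k) mpoly set) (map (\<lambda>h. var h ^ m h) ns) \<and>
    adjoins (mideal ?S :: ('h, 'k) mpoly set) (map (\<lambda>h. var h ^ m h) ns) = mideal {\<kappa> \<in> ?S. \<forall>h\<in>set ns. count \<kappa> h < m h}"
  proof (rule Cons.IH)
    show "distinct ns" using Cons.prems(1) by simp
    show "n \<in> ?S" if "k + n \<in> ?S" for k n using that Cons.prems(2)[of k n] by auto
    show "add_mset g \<kappa> \<in> ?S" if "g \<in> set ns" "\<kappa> \<in> ?S" for g \<kappa> using that Cons.prems(1,3) by auto
  qed
  moreover have "{\<kappa> \<in> ?S. \<forall>h\<in>set ns. count \<kappa> h < m h} = {\<kappa> \<in> Std. \<forall>h\<in>set (h # ns). count \<kappa> h < m h}" by auto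
  ultimately show ?case using reg eq by simp
qed

subsection \<open>Square-free monomial ideals\<close>

locale sqfree =
  fixes H :: "'h set" and Sig :: "'h multiset set" and idx :: "'h \<Rightarrow> nat" and ktype :: "'k::field itself"
  assumes finH: "finite H" and mi: "monomial_ideal H Sig" and sf: "square_free Sig" and ne: "{#} \<notin> Sig"
    and injH: "inj_on idx H"
begin

abbreviation Std :: "'h multiset set" where "Std \<equiv> standard_monomials H Sig"
abbreviation C :: "'h set" where "C \<equiv> core_set Sig"

definition StdC :: "'h multiset set" where "StdC = {m \<in> Std. set_mset m \<subseteq> C}"

text \<open>Turns out to be the dimension of the core at the irrelevant ideal.\<close>

definition dC :: nat where "dC = Max (card ` {F. F \<subseteq> C \<and> mset_set F \<in> Std})"

lemma Sig_sub: "m \<in> Sig \<Longrightarrow> set_mset m \<subseteq> H" using mi by (auto simp: monomial_ideal_def monomials_def)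

lemma Std_iff: "m \<in> Std \<longleftrightarrow> set_mset m \<subseteq> H \<and> m \<notin> Sig" by (auto simp: standard_monomials_def monomials_def)

lemma Sig_up: assumes "\<mu> \<in> Sig" "\<mu> \<subseteq># m" "set_mset m \<subseteq> H" shows "m \<in> Sig"
proof -
  have "m - \<mu> \<in> monomials H" using assms(3) by (auto simp: monomials_def dest: in_diffD)
  then have "\<mu> + (m - \<mu>) \<in> Sig" using mi assms(1) by (auto simp: monomial_ideal_def)
  then show ?thesis using assms(2) by simp
qed

lemma min_gen_below: "m \<in> Sig \<Longrightarrow> \<exists>\<mu>. min_gen Sig \<mu> \<and> \<mu> \<subseteq># m"
proof (induction "size m" arbitrary: m rule: less_induct)
  case less
  show ?case
  proof (cases "min_gen Sig m")
    case False
    then obtain \<nu> where n: "\<nu> \<in> Sig" "\<nu> \<subseteq># m" "\<nu> \<noteq> m" using less.prems by (auto simp: min_gen_def)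
    then have "size \<nu> < size m" by (simp add: mset_subset_size subset_mset.less_le)
    then show ?thesis using less.hyps n by (meson subset_mset.order_trans)
  qed auto
qed

lemma C_sub: "C \<subseteq> H" using Sig_sub by (auto simp: core_set_def min_gen_def)

lemma finC: "finite C" using C_sub finH finite_subset by blast

lemma min_gen_C: "min_gen Sig \<mu> \<Longrightarrow> set_mset \<mu> \<subseteq> C" by (auto simp: core_set_def)

text \<open>Square-freeness enters here: divisibility by a minimal generator is a matter of
  supports.\<close>

lemma min_gen_subset: assumes "min_gen Sig \<mu>" "set_mset \<mu> \<subseteq> set_mset m" shows "\<mu> \<subseteq># m"
  unfolding subseteq_mset_def
proof
  fix h
  have "count \<mu> h \<le> 1" using assms(1) sf by (auto simp: square_free_def)
  moreover have "0 < count m h" if "0 < count \<mu> h" using that assms(2) unfolding count_greater_zero_iff by blast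
  ultimately show "count \<mu> h \<le> count m h" by linarith
qed

lemma Std_supp: assumes "m \<in> Std" "set_mset n \<subseteq> set_mset m" shows "n \<in> Std"
proof (rule ccontr)
  assume "n \<notin> Std"
  then have "n \<in> Sig" using assms by (auto simp: Std_iff)
  then obtain \<mu> where m: "min_gen Sig \<mu>" "\<mu> \<subseteq># n" using min_gen_below by blast
  then have "\<mu> \<subseteq># m" using assms(2) set_mset_mono[OF m(2)] by (intro min_gen_subset) auto
  then show False using Sig_up[of \<mu> m] m(1) assms(1) by (auto simp: Std_iff min_gen_def)
qed

lemma Std_down: "m + n \<in> Std \<Longrightarrow> n \<in> Std" by (erule Std_supp) auto

lemma StdC_supp: "m \<in> StdC \<Longrightarrow> set_mset n \<subseteq> set_mset m \<Longrightarrow> n \<in> StdC" using Std_supp by (auto simp: StdC_def)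

text \<open>A variable outside the core divides no minimal generator, so it cannot make a standard
  monomial nonstandard.\<close>

lemma Std_cone: assumes "\<kappa> \<in> Std" "set_mset \<rho> \<subseteq> H - C" shows "\<kappa> + \<rho> \<in> Std"
proof (rule ccontr)
  assume "\<kappa> + \<rho> \<notin> Std"
  then have "\<kappa> + \<rho> \<in> Sig" using assms by (auto simp: Std_iff)
  then obtain \<mu> where m: "min_gen Sig \<mu>" "\<mu> \<subseteq># \<kappa> + \<rho>" using min_gen_below by blast
  then have "set_mset \<mu> \<subseteq> set_mset \<kappa>" using min_gen_C[OF m(1)] set_mset_mono[OF m(2)] assms(2) by auto
  then have "\<mu> \<subseteq># \<kappa>" by (rule min_gen_subset[OF m(1)])
  then show False using Sig_up[of \<mu> \<kappa>] m(1) assms(1) by (auto simp: Std_iff min_gen_def)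
qed

lemma empty_Std: "{#} \<in> Std" "{#} \<in> StdC" using ne by (auto simp: Std_iff StdC_def)

sublocale sr: srcomplex C idx StdC ktype
  by unfold_locales (rule finC, rule inj_on_subset[OF injH C_sub], simp add: StdC_def, rule StdC_supp)

lemma finite_faces: "finite {F. F \<subseteq> C \<and> mset_set F \<in> Std}" by (rule finite_subset[of _ "Pow C"]) (auto simp: finC)

lemma top_face: "\<exists>F. F \<subseteq> C \<and> mset_set F \<in> Std \<and> card F = dC"
proof -
  have "{} \<in> {F. F \<subseteq> C \<and> mset_set F \<in> Std}" using empty_Std by simp
  then have "dC \<in> card ` {F. F \<subseteq> C \<and> mset_set F \<in> Std}" unfolding dC_def
    using finite_faces by (intro Max_in) auto
  then show ?thesis by auto
qed

lemma face_le: assumes "F \<subseteq> C" "mset_set F \<in> Std" shows "card F \<le> dC"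
  unfolding dC_def using assms finite_faces by (intro Max_ge) auto

lemma card_StdC: assumes "m \<in> StdC" shows "card (set_mset m) \<le> dC"
  using assms StdC_supp[OF assms, of "mset_set (set_mset m)"] by (intro face_le) (auto simp: StdC_def)

lemma card_Std: assumes "m \<in> Std" shows "card (set_mset m) \<le> dC + card (H - C)"
proof -
  have "mset_set (set_mset m \<inter> C) \<in> Std" by (rule Std_supp[OF assms]) auto
  then have "card (set_mset m \<inter> C) \<le> dC" by (intro face_le) auto
  moreover have "card (set_mset m - C) \<le> card (H - C)" using assms finH by (intro card_mono) (auto simp: Std_iff)
  moreover have "card (set_mset m) = card (set_mset m \<inter> C) + card (set_mset m - C)"
    by (subst card_Un_disjoint[symmetric]) (auto intro: arg_cong[where f = card])
  ultimately show ?thesis by linarith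
qed

abbreviation JC :: "('h, 'k) mpoly set" where "JC \<equiv> mideal StdC"

lemma ideal_JC: "is_ideal JC" by (rule ideal_mideal) (auto elim: StdC_supp)

lemma ideal_JStd: "is_ideal (mideal Std :: ('h, 'k) mpoly set)" by (rule ideal_mideal) (rule Std_down)

lemma var_JC: "h \<notin> C \<Longrightarrow> var h \<in> JC" by (simp add: mon_in_mideal StdC_def)

text \<open>A prime over I avoiding the powers of p would contain all variables, hence p.\<close>

lemma radical_irr:
  fixes I :: "('h, 'k) mpoly set"
  assumes I: "is_ideal I" and Q: "\<And>Q h. is_prime Q \<Longrightarrow> I \<subseteq> Q \<Longrightarrow> var h \<in> Q" and p: "p \<in> irr"
  shows "\<exists>k>0. p ^ k \<in> I"
proof (rule ccontr)
  assume n: "\<not> (\<exists>k>0. p ^ k \<in> I)"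
  have "p ^ k \<notin> I" for k using n ideal_mult_left[OF I, of "p ^ k" p] by (metis power_Suc zero_less_Suc)
  then have "\<exists>Q. is_prime Q \<and> I \<subseteq> Q \<and> Q \<inter> range (\<lambda>k. p ^ k) = {}"
    by (intro exists_prime_avoiding[OF I]) (auto simp: power_add[symmetric] intro: range_eqI[of _ _ 0])
  then obtain Q where q: "is_prime Q" "I \<subseteq> Q" "Q \<inter> range (\<lambda>k. p ^ k) = {}" by blast
  have "p \<in> Q"
  proof (rule ideal_of_terms[OF is_primeD(1)[OF q(1)]])
    fix m assume "m \<in> keys p"
    then have "m \<noteq> {#}" using p by (auto simp: irr_def in_keys_iff)
    then obtain h where "h \<in># m" by auto
    then show "mon m \<in> Q" by (rule mon_in_ideal[OF is_primeD(1)[OF q(1)] Q[OF q(1,2)]])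
  qed
  moreover have "p \<in> range (\<lambda>k. p ^ k)" by (rule range_eqI[of _ _ 1]) simp
  ultimately show False using q(3) by blast
qed

text \<open>Degrees 1 to dC suffice for parameters: an elementary symmetric function of larger
  degree involves no face and vanishes modulo \<open>JC\<close>.\<close>

definition thetas :: "('h, 'k) mpoly list" where "thetas = map (\<lambda>j. esum (Suc j) C) [0..<dC]"

lemma length_thetas [simp]: "length thetas = dC" by (simp add: thetas_def)

lemma thetas_irr: "t \<in> set thetas \<Longrightarrow> t \<in> irr"
proof -
  assume "t \<in> set thetas"
  then obtain j where t: "t = esum (Suc j) C" by (auto simp: thetas_def)
  have "{#} \<notin> keys (esum (Suc j) C :: ('h, 'k) mpoly)"
  proof
    assume "{#} \<in> keys (esum (Suc j) C :: ('h, 'k) mpoly)"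
    then obtain F where F: "F \<subseteq> C" "card F = Suc j" "{#} = mset_set F" using keys_esum by blast
    then have "F = {}" using sr.subD(1)[OF F(1)] by (metis mset_set_empty_iff)
    then show False using F(2) by simp
  qed
  then show ?thesis by (simp add: t irr_def in_keys_iff)
qed

lemma thetas_homog: "t \<in> set thetas \<Longrightarrow> \<exists>e>0. homog (\<lambda>_. 1) e t"
proof -
  assume "t \<in> set thetas"
  then obtain j where t: "t = esum (Suc j) C" by (auto simp: thetas_def)
  show ?thesis unfolding t by (intro exI[of _ "Suc j"] conjI homog_esum[OF finC]) simp
qed

lemma thetas_psub: "t \<in> set thetas \<Longrightarrow> t \<in> psub C"
proof -
  assume "t \<in> set thetas"
  then obtain j where t: "t = esum (Suc j) C" by (auto simp: thetas_def)
  show ?thesis unfolding psub_def t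
  proof (intro CollectI ballI)
    fix m assume "m \<in> keys (esum (Suc j) C :: ('h, 'k) mpoly)"
    then obtain F where "F \<subseteq> C" "m = mset_set F" using keys_esum by blast
    then show "set_mset m \<subseteq> C" using sr.subD(1) by auto
  qed
qed

text \<open>A prime over this ideal contains all elementary symmetric functions of C of positive
  degree, the high ones through \<open>JC\<close>, and therefore every variable.\<close>

lemma powers_radical:
  assumes "length ms = dC" "p \<in> irr" shows "\<exists>k>0. p ^ k \<in> adjoins JC (sr.powers thetas ms)"
proof (rule radical_irr[OF ideal_adjoins[OF ideal_JC] _ assms(2)])
  fix Q :: "('h, 'k) mpoly set" and h :: 'h assume Q: "is_prime Q" "adjoins JC (sr.powers thetas ms) \<subseteq> Q"
  have JQ: "JC \<subseteq> Q" by (rule order_trans[OF adjoins_subset Q(2)])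
  have e: "esum j C \<in> Q" if "0 < j" for j
  proof (cases "j \<le> dC")
    case True
    have i: "j - 1 < dC" using True that by simp
    have "sr.powers thetas ms ! (j - 1) = (thetas ! (j - 1)) ^ (ms ! (j - 1))" "length (sr.powers thetas ms) = dC"
      using i assms(1) by (auto simp: sr.powers_def)
    then have "(thetas ! (j - 1)) ^ (ms ! (j - 1)) \<in> adjoins JC (sr.powers thetas ms)"
      using i nth_mem[of "j - 1" "sr.powers thetas ms"] by (intro adjoins_mem[OF ideal_JC]) auto
    then have "thetas ! (j - 1) \<in> Q" using prime_power[OF Q(1)] Q(2) by blast
    then show ?thesis using i that by (simp add: thetas_def)
  next
    case False
    have "esum j C \<in> JC" unfolding mideal_def
    proof (intro CollectI equals0I)
      fix m assume "m \<in> keys (esum j C :: ('h, 'k) mpoly) \<inter> StdC"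
      then have k: "m \<in> keys (esum j C :: ('h, 'k) mpoly)" and m: "m \<in> Std" by (auto simp: StdC_def)
      obtain F where F: "F \<subseteq> C" "card F = j" "m = mset_set F" using keys_esum[OF k] by blast
      then show False using face_le[OF F(1)] m False by simp
    qed
    then show ?thesis using JQ by blast
  qed
  show "var h \<in> Q"
  proof (cases "h \<in> C")
    case True
    show ?thesis by (rule prime_power[OF Q(1) var_power_in_esum_ideal[OF is_primeD(1)[OF Q(1)] finC True e]])
  next
    case False
    then show ?thesis using JQ var_JC by blast
  qed
qed

lemma kgen_torsion:
  fixes J :: "('h, 'k) mpoly set"
  assumes K: "koszul idx K" and J: "is_ideal J" and out: "\<And>h. h \<notin> K \<Longrightarrow> var h \<in> J" and p: "p \<in> irr"
  shows "\<exists>k>0. p ^ k \<in> koszul.kgen var K n J"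
proof -
  interpret koszul idx "var :: 'h \<Rightarrow> ('h, 'k) mpoly" K by (rule K)
  have JK: "J \<subseteq> kgen n J"
  proof
    fix a assume "a \<in> J"
    then have "a - (\<Sum>h\<in>K. var h ^ n * 0) \<in> J" by simp
    then show "a \<in> kgen n J" unfolding kgen_def by (intro CollectI exI[of _ "\<lambda>_. 0"])
  qed
  have I: "is_ideal (kgen n J)" unfolding is_ideal_def
  proof (intro conjI ballI allI)
    show "0 \<in> kgen n J" using JK ideal_zero[OF J] by blast
    fix a assume "a \<in> kgen n J"
    then obtain ra where a: "a - (\<Sum>h\<in>K. var h ^ n * ra h) \<in> J" by (auto simp: kgen_def)
    { fix b assume "b \<in> kgen n J"
      then obtain rb where b: "b - (\<Sum>h\<in>K. var h ^ n * rb h) \<in> J" by (auto simp: kgen_def)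
      have "(a + b) - (\<Sum>h\<in>K. var h ^ n * (ra h + rb h)) \<in> J"
        using ideal_add[OF J a b] by (simp add: algebra_simps sum.distrib)
      then show "a + b \<in> kgen n J" unfolding kgen_def by (intro CollectI exI[of _ "\<lambda>h. ra h + rb h"]) }
    fix r
    have "r * a - (\<Sum>h\<in>K. var h ^ n * (r * ra h)) \<in> J"
      using ideal_mult_left[OF J a, of r] by (simp add: right_diff_distrib sum_distrib_left mult.left_commute)
    then show "r * a \<in> kgen n J" unfolding kgen_def by (intro CollectI exI[of _ "\<lambda>h. r * ra h"])
  qed
  show ?thesis
  proof (rule radical_irr[OF I _ p])
    fix Q :: "('h, 'k) mpoly set" and h :: 'h assume Q: "is_prime Q" "kgen n J \<subseteq> Q"
    show "var h \<in> Q"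
    proof (cases "h \<in> K")
      case True
      have "(\<Sum>g\<in>K. var g ^ n * (if g = h then 1 else 0)) = (var h ^ n :: ('h, 'k) mpoly)"
        using True finC by (subst sum.remove[OF _ True]) auto
      then have "var h ^ n - (\<Sum>g\<in>K. var g ^ n * (if g = h then 1 else 0)) \<in> J" using ideal_zero[OF J] by simp
      then have "var h ^ n \<in> kgen n J" unfolding kgen_def by (intro CollectI exI[of _ "\<lambda>g. if g = h then 1 else 0"])
      then show ?thesis using Q prime_power[OF Q(1)] by blast
    next
      case False
      then show ?thesis using out JK Q(2) by blast
    qed
  qed
qed

text \<open>The polynomial ring on a largest face gives a chain of this length; the growth of the
  number of standard monomials excludes longer ones.\<close>

lemma prime_chain_JC: "prime_chain JC irr dC" "prime_chain JC irr n \<Longrightarrow> n \<le> dC"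
proof -
  obtain F where F: "F \<subseteq> C" "mset_set F \<in> Std" "card F = dC" using top_face by blast
  have fF: "finite F" using F(1) by (rule sr.subD)
  have "JC \<subseteq> mideal {m. set_mset m \<subseteq> F}"
  proof
    fix p assume p: "p \<in> JC"
    have "m \<in> StdC" if "set_mset m \<subseteq> F" for m using Std_supp[OF F(2), of m] that F(1) fF by (auto simp: StdC_def)
    then show "p \<in> mideal {m. set_mset m \<subseteq> F}" using p by (auto simp: mideal_def)
  qed
  then show "prime_chain JC irr dC" using prime_chain_mono[OF prime_chain_face[OF fF]] F(3) by simp
  show "n \<le> dC" if "prime_chain JC irr n"
    by (rule dim_le_faces[OF finC _ card_StdC order_refl that]) (auto simp: StdC_def)
qed

text \<open>The exponents are completed by ones to a full system of parameters, to which the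
  Buchsbaum property applies at \<open>irr\<close>; homogeneity then removes the multiplier outside
  \<open>irr\<close>.\<close>

lemma weak_parameters:
  assumes L: "locring JC irr L fr" "buchsbaum_local L"
    and ms: "length ms < dC" "0 \<notin> set ms" "0 < m" and h: "h \<in> C"
    and a: "a * (thetas ! length ms) ^ m \<in> adjoins JC (sr.powers thetas ms)"
  shows "var h * a \<in> adjoins JC (sr.powers thetas ms)"
proof -
  interpret L: locring JC irr L fr by (rule L(1))
  let ?ms = "ms @ m # replicate (dC - Suc (length ms)) 1"
  let ?us = "sr.powers thetas ?ms"
  have len: "length ?ms = dC" "length ?us = dC" using ms(1) by (auto simp: sr.powers_def)
  have nth: "?us ! length ms = (thetas ! length ms) ^ m" using ms(1) by (simp add: sr.powers_def nth_append)
  have tk: "take (length ms) ?us = sr.powers thetas ms" using ms(1)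
    by (intro nth_equalityI) (auto simp: sr.powers_def nth_append)
  have pos: "?ms ! j > 0" if "j < dC" for j
  proof -
    have "?ms ! j \<in> set ?ms" using that len(1) by (intro nth_mem) simp
    then show ?thesis using ms(2,3) by (intro Nat.gr0I) auto
  qed
  have irr_us: "set ?us \<subseteq> irr"
  proof
    fix u assume "u \<in> set ?us"
    then obtain j where j: "j < dC" "u = ?us ! j" using len(2) by (metis in_set_conv_nth)
    then have "u = (thetas ! j) ^ (?ms ! j)" using len by (simp add: sr.powers_def)
    moreover have "(thetas ! j) ^ k \<in> irr" if "0 < k" for k
      using that thetas_irr[of "thetas ! j"] j(1) ideal_mult_right[OF is_primeD(1)[OF prime_irr], of "thetas ! j"] by (cases k) auto
    ultimately show "u \<in> irr" using pos[OF j(1)] by simp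
  qed
  have hom: "homog_ideal (\<lambda>_. 1) (adjoins JC (sr.powers thetas ms))"
  proof (rule homog_ideal_adjoins[OF ideal_JC homog_ideal_mideal])
    fix u assume "u \<in> set (sr.powers thetas ms)"
    then obtain t k where "t \<in> set thetas" "u = t ^ k" by (auto simp: sr.powers_def dest!: set_zip_leftD)
    then show "\<exists>e. homog (\<lambda>_. 1) e u" using thetas_homog homog_power by blast
  qed
  obtain e where e: "homog (\<lambda>_. 1) e (thetas ! length ms)" using thetas_homog[of "thetas ! length ms"] ms(1) by auto
  show ?thesis
  proof (rule homog_ideal_weak[OF ideal_adjoins[OF ideal_JC] hom _ homog_power[OF e] _ a])
    fix b assume b: "b * (thetas ! length ms) ^ m \<in> adjoins JC (sr.powers thetas ms)"
    have "\<exists>s. s \<notin> irr \<and> s * (b * var h) \<in> adjoins JC (take (length ms) ?us)"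
    proof (rule L.weak_of_buchsbaum[OF L(2)])
      show "prime_chain JC irr (length ?us)" using prime_chain_JC(1) len by simp
      show "n \<le> length ?us" if "prime_chain JC irr n" for n using prime_chain_JC(2)[OF that] len by simp
      show "\<exists>k. p ^ k \<in> adjoins JC ?us" if "p \<in> irr" for p using powers_radical[OF len(1) that] by blast
      show "b * ?us ! length ms \<in> adjoins JC (take (length ms) ?us)" using b unfolding nth tk .
    qed (use irr_us ms len in \<open>auto simp: mon_in_irr\<close>)
    then show "\<exists>s. s \<notin> irr \<and> s * (b * var h) \<in> adjoins JC (sr.powers thetas ms)" unfolding tk .
  qed simp
qed

text \<open>The Buchsbaum hypothesis supplies annihilation by the variables of C, the input of the
  multigraded analysis; Z is the simplicial statement that has to come from A.\<close>

lemma vanish_core: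
  assumes L: "locring JC irr L fr" "buchsbaum_local L" and i: "i < dC"
    and Z: "\<And>g. (\<And>F. \<not> (F \<subseteq> C \<and> mset_set F \<in> StdC) \<Longrightarrow> g F = 0) \<Longrightarrow>
      (\<And>G. G \<subseteq> C \<Longrightarrow> mset_set G \<in> StdC \<Longrightarrow> card G = Suc i \<Longrightarrow> sr.sd g G = 0) \<Longrightarrow>
      \<exists>b. \<forall>F. F \<subseteq> C \<and> mset_set F \<in> StdC \<and> card F = i \<longrightarrow> sr.sd b F = g F"
  shows "sr.vanish {1} JC i"
  unfolding sr.JS_def[symmetric]
proof (rule sr.vanish_JS[OF _ Z])
  fix n c v assume v: "v \<in> C" and c: "sr.cocycle sr.JS i n c"
  have p0: "sr.powers thetas [] = []" by (simp add: sr.powers_def)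
  have K: "koszul idx C" by (rule sr.koszul_axioms)
  have "sr.trivial {1} (adjoins JC (sr.powers thetas [])) i n (\<lambda>F. var v * c F)"
  proof (rule sr.weak_list_annihilates[OF ideal_JC _ _ v])
    show "var h * a \<in> adjoins JC (sr.powers thetas ms)"
      if "length ms < length thetas" "0 \<notin> set ms" "0 < m" "h \<in> C" "a * (thetas ! length ms) ^ m \<in> adjoins JC (sr.powers thetas ms)" for ms m a h
      using that by (intro weak_parameters[OF L]) auto
    show "\<exists>m>0. t ^ m \<in> sr.kgen n JC" if "t \<in> set thetas" for t n
      by (rule kgen_torsion[OF K ideal_JC var_JC thetas_irr[OF that]])
    show "i + length ([] :: nat list) < length thetas" using i by simp
    show "sr.cocycle (adjoins JC (sr.powers thetas [])) i n c" using c unfolding p0 adjoins_simps sr.JS_def .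
  qed simp
  then show "sr.trivial {1} sr.JS i n (\<lambda>F. var v * c F)" unfolding p0 adjoins_simps sr.JS_def .
qed

text \<open>A weak sequence in a ring whose local cohomology vanishes below its length is regular.
  All positive exponents are allowed because the maximal ideal at hand will dictate them.\<close>

lemma reg_list_powers:
  assumes L: "locring JC irr L fr" "buchsbaum_local L" and van: "\<And>i. i < dC \<Longrightarrow> sr.vanish {1} JC i"
    and ms: "length ms = dC" "0 \<notin> set ms"
  shows "reg_list {1} JC (sr.powers thetas ms)"
proof -
  have len: "length (sr.powers thetas ms) = dC" unfolding sr.powers_def length_map length_zip ms(1) length_thetas by (rule min.idem)
  have v: "sr.vanish {1} JC i" if "i < length (sr.powers thetas ms)" for i using van[of i] that unfolding len .
  have w: "var h * a \<in> adjoins JC (take i (sr.powers thetas ms))" if i: "i < length (sr.powers thetas ms)" and h: "h \<in> C"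
    and a: "a * sr.powers thetas ms ! i \<in> adjoins JC (take i (sr.powers thetas ms))" for i a h
  proof -
    have tk: "take i (sr.powers thetas ms) = sr.powers thetas (take i ms)" using i ms(1)
      by (intro nth_equalityI) (auto simp: sr.powers_def)
    have nth: "sr.powers thetas ms ! i = (thetas ! length (take i ms)) ^ (ms ! i)" using i ms(1) by (simp add: sr.powers_def)
    have m: "0 < ms ! i" using i ms len by (metis Nat.gr0I nth_mem)
    show "var h * a \<in> adjoins JC (take i (sr.powers thetas ms))" unfolding tk
    proof (rule weak_parameters[OF L _ _ m h])
      show "length (take i ms) < dC" using i len ms(1) by simp
      show "0 \<notin> set (take i ms)" using ms(2) by (meson in_set_takeD)
      show "a * thetas ! length (take i ms) ^ (ms ! i) \<in> adjoins JC (sr.powers thetas (take i ms))" using a unfolding tk nth .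
    qed
  qed
  show ?thesis by (rule sr.reg_list_of_weak_vanish[OF ideal_JC w v])
qed

end

subsection \<open>Comparison of a Hodge algebra with its discrete counterpart\<close>

text \<open>Cochains on C are extended by zero to K. Deleting a variable outside C produces a factor
  in J as soon as the exponent is positive, which is arranged by raising it first.\<close>

lemma vanish_restrict:
  fixes x :: "'h \<Rightarrow> 'r::comm_ring_1"
  assumes K: "koszul idx K" and CK: "C \<subseteq> K" and J: "is_ideal J" and out: "\<And>h. h \<in> K - C \<Longrightarrow> x h \<in> J"
    and v: "koszul.vanish idx x K U J i"
  shows "koszul.vanish idx x C U J i"
proof -
  interpret K: koszul idx x K by (rule K)
  interpret C: koszul idx x C using CK K.finC K.inj by unfold_locales (auto intro: finite_subset inj_on_subset)
  have pos: "C.trivial U J i n c" if n: "0 < n" and c: "C.cocycle J i n c" for n c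
  proof -
    let ?c = "\<lambda>F. if F \<subseteq> C then c F else 0"
    have "K.cocycle J i n ?c" unfolding K.cocycle_def
    proof (intro allI impI)
      fix G assume G: "G \<subseteq> K \<and> card G = Suc i"
      show "K.d n ?c G \<in> J"
      proof (cases "G \<subseteq> C")
        case True
        have "K.d n ?c G = C.d n c G" unfolding kdiff_def using True by (intro sum.cong refl) auto
        then show ?thesis using c G True by (simp add: C.cocycle_def)
      next
        case False
        show ?thesis unfolding kdiff_def
        proof (rule ideal_sum[OF J])
          fix h assume h: "h \<in> G"
          show "ksgn idx h G * x h ^ n * ?c (G - {h}) \<in> J"
          proof (cases "G - {h} \<subseteq> C")
            case True
            then have "h \<in> K - C" using False h G by auto
            then have "x h ^ n \<in> J" using n ideal_mult_right[OF J out] by (cases n) auto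
            then show ?thesis by (intro ideal_mult_right[OF J] ideal_mult_left[OF J])
          next
            case False
            then show ?thesis using ideal_zero[OF J] by simp
          qed
        qed
      qed
    qed
    then have "K.trivial U J i n ?c" by (rule K.vanishD[OF v])
    then obtain s N b where s: "s \<in> U" "\<forall>F. F \<subseteq> K \<and> card F = i \<longrightarrow> s * (K.xp F ^ N * ?c F) - K.d (n + N) b F \<in> J"
      by (rule K.trivialE)
    show ?thesis
    proof (rule C.trivialI[OF s(1)])
      fix F assume F: "F \<subseteq> C" "card F = i"
      then show "s * (C.xp F ^ N * c F) - C.d (n + N) b F \<in> J" using s(2)[rule_format, of F] CK by auto
    qed
  qed
  show ?thesis unfolding C.vanish_def
  proof (intro allI impI)
    fix n c assume c: "C.cocycle J i n c"
    have "C.cocycle J i (n + 1) (\<lambda>F. C.xp F ^ 1 * c F)" unfolding C.cocycle_def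
    proof (intro allI impI)
      fix G assume G: "G \<subseteq> C \<and> card G = Suc i"
      have "C.d (n + 1) (\<lambda>F. C.xp F ^ 1 * c F) G = C.xp G ^ 1 * C.d n c G"
        using G by (intro kdiff_raise) (auto simp: C.subD)
      then show "C.d (n + 1) (\<lambda>F. C.xp F ^ 1 * c F) G \<in> J"
        using ideal_mult_left[OF J, of "C.d n c G"] c G by (auto simp: C.cocycle_def)
    qed
    then have "C.trivial U J i (n + 1) (\<lambda>F. C.xp F ^ 1 * c F)" by (intro pos) simp
    then show "C.trivial U J i n c" by (rule C.trivial_shift)
  qed
qed

lemma keys_mon_mult:
  assumes "n \<in> keys (mon m * p :: ('h, 'k::field) mpoly)" shows "\<exists>b\<in>keys p. n = m + b"
proof -
  obtain a b where "a \<in> keys (mon m :: ('h, 'k) mpoly)" "b \<in> keys p" "n = a + b" using assms by (rule keys_multE)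
  then show ?thesis by (auto split: if_splits)
qed

lemma wt_ge_member: "y \<in># \<nu> \<Longrightarrow> w y \<le> wt w \<nu>"
  by (metis insert_DiffM le_add1 wt_empty(3))

lemma wt_le_size: "(\<And>h. h \<in># \<mu> \<Longrightarrow> w h \<le> B) \<Longrightarrow> wt w \<mu> \<le> size \<mu> * B"
proof (induction \<mu>)
  case (add h \<mu>)
  have "w h \<le> B" "wt w \<mu> \<le> size \<mu> * B" using add by auto
  then show ?case by simp
qed simp

text \<open>A is replaced by the kernel \<open>JA\<close> of its presentation on all variables of
  the type; \<open>expand\<close> and \<open>basisA\<close> together are the basis property,
  \<open>straightA\<close> is the straightening condition.\<close>

locale hodge = sqfree H Sig idx ktype
  for H :: "'h set" and Sig :: "'h multiset set" and idx :: "'h \<Rightarrow> nat" and ktype :: "'k::field itself" +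
  fixes JA :: "('h, 'k) mpoly set" and dg :: "'h \<Rightarrow> nat" and leq :: "'h \<Rightarrow> 'h \<Rightarrow> bool"
  assumes JA: "is_ideal JA" and homJA: "homog_ideal dg JA" and dgpos: "0 < dg h"
    and outA: "h \<notin> H \<Longrightarrow> var h \<in> JA"
    and expand: "\<exists>q. p - q \<in> JA \<and> keys q \<subseteq> Std"
    and basisA: "p \<in> JA \<Longrightarrow> keys p \<subseteq> Std \<Longrightarrow> p = 0"
    and straightA: "min_gen Sig \<mu> \<Longrightarrow> mon \<mu> - q \<in> JA \<Longrightarrow> keys q \<subseteq> Std \<Longrightarrow> \<nu> \<in> keys q \<Longrightarrow> z \<in># \<mu> \<Longrightarrow>
      \<exists>y. y \<in># \<nu> \<and> leq y z \<and> y \<noteq> z"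
    and po: "partial_order_on_set H leq"
begin

text \<open>By homogeneity the constant term of an element of \<open>JA\<close> lies in
  \<open>JA\<close>, and a constant is a combination of standard monomials.\<close>

lemma JA_irr: "JA \<subseteq> irr"
proof
  fix p assume p: "p \<in> JA"
  have w0: "wt dg m = 0 \<longleftrightarrow> m = {#}" for m
    using size_le_wt[of m dg] dgpos by (auto simp: Suc_le_eq)
  have eq: "hpart dg 0 p = cst (coef p {#})" by (rule poly_mapping_eqI) (auto simp: coef_part w0 lookup_single when_def)
  have "cst (coef p {#}) \<in> JA" using homJA p unfolding homog_ideal_def eq[symmetric] by blast
  then have "(cst (coef p {#}) :: ('h, 'k) mpoly) = 0" using empty_Std by (intro basisA) auto
  then have "coef (cst (coef p {#}) :: ('h, 'k) mpoly) {#} = 0" by simp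
  then show "p \<in> irr" by (simp add: irr_def)
qed

text \<open>A standard monomial times a cone variable is standard again, without straightening.
  Hence modulo \<open>JA\<close> the ideal of the cone variables is spanned by the standard
  monomials that they divide.\<close>

lemma cone_adjoins:
  assumes "set ms \<subseteq> H - C" "p \<in> adjoins JA (map var ms)"
  shows "\<exists>q. p - q \<in> JA \<and> keys q \<subseteq> Std \<and> (\<forall>\<kappa>\<in>keys q. set_mset \<kappa> \<inter> set ms \<noteq> {})"
  using assms
proof (induction ms arbitrary: p rule: rev_induct)
  case Nil
  then show ?case by (intro exI[of _ 0]) simp
next
  case (snoc h ms)
  have "p \<in> adjoin (adjoins JA (map var ms)) (var h)" using snoc.prems(2) by simp
  then obtain c where c: "p - c * var h \<in> adjoins JA (map var ms)" unfolding in_adjoin by blast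
  have "set ms \<subseteq> H - C" using snoc.prems(1) by simp
  from snoc.IH[OF this c] obtain q where
    q: "p - c * var h - q \<in> JA" "keys q \<subseteq> Std" "\<forall>\<kappa>\<in>keys q. set_mset \<kappa> \<inter> set ms \<noteq> {}" by blast
  obtain s where s: "c - s \<in> JA" "keys s \<subseteq> Std" using expand by blast
  have "(p - c * var h - q) + var h * (c - s) \<in> JA" by (intro ideal_add[OF JA] q ideal_mult_left[OF JA] s)
  then have 1: "p - (q + s * var h) \<in> JA" by (simp add: algebra_simps)
  have 2: "\<kappa> \<in> Std \<and> h \<in># \<kappa>" if k: "\<kappa> \<in> keys (s * var h)" for \<kappa>
  proof -
    obtain a where a: "a \<in> keys s" "\<kappa> = {#h#} + a" using keys_mon_mult[of \<kappa> "{#h#}" s] k by (auto simp: mult.commute)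
    then show ?thesis using Std_cone[of a "{#h#}"] s(2) snoc.prems(1) by (auto simp: union_commute)
  qed
  have "\<kappa> \<in> keys q \<or> \<kappa> \<in> keys (s * var h)" if "\<kappa> \<in> keys (q + s * var h)" for \<kappa> using that keys_add[of q "s * var h"] by blast
  then have "keys (q + s * var h) \<subseteq> Std \<and> (\<forall>\<kappa>\<in>keys (q + s * var h). set_mset \<kappa> \<inter> set (ms @ [h]) \<noteq> {})"
    using q(2,3) 2 by auto
  then show ?case using 1 by (intro exI[of _ "q + s * var h"] conjI) auto
qed

lemma basis_adjoins:
  assumes ms: "set ms \<subseteq> H - C" and p: "p \<in> adjoins JA (map var ms)"
    and k: "\<And>\<kappa>. \<kappa> \<in> keys p \<Longrightarrow> \<kappa> \<in> Std \<and> set_mset \<kappa> \<inter> set ms = {}"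
  shows "p = 0"
proof -
  obtain q where q: "p - q \<in> JA" "keys q \<subseteq> Std" "\<forall>\<kappa>\<in>keys q. set_mset \<kappa> \<inter> set ms \<noteq> {}" using cone_adjoins[OF ms p] by blast
  have "keys (p - q) \<subseteq> Std" using keys_diff[of p q] k q(2) by blast
  then have "p = q" using basisA[OF q(1)] by simp
  then have "keys p = {}" using q(3) k by blast
  then show ?thesis by simp
qed

text \<open>On the standard monomials free of the earlier cone variables, multiplication by h is an
  injective relabelling, so it annihilates nothing.\<close>

lemma reg_list_cone_vars:
  assumes "distinct ms" "set ms \<subseteq> H - C" shows "reg_list {1} JA (map var ms)"
  using assms
proof (induction ms rule: rev_induct)
  case (snoc h ms)
  let ?I = "adjoins JA (map var ms)"
  have I: "is_ideal ?I" by (rule ideal_adjoins[OF JA])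
  have "regular_on {1} ?I (var h)" unfolding regular_on_def
  proof (intro allI impI)
    fix a assume a: "a * var h \<in> ?I"
    obtain s where s: "a - s \<in> JA" "keys s \<subseteq> Std" using expand by blast
    let ?Q = "\<lambda>\<kappa>. set_mset \<kappa> \<inter> set ms = {}"
    have sub: "JA \<subseteq> ?I" by (rule adjoins_subset)
    have s2: "part (\<lambda>\<kappa>. \<not> ?Q \<kappa>) s \<in> ?I"
    proof (rule ideal_of_terms[OF I])
      fix m assume "m \<in> keys (part (\<lambda>\<kappa>. \<not> ?Q \<kappa>) s)"
      then obtain g where g: "g \<in># m" "g \<in> set ms" by (auto simp: keys_part)
      have "var g \<in> ?I" using g(2) by (intro adjoins_mem[OF JA]) auto
      then show "mon m \<in> ?I" by (rule mon_in_ideal[OF I _ g(1)])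
    qed
    have eq: "a = (a - s) + (part ?Q s + part (\<lambda>\<kappa>. \<not> ?Q \<kappa>) s)" unfolding part_split by simp
    have "a * var h - var h * ((a - s) + part (\<lambda>\<kappa>. \<not> ?Q \<kappa>) s) \<in> ?I"
      using s(1) sub s2 by (intro ideal_diff[OF I a] ideal_mult_left[OF I] ideal_add[OF I]) auto
    also have "a * var h - var h * ((a - s) + part (\<lambda>\<kappa>. \<not> ?Q \<kappa>) s) = var h * part ?Q s"
      by (subst (1) eq) (simp add: algebra_simps)
    finally have m: "var h * part ?Q s \<in> ?I" .
    have "var h * part ?Q s = 0"
    proof (rule basis_adjoins[OF _ m])
      show "set ms \<subseteq> H - C" using snoc.prems by auto
      fix \<kappa> assume "\<kappa> \<in> keys (var h * part ?Q s)"
      from keys_mon_mult[OF this] obtain b where b: "b \<in> keys s" "?Q b" "\<kappa> = {#h#} + b" unfolding keys_part by blast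
      then show "\<kappa> \<in> Std \<and> set_mset \<kappa> \<inter> set ms = {}" using Std_cone[of b "{#h#}"] s(2) snoc.prems by (auto simp: union_commute)
    qed
    then have "coef (var h * part ?Q s) (m + {#h#}) = 0" for m by (simp only: lookup_zero)
    then have "coef (part ?Q s) m = 0" for m unfolding coef_term_mult by simp
    then have "part ?Q s = 0" by (intro poly_mapping_eqI) simp
    then have "a = (a - s) + part (\<lambda>\<kappa>. \<not> ?Q \<kappa>) s" using eq by simp
    moreover have "(a - s) + part (\<lambda>\<kappa>. \<not> ?Q \<kappa>) s \<in> ?I" using s(1) sub s2 by (intro ideal_add[OF I]) auto
    ultimately show "\<exists>s\<in>{1}. s * a \<in> ?I" by simp
  qed
  then show ?case using snoc by (simp add: reg_list_append)
qed simp

definition ns :: "'h list" where "ns = (SOME ns. distinct ns \<and> set ns = H - C)"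

lemma ns: "distinct ns" "set ns = H - C" "length ns = card (H - C)"
proof -
  have "\<exists>ns. distinct ns \<and> set ns = H - C" using finite_distinct_list[of "H - C"] finH by auto
  then have "distinct ns \<and> set ns = H - C" unfolding ns_def by (rule someI_ex)
  then show "distinct ns" "set ns = H - C" "length ns = card (H - C)" using distinct_card[of ns] by auto
qed

definition J1 :: "('h, 'k) mpoly set" where "J1 = adjoins JA (map var ns)"

lemma ideal_J1: "is_ideal J1" unfolding J1_def by (rule ideal_adjoins[OF JA])

lemma JA_J1: "JA \<subseteq> J1" unfolding J1_def by (rule adjoins_subset)

lemma var_J1: assumes "h \<notin> C" shows "var h \<in> J1"
proof (cases "h \<in> H")
  case True
  then show ?thesis unfolding J1_def using assms ns(2) by (intro adjoins_mem[OF JA]) auto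
next
  case False
  then show ?thesis using outA JA_J1 by blast
qed

text \<open>Smaller elements get larger weights, as the exponent counts the elements above h. The
  base exceeds the number of factors of a square-free monomial on H, so one factor below z outweighs
  any such monomial whose factors weigh at most \<open>ww z\<close>.\<close>

definition ww :: "'h \<Rightarrow> nat" where "ww h = (if h \<in> H then (card H + 1) ^ card {g \<in> H. leq h g \<and> h \<noteq> g} else 0)"

lemma ww_less: assumes "y \<in> H" "z \<in> H" "leq y z" "y \<noteq> z" shows "(card H + 1) * ww z \<le> ww y"
proof -
  have p: "\<And>a b c. a \<in> H \<Longrightarrow> b \<in> H \<Longrightarrow> c \<in> H \<Longrightarrow> leq a b \<Longrightarrow> leq b c \<Longrightarrow> leq a c"
    "\<And>a b. a \<in> H \<Longrightarrow> b \<in> H \<Longrightarrow> leq a b \<Longrightarrow> leq b a \<Longrightarrow> a = b" using po unfolding partial_order_on_set_def by blast+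
  have "insert z {g \<in> H. leq z g \<and> z \<noteq> g} \<subseteq> {g \<in> H. leq y g \<and> y \<noteq> g}"
    using assms p(1)[of y z] p(2)[of y z] by auto
  then have "card (insert z {g \<in> H. leq z g \<and> z \<noteq> g}) \<le> card {g \<in> H. leq y g \<and> y \<noteq> g}" using finH by (intro card_mono) auto
  moreover have "card (insert z {g \<in> H. leq z g \<and> z \<noteq> g}) = Suc (card {g \<in> H. leq z g \<and> z \<noteq> g})"
    by (rule card_insert_disjoint) (use finH in auto)
  ultimately have "Suc (card {g \<in> H. leq z g \<and> z \<noteq> g}) \<le> card {g \<in> H. leq y g \<and> y \<noteq> g}" by linarith
  then have "(card H + 1) ^ Suc (card {g \<in> H. leq z g \<and> z \<noteq> g}) \<le> (card H + 1) ^ card {g \<in> H. leq y g \<and> y \<noteq> g}"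
    by (intro power_increasing) auto
  then show ?thesis using assms by (simp add: ww_def)
qed

text \<open>The straightening condition is applied to a factor z of greatest weight in the generator
  and provides a factor y < z of the term; square-freeness bounds the generator by card H * ww z,
  which is less than ww y.\<close>

lemma straight_weight:
  assumes \<mu>: "min_gen Sig \<mu>" and q: "mon \<mu> - q \<in> JA" "keys q \<subseteq> Std" "\<nu> \<in> keys q"
  shows "wt ww \<mu> < wt ww \<nu>"
proof -
  have "\<mu> \<noteq> {#}" using \<mu> ne by (auto simp: min_gen_def)
  then have "Max (ww ` set_mset \<mu>) \<in> ww ` set_mset \<mu>" by (intro Max_in) auto
  then obtain z where z: "z \<in># \<mu>" "ww z = Max (ww ` set_mset \<mu>)" by auto
  have zm: "ww h \<le> ww z" if "h \<in># \<mu>" for h using that z(2) by simp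
  have mH: "set_mset \<mu> \<subseteq> H" using \<mu> Sig_sub by (auto simp: min_gen_def)
  obtain y where y: "y \<in># \<nu>" "leq y z" "y \<noteq> z" using straightA[OF \<mu> q z(1)] by blast
  have "\<nu> \<in> Std" using q(2,3) by blast
  then have yH: "y \<in> H" using y(1) unfolding Std_iff by blast
  have "size \<mu> = (\<Sum>h\<in>set_mset \<mu>. count \<mu> h)" by (rule size_multiset_overloaded_eq)
  also have "\<dots> \<le> (\<Sum>h\<in>set_mset \<mu>. 1)" using sf \<mu> by (intro sum_mono) (auto simp: square_free_def)
  also have "\<dots> \<le> card H" using mH finH by (simp add: card_mono)
  finally have sz: "size \<mu> \<le> card H" .
  have "wt ww \<mu> \<le> size \<mu> * ww z" using zm by (rule wt_le_size)
  also have "\<dots> \<le> card H * ww z" using sz by (rule mult_le_mono1)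
  also have "\<dots> < (card H + 1) * ww z" using z(1) mH by (auto simp: ww_def)
  also have "\<dots> \<le> ww y" using yH z(1) mH y by (intro ww_less) auto
  also have "\<dots> \<le> wt ww \<nu>" using y(1) by (rule wt_ge_member)
  finally show ?thesis .
qed

lemma straighten_J1:
  assumes \<nu>: "\<nu> \<notin> StdC"
  shows "\<exists>q. mon \<nu> - q \<in> J1 \<and> (\<forall>\<kappa>\<in>keys q. wt dg \<kappa> = wt dg \<nu> \<and> wt ww \<nu> < wt ww \<kappa>)"
proof (cases "set_mset \<nu> \<subseteq> C")
  case False
  then obtain h where "h \<in># \<nu>" "h \<notin> C" by auto
  then have "mon \<nu> \<in> J1" using mon_in_ideal[OF ideal_J1 var_J1] by blast
  then show ?thesis by (intro exI[of _ 0]) simp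
next
  case True
  then have "\<nu> \<in> Sig" using \<nu> C_sub by (auto simp: StdC_def Std_iff)
  then obtain \<mu> where \<mu>: "min_gen Sig \<mu>" "\<mu> \<subseteq># \<nu>" using min_gen_below by blast
  obtain q0 where q0: "mon \<mu> - q0 \<in> JA" "keys q0 \<subseteq> Std" using expand by blast
  \<comment> \<open>Keeping only the component in the degree of the generator makes the rewriting
    homogeneous; it is still a standard expansion of the generator, so the straightening condition
    applies to it.\<close>
  let ?q = "hpart dg (wt dg \<mu>) q0"
  have "hpart dg (wt dg \<mu>) (mon \<mu> - q0) \<in> JA" using homJA q0(1) by (auto simp: homog_ideal_def)
  moreover have "hpart dg (wt dg \<mu>) (mon \<mu> :: ('h, 'k) mpoly) = mon \<mu>" by (rule part_all) (auto split: if_splits)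
  ultimately have q1: "mon \<mu> - ?q \<in> JA" by (simp add: part_diff)
  have q2: "keys ?q \<subseteq> Std" using q0(2) by (auto simp: keys_part)
  let ?\<tau> = "\<nu> - \<mu>"
  have \<nu>eq: "\<nu> = ?\<tau> + \<mu>" using \<mu>(2) by simp
  have "mon ?\<tau> * (mon \<mu> - ?q) \<in> JA" by (rule ideal_mult_left[OF JA q1])
  moreover have "mon ?\<tau> * mon \<mu> = (mon \<nu> :: ('h, 'k) mpoly)" using \<nu>eq mon_add[of ?\<tau> \<mu>, where 'k = 'k] by simp
  ultimately have "mon \<nu> - mon ?\<tau> * ?q \<in> J1" using JA_J1 by (auto simp: right_diff_distrib)
  moreover have "wt dg \<kappa> = wt dg \<nu> \<and> wt ww \<nu> < wt ww \<kappa>" if k: "\<kappa> \<in> keys (mon ?\<tau> * ?q)" for \<kappa>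
  proof -
    obtain b where b: "b \<in> keys ?q" "\<kappa> = ?\<tau> + b" using keys_mon_mult[OF k] by blast
    have "wt ww \<mu> < wt ww b" by (rule straight_weight[OF \<mu>(1) q1 q2 b(1)])
    moreover have "wt dg b = wt dg \<mu>" using b(1) by (simp add: keys_part)
    ultimately show ?thesis using b(2) \<nu>eq wt_add by (metis add_less_cancel_left)
  qed
  ultimately show ?thesis by blast
qed

sublocale st: straightening C idx StdC ktype J1 dg ww "(card H + 1) ^ card H"
proof unfold_locales
  show "is_ideal J1" by (rule ideal_J1)
  show "homog_ideal dg J1" unfolding J1_def
  proof (rule homog_ideal_adjoins[OF JA homJA])
    fix u :: "('h, 'k) mpoly" assume "u \<in> set (map var ns)"
    then obtain h where "u = var h" by auto
    then have "homog dg (dg h) u" by (simp add: homog_def)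
    then show "\<exists>e. homog dg e u" by blast
  qed
  show "0 < dg h" for h by (rule dgpos)
  show "ww h \<le> (card H + 1) ^ card H" for h
    unfolding ww_def using finH by (auto intro!: power_increasing card_mono)
  show "p = 0" if "p \<in> J1" "keys p \<subseteq> StdC" for p
  proof (rule basis_adjoins)
    show "set ns \<subseteq> H - C" using ns(2) by simp
    show "p \<in> adjoins JA (map var ns)" using that(1) by (simp add: J1_def)
    show "\<kappa> \<in> Std \<and> set_mset \<kappa> \<inter> set ns = {}" if "\<kappa> \<in> keys p" for \<kappa> using that \<open>keys p \<subseteq> StdC\<close> ns(2) by (auto simp: StdC_def)
  qed
  show "\<exists>q. mon \<nu> - q \<in> J1 \<and> (\<forall>\<kappa>\<in>keys q. wt dg \<kappa> = wt dg \<nu> \<and> wt ww \<nu> < wt ww \<kappa>)" if "\<nu> \<notin> StdC" for \<nu>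
    by (rule straighten_J1[OF that])
qed

text \<open>The monomials on a largest face of the core together with all cone variables are
  standard, hence independent in A; this forces the regular sequences of the Cohen-Macaulay ring to
  reach the asserted length.\<close>

lemma regular_list_of_cohen_macaulay:
  assumes L: "locring JA irr L fr" "cohen_macaulay_local L"
  shows "\<exists>us. length us = dC + card (H - C) \<and> set us \<subseteq> irr \<and> reg_list (- irr) JA us"
proof -
  interpret L: locring JA irr L fr by (rule L(1))
  obtain F where F: "F \<subseteq> C" "mset_set F \<in> Std" "card F = dC" using top_face by blast
  have fF: "finite F" using F(1) by (rule sr.subD)
  have cF: "card (F \<union> (H - C)) = dC + card (H - C)" using F fF finH by (subst card_Un_disjoint) auto
  from L.regular_of_cohen_macaulay[OF L(2), of "dC + card (H - C)"] show ?thesis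
  proof
    assume "\<exists>us. length us < dC + card (H - C) \<and> set us \<subseteq> irr \<and> reg_list (- irr) JA us \<and> \<not> prime_chain JA irr (Suc (length us))"
    then obtain us where us: "length us < dC + card (H - C)" "set us \<subseteq> irr" "reg_list (- irr) JA us" "\<not> prime_chain JA irr (Suc (length us))" by blast
    have "dC + card (H - C) \<le> length us"
    proof (rule depth_ge_faces[OF finH JA JA_irr homJA dgpos outA _ cF _ us(2-4)])
      show "F \<union> (H - C) \<subseteq> H" using F(1) C_sub by auto
      fix p assume p: "p \<in> JA" and k: "\<And>m. m \<in> keys p \<Longrightarrow> set_mset m \<subseteq> F \<union> (H - C)"
      have "mset_set F + mset_set (H - C) \<in> Std" using F(2) finH by (intro Std_cone) auto
      then have "m \<in> Std" if "m \<in> keys p" for m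
        by (rule Std_supp) (use k[OF that] fF finH in simp)
      then have "keys p \<subseteq> Std" by blast
      then show "p = 0" by (rule basisA[OF p])
    qed
    then show ?thesis using us(1) by simp
  qed blast
qed

text \<open>The range of vanishing over H, below dC + card (H - C), shrinks by one for each cone
  variable, which leaves the degrees below dC; then the variables that are zero in the quotient are
  discarded.\<close>

lemma vanish_J1:
  assumes us: "length us = dC + card (H - C)" "set us \<subseteq> irr" "reg_list (- irr) JA us" and i: "i < dC"
  shows "sr.vanish (- irr) J1 i"
proof -
  have K: "koszul idx H" using finH injH by unfold_locales
  interpret K: koszul idx "var :: 'h \<Rightarrow> ('h, 'k) mpoly" H by (rule K)
  have U: "1 \<in> - irr" "\<And>a b :: ('h, 'k) mpoly. a \<in> - irr \<Longrightarrow> b \<in> - irr \<Longrightarrow> a * b \<in> - irr"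
    using is_primeD(2,3)[OF prime_irr] by auto
  have "K.vanish (- irr) JA j" if j: "j < dC + length ns" for j
  proof (rule K.vanish_of_reg_list[OF JA U us(3)])
    show "\<exists>m. u ^ m \<in> K.kgen n JA" if "u \<in> set us" for u n
    proof -
      have "\<exists>k>0. u ^ k \<in> K.kgen n JA" using that us(2) by (intro kgen_torsion[OF K JA outA]) auto
      then show ?thesis by blast
    qed
    show "j < length us" using j us(1) ns(3) by simp
  qed
  moreover have "reg_list (- irr) JA (map var ns)"
  proof (rule reg_list_mono)
    show "{1} \<subseteq> - (irr :: ('h, 'k) mpoly set)" using U(1) by simp
    show "reg_list {1} JA (map var ns)" by (rule reg_list_cone_vars[OF ns(1)]) (simp add: ns(2))
  qed
  ultimately have "K.vanish (- irr) J1 i" unfolding J1_def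
    by (intro K.vanish_adjoins[OF JA U _ _ i]) simp_all
  then show ?thesis by (rule vanish_restrict[OF K C_sub ideal_J1, rotated]) (simp add: var_J1)
qed

end

context sqfree
begin

text \<open>Modulo the powers of the cone variables the standard monomials are products of those of
  the core with bounded cone monomials, so regularity over the core carries over.\<close>

lemma reg_list_discrete:
  assumes ns: "distinct ns" "set ns = H - C"
    and r: "reg_list {1} JC (map (\<lambda>t. t ^ m t) thetas)"
  shows "reg_list {1} (mideal Std) (map (\<lambda>y. y ^ m y) (map var ns @ thetas))"
proof -
  let ?S = "{\<kappa> \<in> Std. \<forall>h\<in>set ns. count \<kappa> h < m (var h)}"
  have 1: "reg_list {1} (mideal Std :: ('h, 'k) mpoly set) (map (\<lambda>h. var h ^ m (var h)) ns) \<and>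
    adjoins (mideal Std :: ('h, 'k) mpoly set) (map (\<lambda>h. var h ^ m (var h)) ns) = mideal ?S"
  proof (rule reg_list_cone_powers[OF ns(1) Std_down])
    fix \<kappa> h assume "h \<in> set ns" "\<kappa> \<in> Std"
    then show "add_mset h \<kappa> \<in> Std" using Std_cone[of \<kappa> "{#h#}"] ns(2) by simp
  qed
  interpret cn: cone C ?S StdC "{\<rho>. set_mset \<rho> \<subseteq> H - C \<and> (\<forall>h\<in>set ns. count \<rho> h < m (var h))}" ktype
  proof unfold_locales
    fix \<mu> \<rho> assume c: "set_mset \<mu> \<subseteq> C" "set_mset \<rho> \<inter> C = {}"
    have ct: "count (\<mu> + \<rho>) h = count \<rho> h" if "h \<in> set ns" for h using that c(1) ns(2) by (auto simp: count_eq_zero_iff)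
    have "\<mu> + \<rho> \<in> Std \<longleftrightarrow> \<mu> \<in> StdC \<and> set_mset \<rho> \<subseteq> H - C"
    proof
      assume a: "\<mu> + \<rho> \<in> Std"
      then have "\<mu> \<in> Std" by (rule Std_supp) simp
      then show "\<mu> \<in> StdC \<and> set_mset \<rho> \<subseteq> H - C" using c a by (auto simp: StdC_def Std_iff)
    next
      assume "\<mu> \<in> StdC \<and> set_mset \<rho> \<subseteq> H - C"
      then show "\<mu> + \<rho> \<in> Std" by (intro Std_cone) (auto simp: StdC_def)
    qed
    then show "(\<mu> + \<rho> \<in> ?S) = (\<mu> \<in> StdC \<and> \<rho> \<in> {\<rho>. set_mset \<rho> \<subseteq> H - C \<and> (\<forall>h\<in>set ns. count \<rho> h < m (var h))})"
      using ct by auto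
  next
    show "set_mset \<mu> \<subseteq> C" if "\<mu> \<in> StdC" for \<mu> using that by (simp add: StdC_def)
    show "k \<in> ?S" if "j + k \<in> ?S" for j k using that Std_down[of j k] by auto
    show "k \<in> StdC" if "j + k \<in> StdC" for j k using StdC_supp[OF that, of k] by simp
  qed
  have "set (map (\<lambda>t. t ^ m t) thetas) \<subseteq> psub C" using thetas_psub psub_power by auto
  then have "reg_list {1} (mideal ?S) (map (\<lambda>t. t ^ m t) thetas)" using r by (rule cn.reg_list_cone)
  then show ?thesis using 1 by (simp add: reg_list_append comp_def)
qed

lemma monic_leading:
  fixes y :: "('h, 'k) mpoly"
  assumes y: "homog (\<lambda>_. 1) e y" and e: "0 < e" and m: "0 < m"
  shows "\<exists>e'. homog (\<lambda>_. 1) e' (y ^ m) \<and> size_le e' (y ^ m + (\<Sum>i<m. cst (c i) * y ^ i)) \<and>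
    hp e' (y ^ m + (\<Sum>i<m. cst (c i) * y ^ i)) = y ^ m"
proof (intro exI[of _ "e * m"] conjI)
  have h: "homog (\<lambda>_. 1) (e * i) (y ^ i)" for i by (rule homog_power[OF y])
  show "homog (\<lambda>_. 1) (e * m) (y ^ m)" by (rule h)
  have low: "size k < e * m" if k: "k \<in> keys (\<Sum>i<m. cst (c i) * y ^ i)" for k
  proof -
    obtain i where i: "i \<in> {..<m}" "k \<in> keys (cst (c i) * y ^ i)" using k by (rule keys_sumE)
    then have "k \<in> keys (y ^ i)" by (auto simp: in_keys_iff coef_cst_mult)
    then have "size k = e * i" using h[of i] by (simp add: homog_def)
    then show ?thesis using i(1) e by simp
  qed
  have top: "size k = e * m" if "k \<in> keys (y ^ m)" for k using h[of m] that by (auto simp: homog_def wt_one)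
  show "size_le (e * m) (y ^ m + (\<Sum>i<m. cst (c i) * y ^ i))"
    using low top keys_add[of "y ^ m" "\<Sum>i<m. cst (c i) * y ^ i"] by (auto simp: less_imp_le)
  have "hp (e * m) (\<Sum>i<m. cst (c i) * y ^ i) = 0"
  proof (rule part_none)
    fix k assume "k \<in> keys (\<Sum>i<m. cst (c i) * y ^ i)"
    from low[OF this] show "\<not> wt (\<lambda>_. 1) k = e * m" by simp
  qed
  moreover have "hp (e * m) (y ^ m) = y ^ m" using top by (intro part_all) (auto simp: wt_one)
  ultimately show "hp (e * m) (y ^ m + (\<Sum>i<m. cst (c i) * y ^ i)) = y ^ m" by (simp add: part_add)
qed

end

lemma (in hodge) regular_in_maximal:
  assumes us0: "length us0 = dC + card (H - C)" "set us0 \<subseteq> irr" "reg_list (- irr) JA us0"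
    and L: "locring JC irr L fr" "buchsbaum_local L"
    and M: "is_prime M" "\<And>a. a \<notin> M \<Longrightarrow> \<exists>b. a * b - 1 \<in> M" "mideal Std \<subseteq> M"
  shows "\<exists>us. length us = dC + card (H - C) \<and> set us \<subseteq> M \<and> reg_list {1} (mideal Std :: ('h, 'k) mpoly set) us"
proof -
  have van: "sr.vanish {1} JC i" if i: "i < dC" for i
  proof (rule vanish_core[OF L i])
    fix g assume g: "\<And>F. \<not> (F \<subseteq> C \<and> mset_set F \<in> StdC) \<Longrightarrow> g F = 0"
      "\<And>G. G \<subseteq> C \<Longrightarrow> mset_set G \<in> StdC \<Longrightarrow> card G = Suc i \<Longrightarrow> sr.sd g G = 0"
    show "\<exists>b. \<forall>F. F \<subseteq> C \<and> mset_set F \<in> StdC \<and> card F = i \<longrightarrow> sr.sd b F = g F"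
      by (rule st.simplicial_vanishing[OF vanish_J1[OF us0 i] g])
  qed
  have out: "var h \<in> M" if "h \<notin> H" for h using that M(3) by (auto simp: mon_in_mideal Std_iff)
  \<comment> \<open>Each parameter y has a monic polynomial in y over k that lies in M; its degree
    \<open>m y\<close> becomes the exponent of y in the sequence of leading forms.\<close>
  have "\<forall>y. \<exists>m c. 0 < m \<and> y ^ m + (\<Sum>i<m. cst (c i) * y ^ i) \<in> M" using zariski[OF finH M(1,2) out] by blast
  then obtain m c where mc[rule_format]: "\<forall>y. 0 < m y \<and> y ^ m y + (\<Sum>i<m y. cst (c y i) * y ^ i) \<in> M"
    by (elim choice[THEN exE]) (rule that)
  let ?ys = "map var ns @ thetas :: ('h, 'k) mpoly list"
  let ?g = "\<lambda>y. y ^ m y + (\<Sum>i<m y. cst (c y i) * y ^ i)"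
  have pw: "sr.powers thetas (map m thetas) = map (\<lambda>t. t ^ m t) thetas"
    by (rule nth_equalityI) (auto simp: sr.powers_def)
  have "reg_list {1} JC (sr.powers thetas (map m thetas))"
  proof (rule reg_list_powers[OF L van])
    show "0 \<notin> set (map m thetas)" using mc by (metis (no_types, lifting) imageE list.set_map less_irrefl)
  qed simp_all
  then have r: "reg_list {1} (mideal Std) (map (\<lambda>y. y ^ m y) ?ys)" unfolding pw by (rule reg_list_discrete[OF ns(1,2)])
  have "reg_list {1} (mideal Std :: ('h, 'k) mpoly set) (map ?g ?ys)"
  proof (rule reg_list_of_leading[OF ideal_JStd ideal_JStd homog_ideal_mideal leads_refl[OF ideal_JStd homog_ideal_mideal] _ r])
    have "\<exists>e. homog (\<lambda>_. 1) e (y ^ m y) \<and> size_le e (?g y) \<and> hp e (?g y) = y ^ m y" if y: "y \<in> set ?ys" for y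
    proof -
      have "\<exists>e>0. homog (\<lambda>_. 1) e y"
      proof (cases "y \<in> set thetas")
        case False
        then obtain h where "y = var h" using y by auto
        then have "homog (\<lambda>_. 1) 1 y" by (simp add: homog_def)
        then show ?thesis by (intro exI[of _ 1]) simp
      qed (rule thetas_homog)
      then obtain e where "homog (\<lambda>_. 1) e y" "0 < e" by blast
      then show ?thesis using mc by (intro monic_leading) auto
    qed
    then show "list_all2 (\<lambda>g G. \<exists>e. homog (\<lambda>_. 1) e G \<and> size_le e g \<and> hp e g = G) (map ?g ?ys) (map (\<lambda>y. y ^ m y) ?ys)"
      unfolding list_all2_map1 list_all2_map2 by (intro list.rel_refl_strong)
  qed
  moreover have "length (map ?g ?ys) = dC + card (H - C)" using ns(3) by simp
  moreover have "set (map ?g ?ys) \<subseteq> M" using mc by (simp only: set_map) blast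
  ultimately show ?thesis by blast
qed

subsection \<open>The rings of the theorem as quotients of one polynomial ring\<close>

context surj_hom
begin

lemma vimage_genideal:
  assumes I: "is_ideal I" "ker \<subseteq> I" "G \<subseteq> I"
    and least: "\<And>I'. is_ideal I' \<Longrightarrow> ker \<subseteq> I' \<Longrightarrow> G \<subseteq> I' \<Longrightarrow> I \<subseteq> I'"
  shows "\<phi> -` (Idl (\<phi> ` G)) = I" "Idl (\<phi> ` G) = \<phi> ` I"
proof -
  have sub: "\<phi> ` G \<subseteq> carrier R" by auto
  have K: "ideal (Idl (\<phi> ` G)) R" by (rule genideal_ideal[OF sub])
  have "Idl (\<phi> ` G) \<subseteq> \<phi> ` I" using I(3) by (intro genideal_minimal[OF ideal_image[OF I(1)]]) auto
  then have 1: "\<phi> -` (Idl (\<phi> ` G)) \<subseteq> I" using image_mem[OF I(1,2)] by blast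
  have "I \<subseteq> \<phi> -` (Idl (\<phi> ` G))"
  proof (rule least[OF ideal_vimage(1,2)[OF K]])
    show "G \<subseteq> \<phi> -` (Idl (\<phi> ` G))" using genideal_self[OF sub] by auto
  qed
  with 1 show eq: "\<phi> -` (Idl (\<phi> ` G)) = I" by (rule equalityI)
  show "Idl (\<phi> ` G) = \<phi> ` I" using ideal_vimage(3)[OF K] unfolding eq by (rule sym)
qed

lemma surj_hom_Quot:
  assumes K: "ideal K R"
  shows "surj_hom (R Quot K) (\<lambda>a. K +> \<phi> a)" "surj_hom.ker (R Quot K) (\<lambda>a. K +> \<phi> a) = \<phi> -` K"
proof -
  interpret K: ideal K R by (rule K)
  have h: "(+>) K \<in> ring_hom R (R Quot K)" by (rule K.rcos_ring_hom)
  have z: "\<zero>\<^bsub>R Quot K\<^esub> = K" by (simp add: FactRing_def)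
  show s: "surj_hom (R Quot K) (\<lambda>a. K +> \<phi> a)"
  proof
    show "carrier (R Quot K) = range (\<lambda>a. K +> \<phi> a)" unfolding FactRing_def A_RCOSETS_def' using carrR by auto
    show "K +> \<phi> (a + b) = (K +> \<phi> a) \<oplus>\<^bsub>R Quot K\<^esub> (K +> \<phi> b)" for a b by (simp add: hom_add ring_hom_add[OF h])
    show "K +> \<phi> (a * b) = (K +> \<phi> a) \<otimes>\<^bsub>R Quot K\<^esub> (K +> \<phi> b)" for a b by (simp add: hom_mult ring_hom_mult[OF h])
    show "K +> \<phi> 1 = \<one>\<^bsub>R Quot K\<^esub>" by (simp add: hom_one ring_hom_one[OF h])
    show "K +> \<phi> 0 = \<zero>\<^bsub>R Quot K\<^esub>" unfolding z hom_zero by (rule K.a_rcos_const) (rule K.zero_closed)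
  qed
  show "surj_hom.ker (R Quot K) (\<lambda>a. K +> \<phi> a) = \<phi> -` K"
    unfolding surj_hom.ker_def[OF s] z using K.rcos_const_imp_mem K.a_rcos_const by auto
qed

end

text \<open>Dropping the monomials with a variable outside H is the homomorphism that sends these
  variables to 0.\<close>

definition to_poly :: "'h set \<Rightarrow> ('h, 'k::field) mpoly \<Rightarrow> 'h multiset \<Rightarrow> 'k" where
  "to_poly H p = (\<lambda>m. if set_mset m \<subseteq> H then coef p m else 0)"

lemma coef_mult_subsets:
  fixes p q :: "('h, 'k::field) mpoly"
  shows "coef (p * q) m = (\<Sum>\<alpha>\<in>{\<alpha>. \<alpha> \<subseteq># m}. coef p \<alpha> * coef q (m - \<alpha>))"
proof -
  have fin: "finite {\<alpha>. \<alpha> \<subseteq># m}"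
    by (rule finite_subset[OF _ card_monomials(1)[of "set_mset m" "size m"]]) (auto dest: set_mset_mono size_mset_mono)
  have "coef (p * q) m = (\<Sum>\<alpha>\<in>keys p. if \<alpha> \<subseteq># m then coef p \<alpha> * coef q (m - \<alpha>) else 0)" by (rule coef_mult)
  also have "\<dots> = (\<Sum>\<alpha>\<in>keys p \<inter> {\<alpha>. \<alpha> \<subseteq># m}. coef p \<alpha> * coef q (m - \<alpha>))" by (simp add: sum.inter_restrict)
  also have "\<dots> = (\<Sum>\<alpha>\<in>{\<alpha>. \<alpha> \<subseteq># m}. coef p \<alpha> * coef q (m - \<alpha>))"
    using fin by (intro sum.mono_neutral_left) (auto simp: in_keys_iff)
  finally show ?thesis .
qed

lemma surj_hom_poly_ring: "surj_hom (poly_ring H) (to_poly H :: ('h, 'k::field) mpoly \<Rightarrow> _)"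
proof
  show "carrier (poly_ring H) = range (to_poly H :: ('h, 'k) mpoly \<Rightarrow> _)"
  proof (intro equalityI subsetI)
    fix p :: "'h multiset \<Rightarrow> 'k" assume p: "p \<in> carrier (poly_ring H)"
    then have "coef (Abs_poly_mapping p) = p" by (simp add: poly_ring_def Abs_poly_mapping_inverse)
    then have "p = to_poly H (Abs_poly_mapping p)" using p by (auto simp: poly_ring_def to_poly_def fun_eq_iff)
    then show "p \<in> range (to_poly H)" by blast
  next
    fix p :: "'h multiset \<Rightarrow> 'k" assume "p \<in> range (to_poly H)"
    then obtain q :: "('h, 'k) mpoly" where q: "p = to_poly H q" by blast
    have "finite {m. p m \<noteq> 0}" by (rule finite_subset[of _ "keys q"]) (auto simp: q to_poly_def in_keys_iff)
    then show "p \<in> carrier (poly_ring H)" by (auto simp: poly_ring_def q to_poly_def)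
  qed
  fix a b :: "('h, 'k) mpoly"
  show "to_poly H (a + b) = to_poly H a \<oplus>\<^bsub>poly_ring H\<^esub> to_poly H b"
    by (auto simp: poly_ring_def to_poly_def lookup_add)
  show "to_poly H (a * b) = to_poly H a \<otimes>\<^bsub>poly_ring H\<^esub> to_poly H b"
  proof
    fix m
    have "(\<Sum>\<alpha>\<in>{\<alpha>. \<alpha> \<subseteq># m}. to_poly H a \<alpha> * to_poly H b (m - \<alpha>)) =
      (\<Sum>\<alpha>\<in>{\<alpha>. \<alpha> \<subseteq># m}. if set_mset m \<subseteq> H then coef a \<alpha> * coef b (m - \<alpha>) else 0)"
    proof (rule sum.cong[OF refl])
      fix \<alpha> assume "\<alpha> \<in> {\<alpha>. \<alpha> \<subseteq># m}"
      then have "set_mset m = set_mset \<alpha> \<union> set_mset (m - \<alpha>)" by (metis mem_Collect_eq set_mset_union subset_mset.add_diff_inverse)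
      then show "to_poly H a \<alpha> * to_poly H b (m - \<alpha>) = (if set_mset m \<subseteq> H then coef a \<alpha> * coef b (m - \<alpha>) else 0)"
        by (auto simp: to_poly_def)
    qed
    then show "to_poly H (a * b) m = (to_poly H a \<otimes>\<^bsub>poly_ring H\<^esub> to_poly H b) m"
      by (auto simp: poly_ring_def to_poly_def coef_mult_subsets)
  qed
  show "to_poly H (1 :: ('h, 'k) mpoly) = \<one>\<^bsub>poly_ring H\<^esub>"
    by (auto simp: poly_ring_def to_poly_def lookup_one fun_eq_iff)
  show "to_poly H (0 :: ('h, 'k) mpoly) = \<zero>\<^bsub>poly_ring H\<^esub>" by (auto simp: poly_ring_def to_poly_def)
qed

lemma to_poly_mon: "set_mset \<mu> \<subseteq> H \<Longrightarrow> to_poly H (mon \<mu>) = pmono \<mu>"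
  by (auto simp: to_poly_def pmono_def fun_eq_iff lookup_single when_def)

definition to_Adis :: "'h set \<Rightarrow> 'h multiset set \<Rightarrow> ('h, 'k::field) mpoly \<Rightarrow> ('h multiset \<Rightarrow> 'k) set" where
  "to_Adis H Sig p = a_r_coset (poly_ring H) (Adis_ideal H Sig) (to_poly H p)"

definition to_core :: "'h set \<Rightarrow> 'h multiset set \<Rightarrow> ('h, 'k::field) mpoly \<Rightarrow> ('h multiset \<Rightarrow> 'k) set set" where
  "to_core H Sig p = a_r_coset (Adis H Sig) (core_ideal H Sig) (to_Adis H Sig p)"

text \<open>The monomials of Sig and those with a variable outside H die alike, which is why the
  kernel is described by the standard monomials that survive.\<close>

lemma surj_hom_Adis:
  assumes mi: "monomial_ideal H Sig"
  shows "surj_hom (Adis H Sig) (to_Adis H Sig :: ('h, 'k::field) mpoly \<Rightarrow> _)"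
    and "surj_hom.ker (Adis H Sig) (to_Adis H Sig :: ('h, 'k::field) mpoly \<Rightarrow> _) = mideal (standard_monomials H Sig)"
proof -
  interpret P: surj_hom "poly_ring H" "to_poly H :: ('h, 'k) mpoly \<Rightarrow> _" by (rule surj_hom_poly_ring)
  have SH: "Sig \<subseteq> monomials H" using mi by (simp add: monomial_ideal_def)
  have "(pmono ` Sig :: ('h multiset \<Rightarrow> 'k) set) = to_poly H ` (mon ` Sig)" unfolding image_image
    using SH by (intro image_cong refl) (auto simp: monomials_def to_poly_mon)
  then have gen: "(Adis_ideal H Sig :: ('h multiset \<Rightarrow> 'k) set) = Idl\<^bsub>poly_ring H\<^esub> (to_poly H ` (mon ` Sig))" by (simp add: Adis_ideal_def)
  have down: "n \<in> standard_monomials H Sig" if "m + n \<in> standard_monomials H Sig" for m n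
    using that mi by (auto simp: standard_monomials_def monomials_def monomial_ideal_def union_commute)
  have id: "is_ideal (mideal (standard_monomials H Sig) :: ('h, 'k) mpoly set)" by (rule ideal_mideal) (rule down)
  have z: "\<zero>\<^bsub>poly_ring H\<^esub> = (\<lambda>_. 0 :: 'k)" by (simp add: poly_ring_def)
  have ker: "p \<in> P.ker \<longleftrightarrow> (\<forall>m. set_mset m \<subseteq> H \<longrightarrow> coef p m = 0)" for p
    unfolding P.ker_def z by (auto simp: to_poly_def fun_eq_iff)
  have K: "to_poly H -` Adis_ideal H Sig = (mideal (standard_monomials H Sig) :: ('h, 'k) mpoly set)" unfolding gen
  proof (rule P.vimage_genideal(1)[OF id])
    show "P.ker \<subseteq> mideal (standard_monomials H Sig)" by (auto simp: ker mideal_coef standard_monomials_def monomials_def)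
    show "mon ` Sig \<subseteq> mideal (standard_monomials H Sig)" by (auto simp: mon_in_mideal standard_monomials_def)
    fix I' :: "('h, 'k) mpoly set" assume I': "is_ideal I'" "P.ker \<subseteq> I'" "mon ` Sig \<subseteq> I'"
    show "mideal (standard_monomials H Sig) \<subseteq> I'"
    proof
      fix p :: "('h, 'k) mpoly" assume p: "p \<in> mideal (standard_monomials H Sig)"
      show "p \<in> I'"
      proof (rule ideal_of_terms[OF I'(1)])
        fix m assume "m \<in> keys p"
        then have "m \<in> Sig \<or> \<not> set_mset m \<subseteq> H" using p by (auto simp: mideal_def standard_monomials_def monomials_def)
        then show "mon m \<in> I'"
        proof
          assume "\<not> set_mset m \<subseteq> H"
          then have "mon m \<in> P.ker" unfolding ker by (auto simp: lookup_single when_def)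
          then show ?thesis using I'(2) by blast
        qed (use I'(3) in blast)
      qed
    qed
  qed
  have idA: "ideal (Adis_ideal H Sig) (poly_ring H :: ('h multiset \<Rightarrow> 'k) ring)" unfolding gen
    by (rule P.genideal_ideal) auto
  show "surj_hom (Adis H Sig) (to_Adis H Sig :: ('h, 'k) mpoly \<Rightarrow> _)"
    using P.surj_hom_Quot(1)[OF idA] unfolding Adis_def to_Adis_def[abs_def] .
  show "surj_hom.ker (Adis H Sig) (to_Adis H Sig :: ('h, 'k) mpoly \<Rightarrow> _) = mideal (standard_monomials H Sig)"
    using P.surj_hom_Quot(2)[OF idA] unfolding Adis_def to_Adis_def[abs_def] K .
qed

lemma dvar_eq: "h \<in> H \<Longrightarrow> dvar H Sig h = to_Adis H Sig (var h)"
  by (simp add: dvar_def to_Adis_def pvar_def to_poly_mon)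

context sqfree
begin

text \<open>The third claim identifies the ideal at which the Buchsbaum property is stated with the
  image of \<open>irr\<close>.\<close>

lemma surj_hom_core:
  shows "surj_hom (core_Adis H Sig) (to_core H Sig :: ('h, 'k) mpoly \<Rightarrow> _)"
    and "surj_hom.ker (core_Adis H Sig) (to_core H Sig :: ('h, 'k) mpoly \<Rightarrow> _) = JC"
    and "core_irrelevant H Sig = to_core H Sig ` (irr :: ('h, 'k) mpoly set)"
proof -
  interpret D: surj_hom "Adis H Sig" "to_Adis H Sig :: ('h, 'k) mpoly \<Rightarrow> _" by (rule surj_hom_Adis[OF mi])
  have kD: "D.ker = mideal Std" by (rule surj_hom_Adis(2)[OF mi])
  have "dvar H Sig ` (H - C) = to_Adis H Sig ` (var ` (H - C) :: ('h, 'k) mpoly set)"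
    unfolding image_image by (intro image_cong refl) (simp add: dvar_eq)
  then have gen: "core_ideal H Sig = Idl\<^bsub>Adis H Sig\<^esub> (to_Adis H Sig ` (var ` (H - C) :: ('h, 'k) mpoly set))"
    by (simp add: core_ideal_def)
  have K: "to_Adis H Sig -` core_ideal H Sig = JC" unfolding gen
  proof (rule D.vimage_genideal(1)[OF ideal_JC])
    show "D.ker \<subseteq> JC" unfolding kD by (auto simp: mideal_def StdC_def)
    show "var ` (H - C) \<subseteq> JC" using var_JC by auto
    fix I' :: "('h, 'k) mpoly set" assume I': "is_ideal I'" "D.ker \<subseteq> I'" "var ` (H - C) \<subseteq> I'"
    show "JC \<subseteq> I'"
    proof
      fix p assume p: "p \<in> JC"
      show "p \<in> I'"
      proof (rule ideal_of_terms[OF I'(1)])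
        fix m assume "m \<in> keys p"
        then have m: "m \<notin> StdC" using p by (auto simp: mideal_def)
        show "mon m \<in> I'"
        proof (cases "m \<in> Std")
          case True
          then obtain h where h: "h \<in># m" "h \<in> H - C" using m by (auto simp: StdC_def Std_iff)
          then have "var h \<in> I'" using I'(3) by blast
          then show ?thesis by (rule mon_in_ideal[OF I'(1) _ h(1)])
        next
          case False
          then show ?thesis using I'(2) unfolding kD by (auto simp: mon_in_mideal)
        qed
      qed
    qed
  qed
  have idA: "ideal (core_ideal H Sig) (Adis H Sig :: ('h multiset \<Rightarrow> 'k) set ring)" unfolding gen
    by (rule D.genideal_ideal) auto
  show s: "surj_hom (core_Adis H Sig) (to_core H Sig :: ('h, 'k) mpoly \<Rightarrow> _)"
    using D.surj_hom_Quot(1)[OF idA] unfolding core_Adis_def to_core_def[abs_def] .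
  show kE: "surj_hom.ker (core_Adis H Sig) (to_core H Sig :: ('h, 'k) mpoly \<Rightarrow> _) = JC"
    using D.surj_hom_Quot(2)[OF idA] unfolding core_Adis_def to_core_def[abs_def] K .
  interpret E: surj_hom "core_Adis H Sig" "to_core H Sig :: ('h, 'k) mpoly \<Rightarrow> _" by (rule s)
  have "(\<lambda>h. a_r_coset (Adis H Sig) (core_ideal H Sig) (dvar H Sig h)) ` H = to_core H Sig ` (var ` H :: ('h, 'k) mpoly set)"
    unfolding image_image by (intro image_cong refl) (simp add: dvar_eq to_core_def)
  then have "core_irrelevant H Sig = Idl\<^bsub>core_Adis H Sig\<^esub> (to_core H Sig ` (var ` H :: ('h, 'k) mpoly set))"
    by (simp add: core_irrelevant_def)
  also have "\<dots> = to_core H Sig ` irr"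
  proof (rule E.vimage_genideal(2)[OF is_primeD(1)[OF prime_irr]])
    show "E.ker \<subseteq> irr" unfolding kE using empty_Std by (auto simp: mideal_coef irr_def)
    show "var ` H \<subseteq> irr" by (auto simp: mon_in_irr)
    fix I' :: "('h, 'k) mpoly set" assume I': "is_ideal I'" "E.ker \<subseteq> I'" "var ` H \<subseteq> I'"
    have v: "var h \<in> I'" for h
    proof (cases "h \<in> H")
      case False
      then have "var h \<in> JC" using C_sub by (intro var_JC) auto
      then show ?thesis using I'(2) unfolding kE by blast
    qed (use I'(3) in blast)
    show "irr \<subseteq> I'"
    proof
      fix p :: "('h, 'k) mpoly" assume p: "p \<in> irr"
      show "p \<in> I'"
      proof (rule ideal_of_terms[OF I'(1)])
        fix m assume "m \<in> keys p"
        then have "m \<noteq> {#}" using p by (auto simp: irr_def in_keys_iff)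
        then obtain h where "h \<in># m" by auto
        then show "mon m \<in> I'" by (rule mon_in_ideal[OF I'(1) v])
      qed
    qed
  qed
  finally show "core_irrelevant H Sig = to_core H Sig ` (irr :: ('h, 'k) mpoly set)" .
qed

end

section \<open>The Hodge algebra as a quotient of the polynomial ring\<close>

locale graded_hodge = cring A
  for A :: "'a ring" (structure) and \<iota> :: "'k::field \<Rightarrow> 'a" and H :: "'h set" and leq :: "'h \<Rightarrow> 'h \<Rightarrow> bool"
    and x :: "'h \<Rightarrow> 'a" and Sig :: "'h multiset set" and Agr :: "nat \<Rightarrow> 'a set" +
  assumes hodge: "hodge_algebra A \<iota> H leq x Sig" and graded: "graded_algebra A \<iota> H x Agr"
begin

abbreviation Std :: "'h multiset set" where "Std \<equiv> standard_monomials H Sig"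

lemma iota: "\<iota> c \<in> carrier A" "\<iota> (a + b) = \<iota> a \<oplus> \<iota> b" "\<iota> (a * b) = \<iota> a \<otimes> \<iota> b" "\<iota> 1 = \<one>" "\<iota> 0 = \<zero>"
proof -
  have h: "\<iota> \<in> ring_hom type_ring A" using hodge by (simp add: hodge_algebra_def)
  show c: "\<iota> c \<in> carrier A" for c using ring_hom_closed[OF h, of c] by (simp add: type_ring_def)
  show ad: "\<iota> (a + b) = \<iota> a \<oplus> \<iota> b" for a b using ring_hom_add[OF h, of a b] by (simp add: type_ring_def)
  show "\<iota> (a * b) = \<iota> a \<otimes> \<iota> b" using ring_hom_mult[OF h, of a b] by (simp add: type_ring_def)
  show "\<iota> 1 = \<one>" using ring_hom_one[OF h] by (simp add: type_ring_def)
  show "\<iota> 0 = \<zero>" using ad[of 0 0] c[of 0] by (metis add.l_cancel_one' add_0)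
qed

text \<open>The variables outside H are sent to 0, so that the polynomial ring on the whole type maps onto A.\<close>

definition xx :: "'h \<Rightarrow> 'a" where "xx h = (if h \<in> H then x h else \<zero>)"

lemma xx_in: "xx h \<in> carrier A" using hodge by (auto simp: xx_def hodge_algebra_def)

definition ev :: "'h multiset \<Rightarrow> 'a" where "ev = mon_eval A xx"

lemma ev_superset:
  assumes "finite F" "set_mset \<mu> \<subseteq> F" shows "ev \<mu> = finprod A (\<lambda>h. xx h [^] count \<mu> h) F"
  unfolding ev_def mon_eval_def
proof (rule finprod_mono_neutral_cong_left[OF assms])
  fix h assume "h \<in> F - set_mset \<mu>"
  then have "count \<mu> h = 0" by (simp add: not_in_iff)
  then show "xx h [^] count \<mu> h = \<one>" by simp
qed (auto simp: xx_in)

lemma ev_in: "ev \<mu> \<in> carrier A" unfolding ev_def mon_eval_def using xx_in by (intro finprod_closed) auto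

lemma ev_add: "ev (\<mu> + \<nu>) = ev \<mu> \<otimes> ev \<nu>"
proof -
  let ?F = "set_mset (\<mu> + \<nu>)"
  have "ev (\<mu> + \<nu>) = finprod A (\<lambda>h. xx h [^] count \<mu> h \<otimes> xx h [^] count \<nu> h) ?F"
    unfolding ev_superset[of ?F "\<mu> + \<nu>", OF finite_set_mset subset_refl] by (intro finprod_cong') (auto simp: xx_in nat_pow_mult)
  also have "\<dots> = ev \<mu> \<otimes> ev \<nu>"
    using ev_superset[of ?F \<mu>] ev_superset[of ?F \<nu>] xx_in by (simp add: finprod_multf)
  finally show ?thesis .
qed

lemma ev_empty: "ev {#} = \<one>" by (simp add: ev_def mon_eval_def)

lemma ev_single: "ev {#h#} = xx h"
  unfolding ev_def mon_eval_def using xx_in by simp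

lemma ev_H: "set_mset \<mu> \<subseteq> H \<Longrightarrow> ev \<mu> = mon_eval A x \<mu>"
  unfolding ev_def mon_eval_def using hodge by (intro finprod_cong') (auto simp: xx_def hodge_algebra_def)

definition to_A :: "('h, 'k) mpoly \<Rightarrow> 'a" where "to_A p = finsum A (\<lambda>\<mu>. \<iota> (coef p \<mu>) \<otimes> ev \<mu>) (keys p)"

lemma term_in [simp]: "\<iota> c \<otimes> ev \<mu> \<in> carrier A" by (simp add: iota ev_in)

lemma to_A_superset: assumes "finite M" "keys p \<subseteq> M" shows "to_A p = finsum A (\<lambda>\<mu>. \<iota> (coef p \<mu>) \<otimes> ev \<mu>) M"
  unfolding to_A_def
  by (rule add.finprod_mono_neutral_cong_left[OF assms]) (auto simp: in_keys_iff iota ev_in)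

lemma to_A_in: "to_A p \<in> carrier A" unfolding to_A_def by (intro finsum_closed) auto

lemma to_A_add: "to_A (p + q) = to_A p \<oplus> to_A q"
proof -
  let ?M = "keys p \<union> keys q"
  have "to_A (p + q) = finsum A (\<lambda>\<mu>. \<iota> (coef p \<mu>) \<otimes> ev \<mu> \<oplus> \<iota> (coef q \<mu>) \<otimes> ev \<mu>) ?M"
    unfolding to_A_superset[of ?M "p + q", OF finite_UnI[OF finite_keys finite_keys] keys_add]
    by (intro finsum_cong') (auto simp: lookup_add iota ev_in l_distr)
  also have "\<dots> = to_A p \<oplus> to_A q" using to_A_superset[of ?M p] to_A_superset[of ?M q] by (simp add: finsum_addf)
  finally show ?thesis .
qed

lemma to_A_zero: "to_A 0 = \<zero>" by (simp add: to_A_def)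

lemma to_A_term: "to_A (term_of \<mu> c) = \<iota> c \<otimes> ev \<mu>"
  using to_A_superset[of "{\<mu>}" "term_of \<mu> c"] by (auto simp: lookup_single)

lemma to_A_sum: "finite K \<Longrightarrow> to_A (\<Sum>i\<in>K. f i) = finsum A (\<lambda>i. to_A (f i)) K"
proof (induction K rule: finite_induct)
  case (insert i K)
  then show ?case by (simp add: to_A_add to_A_in)
qed (simp add: to_A_zero)

lemma to_A_mult: "to_A (p * q) = to_A p \<otimes> to_A q"
proof -
  have "p * q = (\<Sum>a\<in>keys p. term_of a (coef p a)) * (\<Sum>b\<in>keys q. term_of b (coef q b))"
    using poly_expand[of p] poly_expand[of q] by simp
  also have "\<dots> = (\<Sum>a\<in>keys p. \<Sum>b\<in>keys q. term_of (a + b) (coef p a * coef q b))"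
    unfolding sum_product mult_single ..
  finally have "to_A (p * q) = finsum A (\<lambda>a. finsum A (\<lambda>b. \<iota> (coef p a * coef q b) \<otimes> ev (a + b)) (keys q)) (keys p)"
    by (simp add: to_A_sum to_A_term)
  also have "\<dots> = finsum A (\<lambda>a. \<iota> (coef p a) \<otimes> ev a \<otimes> to_A q) (keys p)"
  proof (rule finsum_cong')
    fix a
    have "finsum A (\<lambda>b. \<iota> (coef p a * coef q b) \<otimes> ev (a + b)) (keys q) =
      finsum A (\<lambda>b. (\<iota> (coef p a) \<otimes> ev a) \<otimes> (\<iota> (coef q b) \<otimes> ev b)) (keys q)"
      by (intro finsum_cong') (auto simp: iota ev_in ev_add m_ac)
    also have "\<dots> = \<iota> (coef p a) \<otimes> ev a \<otimes> to_A q" unfolding to_A_def by (intro finsum_rdistr[symmetric]) auto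
    finally show "finsum A (\<lambda>b. \<iota> (coef p a * coef q b) \<otimes> ev (a + b)) (keys q) = \<iota> (coef p a) \<otimes> ev a \<otimes> to_A q" .
  qed (auto simp: to_A_in)
  also have "\<dots> = to_A p \<otimes> to_A q" unfolding to_A_def[of p] by (intro finsum_ldistr[symmetric]) (auto simp: to_A_in)
  finally show ?thesis .
qed

lemma std_expansion_to_A:
  assumes "keys p \<subseteq> Std" shows "std_expansion A \<iota> H x Sig (to_A p) (coef p)"
proof -
  have k: "{\<mu>. coef p \<mu> \<noteq> 0} = keys p" by (auto simp: in_keys_iff)
  have "to_A p = finsum A (\<lambda>\<mu>. \<iota> (coef p \<mu>) \<otimes> mon_eval A x \<mu>) (keys p)"
    unfolding to_A_def
  proof (rule finsum_cong')
    fix \<mu> assume "\<mu> \<in> keys p"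
    then have e: "mon_eval A x \<mu> = ev \<mu>" using assms by (intro ev_H[symmetric]) (auto simp: standard_monomials_def monomials_def)
    then show "\<iota> (coef p \<mu>) \<otimes> ev \<mu> = \<iota> (coef p \<mu>) \<otimes> mon_eval A x \<mu>" by simp
  next
    show "(\<lambda>\<mu>. \<iota> (coef p \<mu>) \<otimes> mon_eval A x \<mu>) \<in> keys p \<rightarrow> carrier A"
    proof
      fix \<mu> assume "\<mu> \<in> keys p"
      then have "mon_eval A x \<mu> = ev \<mu>" using assms by (intro ev_H[symmetric]) (auto simp: standard_monomials_def monomials_def)
      then show "\<iota> (coef p \<mu>) \<otimes> mon_eval A x \<mu> \<in> carrier A" by simp
    qed
  qed simp
  then show ?thesis unfolding std_expansion_def k using assms by (auto simp: in_keys_iff)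
qed

lemma std_unique: assumes "keys p \<subseteq> Std" "keys q \<subseteq> Std" "to_A p = to_A q" shows "p = q"
proof -
  have "\<exists>!c. std_expansion A \<iota> H x Sig (to_A p) c" using hodge to_A_in[of p] unfolding hodge_algebra_def by blast
  then have "coef p = coef q" using std_expansion_to_A[OF assms(1)] std_expansion_to_A[OF assms(2)] assms(3) by metis
  then show ?thesis by (simp add: poly_mapping_eqI)
qed

lemma std_exists: assumes a: "a \<in> carrier A" shows "\<exists>p. keys p \<subseteq> Std \<and> to_A p = a"
proof -
  obtain c where c: "std_expansion A \<iota> H x Sig a c" using hodge a unfolding hodge_algebra_def by blast
  define p where "p = Abs_poly_mapping c"
  have pc: "coef p = c" unfolding p_def using c by (simp add: std_expansion_def Abs_poly_mapping_inverse)
  have k: "{\<mu>. c \<mu> \<noteq> 0} = keys p" by (auto simp: in_keys_iff pc)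
  have s: "keys p \<subseteq> Std" using c by (auto simp: std_expansion_def k[symmetric])
  have "to_A p = a" using std_expansion_to_A[OF s] c unfolding std_expansion_def pc by simp
  then show ?thesis using s by blast
qed

sublocale SA: surj_hom A to_A
proof
  show "carrier A = range to_A" using std_exists to_A_in by blast
  show "to_A 1 = \<one>" using to_A_term[of "{#}" 1] by (simp add: iota ev_empty)
qed (rule to_A_add to_A_mult to_A_zero)+

text \<open>Outside H the value 1 keeps all degrees positive; the variables there map to 0, which
  lies in every graded piece.\<close>

definition dg :: "'h \<Rightarrow> nat" where "dg h = (if h \<in> H then SOME n. 0 < n \<and> x h \<in> Agr n else 1)"

lemma Agr_zero: "\<zero> \<in> Agr n"
proof -
  have "subgroup (Agr n) (add_monoid A)" using graded by (simp add: graded_algebra_def)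
  from subgroup.one_closed[OF this] show ?thesis by simp
qed

lemma Agr_add: assumes "a \<in> Agr n" "b \<in> Agr n" shows "a \<oplus> b \<in> Agr n"
proof -
  have "subgroup (Agr n) (add_monoid A)" using graded by (simp add: graded_algebra_def)
  from subgroup.m_closed[OF this assms] show ?thesis by simp
qed

lemma dg: "0 < dg h" "xx h \<in> Agr (dg h)"
proof -
  have "0 < dg h \<and> xx h \<in> Agr (dg h)"
  proof (cases "h \<in> H")
    case True
    then have "\<exists>n. 0 < n \<and> x h \<in> Agr n" using graded by (auto simp: graded_algebra_def)
    from someI_ex[OF this] show ?thesis using True by (simp add: dg_def xx_def)
  qed (simp add: dg_def xx_def Agr_zero)
  then show "0 < dg h" "xx h \<in> Agr (dg h)" by auto
qed

lemma ev_Agr: "ev \<mu> \<in> Agr (wt dg \<mu>)"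
proof (induction \<mu>)
  case empty
  have "Agr 0 = range \<iota>" using graded by (simp add: graded_algebra_def)
  then show ?case using iota(4) by (simp add: ev_empty) (metis rangeI)
next
  case (add h \<mu>)
  have "ev (add_mset h \<mu>) = xx h \<otimes> ev \<mu>" using ev_add[of "{#h#}" \<mu>] by (simp add: ev_single)
  then show ?case using graded add dg(2)[of h] by (simp add: graded_algebra_def)
qed

lemma to_A_Agr: assumes "homog dg k p" shows "to_A p \<in> Agr k"
proof -
  have ind: "finite K \<Longrightarrow> (\<And>\<mu>. \<mu> \<in> K \<Longrightarrow> wt dg \<mu> = k) \<Longrightarrow> finsum A (\<lambda>\<mu>. \<iota> (coef p \<mu>) \<otimes> ev \<mu>) K \<in> Agr k" for K
  proof (induction K rule: finite_induct)
    case (insert \<mu> K)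
    have "\<iota> (coef p \<mu>) \<otimes> ev \<mu> \<in> Agr k" using ev_Agr[of \<mu>] insert.prems graded by (auto simp: graded_algebra_def)
    then show ?case using insert by (simp add: Agr_add)
  qed (simp add: Agr_zero)
  show ?thesis unfolding to_A_def by (rule ind) (use assms in \<open>simp_all add: homog_def\<close>)
qed

text \<open>The images of the homogeneous components of p form a graded decomposition of 0, and by
  uniqueness all of them vanish.\<close>

lemma homog_ker: "homog_ideal dg SA.ker" unfolding homog_ideal_def
proof (intro ballI allI)
  fix p k assume p: "p \<in> SA.ker"
  define f where "f = (\<lambda>n. to_A (hpart dg n p))"
  have "hpart dg n p = 0" if "n \<notin> wt dg ` keys p" for n using that by (intro part_none) auto
  then have f0: "f n = \<zero>" if "n \<notin> wt dg ` keys p" for n using that by (simp add: f_def to_A_zero)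
  have sub: "{n. f n \<noteq> \<zero>} \<subseteq> wt dg ` keys p" using f0 by blast
  have fin: "finite {n. f n \<noteq> \<zero>}" by (rule finite_subset[OF sub]) simp
  have "finsum A f {n. f n \<noteq> \<zero>} = finsum A f (wt dg ` keys p)"
    by (rule add.finprod_mono_neutral_cong_left[OF _ sub]) (auto simp: f_def to_A_in)
  also have "\<dots> = to_A (\<Sum>n\<in>wt dg ` keys p. hpart dg n p)" unfolding f_def by (rule to_A_sum[symmetric]) simp
  also have "\<dots> = \<zero>" using p unfolding sum_hpart by (simp add: SA.ker_def)
  finally have s: "\<zero> = finsum A f {n. f n \<noteq> \<zero>}" by simp
  let ?D = "\<lambda>f. (\<forall>n. f n \<in> Agr n) \<and> finite {n. f n \<noteq> \<zero>} \<and> \<zero> = finsum A f {n. f n \<noteq> \<zero>}"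
  have u: "\<exists>!f. ?D f" using graded unfolding graded_algebra_def by blast
  have d1: "?D f" using to_A_Agr[OF homog_hpart] fin s by (simp add: f_def)
  have d2: "?D (\<lambda>_. \<zero>)" using Agr_zero by simp
  have "f = (\<lambda>_. \<zero>)" using the1_equality[where P = ?D, OF u d1] the1_equality[where P = ?D, OF u d2] by (rule trans[OF sym])
  then have "f k = \<zero>" by simp
  then show "hpart dg k p \<in> SA.ker" by (simp add: SA.ker_def f_def)
qed

lemma hodge_ker:
  fixes idx :: "'h \<Rightarrow> nat"
  assumes sf: "square_free Sig" and ne: "{#} \<notin> Sig" and idx: "inj_on idx H"
  shows "hodge H Sig idx SA.ker dg leq"
proof unfold_locales
  have ker: "p \<in> SA.ker \<longleftrightarrow> to_A p = \<zero>" for p by (simp add: SA.ker_def)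
  show "finite H" "monomial_ideal H Sig" "partial_order_on_set H leq" using hodge by (auto simp: hodge_algebra_def)
  show "square_free Sig" "{#} \<notin> Sig" "inj_on idx H" by (rule sf ne idx)+
  show "is_ideal SA.ker" by (rule SA.ideal_ker)
  show "homog_ideal dg SA.ker" by (rule homog_ker)
  show "0 < dg h" for h by (rule dg)
  show "var h \<in> SA.ker" if "h \<notin> H" for h
    unfolding ker to_A_term ev_single using that by (simp add: xx_def iota)
  show "\<exists>q. p - q \<in> SA.ker \<and> keys q \<subseteq> Std" for p
  proof -
    obtain q where "keys q \<subseteq> Std" "to_A q = to_A p" using std_exists[OF to_A_in] by blast
    then show ?thesis by (metis SA.hom_eq)
  qed
  show "p = 0" if "p \<in> SA.ker" "keys p \<subseteq> Std" for p
    using that std_unique[of p 0] by (simp add: ker to_A_zero)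
  show "\<exists>y. y \<in># \<nu> \<and> leq y z \<and> y \<noteq> z"
    if \<mu>: "min_gen Sig \<mu>" and q: "mon \<mu> - q \<in> SA.ker" "keys q \<subseteq> Std" "\<nu> \<in> keys q" and z: "z \<in># \<mu>" for \<mu> q \<nu> z
  proof -
    have mH: "set_mset \<mu> \<subseteq> H" using \<mu> hodge by (auto simp: min_gen_def hodge_algebra_def monomial_ideal_def monomials_def)
    have "to_A q = to_A (mon \<mu>)" using q(1) SA.hom_eq by metis
    also have "\<dots> = mon_eval A x \<mu>" unfolding to_A_term using ev_in[of \<mu>] by (simp add: iota ev_H[OF mH, symmetric])
    finally have e: "std_expansion A \<iota> H x Sig (mon_eval A x \<mu>) (coef q)" using std_expansion_to_A[OF q(2)] by simp
    have "coef q \<nu> \<noteq> 0" using q(3) by (simp add: in_keys_iff)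
    moreover have "\<forall>\<mu> c. min_gen Sig \<mu> \<longrightarrow> std_expansion A \<iota> H x Sig (mon_eval A x \<mu>) c \<longrightarrow>
        (\<forall>\<nu>. c \<nu> \<noteq> 0 \<longrightarrow> (\<forall>z\<in>H. z \<in># \<mu> \<longrightarrow> (\<exists>y. y \<in># \<nu> \<and> leq y z \<and> y \<noteq> z)))"
      using hodge unfolding hodge_algebra_def by (elim conjE)
    ultimately show ?thesis using \<mu> e z mH by blast
  qed
qed

end

theorem theorem5p5:
  fixes A :: "'a ring" and \<iota> :: "'k::field \<Rightarrow> 'a" and H :: "'h set"
    and leq :: "'h \<Rightarrow> 'h \<Rightarrow> bool" and x :: "'h \<Rightarrow> 'a" and Sig :: "'h multiset set"
    and Agr :: "nat \<Rightarrow> 'a set"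
  assumes "hodge_algebra A \<iota> H leq x Sig"
    and "graded_algebra A \<iota> H x Agr"
    and "square_free Sig"
    and "cohen_macaulay A"
    and "graded_buchsbaum (core_Adis H Sig :: ('h multiset \<Rightarrow> 'k) set set ring)
                          (core_irrelevant H Sig)"
  shows "cohen_macaulay (Adis H Sig :: ('h multiset \<Rightarrow> 'k) set ring)"
proof -
  have mi: "monomial_ideal H Sig" and finH: "finite H" and crA: "cring A" using assms(1) by (auto simp: hodge_algebra_def)
  interpret A: graded_hodge A \<iota> H leq x Sig Agr
    by (intro graded_hodge.intro crA graded_hodge_axioms.intro assms(1,2))
  interpret D: surj_hom "Adis H Sig" "to_Adis H Sig :: ('h, 'k) mpoly \<Rightarrow> _" by (rule surj_hom_Adis[OF mi])
  let ?JD = "mideal (standard_monomials H Sig) :: ('h, 'k) mpoly set"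
  have kD: "D.ker = ?JD" by (rule surj_hom_Adis(2)[OF mi])
  have fg: "\<exists>us. I = adjoins D.ker us" if "is_ideal I" "D.ker \<subseteq> I" for I
  proof (rule ideals_finitely_generated[OF finH D.ideal_ker _ that])
    show "var h \<in> D.ker" if "h \<notin> H" for h using that unfolding kD mon_in_mideal by (simp add: standard_monomials_def monomials_def)
  qed
  have "cohen_macaulay_local (localize_at (Adis H Sig :: ('h multiset \<Rightarrow> 'k) set ring) M)" if M: "maximalideal M (Adis H Sig)" for M
  proof -
    let ?M = "to_Adis H Sig -` M :: ('h, 'k) mpoly set"
    have pM: "is_prime ?M" and mxM: "\<And>a. a \<notin> ?M \<Longrightarrow> \<exists>b. a * b - 1 \<in> ?M" using D.maximal_vimage[OF M] by blast+
    have Mid: "ideal M (Adis H Sig)" using M by (rule maximalideal.axioms(1))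
    have kM: "D.ker \<subseteq> ?M" by (rule D.ideal_vimage(2)[OF Mid])
    have imM: "to_Adis H Sig ` ?M = M" by (rule D.ideal_vimage(3)[OF Mid])
    \<comment> \<open>If the empty monomial belonged to Sig, the discrete algebra would be the zero
      ring and have no maximal ideal.\<close>
    have ne: "{#} \<notin> Sig"
    proof
      assume "{#} \<in> Sig"
      then have "1 \<in> D.ker" unfolding kD mideal_coef by (auto simp: standard_monomials_def lookup_one when_def)
      then show False using kM is_primeD(2)[OF pM] by blast
    qed
    obtain idx :: "'h \<Rightarrow> nat" where idx: "inj_on idx H" using finite_imp_inj_to_nat_seg[OF finH] by auto
    interpret h: hodge H Sig idx "TYPE('k)" A.SA.ker A.dg leq by (rule A.hodge_ker[OF assms(3) ne idx])
    interpret E: surj_hom "core_Adis H Sig" "to_core H Sig :: ('h, 'k) mpoly \<Rightarrow> _" by (rule h.surj_hom_core)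
    have kE: "E.ker = h.JC" by (rule h.surj_hom_core(2))
    have "h.JC \<subseteq> irr" using h.empty_Std by (auto simp: mideal_coef irr_def)
    then have lE: "locring h.JC irr (localize_at (core_Adis H Sig) (to_core H Sig ` irr))
        (\<lambda>a s. loc_rel (core_Adis H Sig) (carrier (core_Adis H Sig) - to_core H Sig ` irr) `` {(to_core H Sig a, to_core H Sig s)})"
      using E.locring_localize[OF prime_irr] unfolding kE by blast
    have bE: "buchsbaum_local (localize_at (core_Adis H Sig) (to_core H Sig ` (irr :: ('h, 'k) mpoly set)))"
      using assms(5) unfolding graded_buchsbaum_def h.surj_hom_core(3) by blast
    \<comment> \<open>The irrelevant ideal of A is maximal because elements with a nonzero constant
      term are invertible modulo it; Cohen-Macaulayness of A is applied here.\<close>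
    have "maximalideal (A.to_A ` irr) A"
      by (rule A.SA.maximal_image[OF is_primeD(1)[OF prime_irr] h.JA_irr is_primeD(2)[OF prime_irr] irr_maximal])
    then have cA: "cohen_macaulay_local (localize_at A (A.to_A ` irr))" using assms(4) by (simp add: cohen_macaulay_def)
    obtain us0 where us0: "length us0 = h.dC + card (H - core_set Sig)" "set us0 \<subseteq> irr" "reg_list (- irr) A.SA.ker us0"
      using h.regular_list_of_cohen_macaulay[OF A.SA.locring_localize[OF prime_irr h.JA_irr] cA] by blast
    have "?JD \<subseteq> ?M" using kM unfolding kD .
    \<comment> \<open>This passes from the irrelevant ideals of A and of the core to the arbitrary
      maximal ideal M of the discrete algebra.\<close>
    from h.regular_in_maximal[OF us0 lE bE pM mxM this]
    obtain us where us: "length us = h.dC + card (H - core_set Sig)" "set us \<subseteq> ?M" "reg_list {1} ?JD us" by blast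
    interpret L: locring D.ker ?M "localize_at (Adis H Sig) (to_Adis H Sig ` ?M)"
      "\<lambda>a s. loc_rel (Adis H Sig) (carrier (Adis H Sig) - to_Adis H Sig ` ?M) `` {(to_Adis H Sig a, to_Adis H Sig s)}"
      by (rule D.locring_localize[OF pM kM])
    have "cohen_macaulay_local (localize_at (Adis H Sig) (to_Adis H Sig ` ?M))"
    proof (rule L.cohen_macaulay_localI[OF fg us(2)])
      have "{1} \<subseteq> - ?M" using is_primeD(2)[OF pM] by simp
      then show "reg_list (- ?M) D.ker us" unfolding kD by (rule reg_list_mono[OF _ us(3)])
      \<comment> \<open>The length of \<open>us\<close> is also an upper bound for the number of
        variables in a standard monomial, which bounds the chains of primes.\<close>
      show "n \<le> length us" if "prime_chain D.ker ?M n" for n unfolding us(1)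
      proof (rule dim_le_faces[OF finH _ h.card_Std _ that])
        show "set_mset m \<subseteq> H" if "m \<in> standard_monomials H Sig" for m using that unfolding h.Std_iff by blast
        show "?JD \<subseteq> D.ker" unfolding kD by (rule subset_refl)
      qed
    qed
    then show ?thesis unfolding imM .
  qed
  then show ?thesis unfolding cohen_macaulay_def
    by (intro conjI allI impI D.cring_R D.noetherian_R[OF fg])
qed

end
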